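(* Let $M>0$. There exists a constant $C_1=C_1(\Omega,N,M)>0$ depending only on the listed parameters such that the following holds. Let $V^{(1)},V^{(2)}$ be two solutions of the system $$\Delta V(\mathbf{x})+K(\nabla V(\mathbf{x}))=0,\quad \mathbf{x}\in\Omega,$$ with boundary conditions $$V^{(j)}(\mathbf{x})=\psi_0^{(j)}(\mathbf{x})\ \text{ for }\mathbf{x}\in\partial\Omega,\qquad \partial_zV^{(j)}(\mathbf{x})=\psi_1^{(j)}(\mathbf{x})\ \text{ for }\mathbf{x}\in\Gamma,\qquad j=1,2.$$ Suppose that there exist two vector functions $F_1,F_2\in H^3_N(\Omega)$ satisfying the same boundary conditions, i.e. $F_j=\psi_0^{(j)}$ on $\partial\Omega$ and $\partial_zF_j=\psi_1^{(j)}$ on $\Gamma$ for $j=1,2$, and that $$V^{(1)},V^{(2)},F_1,F_2\in G(M)=\{W\in H^3_N(\Omega):\|W\|_{H^3_N(\Omega)}<M\}.$$ Then $$\|V^{(1)}-V^{(2)}\|_{H^2_N(\Omega)}\le C_1\|F_1-F_2\|_{H^2_N(\Omega)}.$$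
   Context: Fix throughout real numbers $R>0$, $d>R$, $a>0$, $k>0$ and an integer $N\ge1$ (constants may depend on the fixed parameters $k,a,d$ without this being indicated). Write $\mathbf{x}=(x,y,z)\in\mathbb{R}^3$, and let $\Omega=\{|x|,|y|,|z|<R\}$, $\Gamma=\{|x|,|y|<R,\ z=-R\}\subset\partial\Omega$. For $\alpha\in[-a,a]$ let $\mathbf{x}_\alpha=(\alpha,0,-d)$ and define the $\mathbb{C}^3$-valued functions $$\tilde{\mathbf{x}}_\alpha=\frac{\mathrm{i}k(\mathbf{x}-\mathbf{x}_\alpha)}{|\mathbf{x}-\mathbf{x}_\alpha|}-\frac{\mathbf{x}-\mathbf{x}_\alpha}{|\mathbf{x}-\mathbf{x}_\alpha|^2},$$ $$\widehat{\mathbf{x}}_\alpha=\partial_\alpha\tilde{\mathbf{x}}_\alpha=\frac{\mathrm{i}k}{|\mathbf{x}-\mathbf{x}_\alpha|^3}\big(-y^2-(z+d)^2,(x-\alpha)y,(x-\alpha)(z+d)\big)-\frac{1}{|\mathbf{x}-\mathbf{x}_\alpha|^4}\big((x-\alpha)^2-y^2-(z+d)^2,2(x-\alpha)y,2(x-\alpha)(z+d)\big).$$ Let $\{\Psi_n\}_{n\ge0}$ be the orthonormal basis of $L^2(-a,a)$ obtained by Gram–Schmidt orthonormalization of the functions $\alpha^ne^\alpha$, $n=0,1,2,\dots$. Let $S_N=(s_{mn})_{m,n=0}^{N-1}$, $s_{mn}=\int_{-a}^a\Psi_n'(\alpha)\Psi_m(\alpha)\,d\alpha$; this matrix is upper triangular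 with ones on the diagonal, hence invertible. For a complex vector function $V=(v_0,\dots,v_{N-1})^T$ on $\Omega$ define $f(\nabla V)=(f_0,\dots,f_{N-1})^T$ by $$f_m(\nabla V(\mathbf{x}))=2\sum_{n,l=0}^{N-1}\nabla v_n\cdot\nabla v_l\int_{-a}^a\Psi_m\Psi_n\Psi_l'\,d\alpha+2\sum_{n=0}^{N-1}\int_{-a}^a\Psi_m\Psi_n'\,\nabla v_n\cdot\tilde{\mathbf{x}}_\alpha\,d\alpha+2\sum_{n=0}^{N-1}\int_{-a}^a\Psi_m\Psi_n\,\widehat{\mathbf{x}}_\alpha\cdot\nabla v_n\,d\alpha,$$ where $A\cdot B=\sum_jA_jB_j$ without complex conjugation, and set $K(\nabla V)=S_N^{-1}f(\nabla V)$. For a Banach space $B$ and integer $X$, $B_X=B\times\dots\times B$ ($X$ times) with norm $\|g\|_{B_X}=(\sum_{j=1}^X\|g_j\|_B^2)^{1/2}$; thus $H^s_N(\Omega)$ denotes $N$-component (complex valued) vector functions with components in the Sobolev space $H^s(\Omega)$. *)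

theory Defs
  imports "HOL-Analysis.Analysis" "Jordan_Normal_Form.Gauss_Jordan_Elimination"
begin

no_notation Matrix.vec_index (infixl "$" 100)

section \<open>Weak derivatives and Sobolev spaces on open sets of R^3\<close>

definition partial :: "3 \<Rightarrow> (real^3 \<Rightarrow> real) \<Rightarrow> real^3 \<Rightarrow> real" where
  "partial i f x = frechet_derivative f (at x) (axis i 1)"

text \<open>All iterated partial derivatives are (Frechet) differentiable, i.e. the function is
  infinitely often continuously differentiable.\<close>

definition smooth :: "(real^3 \<Rightarrow> real) \<Rightarrow> bool" where
  "smooth f \<longleftrightarrow> (\<forall>js :: 3 list. \<forall>x. foldr partial js f differentiable (at x))"

definition test_function :: "(real^3) set \<Rightarrow> (real^3 \<Rightarrow> real) \<Rightarrow> bool" where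
  "test_function \<Omega> \<phi> \<longleftrightarrow>
     smooth \<phi> \<and> compact (closure {x. \<phi> x \<noteq> 0}) \<and> closure {x. \<phi> x \<noteq> 0} \<subseteq> \<Omega>"

text \<open>Multi-indices are elements of \<^typ>\<open>nat^3\<close>; in particular \<^term>\<open>axis i k :: nat^3\<close> stands for
  \<open>k\<close> derivatives in direction \<open>i\<close>.\<close>

definition morder :: "nat^3 \<Rightarrow> nat" where
  "morder \<beta> = (\<Sum>i\<in>UNIV. \<beta> $ i)"

definition mpartial :: "nat^3 \<Rightarrow> (real^3 \<Rightarrow> real) \<Rightarrow> real^3 \<Rightarrow> real" where
  "mpartial \<beta> \<phi> =
     (partial 1 ^^ (\<beta> $ 1)) ((partial 2 ^^ (\<beta> $ 2)) ((partial 3 ^^ (\<beta> $ 3)) \<phi>))"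

definition locally_integrable :: "(real^3) set \<Rightarrow> (real^3 \<Rightarrow> complex) \<Rightarrow> bool" where
  "locally_integrable \<Omega> u \<longleftrightarrow> (\<forall>K. compact K \<and> K \<subseteq> \<Omega> \<longrightarrow> integrable (lebesgue_on K) u)"

definition has_weak_deriv ::
    "(real^3) set \<Rightarrow> nat^3 \<Rightarrow> (real^3 \<Rightarrow> complex) \<Rightarrow> (real^3 \<Rightarrow> complex) \<Rightarrow> bool" where
  "has_weak_deriv \<Omega> \<beta> u v \<longleftrightarrow>
     locally_integrable \<Omega> u \<and> locally_integrable \<Omega> v \<and>
     (\<forall>\<phi>. test_function \<Omega> \<phi> \<longrightarrow>
        (LINT x|lebesgue_on \<Omega>. u x * of_real (mpartial \<beta> \<phi> x)) =
        (-1) ^ morder \<beta> * (LINT x|lebesgue_on \<Omega>. v x * of_real (\<phi> x)))"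

text \<open>Determined only up to a null set of \<open>\<Omega>\<close>; it is used below only under integrals, almost
  everywhere, or through a continuous representative.\<close>

definition weak_deriv ::
    "(real^3) set \<Rightarrow> nat^3 \<Rightarrow> (real^3 \<Rightarrow> complex) \<Rightarrow> real^3 \<Rightarrow> complex" where
  "weak_deriv \<Omega> \<beta> u = (SOME v. has_weak_deriv \<Omega> \<beta> u v)"

definition L2 :: "(real^3) set \<Rightarrow> (real^3 \<Rightarrow> complex) set" where
  "L2 \<Omega> = {u. u \<in> borel_measurable (lebesgue_on \<Omega>) \<and>
              integrable (lebesgue_on \<Omega>) (\<lambda>x. (cmod (u x))\<^sup>2)}"

definition L2_norm :: "(real^3) set \<Rightarrow> (real^3 \<Rightarrow> complex) \<Rightarrow> real" where
  "L2_norm \<Omega> u = sqrt (LINT x|lebesgue_on \<Omega>. (cmod (u x))\<^sup>2)"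

definition Sobolev :: "nat \<Rightarrow> (real^3) set \<Rightarrow> (real^3 \<Rightarrow> complex) set" where
  "Sobolev s \<Omega> = {u \<in> L2 \<Omega>. \<forall>\<beta>. morder \<beta> \<le> s \<longrightarrow> (\<exists>v\<in>L2 \<Omega>. has_weak_deriv \<Omega> \<beta> u v)}"

definition Sobolev_norm :: "nat \<Rightarrow> (real^3) set \<Rightarrow> (real^3 \<Rightarrow> complex) \<Rightarrow> real" where
  "Sobolev_norm s \<Omega> u = sqrt (\<Sum>\<beta> | morder \<beta> \<le> s. (L2_norm \<Omega> (weak_deriv \<Omega> \<beta> u))\<^sup>2)"

text \<open>Vector functions with \<open>N\<close> components: only the components with index below \<open>N\<close> matter.\<close>

type_synonym vfun = "nat \<Rightarrow> real^3 \<Rightarrow> complex"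

definition Sobolev_vec :: "nat \<Rightarrow> nat \<Rightarrow> (real^3) set \<Rightarrow> vfun set" where
  "Sobolev_vec N s \<Omega> = {V. \<forall>m<N. V m \<in> Sobolev s \<Omega>}"

definition Sobolev_vec_norm :: "nat \<Rightarrow> nat \<Rightarrow> (real^3) set \<Rightarrow> vfun \<Rightarrow> real" where
  "Sobolev_vec_norm N s \<Omega> V = sqrt (\<Sum>m<N. (Sobolev_norm s \<Omega> (V m))\<^sup>2)"

text \<open>Boundary values on \<open>S\<close> (a part of the boundary), taken through the representative that is
  continuous up to the boundary; it is unique where it exists.  Below this is applied to functions
  in \<open>H\<^sup>3\<close> of a cube and to their first derivatives.  By the Sobolev embedding of \<open>H\<^sup>2\<close> into the
  continuous functions on the closed cube they all have such a representative, whose restriction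
  to the boundary is the trace.\<close>

definition has_boundary_values ::
    "(real^3) set \<Rightarrow> (real^3 \<Rightarrow> complex) \<Rightarrow> (real^3) set \<Rightarrow> (real^3 \<Rightarrow> complex) \<Rightarrow> bool" where
  "has_boundary_values \<Omega> u S g \<longleftrightarrow>
     (\<exists>U. continuous_on (closure \<Omega>) U \<and> (AE x in lebesgue_on \<Omega>. U x = u x) \<and> (\<forall>x\<in>S. U x = g x))"

section \<open>The orthonormal basis and its matrix\<close>

definition ip :: "real \<Rightarrow> (real \<Rightarrow> real) \<Rightarrow> (real \<Rightarrow> real) \<Rightarrow> real" where
  "ip a f g = (LINT t:{-a<..<a}|lborel. f t * g t)"

text \<open>Gram-Schmidt applied to the functions \<open>t\<^sup>n e\<^sup>t\<close> in \<open>L\<^sup>2(-a,a)\<close>.  The \<open>\<Psi>\<^sub>n\<close>, being polynomials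
  times the exponential function, are taken as functions on the whole line.\<close>

fun Psi :: "real \<Rightarrow> nat \<Rightarrow> real \<Rightarrow> real" where
  "Psi a n =
     (let g = (\<lambda>t. t ^ n * exp t);
          w = (\<lambda>t. g t - (\<Sum>m<n. ip a g (Psi a m) * Psi a m t))
      in (\<lambda>t. w t / sqrt (ip a w w)))"

declare Psi.simps [simp del]

definition S_mat :: "real \<Rightarrow> nat \<Rightarrow> complex mat" where
  "S_mat a N = mat N N (\<lambda>(m, n). of_real (LINT t:{-a<..<a}|lborel. deriv (Psi a n) t * Psi a m t))"

section \<open>The nonlinear system\<close>

definition source :: "real \<Rightarrow> real \<Rightarrow> real^3" where
  "source d \<alpha> = vector [\<alpha>, 0, -d]"

definition x_tilde :: "real \<Rightarrow> real \<Rightarrow> real^3 \<Rightarrow> real \<Rightarrow> complex^3" where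
  "x_tilde k d x \<alpha> = (let w = x - source d \<alpha> in
     \<chi> j. \<i> * of_real k * of_real (w $ j) / of_real (norm w)
          - of_real (w $ j) / of_real ((norm w)\<^sup>2))"

definition x_hat :: "real \<Rightarrow> real \<Rightarrow> real^3 \<Rightarrow> real \<Rightarrow> complex^3" where
  "x_hat k d x \<alpha> =
     (let r = norm (x - source d \<alpha>);
          p = (vector [- (x$2)\<^sup>2 - (x$3 + d)\<^sup>2, (x$1 - \<alpha>) * x$2, (x$1 - \<alpha>) * (x$3 + d)] :: real^3);
          q = (vector [(x$1 - \<alpha>)\<^sup>2 - (x$2)\<^sup>2 - (x$3 + d)\<^sup>2,
                       2 * (x$1 - \<alpha>) * x$2, 2 * (x$1 - \<alpha>) * (x$3 + d)] :: real^3)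
      in \<chi> j. \<i> * of_real k / of_real (r ^ 3) * of_real (p $ j) - of_real (q $ j) / of_real (r ^ 4))"

lemma x_hat_is_derivative:
  assumes "x \<noteq> source d \<alpha>"
  shows "((\<lambda>\<alpha>. x_tilde k d x \<alpha> $ j) has_vector_derivative x_hat k d x \<alpha> $ j) (at \<alpha>)"
proof -
  define b where "b = (x$2)\<^sup>2 + (x$3 + d)\<^sup>2"
  define r where "r = (\<lambda>t. sqrt ((x$1 - t)\<^sup>2 + b))"
  define c where "c = (\<lambda>t. (x - source d t) $ j)"
  define c' where "c' = (if j = 1 then - 1 else (0::real))"
  have nr: "norm (x - source d t) = r t" for t
    by (simp add: norm_vec_def L2_set_def sum_3 source_def r_def b_def add.assoc)
  have r0: "r \<alpha> > 0" using assms nr[of \<alpha>] by (metis eq_iff_diff_eq_0 zero_less_norm_iff)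
  have rsq: "(r \<alpha>)\<^sup>2 = (x$1 - \<alpha>)\<^sup>2 + b"
    unfolding r_def b_def by simp
  have rr: "(x$1 - \<alpha>)\<^sup>2 + b > 0" using r0 rsq by (metis zero_less_power)
  have dr: "(r has_real_derivative - (x$1 - \<alpha>) / r \<alpha>) (at \<alpha>)"
    unfolding r_def using rr
    by (auto intro!: derivative_eq_intros simp: field_simps)
  have j: "j = 1 \<or> j = 2 \<or> j = 3" by (rule exhaust_3)
  have dc: "(c has_real_derivative c') (at \<alpha>)"
    using j unfolding c_def c'_def source_def
    by (auto intro!: derivative_eq_intros simp: vector_3)
  define p where "p = (vector [- (x$2)\<^sup>2 - (x$3 + d)\<^sup>2, (x$1 - \<alpha>) * x$2, (x$1 - \<alpha>) * (x$3 + d)] :: real^3) $ j"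
  define q where "q = (vector [(x$1 - \<alpha>)\<^sup>2 - (x$2)\<^sup>2 - (x$3 + d)\<^sup>2,
                       2 * (x$1 - \<alpha>) * x$2, 2 * (x$1 - \<alpha>) * (x$3 + d)] :: real^3) $ j"
  have pe: "p = c' * (r \<alpha>)\<^sup>2 + c \<alpha> * (x$1 - \<alpha>)"
    using j unfolding p_def c_def c'_def rsq source_def b_def
    by (auto simp: vector_3 power2_eq_square algebra_simps)
  have qe: "q = c' * (r \<alpha>)\<^sup>2 + 2 * c \<alpha> * (x$1 - \<alpha>)"
    using j unfolding q_def c_def c'_def rsq source_def b_def
    by (auto simp: vector_3 power2_eq_square algebra_simps)
  have d1: "((\<lambda>t. c t / r t) has_real_derivative p / r \<alpha> ^ 3) (at \<alpha>)"
    by (rule DERIV_cong[OF DERIV_divide[OF dc dr]])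
       (use r0 in \<open>auto simp: pe field_simps power2_eq_square power3_eq_cube\<close>)
  have d2: "((\<lambda>t. c t / (r t)\<^sup>2) has_real_derivative q / r \<alpha> ^ 4) (at \<alpha>)"
    by (rule DERIV_cong[OF DERIV_divide[OF dc DERIV_power[OF dr]]])
       (use r0 in \<open>auto simp: qe field_simps power2_eq_square power4_eq_xxxx\<close>)
  have e1: "((\<lambda>t. complex_of_real (c t / r t)) has_vector_derivative of_real (p / r \<alpha> ^ 3)) (at \<alpha>)"
    using d1 by (rule has_vector_derivative_of_real)
  have e2: "((\<lambda>t. complex_of_real (c t / (r t)\<^sup>2)) has_vector_derivative of_real (q / r \<alpha> ^ 4)) (at \<alpha>)"
    using d2 by (rule has_vector_derivative_of_real)
  have "((\<lambda>t. (\<i> * of_real k) * complex_of_real (c t / r t) - complex_of_real (c t / (r t)\<^sup>2))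
     has_vector_derivative (\<i> * of_real k) * of_real (p / r \<alpha> ^ 3) - of_real (q / r \<alpha> ^ 4)) (at \<alpha>)"
    by (intro has_vector_derivative_diff has_vector_derivative_mult_right e1 e2)
  then show ?thesis
    by (simp add: x_tilde_def x_hat_def Let_def nr c_def p_def q_def)
qed

text \<open>No complex conjugation.\<close>

definition cdot :: "complex^3 \<Rightarrow> complex^3 \<Rightarrow> complex" where
  "cdot A B = (\<Sum>j\<in>UNIV. A $ j * B $ j)"

text \<open>In \<open>f_fun\<close> and \<open>K_fun\<close> the argument \<open>P\<close> stands for the family of gradients \<open>\<nabla>v\<^sub>n\<close> at \<open>x\<close>.
  \<open>mat_inverse\<close> is not \<open>None\<close> in \<open>K_fun\<close>: \<open>S_mat\<close> is upper triangular with unit diagonal.\<close>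

definition f_fun ::
    "real \<Rightarrow> real \<Rightarrow> real \<Rightarrow> nat \<Rightarrow> real^3 \<Rightarrow> (nat \<Rightarrow> complex^3) \<Rightarrow> nat \<Rightarrow> complex" where
  "f_fun k a d N x P m =
     2 * (\<Sum>n<N. \<Sum>l<N. cdot (P n) (P l) *
            of_real (LINT t:{-a<..<a}|lborel. Psi a m t * Psi a n t * deriv (Psi a l) t))
   + 2 * (\<Sum>n<N. LINT t:{-a<..<a}|lborel.
            of_real (Psi a m t * deriv (Psi a n) t) * cdot (P n) (x_tilde k d x t))
   + 2 * (\<Sum>n<N. LINT t:{-a<..<a}|lborel.
            of_real (Psi a m t * Psi a n t) * cdot (x_hat k d x t) (P n))"

definition K_fun ::
    "real \<Rightarrow> real \<Rightarrow> real \<Rightarrow> nat \<Rightarrow> real^3 \<Rightarrow> (nat \<Rightarrow> complex^3) \<Rightarrow> complex Matrix.vec" where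
  "K_fun k a d N x P = the (mat_inverse (S_mat a N)) *\<^sub>v Matrix.vec N (f_fun k a d N x P)"

definition weak_grad :: "(real^3) set \<Rightarrow> (real^3 \<Rightarrow> complex) \<Rightarrow> real^3 \<Rightarrow> complex^3" where
  "weak_grad \<Omega> u x = (\<chi> i. weak_deriv \<Omega> (axis i 1) u x)"

definition weak_laplacian :: "(real^3) set \<Rightarrow> (real^3 \<Rightarrow> complex) \<Rightarrow> real^3 \<Rightarrow> complex" where
  "weak_laplacian \<Omega> u x = (\<Sum>i\<in>UNIV. weak_deriv \<Omega> (axis i 2) u x)"

definition cube :: "real \<Rightarrow> (real^3) set" where
  "cube R = {x. \<bar>x$1\<bar> < R \<and> \<bar>x$2\<bar> < R \<and> \<bar>x$3\<bar> < R}"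

definition Gam :: "real \<Rightarrow> (real^3) set" where
  "Gam R = {x. \<bar>x$1\<bar> < R \<and> \<bar>x$2\<bar> < R \<and> x$3 = - R}"

definition solves_system :: "real \<Rightarrow> real \<Rightarrow> real \<Rightarrow> real \<Rightarrow> nat \<Rightarrow> vfun \<Rightarrow> bool" where
  "solves_system R k a d N V \<longleftrightarrow>
     (AE x in lebesgue_on (cube R). \<forall>m<N.
        weak_laplacian (cube R) (V m) x
        + Matrix.vec_index (K_fun k a d N x (\<lambda>n. weak_grad (cube R) (V n) x)) m = 0)"

definition boundary_conditions :: "real \<Rightarrow> nat \<Rightarrow> vfun \<Rightarrow> vfun \<Rightarrow> vfun \<Rightarrow> bool" where
  "boundary_conditions R N W \<psi>0 \<psi>1 \<longleftrightarrow>
     (\<forall>m<N. has_boundary_values (cube R) (W m) (frontier (cube R)) (\<psi>0 m) \<and>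
            has_boundary_values (cube R) (weak_deriv (cube R) (axis 3 1) (W m)) (Gam R) (\<psi>1 m))"

definition G_set :: "real \<Rightarrow> nat \<Rightarrow> real \<Rightarrow> vfun set" where
  "G_set R N M = {W \<in> Sobolev_vec N 3 (cube R). Sobolev_vec_norm N 3 (cube R) W < M}"

end

theory Submission
  imports Defs
begin

text \<open>The difference \<open>v = V\<^sub>1 - V\<^sub>2\<close> of the two solutions is compared with \<open>\<phi> = F\<^sub>1 - F\<^sub>2\<close>.  As \<open>F\<^sub>j\<close> carries
  the boundary data of \<open>V\<^sub>j\<close>, the function \<open>w = v - \<phi>\<close> vanishes on the boundary of the cube and its
  normal derivative vanishes on the bottom face \<open>\<Gamma>\<close>.  With such data the Cauchy problem for the
  Laplacian is stable; the claim is that this survives the nonlinearity.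

  The nonlinearity \<open>K\<close> is a quadratic polynomial in the gradients, with coefficients that are bounded
  on the cube because the sources stay at a positive distance from it.  The gradients of functions
  in \<open>G(M)\<close> are bounded by a multiple of \<open>M\<close>, by the embedding of \<open>H\<^sup>2\<close> into the bounded functions in
  dimension three (\<open>first_derivatives_bounded\<close>).  So \<open>K\<close> is Lipschitz continuous on the range that
  matters (\<open>K_fun_Lipschitz\<close>), and \<open>w\<close> satisfies a differential inequality: the Laplacian of \<open>w\<close> is
  dominated by the gradient of \<open>w\<close> and the derivatives of \<open>\<phi>\<close> up to order two
  (\<open>solution_difference_inequality\<close>).

  The gradient of \<open>w\<close> is absorbed with a Carleman estimate.  For the weight \<open>exp (l (z - 2 R)\<^sup>2)\<close> the
  weighted square integral of \<open>\<Delta>w\<close> bounds \<open>l\<close> times that of \<open>\<nabla>w\<close> and \<open>l\<^sup>3\<close> times that of \<open>w\<close>, with a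
  factor that does not depend on \<open>l\<close> (\<open>Carleman_estimate\<close>).  If \<open>l\<close> is large, the contribution of
  \<open>\<nabla>w\<close> to \<open>\<Delta>w\<close> costs less than it gains, and only \<open>\<phi>\<close> remains on the right-hand side.  The second
  derivatives are bounded by \<open>\<Delta>w\<close> itself, since \<open>w\<close> vanishes on the whole boundary
  (\<open>second_derivatives_le_lap\<close>).  Both are combined in \<open>differential_inequality_stability\<close>.

  The Carleman estimate comes from pairing \<open>\<Delta>w\<close> with \<open>2 p \<partial>\<^sub>z w - (2 l p\<^sup>2 + 1) w\<close>, where \<open>p = 2 R - z\<close>,
  and integrating by parts.  As \<open>w\<close> is only a function with three weak derivatives, the integrations
  by parts are carried out on smooth functions that approximate \<open>w\<close> up to the boundary
  (\<open>Sobolev_approximation\<close>).  They converge in mean square with all derivatives up to order three,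
  and uniformly wherever there is a continuous representative; the boundary conditions enter
  through the uniform limits.\<close>

no_notation Matrix.scalar_prod (infix "\<bullet>" 70)

section \<open>Square integrable functions\<close>

lemma L2_measurable: "u \<in> L2 \<Omega> \<Longrightarrow> u \<in> borel_measurable (lebesgue_on \<Omega>)"
  by (simp add: L2_def)

lemma L2_integrable: "u \<in> L2 \<Omega> \<Longrightarrow> integrable (lebesgue_on \<Omega>) (\<lambda>x. (cmod (u x))\<^sup>2)"
  by (simp add: L2_def)

lemma L2_add:
  assumes "u \<in> L2 \<Omega>" "v \<in> L2 \<Omega>" shows "(\<lambda>x. u x + v x) \<in> L2 \<Omega>"
proof -
  have m: "u \<in> borel_measurable (lebesgue_on \<Omega>)" "v \<in> borel_measurable (lebesgue_on \<Omega>)"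
    using assms L2_measurable by auto
  have "integrable (lebesgue_on \<Omega>) (\<lambda>x. (cmod (u x + v x))\<^sup>2)"
  proof (rule Bochner_Integration.integrable_bound)
    show "integrable (lebesgue_on \<Omega>) (\<lambda>x. 2 * (cmod (u x))\<^sup>2 + 2 * (cmod (v x))\<^sup>2)"
      using assms by (intro Bochner_Integration.integrable_add integrable_mult_right L2_integrable)
    have "(cmod (u x + v x))\<^sup>2 \<le> 2 * (cmod (u x))\<^sup>2 + 2 * (cmod (v x))\<^sup>2" for x
    proof -
      have "(cmod (u x + v x))\<^sup>2 \<le> (cmod (u x) + cmod (v x))\<^sup>2"
        by (intro power_mono norm_triangle_ineq) auto
      also have "\<dots> \<le> 2 * (cmod (u x))\<^sup>2 + 2 * (cmod (v x))\<^sup>2"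
        using sum_squares_bound[of "cmod (u x)" "cmod (v x)"] by (simp add: power2_sum)
      finally show ?thesis .
    qed
    then show "AE x in lebesgue_on \<Omega>. norm ((cmod (u x + v x))\<^sup>2)
        \<le> norm (2 * (cmod (u x))\<^sup>2 + 2 * (cmod (v x))\<^sup>2)" by simp
  qed (use m in measurable)
  then show ?thesis using m by (simp add: L2_def)
qed

lemma L2_mult_bounded:
  fixes \<eta> :: "real^3 \<Rightarrow> real"
  assumes "u \<in> L2 \<Omega>" and "\<eta> \<in> borel_measurable (lebesgue_on \<Omega>)" and "\<And>x. x \<in> \<Omega> \<Longrightarrow> \<bar>\<eta> x\<bar> \<le> B"
  shows "(\<lambda>x. \<eta> x *\<^sub>R u x) \<in> L2 \<Omega>"
proof -
  have m: "u \<in> borel_measurable (lebesgue_on \<Omega>)" using assms L2_measurable by auto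
  have "integrable (lebesgue_on \<Omega>) (\<lambda>x. (cmod (\<eta> x *\<^sub>R u x))\<^sup>2)"
  proof (rule Bochner_Integration.integrable_bound)
    show "integrable (lebesgue_on \<Omega>) (\<lambda>x. B\<^sup>2 * (cmod (u x))\<^sup>2)"
      using assms by (intro integrable_mult_right L2_integrable)
    have "(cmod (\<eta> x *\<^sub>R u x))\<^sup>2 \<le> B\<^sup>2 * (cmod (u x))\<^sup>2" if "x \<in> \<Omega>" for x
    proof -
      have "\<bar>\<eta> x\<bar>\<^sup>2 \<le> B\<^sup>2" using assms(3)[OF that] by (intro power_mono) auto
      then show ?thesis unfolding norm_scaleR power_mult_distrib by (intro mult_right_mono) auto
    qed
    then show "AE x in lebesgue_on \<Omega>. norm ((cmod (\<eta> x *\<^sub>R u x))\<^sup>2) \<le> norm (B\<^sup>2 * (cmod (u x))\<^sup>2)"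
      by (intro AE_I2) (simp add: space_restrict_space)
  qed (use m assms(2) in measurable)
  then show ?thesis using m assms(2) by (simp add: L2_def)
qed

lemma L2_scaleR: "u \<in> L2 \<Omega> \<Longrightarrow> (\<lambda>x. c *\<^sub>R u x) \<in> L2 \<Omega>"
  by (rule L2_mult_bounded[where B = "\<bar>c\<bar>"]) auto

lemma L2_uminus: "u \<in> L2 \<Omega> \<Longrightarrow> (\<lambda>x. - u x) \<in> L2 \<Omega>"
  using L2_scaleR[of u \<Omega> "-1"] by simp

lemma L2_diff: "u \<in> L2 \<Omega> \<Longrightarrow> v \<in> L2 \<Omega> \<Longrightarrow> (\<lambda>x. u x - v x) \<in> L2 \<Omega>"
  using L2_add[OF _ L2_uminus, of u \<Omega> v] by simp

lemma L2_inner_integrable: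
  assumes "u \<in> L2 \<Omega>" "v \<in> L2 \<Omega>"
  shows "integrable (lebesgue_on \<Omega>) (\<lambda>x. u x \<bullet> v x)"
proof (rule Bochner_Integration.integrable_bound)
  show "integrable (lebesgue_on \<Omega>) (\<lambda>x. (cmod (u x))\<^sup>2 + (cmod (v x))\<^sup>2)"
    using assms by (intro Bochner_Integration.integrable_add L2_integrable)
  have "\<bar>u x \<bullet> v x\<bar> \<le> (cmod (u x))\<^sup>2 + (cmod (v x))\<^sup>2" for x
    using Cauchy_Schwarz_ineq2[of "u x" "v x"] sum_squares_bound[of "cmod (u x)" "cmod (v x)"]
      mult_nonneg_nonneg[of "cmod (u x)" "cmod (v x)"]
    by simp
  then show "AE x in lebesgue_on \<Omega>. norm (u x \<bullet> v x) \<le> norm ((cmod (u x))\<^sup>2 + (cmod (v x))\<^sup>2)"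
    by simp
qed (use assms L2_measurable in \<open>auto intro!: borel_measurable_inner\<close>)

lemma L2_norm_nonneg: "L2_norm \<Omega> u \<ge> 0"
  by (simp add: L2_norm_def)

lemma L2_norm_sq: "(L2_norm \<Omega> u)\<^sup>2 = (LINT x|lebesgue_on \<Omega>. (cmod (u x))\<^sup>2)"
  by (simp add: L2_norm_def)

lemma L2_norm_cong_AE:
  assumes "AE x in lebesgue_on \<Omega>. u x = v x" "u \<in> borel_measurable (lebesgue_on \<Omega>)"
    "v \<in> borel_measurable (lebesgue_on \<Omega>)"
  shows "L2_norm \<Omega> u = L2_norm \<Omega> v"
  unfolding L2_norm_def by (intro arg_cong[where f = sqrt] integral_cong_AE) (use assms in auto)

lemma norm_add_scaleR_sq:
  fixes a b :: "'a::real_inner"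
  shows "(norm (a + t *\<^sub>R b))\<^sup>2 = (norm a)\<^sup>2 + (2 * t * (a \<bullet> b) + t\<^sup>2 * (norm b)\<^sup>2)"
  unfolding power2_norm_eq_inner
  by (simp add: inner_add_left inner_add_right inner_commute power2_eq_square algebra_simps)

lemma L2_Cauchy_Schwarz:
  assumes u: "u \<in> L2 \<Omega>" and v: "v \<in> L2 \<Omega>"
  shows "\<bar>LINT x|lebesgue_on \<Omega>. u x \<bullet> v x\<bar> \<le> L2_norm \<Omega> u * L2_norm \<Omega> v"
proof -
  let ?M = "lebesgue_on \<Omega>"
  define A where "A = (LINT x|?M. (cmod (u x))\<^sup>2)"
  define B where "B = (LINT x|?M. u x \<bullet> v x)"
  define C where "C = (LINT x|?M. (cmod (v x))\<^sup>2)"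
  have q: "A + 2 * t * B + t\<^sup>2 * C \<ge> 0" for t
  proof -
    have "(\<lambda>x. (cmod (u x + t *\<^sub>R v x))\<^sup>2) = (\<lambda>x. (cmod (u x))\<^sup>2 + (2 * t * (u x \<bullet> v x) + t\<^sup>2 * (cmod (v x))\<^sup>2))"
      by (intro ext norm_add_scaleR_sq)
    then have "(LINT x|?M. (cmod (u x + t *\<^sub>R v x))\<^sup>2) = A + 2 * t * B + t\<^sup>2 * C"
      unfolding A_def B_def C_def
      using L2_integrable[OF u] L2_integrable[OF v] L2_inner_integrable[OF u v] by simp
    moreover have "(LINT x|?M. (cmod (u x + t *\<^sub>R v x))\<^sup>2) \<ge> 0" by simp
    ultimately show ?thesis by simp
  qed
  have AC: "A \<ge> 0" "C \<ge> 0" unfolding A_def C_def by simp_all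
  have "B\<^sup>2 \<le> A * C"
  proof (cases "C = 0")
    case True
    have "B = 0"
    proof (rule ccontr)
      assume "B \<noteq> 0"
      then show False using q[of "- (A + 1) / (2 * B)"] True AC by (simp add: field_simps)
    qed
    then show ?thesis using AC by simp
  next
    case False
    then show ?thesis using q[of "- B / C"] AC by (simp add: field_simps power2_eq_square)
  qed
  then have "\<bar>B\<bar> \<le> sqrt (A * C)" by (metis real_sqrt_abs real_sqrt_le_mono)
  then show ?thesis by (simp add: A_def B_def C_def L2_norm_def real_sqrt_mult)
qed

lemma L2_norm_triangle:
  assumes u: "u \<in> L2 \<Omega>" and v: "v \<in> L2 \<Omega>"
  shows "L2_norm \<Omega> (\<lambda>x. u x + v x) \<le> L2_norm \<Omega> u + L2_norm \<Omega> v"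
proof (rule power2_le_imp_le)
  have "(\<lambda>x. (cmod (u x + v x))\<^sup>2) = (\<lambda>x. (cmod (u x))\<^sup>2 + (2 * (u x \<bullet> v x) + (cmod (v x))\<^sup>2))"
    using norm_add_scaleR_sq[of _ 1] by (intro ext) simp
  then have "(L2_norm \<Omega> (\<lambda>x. u x + v x))\<^sup>2
      = (L2_norm \<Omega> u)\<^sup>2 + (2 * (LINT x|lebesgue_on \<Omega>. u x \<bullet> v x) + (L2_norm \<Omega> v)\<^sup>2)"
    unfolding L2_norm_sq
    using L2_integrable[OF u] L2_integrable[OF v] L2_inner_integrable[OF u v] by simp
  also have "\<dots> \<le> (L2_norm \<Omega> u + L2_norm \<Omega> v)\<^sup>2"
    using L2_Cauchy_Schwarz[OF u v] by (simp add: power2_sum)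
  finally show "(L2_norm \<Omega> (\<lambda>x. u x + v x))\<^sup>2 \<le> (L2_norm \<Omega> u + L2_norm \<Omega> v)\<^sup>2" .
qed (simp add: L2_norm_nonneg)

lemma L2_norm_scaleR: "L2_norm \<Omega> (\<lambda>x. c *\<^sub>R u x) = \<bar>c\<bar> * L2_norm \<Omega> u"
  by (simp add: L2_norm_def power_mult_distrib real_sqrt_mult)

lemma L2_norm_minus_commute: "L2_norm \<Omega> (\<lambda>x. u x - v x) = L2_norm \<Omega> (\<lambda>x. v x - u x)"
  by (simp add: L2_norm_def norm_minus_commute)

lemma L2_norm_mono_AE:
  assumes "u \<in> borel_measurable (lebesgue_on \<Omega>)" "v \<in> L2 \<Omega>"
    and "AE x in lebesgue_on \<Omega>. cmod (u x) \<le> cmod (v x)"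
  shows "L2_norm \<Omega> u \<le> L2_norm \<Omega> v"
  unfolding L2_norm_def
proof (intro real_sqrt_le_mono integral_mono_AE)
  show ae: "AE x in lebesgue_on \<Omega>. (cmod (u x))\<^sup>2 \<le> (cmod (v x))\<^sup>2"
    using assms(3) by (auto intro: power_mono)
  show "integrable (lebesgue_on \<Omega>) (\<lambda>x. (cmod (v x))\<^sup>2)" using assms L2_integrable by blast
  then show "integrable (lebesgue_on \<Omega>) (\<lambda>x. (cmod (u x))\<^sup>2)"
    by (rule Bochner_Integration.integrable_bound) (use assms(1) ae in auto)
qed

definition L2_tendsto :: "(real^3) set \<Rightarrow> (nat \<Rightarrow> real^3 \<Rightarrow> complex) \<Rightarrow> (real^3 \<Rightarrow> complex) \<Rightarrow> bool" where
  "L2_tendsto \<Omega> u v \<longleftrightarrow> (\<forall>n. u n \<in> L2 \<Omega>) \<and> v \<in> L2 \<Omega> \<and> (\<lambda>n. L2_norm \<Omega> (\<lambda>x. u n x - v x)) \<longlonglongrightarrow> 0"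

lemma real_tendsto_0_bound:
  fixes f g :: "nat \<Rightarrow> real"
  assumes "\<And>n. \<bar>f n\<bar> \<le> g n" "g \<longlonglongrightarrow> 0"
  shows "f \<longlonglongrightarrow> 0"
  by (rule Lim_null_comparison[OF _ assms(2)]) (simp add: assms(1))

lemma L2_tendsto_L2: "L2_tendsto \<Omega> u v \<Longrightarrow> u n \<in> L2 \<Omega>" "L2_tendsto \<Omega> u v \<Longrightarrow> v \<in> L2 \<Omega>"
  by (simp_all add: L2_tendsto_def)

lemma L2_tendsto_const: "v \<in> L2 \<Omega> \<Longrightarrow> L2_tendsto \<Omega> (\<lambda>n. v) v"
  by (simp add: L2_tendsto_def L2_norm_def)

lemma L2_tendsto_add:
  assumes "L2_tendsto \<Omega> u v" "L2_tendsto \<Omega> u' v'"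
  shows "L2_tendsto \<Omega> (\<lambda>n x. u n x + u' n x) (\<lambda>x. v x + v' x)"
  unfolding L2_tendsto_def
proof (intro conjI allI)
  have b: "L2_norm \<Omega> (\<lambda>x. (u n x + u' n x) - (v x + v' x))
     \<le> L2_norm \<Omega> (\<lambda>x. u n x - v x) + L2_norm \<Omega> (\<lambda>x. u' n x - v' x)" for n
    using L2_norm_triangle[of "\<lambda>x. u n x - v x" \<Omega> "\<lambda>x. u' n x - v' x"] assms
    by (simp add: L2_tendsto_def L2_diff algebra_simps)
  have "(\<lambda>n. L2_norm \<Omega> (\<lambda>x. u n x - v x) + L2_norm \<Omega> (\<lambda>x. u' n x - v' x)) \<longlonglongrightarrow> 0 + 0"
    using assms by (intro tendsto_add) (auto simp: L2_tendsto_def)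
  then have lim: "(\<lambda>n. L2_norm \<Omega> (\<lambda>x. u n x - v x) + L2_norm \<Omega> (\<lambda>x. u' n x - v' x)) \<longlonglongrightarrow> 0" by simp
  show "(\<lambda>n. L2_norm \<Omega> (\<lambda>x. (u n x + u' n x) - (v x + v' x))) \<longlonglongrightarrow> 0"
    by (rule tendsto_sandwich[OF _ _ tendsto_const lim]) (use b L2_norm_nonneg in auto)
qed (use assms in \<open>auto simp: L2_tendsto_def intro: L2_add\<close>)

lemma L2_tendsto_mult_bounded:
  fixes \<eta> :: "real^3 \<Rightarrow> real"
  assumes "L2_tendsto \<Omega> u v" and \<eta>: "\<eta> \<in> borel_measurable (lebesgue_on \<Omega>)" "\<And>x. x \<in> \<Omega> \<Longrightarrow> \<bar>\<eta> x\<bar> \<le> B"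
  shows "L2_tendsto \<Omega> (\<lambda>n x. \<eta> x *\<^sub>R u n x) (\<lambda>x. \<eta> x *\<^sub>R v x)"
  unfolding L2_tendsto_def
proof (intro conjI allI)
  have d: "(\<lambda>x. u n x - v x) \<in> L2 \<Omega>" for n by (rule L2_diff[OF L2_tendsto_L2[OF assms(1)]])
  have b: "L2_norm \<Omega> (\<lambda>x. \<eta> x *\<^sub>R u n x - \<eta> x *\<^sub>R v x) \<le> \<bar>B\<bar> * L2_norm \<Omega> (\<lambda>x. u n x - v x)" for n
  proof -
    have "L2_norm \<Omega> (\<lambda>x. \<eta> x *\<^sub>R u n x - \<eta> x *\<^sub>R v x) \<le> L2_norm \<Omega> (\<lambda>x. B *\<^sub>R (u n x - v x))"
    proof (rule L2_norm_mono_AE)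
      show "(\<lambda>x. \<eta> x *\<^sub>R u n x - \<eta> x *\<^sub>R v x) \<in> borel_measurable (lebesgue_on \<Omega>)"
        using L2_measurable[OF L2_mult_bounded[OF d \<eta>]] by (simp add: scaleR_diff_right)
      show "(\<lambda>x. B *\<^sub>R (u n x - v x)) \<in> L2 \<Omega>" by (rule L2_scaleR[OF d])
      have "cmod (\<eta> x *\<^sub>R u n x - \<eta> x *\<^sub>R v x) \<le> cmod (B *\<^sub>R (u n x - v x))" if "x \<in> \<Omega>" for x
      proof -
        have "cmod (\<eta> x *\<^sub>R (u n x - v x)) \<le> cmod (B *\<^sub>R (u n x - v x))"
          unfolding norm_scaleR using \<eta>(2)[OF that] by (intro mult_right_mono) auto
        then show ?thesis by (simp add: scaleR_diff_right)
      qed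
      then show "AE x in lebesgue_on \<Omega>. cmod (\<eta> x *\<^sub>R u n x - \<eta> x *\<^sub>R v x) \<le> cmod (B *\<^sub>R (u n x - v x))"
        by (intro AE_I2) (simp add: space_restrict_space)
    qed
    then show ?thesis by (simp add: L2_norm_scaleR)
  qed
  have "(\<lambda>n. \<bar>B\<bar> * L2_norm \<Omega> (\<lambda>x. u n x - v x)) \<longlonglongrightarrow> \<bar>B\<bar> * 0"
    using assms by (intro tendsto_mult tendsto_const) (auto simp: L2_tendsto_def)
  then have lim: "(\<lambda>n. \<bar>B\<bar> * L2_norm \<Omega> (\<lambda>x. u n x - v x)) \<longlonglongrightarrow> 0" by simp
  show "(\<lambda>n. L2_norm \<Omega> (\<lambda>x. \<eta> x *\<^sub>R u n x - \<eta> x *\<^sub>R v x)) \<longlonglongrightarrow> 0"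
    by (rule tendsto_sandwich[OF _ _ tendsto_const lim]) (use b L2_norm_nonneg in auto)
  show "(\<lambda>x. \<eta> x *\<^sub>R u n x) \<in> L2 \<Omega>" "(\<lambda>x. \<eta> x *\<^sub>R v x) \<in> L2 \<Omega>" for n
    by (rule L2_mult_bounded[OF L2_tendsto_L2(1)[OF assms(1)] \<eta>] L2_mult_bounded[OF L2_tendsto_L2(2)[OF assms(1)] \<eta>]; assumption)+
qed

lemma L2_tendsto_norm:
  assumes "L2_tendsto \<Omega> u v"
  shows "(\<lambda>n. L2_norm \<Omega> (u n)) \<longlonglongrightarrow> L2_norm \<Omega> v"
proof -
  have "\<bar>L2_norm \<Omega> (u n) - L2_norm \<Omega> v\<bar> \<le> L2_norm \<Omega> (\<lambda>x. u n x - v x)" for n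
  proof -
    note uv = L2_tendsto_L2(1)[OF assms, of n] L2_tendsto_L2(2)[OF assms]
    have "L2_norm \<Omega> (u n) \<le> L2_norm \<Omega> (\<lambda>x. u n x - v x) + L2_norm \<Omega> v"
      using L2_norm_triangle[OF L2_diff[OF uv] uv(2)] by simp
    moreover have "L2_norm \<Omega> v \<le> L2_norm \<Omega> (\<lambda>x. v x - u n x) + L2_norm \<Omega> (u n)"
      using L2_norm_triangle[OF L2_diff[OF uv(2,1)] uv(1)] by simp
    moreover have "L2_norm \<Omega> (\<lambda>x. v x - u n x) = L2_norm \<Omega> (\<lambda>x. u n x - v x)"
      by (rule L2_norm_minus_commute)
    ultimately show ?thesis by linarith
  qed
  moreover have "(\<lambda>n. L2_norm \<Omega> (\<lambda>x. u n x - v x)) \<longlonglongrightarrow> 0"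
    using assms by (simp add: L2_tendsto_def)
  ultimately have "(\<lambda>n. L2_norm \<Omega> (u n) - L2_norm \<Omega> v) \<longlonglongrightarrow> 0"
    by (rule real_tendsto_0_bound)
  then show ?thesis by (rule LIM_zero_cancel)
qed

text \<open>The form in which convergence of approximations is used: the integral of a product passes to
  the limit when both factors converge in mean square.\<close>

lemma L2_tendsto_inner:
  assumes u: "L2_tendsto \<Omega> u v" and u': "L2_tendsto \<Omega> u' v'"
  shows "(\<lambda>n. LINT x|lebesgue_on \<Omega>. u n x \<bullet> u' n x) \<longlonglongrightarrow> (LINT x|lebesgue_on \<Omega>. v x \<bullet> v' x)"
proof -
  note L = L2_tendsto_L2[OF u] L2_tendsto_L2[OF u']
  have "\<bar>(LINT x|lebesgue_on \<Omega>. u n x \<bullet> u' n x) - (LINT x|lebesgue_on \<Omega>. v x \<bullet> v' x)\<bar>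
     \<le> L2_norm \<Omega> (\<lambda>x. u n x - v x) * L2_norm \<Omega> (u' n) + L2_norm \<Omega> v * L2_norm \<Omega> (\<lambda>x. u' n x - v' x)" for n
  proof -
    have "(LINT x|lebesgue_on \<Omega>. u n x \<bullet> u' n x) - (LINT x|lebesgue_on \<Omega>. v x \<bullet> v' x)
       = (LINT x|lebesgue_on \<Omega>. (u n x - v x) \<bullet> u' n x) + (LINT x|lebesgue_on \<Omega>. v x \<bullet> (u' n x - v' x))"
      using L by (simp add: inner_diff_left inner_diff_right L2_inner_integrable)
    then show ?thesis
      using L2_Cauchy_Schwarz[OF L2_diff[OF L(1,2)] L(3), of n n] L2_Cauchy_Schwarz[OF L(2) L2_diff[OF L(3,4)], of n]
      by simp
  qed
  moreover have "(\<lambda>n. L2_norm \<Omega> (\<lambda>x. u n x - v x) * L2_norm \<Omega> (u' n) + L2_norm \<Omega> v * L2_norm \<Omega> (\<lambda>x. u' n x - v' x))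
      \<longlonglongrightarrow> 0"
  proof -
    have "(\<lambda>n. L2_norm \<Omega> (\<lambda>x. u n x - v x)) \<longlonglongrightarrow> 0" "(\<lambda>n. L2_norm \<Omega> (\<lambda>x. u' n x - v' x)) \<longlonglongrightarrow> 0"
      using u u' by (simp_all add: L2_tendsto_def)
    then show ?thesis using L2_tendsto_norm[OF u'] by (auto intro!: tendsto_eq_intros)
  qed
  ultimately have "(\<lambda>n. (LINT x|lebesgue_on \<Omega>. u n x \<bullet> u' n x) - (LINT x|lebesgue_on \<Omega>. v x \<bullet> v' x)) \<longlonglongrightarrow> 0"
    by (rule real_tendsto_0_bound)
  then show ?thesis by (rule LIM_zero_cancel)
qed

text \<open>Dominated convergence for a bounded sequence of factors.\<close>

lemma L2_tendsto_factor:
  fixes \<theta> :: "nat \<Rightarrow> real^3 \<Rightarrow> real"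
  assumes v: "v \<in> L2 \<Omega>" and m: "\<And>n. \<theta> n \<in> borel_measurable (lebesgue_on \<Omega>)"
    and b: "\<And>n x. x \<in> \<Omega> \<Longrightarrow> \<bar>\<theta> n x\<bar> \<le> 1" and lim: "\<And>x. x \<in> \<Omega> \<Longrightarrow> (\<lambda>n. \<theta> n x) \<longlonglongrightarrow> 1"
  shows "L2_tendsto \<Omega> (\<lambda>n x. \<theta> n x *\<^sub>R v x) v"
  unfolding L2_tendsto_def
proof (intro conjI allI)
  have vm: "v \<in> borel_measurable (lebesgue_on \<Omega>)" using v L2_measurable by blast
  have "(\<lambda>n. LINT x|lebesgue_on \<Omega>. (cmod (\<theta> n x *\<^sub>R v x - v x))\<^sup>2) \<longlonglongrightarrow> (LINT x|lebesgue_on \<Omega>. 0)"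
  proof (rule integral_dominated_convergence[where w = "\<lambda>x. 4 * (cmod (v x))\<^sup>2"])
    show "integrable (lebesgue_on \<Omega>) (\<lambda>x. 4 * (cmod (v x))\<^sup>2)"
      by (intro integrable_mult_right L2_integrable v)
    have "(\<lambda>n. (cmod (\<theta> n x *\<^sub>R v x - v x))\<^sup>2) \<longlonglongrightarrow> (cmod (1 *\<^sub>R v x - v x))\<^sup>2" if "x \<in> \<Omega>" for x
      by (intro tendsto_intros lim that)
    then show "AE x in lebesgue_on \<Omega>. (\<lambda>n. (cmod (\<theta> n x *\<^sub>R v x - v x))\<^sup>2) \<longlonglongrightarrow> 0"
      by (intro AE_I2) (simp add: space_restrict_space)
    have "(cmod (\<theta> n x *\<^sub>R v x - v x))\<^sup>2 \<le> 4 * (cmod (v x))\<^sup>2" if "x \<in> \<Omega>" for n x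
    proof -
      have "cmod (\<theta> n x *\<^sub>R v x - v x) = \<bar>\<theta> n x - 1\<bar> * cmod (v x)"
        by (metis norm_scaleR scaleR_diff_left scaleR_one)
      also have "\<dots> \<le> 2 * cmod (v x)" using b[OF that, of n] by (intro mult_right_mono) auto
      finally have "(cmod (\<theta> n x *\<^sub>R v x - v x))\<^sup>2 \<le> (2 * cmod (v x))\<^sup>2" by (intro power_mono) auto
      then show ?thesis by simp
    qed
    then show "AE x in lebesgue_on \<Omega>. norm ((cmod (\<theta> n x *\<^sub>R v x - v x))\<^sup>2) \<le> 4 * (cmod (v x))\<^sup>2" for n
      by (intro AE_I2) (simp add: space_restrict_space)
  qed (use m vm in measurable)
  then have "(\<lambda>n. sqrt (LINT x|lebesgue_on \<Omega>. (cmod (\<theta> n x *\<^sub>R v x - v x))\<^sup>2)) \<longlonglongrightarrow> sqrt 0"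
    by (intro tendsto_real_sqrt) simp
  then show "(\<lambda>n. L2_norm \<Omega> (\<lambda>x. \<theta> n x *\<^sub>R v x - v x)) \<longlonglongrightarrow> 0"
    by (simp add: L2_norm_def)
  show "(\<lambda>x. \<theta> n x *\<^sub>R v x) \<in> L2 \<Omega>" for n
    by (rule L2_mult_bounded[OF v m]) (use b in blast)
qed (rule v)

section \<open>Smooth functions\<close>

text \<open>Partial derivatives and smoothness on the whole space for functions with values in any normed
  space.  The recursion on the order makes closure under products an induction.\<close>

definition dir :: "3 \<Rightarrow> (real^3 \<Rightarrow> 'b::real_normed_vector) \<Rightarrow> real^3 \<Rightarrow> 'b" where
  "dir i f x = frechet_derivative f (at x) (axis i 1)"

lemma partial_eq_dir: "partial = dir"
  by (intro ext) (simp add: partial_def dir_def)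

fun Ck :: "nat \<Rightarrow> (real^3 \<Rightarrow> 'b::real_normed_vector) \<Rightarrow> bool" where
  "Ck 0 f \<longleftrightarrow> continuous_on UNIV f"
| "Ck (Suc k) f \<longleftrightarrow> (\<forall>x. f differentiable at x) \<and> (\<forall>i. Ck k (dir i f))"

definition Cinf :: "(real^3 \<Rightarrow> 'b::real_normed_vector) \<Rightarrow> bool" where
  "Cinf f \<longleftrightarrow> (\<forall>k. Ck k f)"

lemma dir_eqI: "(f has_derivative f') (at x) \<Longrightarrow> dir i f x = f' (axis i 1)"
  unfolding dir_def by (metis frechet_derivative_at)

lemma vec3_expansion: "(h::real^3) = (\<Sum>i\<in>UNIV. h $ i *\<^sub>R axis i 1)"
  using basis_expansion[of h] by (simp add: scalar_mult_eq_scaleR)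

lemma differentiable_has_derivative_dir:
  assumes "f differentiable at x"
  shows "(f has_derivative (\<lambda>h. \<Sum>i\<in>UNIV. h $ i *\<^sub>R dir i f x)) (at x)"
proof -
  let ?f' = "frechet_derivative f (at x)"
  have d: "(f has_derivative ?f') (at x)" using assms frechet_derivative_works by blast
  then have l: "linear ?f'" by (rule has_derivative_linear)
  have "?f' h = (\<Sum>i\<in>UNIV. h $ i *\<^sub>R dir i f x)" for h
    by (subst vec3_expansion[of h], subst linear_sum[OF l]) (simp add: dir_def linear_scale[OF l])
  then have "?f' = (\<lambda>h. \<Sum>i\<in>UNIV. h $ i *\<^sub>R dir i f x)" by blast
  with d show ?thesis by simp
qed

lemma dir_has_vector_derivative:
  assumes "f differentiable at (x + t *\<^sub>R axis i 1)"
  shows "((\<lambda>t. f (x + t *\<^sub>R axis i 1)) has_vector_derivative dir i f (x + t *\<^sub>R axis i 1)) (at t)"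
proof -
  let ?f' = "frechet_derivative f (at (x + t *\<^sub>R axis i 1))"
  have d: "(f has_derivative ?f') (at (x + t *\<^sub>R axis i 1))" using assms frechet_derivative_works by blast
  have "((\<lambda>t. x + t *\<^sub>R axis i 1) has_derivative (\<lambda>h. h *\<^sub>R axis i 1)) (at t)"
    by (auto intro!: derivative_eq_intros)
  from diff_chain_at[OF this d]
  have "((\<lambda>t. f (x + t *\<^sub>R axis i 1)) has_derivative (\<lambda>h. ?f' (h *\<^sub>R axis i 1))) (at t)"
    by (simp add: o_def)
  then show ?thesis
    by (simp add: has_vector_derivative_def dir_def linear_scale[OF has_derivative_linear[OF d]])
qed

lemma Ck_lower: "Ck (Suc k) f \<Longrightarrow> Ck k f"
proof (induction k arbitrary: f)
  case 0
  then show ?case by (auto simp: continuous_on_eq_continuous_at intro: differentiable_imp_continuous_within)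
next
  case (Suc k)
  then show ?case by simp
qed

lemma Cinf_differentiable: "Cinf f \<Longrightarrow> f differentiable at x"
  unfolding Cinf_def by (metis Ck.simps(2))

lemma Cinf_dir: "Cinf f \<Longrightarrow> Cinf (dir i f)"
  unfolding Cinf_def by (metis Ck.simps(2))

lemma Cinf_continuous: "Cinf f \<Longrightarrow> continuous_on S f"
  unfolding Cinf_def using continuous_on_subset by (metis Ck.simps(1) top_greatest)

text \<open>Smoothness is mostly obtained from an explicit family of candidates for all derivatives.\<close>

lemma Cinf_jet:
  fixes G :: "nat^3 \<Rightarrow> real^3 \<Rightarrow> 'b::real_normed_vector"
  assumes J: "\<And>\<beta> x. (G \<beta> has_derivative (\<lambda>h. \<Sum>i\<in>UNIV. h $ i *\<^sub>R G (\<beta> + axis i 1) x)) (at x)"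
  shows "dir i (G \<beta>) = G (\<beta> + axis i 1)" "Cinf (G \<beta>)"
proof -
  show d: "dir i (G \<beta>) = G (\<beta> + axis i 1)" for i \<beta>
  proof
    fix x
    have "dir i (G \<beta>) x = (\<Sum>j\<in>UNIV. (axis i 1 :: real^3) $ j *\<^sub>R G (\<beta> + axis j 1) x)"
      by (rule dir_eqI[OF J])
    also have "\<dots> = (\<Sum>j\<in>UNIV. if j = i then G (\<beta> + axis i 1) x else 0)"
      by (intro sum.cong) (auto simp: axis_def)
    finally show "dir i (G \<beta>) x = G (\<beta> + axis i 1) x" by simp
  qed
  have D: "G \<beta> differentiable at x" for \<beta> x using J differentiable_def by blast
  have "Ck k (G \<beta>)" for k \<beta>
  proof (induction k arbitrary: \<beta>)
    case 0
    then show ?case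
      using D by (auto simp: continuous_on_eq_continuous_at intro: differentiable_imp_continuous_within)
  next
    case (Suc k)
    then show ?case using D by (simp add: d)
  qed
  then show "Cinf (G \<beta>)" by (simp add: Cinf_def)
qed

lemma dir_const: "dir i (\<lambda>x. c) = (\<lambda>x. 0)"
  by (rule ext) (rule dir_eqI, rule has_derivative_const)

lemma Ck_const: "Ck k (\<lambda>x. c)"
  by (induction k arbitrary: c) (auto simp: dir_const)

lemma Cinf_const: "Cinf (\<lambda>x. c)"
  by (simp add: Cinf_def Ck_const)

lemma dir_add:
  assumes "f differentiable at x" "g differentiable at x"
  shows "dir i (\<lambda>x. f x + g x) x = dir i f x + dir i g x"
proof -
  have "((\<lambda>x. f x + g x) has_derivative (\<lambda>h. frechet_derivative f (at x) h + frechet_derivative g (at x) h)) (at x)"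
    using assms frechet_derivative_works by (intro has_derivative_add) blast+
  from dir_eqI[OF this] show ?thesis by (simp only: dir_def)
qed

lemma Ck_add: "Ck k f \<Longrightarrow> Ck k g \<Longrightarrow> Ck k (\<lambda>x. f x + g x)"
proof (induction k arbitrary: f g)
  case 0
  then show ?case by (auto intro: continuous_intros)
next
  case (Suc k)
  then have "dir i (\<lambda>x. f x + g x) = (\<lambda>x. dir i f x + dir i g x)" for i
    by (intro ext dir_add) auto
  with Suc show ?case by (auto intro: differentiable_add)
qed

lemma Cinf_add: "Cinf f \<Longrightarrow> Cinf g \<Longrightarrow> Cinf (\<lambda>x. f x + g x)"
  by (simp add: Cinf_def Ck_add)

lemma dir_bilinear:
  assumes "bounded_bilinear pr" "f differentiable at x" "g differentiable at x"
  shows "dir i (\<lambda>x. pr (f x) (g x)) x = pr (f x) (dir i g x) + pr (dir i f x) (g x)"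
proof -
  have d: "(f has_derivative frechet_derivative f (at x)) (at x)"
    "(g has_derivative frechet_derivative g (at x)) (at x)"
    using assms frechet_derivative_works by blast+
  show ?thesis
    unfolding dir_eqI[OF bounded_bilinear.FDERIV[OF assms(1) d]] by (simp add: dir_def)
qed

lemma Ck_bilinear:
  assumes p: "bounded_bilinear pr"
  shows "Ck k f \<Longrightarrow> Ck k g \<Longrightarrow> Ck k (\<lambda>x. pr (f x) (g x))"
proof (induction k arbitrary: f g)
  case 0
  then show ?case by (auto intro: bounded_bilinear.continuous_on[OF p])
next
  case (Suc k)
  then have D: "f differentiable at x" "g differentiable at x" for x by auto
  have e: "dir i (\<lambda>x. pr (f x) (g x)) = (\<lambda>x. pr (f x) (dir i g x) + pr (dir i f x) (g x))" for i
    by (intro ext dir_bilinear[OF p] D)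
  have "Ck k (\<lambda>x. pr (f x) (dir i g x))" "Ck k (\<lambda>x. pr (dir i f x) (g x))" for i
    using Suc.IH[of f "dir i g"] Suc.IH[of "dir i f" g] Suc.prems Ck_lower by auto
  then have "Ck k (dir i (\<lambda>x. pr (f x) (g x)))" for i
    unfolding e by (rule Ck_add)
  moreover have "(\<lambda>x. pr (f x) (g x)) differentiable at x" for x
  proof -
    obtain f' g' where "(f has_derivative f') (at x)" "(g has_derivative g') (at x)"
      using D[of x] unfolding differentiable_def by auto
    from bounded_bilinear.FDERIV[OF p this] show ?thesis by (rule differentiableI)
  qed
  ultimately show ?case by simp
qed

lemma Cinf_bilinear:
  "bounded_bilinear pr \<Longrightarrow> Cinf f \<Longrightarrow> Cinf g \<Longrightarrow> Cinf (\<lambda>x. pr (f x) (g x))"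
  by (simp add: Cinf_def Ck_bilinear)

lemmas Cinf_scaleR = Cinf_bilinear[OF bounded_bilinear_scaleR]
lemmas Cinf_inner = Cinf_bilinear[OF bounded_bilinear_inner]
lemmas Cinf_mult = Cinf_bilinear[OF bounded_bilinear_mult]

lemma Cinf_coord: "Cinf (\<lambda>x. x $ i)" and dir_coord: "dir j (\<lambda>x. x $ i) x = (if j = i then 1 else 0)"
proof -
  have d: "((\<lambda>x. x $ i) has_derivative (\<lambda>h. h $ i)) (at x)" for x :: "real^3"
    by (rule bounded_linear_imp_has_derivative[OF bounded_linear_vec_nth])
  show e: "dir j (\<lambda>x. x $ i) x = (if j = i then 1 else 0)" for j x
    by (simp add: dir_eqI[OF d] axis_def)
  have "dir j (\<lambda>x. x $ i) = (\<lambda>x. if j = i then 1 else 0)" for j by (rule ext) (rule e)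
  then have "Ck k (dir j (\<lambda>x. x $ i))" for j k
    using Cinf_const[of "if j = i then 1 else (0::real)"] by (simp add: Cinf_def)
  moreover have "(\<lambda>x. x $ i) differentiable at x" for x :: "real^3" using d differentiable_def by blast
  ultimately have "Ck (Suc k) (\<lambda>x. x $ i)" for k by simp
  then show "Cinf (\<lambda>x. x $ i)" unfolding Cinf_def using Ck_lower by blast
qed

lemma Cinf_power: "Cinf (f :: real^3 \<Rightarrow> real) \<Longrightarrow> Cinf (\<lambda>x. f x ^ n)"
  by (induction n) (auto intro: Cinf_const Cinf_mult)

lemma Cinf_uminus: "Cinf (f :: real^3 \<Rightarrow> 'b::real_normed_vector) \<Longrightarrow> Cinf (\<lambda>x. - f x)"
  using Cinf_scaleR[OF Cinf_const, of f "-1"] by simp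

lemma Cinf_diff:
  "Cinf (f :: real^3 \<Rightarrow> 'b::real_normed_vector) \<Longrightarrow> Cinf g \<Longrightarrow> Cinf (\<lambda>x. f x - g x)"
  using Cinf_add[OF _ Cinf_uminus, of f g] by simp

lemma dir_exp:
  fixes q :: "real^3 \<Rightarrow> real"
  assumes "q differentiable at x"
  shows "(\<lambda>x. exp (q x)) differentiable at x" "dir i (\<lambda>x. exp (q x)) x = exp (q x) * dir i q x"
proof -
  have d: "(q has_derivative frechet_derivative q (at x)) (at x)"
    using assms frechet_derivative_works by blast
  have e: "((\<lambda>x. exp (q x)) has_derivative (\<lambda>h. exp (q x) * frechet_derivative q (at x) h)) (at x)"
    using d by (auto intro!: derivative_eq_intros simp: mult.commute)
  show "(\<lambda>x. exp (q x)) differentiable at x" using e differentiable_def by blast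
  show "dir i (\<lambda>x. exp (q x)) x = exp (q x) * dir i q x" unfolding dir_eqI[OF e] by (simp add: dir_def)
qed

lemma Cinf_exp:
  fixes q :: "real^3 \<Rightarrow> real"
  assumes "Cinf q" shows "Cinf (\<lambda>x. exp (q x))"
proof -
  have "Ck k (\<lambda>x. exp (q x))" for k
  proof (induction k)
    case 0
    then show ?case using Cinf_continuous[OF assms] by (auto intro: continuous_intros)
  next
    case (Suc k)
    have "dir i (\<lambda>x. exp (q x)) = (\<lambda>x. exp (q x) * dir i q x)" for i
      using Cinf_differentiable[OF assms] by (intro ext dir_exp)
    moreover have "Ck k (dir i q)" for i using Cinf_dir[OF assms] by (simp add: Cinf_def)
    ultimately show ?case using dir_exp(1)[OF Cinf_differentiable[OF assms]] Suc
      by (auto intro: Ck_bilinear[OF bounded_bilinear_mult])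
  qed
  then show ?thesis by (simp add: Cinf_def)
qed

section \<open>Integration over the cube\<close>

abbreviation ccube :: "real \<Rightarrow> (real^3) set" where
  "ccube R \<equiv> cbox (\<chi> i. - R) (\<chi> i. R)"

lemma mem_ccube: "x \<in> ccube R \<longleftrightarrow> (\<forall>i. \<bar>x $ i\<bar> \<le> R)"
  by (auto simp: mem_box_cart abs_le_iff minus_le_iff)

lemma mem_cube: "x \<in> cube R \<longleftrightarrow> (\<forall>i. \<bar>x $ i\<bar> < R)"
  by (auto simp: cube_def forall_3)

lemma cube_eq_box: "cube R = box (\<chi> i. - R) (\<chi> i. R)"
  by (auto simp: mem_cube mem_box_cart abs_less_iff minus_less_iff set_eq_iff)

lemma cube_subset_ccube: "cube R \<subseteq> ccube R"
  unfolding cube_eq_box by (rule box_subset_cbox)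

lemma sets_cube [measurable, simp]: "cube R \<in> sets lebesgue" "cube R \<in> sets borel"
  by (simp_all add: cube_eq_box)

lemma closure_cube: "R > 0 \<Longrightarrow> closure (cube R) = ccube R"
  unfolding cube_eq_box by (intro closure_box) (simp add: interval_eq_empty_cart not_le)

lemma continuous_bounded_on_ccube:
  fixes f :: "real^3 \<Rightarrow> 'b::real_normed_vector"
  assumes "continuous_on (ccube R) f"
  obtains B where "\<And>x. x \<in> ccube R \<Longrightarrow> norm (f x) \<le> B"
proof -
  have "bounded (f ` ccube R)"
    using compact_continuous_image[OF assms compact_cbox] by (rule compact_imp_bounded)
  then show ?thesis using that unfolding bounded_iff by blast
qed

lemma continuous_integrable_cube:
  fixes f :: "real^3 \<Rightarrow> 'b::euclidean_space"
  assumes "continuous_on (ccube R) f"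
  shows "integrable (lebesgue_on (cube R)) f"
proof -
  have "f absolutely_integrable_on ccube R" by (rule absolutely_integrable_continuous[OF assms])
  then have "f absolutely_integrable_on cube R"
    by (rule set_integrable_subset) (auto simp: cube_subset_ccube)
  then show ?thesis by (simp add: integrable_restrict_space set_integrable_def)
qed

lemma integral_cube_eq_ccube:
  fixes f :: "real^3 \<Rightarrow> 'b::euclidean_space"
  assumes "continuous_on (ccube R) f"
  shows "(LINT x|lebesgue_on (cube R). f x) = integral (ccube R) f"
proof -
  have "(LINT x|lebesgue_on (cube R). f x) = integral (cube R) f"
    by (rule lebesgue_integral_eq_integral[OF continuous_integrable_cube[OF assms]]) simp
  also have "\<dots> = integral (ccube R) f"
    unfolding cube_eq_box by (rule integral_open_interval)
  finally show ?thesis .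
qed

lemma measurable_cube_continuous:
  fixes f :: "real^3 \<Rightarrow> 'b::euclidean_space"
  assumes "continuous_on (ccube R) f"
  shows "f \<in> borel_measurable (lebesgue_on (cube R))"
  using continuous_integrable_cube[OF assms] by (rule borel_measurable_integrable)

lemma continuous_L2_cube:
  assumes "continuous_on (ccube R) f" shows "f \<in> L2 (cube R)"
  unfolding L2_def using assms
  by (auto intro!: measurable_cube_continuous continuous_integrable_cube continuous_intros)

lemma Cinf_L2: "Cinf f \<Longrightarrow> f \<in> L2 (cube R)"
  by (intro continuous_L2_cube Cinf_continuous)

lemma Cinf_bounded_cube:
  fixes \<eta> :: "real^3 \<Rightarrow> real"
  assumes "Cinf \<eta>"
  obtains B where "\<And>x. x \<in> cube R \<Longrightarrow> \<bar>\<eta> x\<bar> \<le> B"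
proof -
  obtain B where "\<And>x. x \<in> ccube R \<Longrightarrow> norm (\<eta> x) \<le> B"
    using continuous_bounded_on_ccube[OF Cinf_continuous[OF assms, of "ccube R"]] by blast
  then show ?thesis using that cube_subset_ccube by (metis real_norm_def subsetD)
qed

lemma Cinf_measurable_cube:
  fixes \<eta> :: "real^3 \<Rightarrow> 'b::euclidean_space"
  shows "Cinf \<eta> \<Longrightarrow> \<eta> \<in> borel_measurable (lebesgue_on (cube R))"
  by (intro measurable_cube_continuous Cinf_continuous)

text \<open>The fundamental theorem of calculus in direction \<open>i\<close>, in the one-sided form in which boundary
  terms are estimated.  The derivative of the integral over the cube translated by \<open>t\<close> in direction
  \<open>i\<close> is the integral of \<open>dir i G\<close>; translating the cube adds a slab of thickness \<open>t\<close> at the face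
  \<open>x\<^sub>i = R\<close> and removes one at the face \<open>x\<^sub>i = - R\<close>.  This avoids iterated integrals.  Each of the two faces
  has area \<open>4 R\<^sup>2\<close>.\<close>

lemma integral_dir_ge:
  fixes G :: "real^3 \<Rightarrow> real"
  assumes R: "R > 0" and D: "\<And>x. G differentiable at x" and C: "continuous_on UNIV (dir i G)"
    and top: "\<And>x. x \<in> ccube R \<Longrightarrow> x $ i = R \<Longrightarrow> G x \<ge> - e"
    and bot: "\<And>x. x \<in> ccube R \<Longrightarrow> x $ i = - R \<Longrightarrow> G x \<le> e"
  shows "(LINT x|lebesgue_on (cube R). dir i G x) \<ge> - (8 * R\<^sup>2 * e)"
proof -
  define v where "v = (axis i 1 :: real^3)"
  define \<Phi> where "\<Phi> = (\<lambda>t. integral (ccube R) (\<lambda>x. G (x + t *\<^sub>R v)))"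
  have vB: "v \<in> Basis" unfolding v_def by (simp add: axis_in_Basis_iff)
  have Gc: "continuous_on S G" for S
    using D by (meson continuous_at_imp_continuous_on differentiable_imp_continuous_within)
  have "(\<Phi> has_vector_derivative integral (ccube R) (\<lambda>x. dir i G (x + 0 *\<^sub>R v))) (at 0 within UNIV)"
    unfolding \<Phi>_def
  proof (rule leibniz_rule_vector_derivative)
    show "((\<lambda>t. G (x + t *\<^sub>R v)) has_vector_derivative dir i G (x + t *\<^sub>R v)) (at t within UNIV)" for x t
      unfolding v_def using D by (simp add: dir_has_vector_derivative)
    show "(\<lambda>x. G (x + t *\<^sub>R v)) integrable_on ccube R" for t
      by (intro integrable_continuous continuous_on_compose2[OF Gc[of UNIV]] continuous_intros) auto
    show "continuous_on (UNIV \<times> ccube R) (\<lambda>(t, x). dir i G (x + t *\<^sub>R v))"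
      unfolding split_def by (intro continuous_on_compose2[OF C] continuous_intros) auto
  qed auto
  then have "((\<lambda>t. (\<Phi> (0 + t) - \<Phi> 0) / t) \<longlongrightarrow> integral (ccube R) (dir i G)) (at 0)"
    by (simp add: has_real_derivative_iff_has_vector_derivative[symmetric] DERIV_def)
  then have lim: "((\<lambda>t. (\<Phi> t - \<Phi> 0) / t) \<longlongrightarrow> integral (ccube R) (dir i G)) (at_right 0)"
    by (simp add: filterlim_at_split)
  have big: "ccube R \<subseteq> ccube (2 * R)"
  proof
    fix y assume "y \<in> ccube R"
    then have "\<bar>y $ j\<bar> \<le> R" for j unfolding mem_ccube by blast
    then have "\<bar>y $ j\<bar> \<le> 2 * R" for j using R order_trans[of "\<bar>y $ j\<bar>" R "2 * R"] by simp
    then show "y \<in> ccube (2 * R)" unfolding mem_ccube by blast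
  qed
  have "integral (ccube R) (dir i G) \<ge> - (8 * R\<^sup>2 * (e + \<epsilon>))" if \<epsilon>: "\<epsilon> > 0" for \<epsilon>
  proof -
    have "uniformly_continuous_on (ccube (2 * R)) G"
      by (intro compact_uniformly_continuous Gc compact_cbox)
    then obtain \<delta> where \<delta>: "\<delta> > 0"
      "\<And>x y. x \<in> ccube (2 * R) \<Longrightarrow> y \<in> ccube (2 * R) \<Longrightarrow> dist x y < \<delta> \<Longrightarrow> dist (G x) (G y) < \<epsilon>"
      unfolding uniformly_continuous_on_def using \<epsilon> by metis
    have "(\<Phi> t - \<Phi> 0) / t \<ge> - (8 * R\<^sup>2 * (e + \<epsilon>))" if t: "0 < t" "t < min \<delta> R" for t
    proof -
      \<comment> \<open>The cube is the box from \<open>l\<close> to \<open>uC\<close>, its translate the one from \<open>l2\<close> to \<open>u\<close>; the slabs are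
        those from \<open>lT\<close> to \<open>u\<close> and from \<open>l\<close> to \<open>uB\<close>.\<close>
      define l where "l = (\<chi> j. - R :: real^3)"
      define u where "u = (\<chi> j. if j = i then R + t else R :: real^3)"
      define l2 where "l2 = (\<chi> j. if j = i then - R + t else - R :: real^3)"
      define lT where "lT = (\<chi> j. if j = i then R else - R :: real^3)"
      define uB where "uB = (\<chi> j. if j = i then - R + t else R :: real^3)"
      define uC where "uC = (\<chi> j. R :: real^3)"
      have xv: "x \<bullet> v = x $ i" for x :: "real^3" unfolding v_def by (simp add: inner_axis)
      have s1: "cbox l u \<inter> {x. x \<bullet> v \<le> R} = ccube R"
        unfolding l_def u_def xv using t by (auto simp: mem_box_cart) (smt (verit))+
      have s2: "cbox l u \<inter> {x. x \<bullet> v \<ge> R} = cbox lT u"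
        unfolding l_def u_def lT_def xv using t R by (auto simp: mem_box_cart) (smt (verit))+
      have s3: "cbox l u \<inter> {x. x \<bullet> v \<le> - R + t} = cbox l uB"
        unfolding l_def u_def uB_def xv using t R by (auto simp: mem_box_cart) (smt (verit))+
      have s4: "cbox l u \<inter> {x. x \<bullet> v \<ge> - R + t} = cbox l2 u"
        unfolding l_def u_def l2_def xv using t R by (auto simp: mem_box_cart) (smt (verit))+
      have int: "G integrable_on cbox p q" for p q by (intro integrable_continuous Gc)
      have "integral (cbox l u) G = \<Phi> 0 + integral (cbox lT u) G"
        using integral_split[OF int vB, of l u R] by (simp add: s1 s2 \<Phi>_def)
      moreover have "integral (cbox l u) G = integral (cbox l uB) G + integral (cbox l2 u) G"
        using integral_split[OF int vB, of l u "- R + t"] unfolding s3 s4 by simp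
      moreover have "integral (cbox l2 u) G = \<Phi> t"
      proof -
        have "l2 = l + t *\<^sub>R v" "u = uC + t *\<^sub>R v"
          unfolding Finite_Cartesian_Product.vec_eq_iff by (auto simp: l2_def l_def u_def uC_def v_def axis_def)
        then have "integral (cbox l2 u) G = integral (cbox l uC) (\<lambda>x. G (x + t *\<^sub>R v))"
          using integral_shift_cbox_plus[where f = G and c = "t *\<^sub>R v" and a = l and b = uC] by (simp add: o_def add.commute)
        then show ?thesis by (simp add: \<Phi>_def l_def uC_def)
      qed
      moreover have cont: "measure lborel (cbox lT u) = t * (2 * R)\<^sup>2" "measure lborel (cbox l uB) = t * (2 * R)\<^sup>2"
      proof -
        have ne: "cbox lT u \<noteq> {}" "cbox l uB \<noteq> {}"
          using R t by (auto simp: interval_eq_empty_cart lT_def u_def l_def uB_def not_less split: if_splits)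
        have pr: "(\<Prod>j\<in>UNIV. if j = i then t else 2 * R) = t * (2 * R)\<^sup>2"
        proof -
          have "(\<Prod>j\<in>UNIV. if j = i then t else 2 * R) = t * (\<Prod>j\<in>UNIV - {i}. if j = i then t else 2 * R)"
            by (subst prod.remove[of UNIV i]) auto
          also have "(\<Prod>j\<in>UNIV - {i}. if j = i then t else 2 * R) = (\<Prod>j\<in>UNIV - {i}. 2 * R)"
            by (rule prod.cong) auto
          also have "\<dots> = (2 * R)\<^sup>2" by (simp add: card_Diff_singleton)
          finally show ?thesis .
        qed
        have "(\<Prod>j\<in>UNIV. u $ j - lT $ j) = (\<Prod>j\<in>UNIV. if j = i then t else 2 * R)"
          "(\<Prod>j\<in>UNIV. uB $ j - l $ j) = (\<Prod>j\<in>UNIV. if j = i then t else 2 * R)"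
          by (auto simp: u_def lT_def uB_def l_def intro!: prod.cong)
        then show "measure lborel (cbox lT u) = t * (2 * R)\<^sup>2" "measure lborel (cbox l uB) = t * (2 * R)\<^sup>2"
          unfolding content_cbox_cart[OF ne(1)] content_cbox_cart[OF ne(2)] pr by simp_all
      qed
      moreover have "integral (cbox lT u) G \<ge> t * (2 * R)\<^sup>2 * (- (e + \<epsilon>))"
      proof -
        have "- (e + \<epsilon>) \<le> G x" if x: "x \<in> cbox lT u" for x
        proof -
          define y where "y = (\<chi> j. if j = i then R else x $ j)"
          have xi: "R \<le> x $ i" "x $ i \<le> R + t" and xj: "j \<noteq> i \<Longrightarrow> \<bar>x $ j\<bar> \<le> R" for j
            using x[unfolded mem_box_cart lT_def u_def, THEN spec, of i]
              x[unfolded mem_box_cart lT_def u_def, THEN spec, of j] by (auto split: if_splits)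
          have "x - y = (x $ i - R) *\<^sub>R v"
            by (auto simp: y_def v_def Finite_Cartesian_Product.vec_eq_iff axis_def)
          then have "dist x y = \<bar>x $ i - R\<bar>" by (simp add: dist_norm v_def norm_axis_1)
          then have "dist x y < \<delta>" using xi t by simp
          moreover have yc: "y \<in> ccube R" using xj R by (auto simp: mem_ccube y_def)
          moreover have "y \<in> ccube (2 * R)" using yc big by blast
          moreover have "x \<in> ccube (2 * R)" unfolding mem_ccube
          proof
            fix j show "\<bar>x $ j\<bar> \<le> 2 * R" using xi xj[of j] t R by (cases "j = i") auto
          qed
          ultimately have "dist (G x) (G y) < \<epsilon>" using \<delta>(2) by blast
          moreover have "G y \<ge> - e" by (rule top[OF yc]) (simp add: y_def)
          ultimately show ?thesis by (simp add: dist_real_def)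
        qed
        then have "integral (cbox lT u) (\<lambda>x. - (e + \<epsilon>)) \<le> integral (cbox lT u) G"
          by (intro integral_le int) auto
        then show ?thesis using cont by simp
      qed
      moreover have "integral (cbox l uB) G \<le> t * (2 * R)\<^sup>2 * (e + \<epsilon>)"
      proof -
        have "G x \<le> e + \<epsilon>" if x: "x \<in> cbox l uB" for x
        proof -
          define y where "y = (\<chi> j. if j = i then - R else x $ j)"
          have xi: "- R \<le> x $ i" "x $ i \<le> - R + t" and xj: "j \<noteq> i \<Longrightarrow> \<bar>x $ j\<bar> \<le> R" for j
            using x[unfolded mem_box_cart l_def uB_def, THEN spec, of i]
              x[unfolded mem_box_cart l_def uB_def, THEN spec, of j] by (auto split: if_splits)
          have "x - y = (x $ i + R) *\<^sub>R v"
            by (auto simp: y_def v_def Finite_Cartesian_Product.vec_eq_iff axis_def)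
          then have "dist x y = \<bar>x $ i + R\<bar>" by (simp add: dist_norm v_def norm_axis_1)
          then have "dist x y < \<delta>" using xi t by simp
          moreover have yc: "y \<in> ccube R" using xj R by (auto simp: mem_ccube y_def)
          moreover have "y \<in> ccube (2 * R)" using yc big by blast
          moreover have "x \<in> ccube (2 * R)" unfolding mem_ccube
          proof
            fix j show "\<bar>x $ j\<bar> \<le> 2 * R" using xi xj[of j] t R by (cases "j = i") auto
          qed
          ultimately have "dist (G x) (G y) < \<epsilon>" using \<delta>(2) by blast
          moreover have "G y \<le> e" by (rule bot[OF yc]) (simp add: y_def)
          ultimately show ?thesis by (simp add: dist_real_def)
        qed
        then have "integral (cbox l uB) G \<le> integral (cbox l uB) (\<lambda>x. e + \<epsilon>)"
          by (intro integral_le int) auto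
        then show ?thesis using cont by simp
      qed
      ultimately have "\<Phi> t - \<Phi> 0 \<ge> t * (- (8 * R\<^sup>2 * (e + \<epsilon>)))"
        by (simp add: algebra_simps power2_eq_square)
      then show ?thesis using t by (simp add: field_simps)
    qed
    then have "eventually (\<lambda>t. - (8 * R\<^sup>2 * (e + \<epsilon>)) \<le> (\<Phi> t - \<Phi> 0) / t) (at_right 0)"
      using \<delta> R by (intro eventually_at_rightI[of 0 "min \<delta> R"]) auto
    then show ?thesis
      by (intro tendsto_lowerbound[OF lim]) auto
  qed
  note * = this
  have "integral (ccube R) (dir i G) \<ge> - (8 * R\<^sup>2 * e)"
  proof (rule field_le_epsilon)
    fix \<epsilon> :: real assume \<epsilon>: "\<epsilon> > 0"
    have "- (8 * R\<^sup>2 * (e + \<epsilon> / (8 * R\<^sup>2))) \<le> integral (ccube R) (dir i G)"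
      using \<epsilon> R by (intro *) simp
    then show "- (8 * R\<^sup>2 * e) \<le> integral (ccube R) (dir i G) + \<epsilon>"
      using R by (simp add: algebra_simps)
  qed
  then show ?thesis
    using integral_cube_eq_ccube[OF continuous_on_subset[OF C], of R] by simp
qed

section \<open>Test functions\<close>

text \<open>The derivatives of \<open>exp (- 1 / x)\<close>, extended by zero to \<open>x \<le> 0\<close>, are polynomials in \<open>1 / x\<close> times
  the function; these are the polynomials, in the recursion given by the chain rule.\<close>

fun hpoly :: "nat \<Rightarrow> real poly" where
  "hpoly 0 = 1"
| "hpoly (Suc n) = [:0, 0, 1:] * (hpoly n - pderiv (hpoly n))"

definition hfun :: "nat \<Rightarrow> real \<Rightarrow> real" where
  "hfun n x = (if x \<le> 0 then 0 else poly (hpoly n) (1 / x) * exp (- (1 / x)))"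

lemma poly_exp_minus_tendsto_0: "((\<lambda>y. poly p y * exp (- y)) \<longlongrightarrow> (0::real)) at_top"
proof -
  have "((\<lambda>y. \<Sum>i\<le>degree p. coeff p i * (y ^ i / exp y)) \<longlongrightarrow> (\<Sum>i\<le>degree p. coeff p i * 0)) at_top"
    by (intro tendsto_sum tendsto_mult tendsto_const tendsto_power_div_exp_0)
  then show ?thesis
    by (simp add: poly_altdef exp_minus sum_distrib_right divide_inverse mult.assoc)
qed

text \<open>A function of one variable is carried along with its derivatives, as the sequence of all of them.\<close>

definition smooth1 :: "(nat \<Rightarrow> real \<Rightarrow> real) \<Rightarrow> bool" where
  "smooth1 B \<longleftrightarrow> (\<forall>n x. (B n has_real_derivative B (Suc n) x) (at x))"

lemma smooth1_hfun: "smooth1 hfun"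
  unfolding smooth1_def
proof (intro allI)
  fix n and x :: real
  consider "x < 0" | "x = 0" | "x > 0" by linarith
  then show "(hfun n has_real_derivative hfun (Suc n) x) (at x)"
  proof cases
    case 1
    have "((\<lambda>x. 0) has_real_derivative hfun (Suc n) x) (at x)" using 1 by (simp add: hfun_def)
    then show ?thesis
      by (rule has_field_derivative_transform_within_open[of _ _ _ "{..<0}"]) (use 1 in \<open>auto simp: hfun_def\<close>)
  next
    case 2
    have l: "((\<lambda>t. (hfun n (0 + t) - hfun n 0) / t) \<longlongrightarrow> 0) (at_left 0)"
      by (rule tendsto_eventually, rule eventually_at_leftI[of "-1"]) (auto simp: hfun_def)
    have "((\<lambda>t. poly ([:0, 1:] * hpoly n) (1 / t) * exp (- (1 / t))) \<longlongrightarrow> 0) (at_right (0::real))"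
      using filterlim_compose[OF poly_exp_minus_tendsto_0 filterlim_inverse_at_top_right]
      unfolding inverse_eq_divide .
    then have r: "((\<lambda>t. (hfun n (0 + t) - hfun n 0) / t) \<longlongrightarrow> 0) (at_right 0)"
      by (rule Lim_transform_eventually, intro eventually_at_rightI[of _ 1]) (auto simp: hfun_def)
    from l r have "((\<lambda>t. (hfun n (0 + t) - hfun n 0) / t) \<longlongrightarrow> 0) (at 0)"
      by (simp add: filterlim_at_split)
    then show ?thesis using 2 by (simp add: DERIV_def hfun_def)
  next
    case 3
    have "((\<lambda>x. poly (hpoly n) (1 / x) * exp (- (1 / x))) has_real_derivative hfun (Suc n) x) (at x)"
      using 3 by (auto intro!: derivative_eq_intros
        simp: hfun_def field_simps power2_eq_square)
    then show ?thesis
      by (rule has_field_derivative_transform_within_open[of _ _ _ "{0<..}"]) (use 3 in \<open>auto simp: hfun_def\<close>)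
  qed
qed

lemma hfun_0: "hfun 0 x \<ge> 0" "hfun 0 x \<le> 1" "x > 0 \<Longrightarrow> hfun 0 x > 0"
  by (auto simp: hfun_def)

lemma smooth1_affine:
  assumes "smooth1 B" shows "smooth1 (\<lambda>n x. c ^ n * B n (c * x + d))"
  unfolding smooth1_def
proof (intro allI)
  fix n x
  have "(B n has_real_derivative B (Suc n) (c * x + d)) (at (c * x + d))"
    using assms by (simp add: smooth1_def)
  note chain = DERIV_chain2[where f = "B n" and g = "\<lambda>x. c * x + d" and x = x and s = UNIV and Db = c, OF this]
  have "((\<lambda>x. B n (c * x + d)) has_real_derivative B (Suc n) (c * x + d) * c) (at x)"
    by (rule chain) (auto intro!: derivative_eq_intros)
  from DERIV_cmult[OF this, of "c ^ n"]
  show "((\<lambda>x. c ^ n * B n (c * x + d)) has_real_derivative c ^ Suc n * B (Suc n) (c * x + d)) (at x)"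
    by (simp add: mult_ac)
qed

lemma Leibniz_sum:
  fixes F G :: "nat \<Rightarrow> real"
  shows "(\<Sum>k\<le>n. real (n choose k) * (F (Suc k) * G (n - k) + F k * G (Suc (n - k))))
       = (\<Sum>k\<le>Suc n. real (Suc n choose k) * (F k * G (Suc n - k)))"
proof -
  define T where "T = (\<lambda>k. F k * G (Suc n - k))"
  have "(\<Sum>k\<le>Suc n. real (Suc n choose k) * T k) = T 0 + (\<Sum>k\<le>n. real (Suc n choose Suc k) * T (Suc k))"
    by (subst sum.atMost_Suc_shift) simp
  also have "\<dots> = (\<Sum>k\<le>n. real (n choose k) * T (Suc k)) + (T 0 + (\<Sum>k\<le>n. real (n choose Suc k) * T (Suc k)))"
    by (simp add: algebra_simps sum.distrib)
  also have "T 0 + (\<Sum>k\<le>n. real (n choose Suc k) * T (Suc k)) = (\<Sum>k\<le>Suc n. real (n choose k) * T k)"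
    by (subst sum.atMost_Suc_shift) simp
  also have "\<dots> = (\<Sum>k\<le>n. real (n choose k) * T k)" by simp
  also have "\<dots> = (\<Sum>k\<le>n. real (n choose k) * (F k * G (Suc (n - k))))"
    by (intro sum.cong) (auto simp: T_def Suc_diff_le)
  finally show ?thesis by (simp add: T_def distrib_left sum.distrib)
qed

lemma smooth1_mult:
  assumes "smooth1 F" "smooth1 G"
  shows "smooth1 (\<lambda>n x. \<Sum>k\<le>n. real (n choose k) * (F k x * G (n - k) x))"
  unfolding smooth1_def
proof (intro allI)
  fix n x
  have d: "(F k has_real_derivative F (Suc k) x) (at x)" "(G k has_real_derivative G (Suc k) x) (at x)" for k
    using assms by (auto simp: smooth1_def)
  have "((\<lambda>x. \<Sum>k\<le>n. real (n choose k) * (F k x * G (n - k) x)) has_real_derivative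
      (\<Sum>k\<le>n. real (n choose k) * (F (Suc k) x * G (n - k) x + F k x * G (Suc (n - k)) x))) (at x)"
    by (auto intro!: derivative_eq_intros d simp: algebra_simps)
  then show "((\<lambda>x. \<Sum>k\<le>n. real (n choose k) * (F k x * G (n - k) x)) has_real_derivative
      (\<Sum>k\<le>Suc n. real (Suc n choose k) * (F k x * G (Suc n - k) x))) (at x)"
    by (simp only: Leibniz_sum[of n "\<lambda>k. F k x" "\<lambda>k. G k x"])
qed

text \<open>The \<open>n\<close>-th derivative, by the Leibniz rule, of \<open>h (N (x - p)) h (N (q - x))\<close> with
  \<open>h x = exp (- 1 / x)\<close>: positive exactly on the interval from \<open>p\<close> to \<open>q\<close>, and steeper for larger \<open>N\<close>.\<close>

definition bump :: "real \<Rightarrow> real \<Rightarrow> real \<Rightarrow> nat \<Rightarrow> real \<Rightarrow> real" where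
  "bump N p q = (\<lambda>n x. \<Sum>k\<le>n. real (n choose k) *
     ((N ^ k * hfun k (N * x + - (N * p))) * ((- N) ^ (n - k) * hfun (n - k) (- N * x + N * q))))"

lemma smooth1_bump: "smooth1 (bump N p q)"
  unfolding bump_def by (intro smooth1_mult smooth1_affine smooth1_hfun)

lemma bump_support:
  assumes "N > 0" "\<not> (p < x \<and> x < q)" shows "bump N p q n x = 0"
proof -
  have "x \<le> p \<or> q \<le> x" using assms by auto
  then have "N * x + - (N * p) \<le> 0 \<or> - N * x + N * q \<le> 0"
    using assms by (auto intro: mult_left_mono)
  then show ?thesis unfolding bump_def hfun_def by (intro sum.neutral) auto
qed

lemma bump_0: "bump N p q 0 x = hfun 0 (N * (x - p)) * hfun 0 (N * (q - x))"
  by (simp add: bump_def algebra_simps)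

lemma smooth1_continuous: "smooth1 B \<Longrightarrow> continuous_on S (B n)"
  unfolding smooth1_def by (meson DERIV_isCont continuous_at_imp_continuous_on)

lemma smooth1_bounded:
  assumes "smooth1 B" and "\<And>n x. x \<notin> {p..q} \<Longrightarrow> B n x = 0"
  obtains C where "\<And>x. \<bar>B n x\<bar> \<le> C"
proof -
  have "bounded (B n ` {p..q})"
    by (intro compact_imp_bounded compact_continuous_image smooth1_continuous assms compact_Icc)
  then obtain C where "\<forall>y\<in>B n ` {p..q}. norm y \<le> C" unfolding bounded_iff by blast
  then have "x \<in> {p..q} \<Longrightarrow> \<bar>B n x\<bar> \<le> C" for x by simp
  then have "\<bar>B n x\<bar> \<le> max C 0" for x using assms(2)[of x n] by (cases "x \<in> {p..q}") force+
  then show ?thesis using that by blast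
qed

text \<open>The products of the \<open>\<beta>\<^sub>i\<close>-th derivatives of three functions of one variable: all partial
  derivatives of the product function \<open>prodjet B 0\<close>.\<close>

definition prodjet :: "(3 \<Rightarrow> nat \<Rightarrow> real \<Rightarrow> real) \<Rightarrow> nat^3 \<Rightarrow> real^3 \<Rightarrow> real" where
  "prodjet B \<beta> x = B 1 (\<beta> $ 1) (x $ 1) * B 2 (\<beta> $ 2) (x $ 2) * B 3 (\<beta> $ 3) (x $ 3)"

lemma prodjet_has_derivative:
  assumes "\<And>i. smooth1 (B i)"
  shows "(prodjet B \<beta> has_derivative (\<lambda>h. \<Sum>i\<in>UNIV. h $ i *\<^sub>R prodjet B (\<beta> + axis i 1) x)) (at x)"
proof -
  have d: "((\<lambda>x. B i n (x $ i)) has_derivative (\<lambda>h. B i (Suc n) (x $ i) * h $ i)) (at x)" for i n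
  proof -
    have "(B i n has_real_derivative B i (Suc n) (x $ i)) (at (x $ i))"
      using assms by (simp add: smooth1_def)
    then have "(B i n has_derivative (\<lambda>t. B i (Suc n) (x $ i) * t)) (at (x $ i))"
      by (simp add: has_field_derivative_def)
    from has_derivative_compose[OF bounded_linear_imp_has_derivative[OF bounded_linear_vec_nth] this]
    show ?thesis .
  qed
  have "((\<lambda>x. B 1 (\<beta> $ 1) (x $ 1) * B 2 (\<beta> $ 2) (x $ 2) * B 3 (\<beta> $ 3) (x $ 3)) has_derivative
      (\<lambda>h. (B 1 (\<beta> $ 1) (x $ 1) * B 2 (\<beta> $ 2) (x $ 2)) * (B 3 (Suc (\<beta> $ 3)) (x $ 3) * h $ 3)
         + (B 1 (\<beta> $ 1) (x $ 1) * (B 2 (Suc (\<beta> $ 2)) (x $ 2) * h $ 2)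
            + (B 1 (Suc (\<beta> $ 1)) (x $ 1) * h $ 1) * B 2 (\<beta> $ 2) (x $ 2)) * B 3 (\<beta> $ 3) (x $ 3))) (at x)"
    by (intro has_derivative_mult d)
  moreover have "(\<lambda>h. (B 1 (\<beta> $ 1) (x $ 1) * B 2 (\<beta> $ 2) (x $ 2)) * (B 3 (Suc (\<beta> $ 3)) (x $ 3) * h $ 3)
         + (B 1 (\<beta> $ 1) (x $ 1) * (B 2 (Suc (\<beta> $ 2)) (x $ 2) * h $ 2)
            + (B 1 (Suc (\<beta> $ 1)) (x $ 1) * h $ 1) * B 2 (\<beta> $ 2) (x $ 2)) * B 3 (\<beta> $ 3) (x $ 3))
      = (\<lambda>h. \<Sum>i\<in>UNIV. h $ i *\<^sub>R prodjet B (\<beta> + axis i 1) x)"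
    by (auto simp: sum_3 prodjet_def axis_def algebra_simps)
  ultimately show ?thesis by (simp add: prodjet_def[abs_def])
qed

lemma prodjet_dir: "(\<And>i. smooth1 (B i)) \<Longrightarrow> dir i (prodjet B \<beta>) = prodjet B (\<beta> + axis i 1)"
  and prodjet_Cinf: "(\<And>i. smooth1 (B i)) \<Longrightarrow> Cinf (prodjet B \<beta>)"
  by (rule Cinf_jet[of "prodjet B"], rule prodjet_has_derivative, assumption)+

lemma Cinf_smooth: "Cinf f \<Longrightarrow> smooth f"
proof -
  assume f: "Cinf f"
  have "Cinf (foldr partial js f)" for js
    by (induction js) (auto simp: f partial_eq_dir intro: Cinf_dir)
  then show ?thesis unfolding smooth_def using Cinf_differentiable by blast
qed

lemma axis_add_nat: "axis i (m + n) = axis i m + (axis i n :: nat^3)"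
  by (auto simp: axis_def Finite_Cartesian_Product.vec_eq_iff)

lemma nat3_expansion: "axis 1 (\<beta> $ 1) + axis 2 (\<beta> $ 2) + axis 3 (\<beta> $ 3) = (\<beta> :: nat^3)"
  by (auto simp: axis_def Finite_Cartesian_Product.vec_eq_iff forall_3)

text \<open>Iterated partial derivatives of a member of a jet are found by adding multi-indices.\<close>

lemma mpartial_jet:
  assumes "\<And>i \<beta>. dir i (G \<beta>) = G (\<beta> + axis i 1)"
  shows "mpartial \<gamma> (G \<beta>) = G (\<beta> + \<gamma>)"
proof -
  have p: "(partial i ^^ n) (G \<beta>) = G (\<beta> + axis i n)" for i n \<beta>
  proof (induction n)
    case 0
    have "axis i 0 = (0 :: nat^3)" by simp
    from this[THEN sym] show ?case by (metis add.right_neutral funpow_0)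
  next
    case (Suc n)
    then show ?case using axis_add_nat[of i n 1] by (simp add: partial_eq_dir assms add.assoc)
  qed
  have "mpartial \<gamma> (G \<beta>) = G (((\<beta> + axis 3 (\<gamma> $ 3)) + axis 2 (\<gamma> $ 2)) + axis 1 (\<gamma> $ 1))"
    unfolding mpartial_def by (simp only: p)
  also have "((\<beta> + axis 3 (\<gamma> $ 3)) + axis 2 (\<gamma> $ 2)) + axis 1 (\<gamma> $ 1) = \<beta> + \<gamma>"
    by (subst nat3_expansion[of \<gamma>, symmetric]) (simp add: add_ac)
  finally show ?thesis .
qed

lemma prodjet_mpartial: "(\<And>i. smooth1 (B i)) \<Longrightarrow> mpartial \<gamma> (prodjet B 0) = prodjet B \<gamma>"
  using mpartial_jet[of "prodjet B" \<gamma> 0] prodjet_dir[of B] by simp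

lemma prodjet_support:
  assumes "\<And>i n x. x \<notin> {p $ i..q $ i} \<Longrightarrow> B i n x = 0" and "x \<notin> cbox p q"
  shows "prodjet B \<beta> x = 0"
proof -
  obtain i where "x $ i \<notin> {p $ i..q $ i}" using assms(2) by (auto simp: mem_box_cart)
  then have "B i (\<beta> $ i) (x $ i) = 0" using assms(1) by blast
  moreover have "i = 1 \<or> i = 2 \<or> i = 3" by (rule exhaust_3)
  ultimately show ?thesis by (auto simp: prodjet_def)
qed

lemma prodjet_test_function:
  assumes s: "\<And>i. smooth1 (B i)" and z: "\<And>i n x. x \<notin> {p $ i..q $ i} \<Longrightarrow> B i n x = 0"
    and \<Omega>: "cbox p q \<subseteq> \<Omega>"
  shows "test_function \<Omega> (prodjet B 0)"
proof -
  have sub: "{x. prodjet B 0 x \<noteq> 0} \<subseteq> cbox p q"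
    using prodjet_support[of p q B, OF z] by blast
  then have cl: "closure {x. prodjet B 0 x \<noteq> 0} \<subseteq> cbox p q"
    by (rule closure_minimal) (rule closed_cbox)
  have "bounded {x. prodjet B 0 x \<noteq> 0}" using sub bounded_cbox bounded_subset by blast
  then have "compact (closure {x. prodjet B 0 x \<noteq> 0})" by simp
  then show ?thesis
    unfolding test_function_def using cl \<Omega> Cinf_smooth[OF prodjet_Cinf[of B, OF s]] by blast
qed

section \<open>Uniqueness of weak derivatives\<close>

lemma borel_measurable_lebesgue_on_AE:
  fixes f g :: "real^3 \<Rightarrow> 'b::euclidean_space"
  assumes g: "g \<in> borel_measurable (lebesgue_on S)" and S: "S \<in> sets lebesgue"
    and ae: "AE x in lebesgue_on S. f x = g x"
  shows "f \<in> borel_measurable (lebesgue_on S)"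
proof -
  let ?f = "\<lambda>x. indicator S x *\<^sub>R f x" and ?g = "\<lambda>x. indicator S x *\<^sub>R g x"
  have gm: "?g \<in> borel_measurable lebesgue"
    using g S borel_measurable_restrict_space_iff[of S lebesgue g] by (simp add: mult.commute)
  have "AE x in lebesgue. x \<in> S \<longrightarrow> f x = g x" using ae S by (simp add: AE_restrict_space_iff)
  then have ae': "AE x in lebesgue. ?f x = ?g x" by (rule AE_mp) (auto simp: indicator_def)
  have "?f \<in> borel_measurable lebesgue"
  proof (rule measurableI)
    fix A :: "'b set" assume A: "A \<in> sets borel"
    show "?f -` A \<inter> space lebesgue \<in> sets lebesgue"
    proof (rule complete_measure.in_sets_AE)
      show "complete_measure (lebesgue :: (real^3) measure)" by unfold_locales
      show "?g -` A \<inter> space lebesgue \<in> sets lebesgue" using gm A by (rule measurable_sets)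
      show "AE x in lebesgue. (x \<in> ?g -` A \<inter> space lebesgue) = (x \<in> ?f -` A \<inter> space lebesgue)"
        using ae' by (rule AE_mp) (auto simp del: indicator_simps)
    qed auto
  qed simp
  then show ?thesis
    using S borel_measurable_restrict_space_iff[of S lebesgue f] by (simp add: mult.commute)
qed

text \<open>Boxes are stable under intersection and generate the Borel sets, so the integral over every Borel
  set vanishes, in particular over the sets where the function is positive or negative.\<close>

lemma AE_zero_if_box_integrals_zero:
  fixes g :: "'a::euclidean_space \<Rightarrow> real"
  assumes g: "integrable lborel g" and z: "\<And>p q. (LINT x:box p q|lborel. g x) = 0"
  shows "AE x in lborel. g x = 0"
proof -
  have gm: "g \<in> borel_measurable borel" using borel_measurable_integrable[OF g] by simp
  have si: "set_integrable lborel A g" if "A \<in> sets borel" for A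
    unfolding set_integrable_def using g that by (intro integrable_mult_indicator) auto
  have U: "(LINT x|lborel. g x) = 0"
  proof -
    define B where "B = (\<lambda>n. box (- real n *\<^sub>R One) (real n *\<^sub>R One :: 'a))"
    have "(\<lambda>n. LINT x|lborel. indicator (B n) x *\<^sub>R g x) \<longlonglongrightarrow> (LINT x|lborel. g x)"
    proof (rule integral_dominated_convergence[where w = "\<lambda>x. \<bar>g x\<bar>"])
      have "(\<lambda>n. indicator (B n) x *\<^sub>R g x) \<longlonglongrightarrow> g x" for x
      proof (rule tendsto_eventually)
        obtain n0 where n0: "norm x < real n0" using reals_Archimedean2 by blast
        have "x \<in> B n" if "n \<ge> n0" for n
        proof -
          have "\<bar>x \<bullet> b\<bar> < real n" if "b \<in> Basis" for b
            using Basis_le_norm[OF that, of x] n0 \<open>n \<ge> n0\<close> by linarith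
          then show ?thesis by (auto simp: B_def mem_box abs_less_iff minus_less_iff)
        qed
        then show "eventually (\<lambda>n. indicator (B n) x *\<^sub>R g x = g x) sequentially"
          by (auto simp: eventually_sequentially intro!: exI[of _ n0])
      qed
      then show "AE x in lborel. (\<lambda>n. indicator (B n) x *\<^sub>R g x) \<longlonglongrightarrow> g x" by simp
      show "AE x in lborel. norm (indicator (B n) x *\<^sub>R g x) \<le> \<bar>g x\<bar>" for n
        by (auto simp: indicator_def)
      show "(\<lambda>x. indicator (B n) x *\<^sub>R g x) \<in> borel_measurable lborel" for n
        using gm by (auto simp: B_def)
    qed (use g gm in auto)
    moreover have "(LINT x|lborel. indicator (B n) x *\<^sub>R g x) = 0" for n
      using z by (simp add: B_def set_lebesgue_integral_def)
    ultimately show ?thesis by (simp add: LIMSEQ_const_iff)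
  qed
  let ?B = "range (\<lambda>(a, b). box a b :: 'a set)"
  have sig: "A \<in> sets borel \<longleftrightarrow> A \<in> sigma_sets UNIV ?B" for A :: "'a set"
    using sets_measure_of[of ?B UNIV] by (simp add: borel_eq_box)
  have all: "(LINT x:A|lborel. g x) = 0" if "A \<in> sets borel" for A
  proof -
    have As: "A \<in> sigma_sets UNIV ?B"
      using that sig by blast
    have IS: "Int_stable ?B"
    proof (rule Int_stableI)
      fix a b assume "a \<in> ?B" "b \<in> ?B"
      then obtain p q p' q' where "a = box p q" "b = box p' q'" by auto
      then show "a \<inter> b \<in> ?B" by (simp only: box_Int_box) (auto intro: rev_image_eqI)
    qed
    show ?thesis
    proof (rule sigma_sets_induct_disjoint[OF IS _ As])
      show "?B \<subseteq> Pow UNIV" by simp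
    next
      show "(LINT x:A|lborel. g x) = 0" if "A \<in> ?B" for A using that z by auto
      show "(LINT x:{}|lborel. g x) = 0" by (simp add: set_lebesgue_integral_def)
    next
      fix A assume "A \<in> sigma_sets UNIV ?B" and zA: "(LINT x:A|lborel. g x) = 0"
      then have A: "A \<in> sets borel" using sig by blast
      have "(LINT x:A \<union> (UNIV - A)|lborel. g x) = (LINT x:A|lborel. g x) + (LINT x:UNIV - A|lborel. g x)"
        by (rule set_integral_Un) (use A in \<open>auto intro: si\<close>)
      then show "(LINT x:UNIV - A|lborel. g x) = 0"
        using U zA by (simp add: set_lebesgue_integral_def)
    next
      fix A :: "nat \<Rightarrow> 'a set"
      assume u: "disjoint_family A" "range A \<subseteq> sigma_sets UNIV ?B" "\<And>i. (LINT x:A i|lborel. g x) = 0"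
      have A: "A i \<in> sets borel" for i using u(2) sig by blast
      have "(LINT x:(\<Union>i. A i)|lborel. g x) = (\<Sum>i. (LINT x:(A i)|lborel. g x))"
        by (rule lebesgue_integral_countable_add) (use u(1) A in \<open>auto intro: si simp: disjoint_family_on_def\<close>)
      then show "(LINT x:(\<Union>i. A i)|lborel. g x) = 0" using u(3) by simp
    qed
  qed
  define A where "A = {x. g x > 0}"
  define A' where "A' = {x. g x < 0}"
  have Am: "A \<in> sets borel" "A' \<in> sets borel" unfolding A_def A'_def using gm by measurable
  have "AE x in lborel. indicator A x *\<^sub>R g x = 0"
    using all[OF Am(1)] si[OF Am(1)]
    by (subst integral_nonneg_eq_0_iff_AE[symmetric])
       (auto simp: set_lebesgue_integral_def set_integrable_def A_def indicator_def)
  moreover have "AE x in lborel. - (indicator A' x *\<^sub>R g x) = 0"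
    using all[OF Am(2)] si[OF Am(2)]
    by (subst integral_nonneg_eq_0_iff_AE[symmetric])
       (auto simp: set_lebesgue_integral_def set_integrable_def A'_def indicator_def)
  ultimately show ?thesis
    by eventually_elim (auto simp: A_def A'_def indicator_def split: if_splits)
qed

lemma AE_zero_if_box_integrals_zero_lebesgue:
  fixes g :: "'a::euclidean_space \<Rightarrow> real"
  assumes g: "integrable lebesgue g" and z: "\<And>p q. (LINT x:box p q|lebesgue. g x) = 0"
  shows "AE x in lebesgue. g x = 0"
proof -
  obtain g' where g': "g' \<in> borel_measurable lborel" and ae: "AE x in lborel. g x = g' x"
    using completion_ex_borel_measurable_real[OF borel_measurable_integrable[OF g]] by blast
  have ae': "AE x in lebesgue. g x = g' x" by (rule AE_completion[OF ae])
  have g'l: "g' \<in> borel_measurable lebesgue" by (rule measurable_completion[OF g'])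
  have "integrable lebesgue g'" by (rule integrable_cong_AE_imp[OF g g'l ae'])
  then have i: "integrable lborel g'" using integrable_completion[OF g'] by simp
  have "(LINT x:box p q|lborel. g' x) = 0" for p q
  proof -
    have "(LINT x:box p q|lborel. g' x) = (LINT x:box p q|lebesgue. g' x)"
      unfolding set_lebesgue_integral_def using g'
      by (intro integral_completion[symmetric] borel_measurable_scaleR borel_measurable_indicator) auto
    also have "\<dots> = (LINT x:box p q|lebesgue. g x)"
      unfolding set_lebesgue_integral_def
    proof (rule integral_cong_AE)
      show "(\<lambda>x. indicator (box p q) x *\<^sub>R g' x) \<in> borel_measurable lebesgue"
        "(\<lambda>x. indicator (box p q) x *\<^sub>R g x) \<in> borel_measurable lebesgue"
        using g'l borel_measurable_integrable[OF g]
        by (intro borel_measurable_scaleR borel_measurable_indicator; simp)+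
      show "AE x in lebesgue. indicator (box p q) x *\<^sub>R g' x = indicator (box p q) x *\<^sub>R g x"
        using ae' by eventually_elim simp
    qed
    finally show ?thesis using z by simp
  qed
  from AE_zero_if_box_integrals_zero[OF i this] have "AE x in lborel. g x = 0"
    using ae by eventually_elim simp
  then show ?thesis by (rule AE_completion)
qed

text \<open>As \<open>N\<close> grows the one-dimensional factors \<open>exp (- 1 / (N t))\<close> increase to \<open>1\<close> for \<open>t > 0\<close>, so their
  products are test functions which tend boundedly to the indicator function of a box.\<close>

definition box_test :: "real \<Rightarrow> real^3 \<Rightarrow> real^3 \<Rightarrow> real^3 \<Rightarrow> real" where
  "box_test N p q = prodjet (\<lambda>i. bump N (p $ i) (q $ i)) 0"

lemma box_test_bounds: "0 \<le> box_test N p q x" "box_test N p q x \<le> 1"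
proof -
  have *: "0 \<le> bump N p q 0 x" "bump N p q 0 x \<le> 1" for p q x
    unfolding bump_0 using hfun_0 by (auto intro: mult_nonneg_nonneg mult_le_one)
  show "0 \<le> box_test N p q x" "box_test N p q x \<le> 1"
    unfolding box_test_def prodjet_def using * by (auto intro!: mult_nonneg_nonneg mult_le_one)
qed

lemma box_test_Cinf: "Cinf (box_test N p q)"
  unfolding box_test_def by (intro prodjet_Cinf smooth1_bump)

lemma box_test_test_function:
  "N > 0 \<Longrightarrow> cbox p q \<subseteq> \<Omega> \<Longrightarrow> test_function \<Omega> (box_test N p q)"
  unfolding box_test_def by (intro prodjet_test_function smooth1_bump bump_support) auto

lemma hfun_limit: "(\<lambda>N. hfun 0 (real (Suc N) * t)) \<longlonglongrightarrow> (if t > 0 then 1 else 0)"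
proof (cases "t > 0")
  case True
  have "(\<lambda>N. exp (- (inverse (real (Suc N)) * (1 / t)))) \<longlonglongrightarrow> exp (- (0 * (1 / t)))"
    by (intro tendsto_exp tendsto_minus tendsto_mult tendsto_const LIMSEQ_inverse_real_of_nat)
  moreover have "hfun 0 (real (Suc N) * t) = exp (- (inverse (real (Suc N)) * (1 / t)))" for N
  proof -
    have "real (Suc N) * t > 0" using True by simp
    then have "\<not> real (Suc N) * t \<le> 0" by linarith
    then show ?thesis by (simp only: hfun_def if_False hpoly.simps poly_1 mult_1 inverse_eq_divide times_divide_times_eq)
  qed
  ultimately show ?thesis using True by simp
next
  case False
  then have "hfun 0 (real (Suc N) * t) = 0" for N by (simp add: hfun_def mult_le_0_iff)
  then show ?thesis using False by simp
qed

lemma box_test_limit: "(\<lambda>N. box_test (real (Suc N)) p q x) \<longlonglongrightarrow> indicator (box p q) x"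
proof -
  have "(\<lambda>N. \<Prod>i\<in>UNIV. hfun 0 (real (Suc N) * (x $ i - p $ i)) * hfun 0 (real (Suc N) * (q $ i - x $ i)))
    \<longlonglongrightarrow> (\<Prod>i\<in>UNIV. (if x $ i - p $ i > 0 then 1 else 0) * (if q $ i - x $ i > 0 then 1 else 0))"
    by (intro tendsto_prod tendsto_mult hfun_limit)
  moreover have "box_test N p q x = (\<Prod>i\<in>UNIV. hfun 0 (N * (x $ i - p $ i)) * hfun 0 (N * (q $ i - x $ i)))" for N
    unfolding box_test_def prodjet_def UNIV_3 by (simp add: bump_0 mult_ac)
  moreover have "(\<Prod>i\<in>UNIV. (if x $ i - p $ i > 0 then 1 else 0) * (if q $ i - x $ i > 0 then 1 else 0))
      = (indicator (box p q) x :: real)"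
    by (cases "x \<in> box p q") (auto simp: mem_box_cart indicator_def intro!: prod.neutral)
  ultimately show ?thesis by simp
qed

lemma box_test_zero: "N > 0 \<Longrightarrow> x \<notin> cbox p q \<Longrightarrow> box_test N p q x = 0"
  unfolding box_test_def by (rule prodjet_support[of p q]) (auto intro: bump_support)

lemma locally_integrable_box:
  assumes "locally_integrable \<Omega> d" "cbox p q \<subseteq> \<Omega>"
  shows "integrable lebesgue (\<lambda>x. indicator (cbox p q) x *\<^sub>R d x)"
    "integrable lebesgue (\<lambda>x. indicator (box p q) x *\<^sub>R d x)"
proof -
  have "integrable (lebesgue_on (cbox p q)) d"
    using assms by (auto simp: locally_integrable_def)
  then show 1: "integrable lebesgue (\<lambda>x. indicator (cbox p q) x *\<^sub>R d x)"
    by (simp add: integrable_restrict_space)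
  have "integrable lebesgue (\<lambda>x. indicator (box p q) x *\<^sub>R (indicator (cbox p q) x *\<^sub>R d x))"
    by (intro integrable_mult_indicator 1) auto
  moreover have "(\<lambda>x. indicator (box p q) x *\<^sub>R (indicator (cbox p q) x *\<^sub>R d x)) = (\<lambda>x. indicator (box p q) x *\<^sub>R d x)"
  proof
    fix x
    show "indicator (box p q) x *\<^sub>R (indicator (cbox p q) x *\<^sub>R d x) = indicator (box p q) x *\<^sub>R d x"
      using box_subset_cbox[of p q] by (cases "x \<in> box p q") auto
  qed
  ultimately show "integrable lebesgue (\<lambda>x. indicator (box p q) x *\<^sub>R d x)" by (simp only:)
qed

lemma box_test_integral_limit:
  assumes d: "locally_integrable \<Omega> d" and \<Omega>: "\<Omega> \<in> sets lebesgue" and pq: "cbox p q \<subseteq> \<Omega>"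
  shows "(\<lambda>N. LINT x|lebesgue_on \<Omega>. d x * of_real (box_test (real (Suc N)) p q x))
    \<longlonglongrightarrow> (LINT x:box p q|lebesgue. d x)"
proof -
  let ?b = "\<lambda>N. box_test (real (Suc N)) p q"
  let ?d = "\<lambda>x. indicator (cbox p q) x *\<^sub>R d x"
  have i: "integrable lebesgue ?d" by (rule locally_integrable_box[OF d pq])
  have "(\<lambda>N. LINT x|lebesgue. ?b N x *\<^sub>R ?d x) \<longlonglongrightarrow> (LINT x|lebesgue. indicator (box p q) x *\<^sub>R ?d x)"
  proof (rule integral_dominated_convergence[where w = "\<lambda>x. cmod (?d x)"])
    show "AE x in lebesgue. (\<lambda>N. ?b N x *\<^sub>R ?d x) \<longlonglongrightarrow> indicator (box p q) x *\<^sub>R ?d x"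
      by (intro AE_I2 tendsto_scaleR tendsto_const box_test_limit)
    show "AE x in lebesgue. norm (?b N x *\<^sub>R ?d x) \<le> cmod (?d x)" for N
    proof (rule AE_I2)
      fix x
      have "\<bar>?b N x\<bar> * cmod (?d x) \<le> 1 * cmod (?d x)"
        using box_test_bounds[of "real (Suc N)" p q x] by (intro mult_right_mono) auto
      then show "norm (?b N x *\<^sub>R ?d x) \<le> cmod (?d x)" by (simp only: norm_scaleR mult_1)
    qed
    have "?b N \<in> borel_measurable lebesgue" for N
      by (intro measurable_completion) (simp add: borel_measurable_continuous_onI Cinf_continuous box_test_Cinf)
    then show "(\<lambda>x. ?b N x *\<^sub>R ?d x) \<in> borel_measurable lebesgue" for N
      using borel_measurable_integrable[OF i] by (rule borel_measurable_scaleR)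
    show "(\<lambda>x. indicator (box p q) x *\<^sub>R ?d x) \<in> borel_measurable lebesgue"
      by (rule borel_measurable_scaleR[OF borel_measurable_indicator borel_measurable_integrable[OF i]]) auto
  qed (rule integrable_norm[OF i])
  moreover have "(LINT x|lebesgue. indicator (box p q) x *\<^sub>R ?d x) = (LINT x:box p q|lebesgue. d x)"
    unfolding set_lebesgue_integral_def using box_subset_cbox[of p q]
    by (intro Bochner_Integration.integral_cong) (auto simp: indicator_def)
  moreover have "(LINT x|lebesgue_on \<Omega>. d x * of_real (?b N x)) = (LINT x|lebesgue. ?b N x *\<^sub>R ?d x)" for N
  proof -
    have "indicator \<Omega> x *\<^sub>R (d x * of_real (?b N x)) = ?b N x *\<^sub>R ?d x" for x
      using pq box_test_zero[of "real (Suc N)" x p q]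
      by (cases "x \<in> cbox p q") (auto simp: indicator_def scaleR_conv_of_real)
    then show ?thesis using \<Omega> by (simp add: integral_restrict_space)
  qed
  ultimately show ?thesis by simp
qed

lemma ccube_subset_cube: "r < R \<Longrightarrow> ccube r \<subseteq> cube R"
  unfolding mem_ccube mem_cube subset_iff by (meson le_less_trans)

lemma box_subset_cube_closed:
  assumes "box p q \<noteq> {}" "box p q \<subseteq> cube r" "0 < r" "r < R" shows "cbox p q \<subseteq> cube R"
proof -
  have "cbox p q = closure (box p q)" using assms(1) by (simp add: closure_box)
  also have "\<dots> \<subseteq> closure (cube r)" by (rule closure_mono[OF assms(2)])
  also have "\<dots> = ccube r" using assms closure_cube by simp
  also have "\<dots> \<subseteq> cube R" using assms by (intro ccube_subset_cube)
  finally show ?thesis .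
qed

lemma cube_Union: "R > 0 \<Longrightarrow> x \<in> cube R \<Longrightarrow> \<exists>n::nat. x \<in> cube (R * (1 - 1 / (n + 2)))"
proof -
  assume R: "R > 0" and x: "x \<in> cube R"
  define m where "m = Max (range (\<lambda>i. \<bar>x $ i\<bar>))"
  have m: "\<bar>x $ i\<bar> \<le> m" for i unfolding m_def by (intro Max_ge) auto
  have "m \<in> range (\<lambda>i. \<bar>x $ i\<bar>)" unfolding m_def by (intro Max_in) auto
  then have "m < R" using x by (auto simp: mem_cube)
  then have pos: "(R - m) / R > 0" using R by simp
  obtain n where n: "1 / real (Suc n) < (R - m) / R" using nat_approx_posE[OF pos] by blast
  have "1 / (real n + 2) < 1 / real (Suc n)" by (intro divide_strict_left_mono) auto
  then have "1 / (real n + 2) < (R - m) / R" using n by (rule less_trans)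
  then have "R * (1 / (real n + 2)) < R * ((R - m) / R)" using R by (rule mult_strict_left_mono)
  moreover have "R * ((R - m) / R) = R - m" using R by simp
  moreover have "R * (1 - 1 / (real n + 2)) = R - R * (1 / (real n + 2))" by (simp only: right_diff_distrib mult_1_right)
  ultimately have mR: "m < R * (1 - 1 / (real n + 2))" by linarith
  then have "x \<in> cube (R * (1 - 1 / (real n + 2)))" unfolding mem_cube
    using le_less_trans[OF m mR] by (intro allI)
  then show ?thesis by (rule exI)
qed

text \<open>Testing with functions that tend to the indicator of a box shows that the two functions have the
  same integral over every box with closure in the cube.  Local integrability makes it necessary
  to argue on smaller cubes first and to exhaust the cube by them.\<close>

lemma fundamental_lemma:
  assumes R: "R > 0" and d: "locally_integrable (cube R) d" "locally_integrable (cube R) d'"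
    and eq: "\<And>\<phi>. test_function (cube R) \<phi> \<Longrightarrow>
      (LINT x|lebesgue_on (cube R). d x * of_real (\<phi> x)) = (LINT x|lebesgue_on (cube R). d' x * of_real (\<phi> x))"
  shows "AE x in lebesgue_on (cube R). d x = d' x"
proof -
  have box: "(LINT x:box p q|lebesgue. d x) = (LINT x:box p q|lebesgue. d' x)" if "cbox p q \<subseteq> cube R" for p q
  proof -
    have "(LINT x|lebesgue_on (cube R). d x * of_real (box_test (real (Suc N)) p q x))
       = (LINT x|lebesgue_on (cube R). d' x * of_real (box_test (real (Suc N)) p q x))" for N
      by (intro eq box_test_test_function that) simp
    then show ?thesis
      using box_test_integral_limit[OF d(1) _ that] box_test_integral_limit[OF d(2) _ that] LIMSEQ_unique
      by simp
  qed
  have r: "AE x in lebesgue. x \<in> cube r \<longrightarrow> d x = d' x" if r: "0 < r" "r < R" for r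
  proof -
    have sub: "ccube r \<subseteq> cube R" using r by (intro ccube_subset_cube)
    define e where "e = (\<lambda>x. indicator (cube r) x *\<^sub>R d x - indicator (cube r) x *\<^sub>R d' x)"
    have i: "integrable lebesgue (\<lambda>x. indicator (cube r) x *\<^sub>R d x)" "integrable lebesgue (\<lambda>x. indicator (cube r) x *\<^sub>R d' x)"
      unfolding cube_eq_box by (rule locally_integrable_box d sub)+
    then have ei: "integrable lebesgue e" unfolding e_def by (rule Bochner_Integration.integrable_diff)
    have z: "(LINT x:box p q|lebesgue. e x) = 0" for p q
    proof -
      obtain p' q' where pq: "box p q \<inter> cube r = box p' q'" unfolding cube_eq_box box_Int_box by blast
      have "(LINT x:box p q|lebesgue. e x) = (LINT x|lebesgue. indicator (box p' q') x *\<^sub>R d x - indicator (box p' q') x *\<^sub>R d' x)"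
        unfolding set_lebesgue_integral_def e_def pq[symmetric]
        by (intro Bochner_Integration.integral_cong) (auto simp: indicator_def)
      also have "\<dots> = 0"
      proof (cases "box p' q' = {}")
        case False
        have c: "cbox p' q' \<subseteq> cube R" by (rule box_subset_cube_closed[OF False _ r]) (use pq in auto)
        show ?thesis
          using box[OF c] locally_integrable_box[OF d(1) c] locally_integrable_box[OF d(2) c]
          by (simp add: set_lebesgue_integral_def)
      qed simp
      finally show ?thesis .
    qed
    have zl: "(LINT x:box p q|lebesgue. Re (e x)) = 0" "(LINT x:box p q|lebesgue. Im (e x)) = 0" for p q
    proof -
      have si: "integrable lebesgue (\<lambda>x. indicator (box p q) x *\<^sub>R e x)"
        by (intro integrable_mult_indicator ei) auto
      show "(LINT x:box p q|lebesgue. Re (e x)) = 0" "(LINT x:box p q|lebesgue. Im (e x)) = 0"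
        using integral_Re[OF si] integral_Im[OF si] z[of p q] by (simp_all add: set_lebesgue_integral_def)
    qed
    have "AE x in lebesgue. Re (e x) = 0" "AE x in lebesgue. Im (e x) = 0"
      by (rule AE_zero_if_box_integrals_zero_lebesgue, use ei zl in auto)+
    then show ?thesis
      by eventually_elim (auto simp: e_def indicator_def complex_eq_iff)
  qed
  have "AE x in lebesgue. \<forall>n::nat. x \<in> cube (R * (1 - 1 / (n + 2))) \<longrightarrow> d x = d' x"
    unfolding AE_all_countable by (intro allI r) (use R in \<open>auto simp: field_simps add_pos_nonneg\<close>)
  then have "AE x in lebesgue. x \<in> cube R \<longrightarrow> d x = d' x"
    by eventually_elim (use cube_Union[OF R] in blast)
  then show ?thesis by (simp add: AE_restrict_space_iff)
qed

lemma L2_cube_integrable: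
  assumes "u \<in> L2 (cube R)" shows "integrable (lebesgue_on (cube R)) u"
proof (rule Bochner_Integration.integrable_bound)
  show "integrable (lebesgue_on (cube R)) (\<lambda>x. 1 + (cmod (u x))\<^sup>2)"
    using L2_integrable[OF assms] continuous_integrable_cube[of R "\<lambda>x. 1::real"] by simp
  have "cmod (u x) \<le> 1 + (cmod (u x))\<^sup>2" for x
    using sum_squares_bound[of "cmod (u x)" 1] norm_ge_zero[of "u x"] unfolding mult_1_right power_one by linarith
  then show "AE x in lebesgue_on (cube R). norm (u x) \<le> norm (1 + (cmod (u x))\<^sup>2)" by simp
qed (rule L2_measurable[OF assms])

lemma L2_cube_integrable_mult:
  fixes \<phi> :: "real^3 \<Rightarrow> real"
  assumes u: "u \<in> L2 (cube R)" and \<phi>: "continuous_on UNIV \<phi>"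
  shows "integrable (lebesgue_on (cube R)) (\<lambda>x. u x * of_real (\<phi> x))"
proof -
  have c: "continuous_on (ccube R) \<phi>" using \<phi> continuous_on_subset by blast
  obtain B where B: "\<And>x. x \<in> ccube R \<Longrightarrow> norm (\<phi> x) \<le> B"
    using continuous_bounded_on_ccube[OF c] by blast
  have "(\<lambda>x. \<phi> x *\<^sub>R u x) \<in> L2 (cube R)"
  proof (rule L2_mult_bounded[OF u measurable_cube_continuous[OF c], of B])
    fix x assume "x \<in> cube R"
    then show "\<bar>\<phi> x\<bar> \<le> B" using B[of x] cube_subset_ccube[of R] by auto
  qed
  from L2_cube_integrable[OF this] show ?thesis by (simp add: scaleR_conv_of_real mult.commute)
qed

lemma L2_locally_integrable:
  assumes "u \<in> L2 (cube R)" shows "locally_integrable (cube R) u"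
  unfolding locally_integrable_def
proof (intro allI impI, elim conjE)
  fix K assume K: "compact K" "K \<subseteq> cube R"
  have KS: "K \<in> sets lebesgue" using K by (simp add: compact_imp_closed borel_closed)
  have "set_integrable lebesgue (cube R) u"
    using L2_cube_integrable[OF assms] by (simp add: set_integrable_def integrable_restrict_space)
  then have "set_integrable lebesgue K u" by (rule set_integrable_subset[OF _ KS K(2)])
  then show "integrable (lebesgue_on K) u"
    using KS by (simp add: set_integrable_def integrable_restrict_space)
qed

lemma smooth_mpartial_continuous:
  assumes "smooth \<phi>" shows "continuous_on UNIV (mpartial \<beta> \<phi>)"
proof -
  have f: "foldr partial (replicate n i @ js) \<phi> = (partial i ^^ n) (foldr partial js \<phi>)" for n i js
    by (induction n) auto
  have "mpartial \<beta> \<phi> = foldr partial (replicate (\<beta> $ 1) 1 @ replicate (\<beta> $ 2) 2 @ replicate (\<beta> $ 3) 3 @ []) \<phi>"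
    unfolding mpartial_def f by simp
  moreover have "foldr partial js \<phi> differentiable at x" for js x using assms by (simp add: smooth_def)
  ultimately have "mpartial \<beta> \<phi> differentiable at x" for x by (simp only:)
  then show ?thesis
    by (auto simp: continuous_on_eq_continuous_at intro: differentiable_imp_continuous_within)
qed

lemma mpartial_0 [simp]: "mpartial 0 \<phi> = \<phi>"
  by (simp add: mpartial_def)

lemma test_function_smooth: "test_function \<Omega> \<phi> \<Longrightarrow> smooth \<phi>"
  by (simp add: test_function_def)

lemma has_weak_deriv_unique:
  assumes "R > 0" "has_weak_deriv (cube R) \<beta> u v" "has_weak_deriv (cube R) \<beta> u v'"
  shows "AE x in lebesgue_on (cube R). v x = v' x"
proof (rule fundamental_lemma[OF assms(1)])
  show "locally_integrable (cube R) v" "locally_integrable (cube R) v'"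
    using assms by (auto simp: has_weak_deriv_def)
  fix \<phi> assume t: "test_function (cube R) \<phi>"
  have "(LINT x|lebesgue_on (cube R). u x * of_real (mpartial \<beta> \<phi> x))
        = (-1) ^ morder \<beta> * (LINT x|lebesgue_on (cube R). v x * of_real (\<phi> x))"
     "(LINT x|lebesgue_on (cube R). u x * of_real (mpartial \<beta> \<phi> x))
        = (-1) ^ morder \<beta> * (LINT x|lebesgue_on (cube R). v' x * of_real (\<phi> x))"
    using assms(2,3) t by (auto simp: has_weak_deriv_def)
  then show "(LINT x|lebesgue_on (cube R). v x * of_real (\<phi> x)) = (LINT x|lebesgue_on (cube R). v' x * of_real (\<phi> x))"
    by simp
qed

lemma weak_deriv_AE:
  assumes "R > 0" "has_weak_deriv (cube R) \<beta> u v"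
  shows "AE x in lebesgue_on (cube R). weak_deriv (cube R) \<beta> u x = v x"
  by (rule has_weak_deriv_unique[OF assms(1) _ assms(2)])
     (unfold weak_deriv_def, rule someI[of _ v], rule assms(2))

lemma Sobolev_weak_deriv:
  assumes R: "R > 0" and u: "u \<in> Sobolev s (cube R)" and \<beta>: "morder \<beta> \<le> s"
  shows "weak_deriv (cube R) \<beta> u \<in> L2 (cube R)"
    "has_weak_deriv (cube R) \<beta> u (weak_deriv (cube R) \<beta> u)"
proof -
  obtain v where v: "v \<in> L2 (cube R)" "has_weak_deriv (cube R) \<beta> u v"
    using u \<beta> by (auto simp: Sobolev_def)
  note ae = weak_deriv_AE[OF R v(2)]
  show "has_weak_deriv (cube R) \<beta> u (weak_deriv (cube R) \<beta> u)"
    unfolding weak_deriv_def by (rule someI[of "has_weak_deriv (cube R) \<beta> u" v]) (rule v(2))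
  have m: "weak_deriv (cube R) \<beta> u \<in> borel_measurable (lebesgue_on (cube R))"
    by (rule borel_measurable_lebesgue_on_AE[OF L2_measurable[OF v(1)] _ ae]) simp
  have "integrable (lebesgue_on (cube R)) (\<lambda>x. (cmod (weak_deriv (cube R) \<beta> u x))\<^sup>2)"
  proof (rule integrable_cong_AE_imp[OF L2_integrable[OF v(1)]])
    show "(\<lambda>x. (cmod (weak_deriv (cube R) \<beta> u x))\<^sup>2) \<in> borel_measurable (lebesgue_on (cube R))"
      using m by measurable
    show "AE x in lebesgue_on (cube R). (cmod (v x))\<^sup>2 = (cmod (weak_deriv (cube R) \<beta> u x))\<^sup>2"
      using ae by eventually_elim simp
  qed
  then show "weak_deriv (cube R) \<beta> u \<in> L2 (cube R)" using m by (simp add: L2_def)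
qed

lemma Sobolev_L2: "u \<in> Sobolev s \<Omega> \<Longrightarrow> u \<in> L2 \<Omega>"
  by (simp add: Sobolev_def)

lemma morder_0 [simp]: "morder 0 = 0"
  by (simp add: morder_def)

lemma weak_deriv_0_AE:
  assumes "R > 0" "u \<in> L2 (cube R)"
  shows "AE x in lebesgue_on (cube R). weak_deriv (cube R) 0 u x = u x"
  using assms by (intro weak_deriv_AE) (auto simp: has_weak_deriv_def L2_locally_integrable)

lemma has_weak_deriv_diff:
  assumes L: "u \<in> L2 (cube R)" "u' \<in> L2 (cube R)" "v \<in> L2 (cube R)" "v' \<in> L2 (cube R)"
    and D: "has_weak_deriv (cube R) \<beta> u v" "has_weak_deriv (cube R) \<beta> u' v'"
  shows "has_weak_deriv (cube R) \<beta> (\<lambda>x. u x - u' x) (\<lambda>x. v x - v' x)"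
  unfolding has_weak_deriv_def
proof (intro conjI allI impI)
  show "locally_integrable (cube R) (\<lambda>x. u x - u' x)" "locally_integrable (cube R) (\<lambda>x. v x - v' x)"
    by (intro L2_locally_integrable L2_diff L)+
  fix \<phi> assume t: "test_function (cube R) \<phi>"
  note s = test_function_smooth[OF t]
  have c: "continuous_on UNIV (mpartial \<beta> \<phi>)" "continuous_on UNIV \<phi>"
    using smooth_mpartial_continuous[OF s, of \<beta>] smooth_mpartial_continuous[OF s, of 0] by simp_all
  have D': "(LINT x|lebesgue_on (cube R). u x * of_real (mpartial \<beta> \<phi> x))
        = (-1) ^ morder \<beta> * (LINT x|lebesgue_on (cube R). v x * of_real (\<phi> x))"
     "(LINT x|lebesgue_on (cube R). u' x * of_real (mpartial \<beta> \<phi> x))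
        = (-1) ^ morder \<beta> * (LINT x|lebesgue_on (cube R). v' x * of_real (\<phi> x))"
    using D t by (auto simp: has_weak_deriv_def)
  show "(LINT x|lebesgue_on (cube R). (u x - u' x) * of_real (mpartial \<beta> \<phi> x))
      = (-1) ^ morder \<beta> * (LINT x|lebesgue_on (cube R). (v x - v' x) * of_real (\<phi> x))"
    using L2_cube_integrable_mult[OF L(1) c(1)] L2_cube_integrable_mult[OF L(2) c(1)]
      L2_cube_integrable_mult[OF L(3) c(2)] L2_cube_integrable_mult[OF L(4) c(2)] D'
    by (simp add: left_diff_distrib right_diff_distrib)
qed

lemma Sobolev_diff:
  assumes R: "R > 0" and u: "u \<in> Sobolev s (cube R)" "u' \<in> Sobolev s (cube R)"
  shows "(\<lambda>x. u x - u' x) \<in> Sobolev s (cube R)"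
    "morder \<beta> \<le> s \<Longrightarrow> AE x in lebesgue_on (cube R).
       weak_deriv (cube R) \<beta> (\<lambda>x. u x - u' x) x = weak_deriv (cube R) \<beta> u x - weak_deriv (cube R) \<beta> u' x"
proof -
  have h: "has_weak_deriv (cube R) \<beta> (\<lambda>x. u x - u' x)
      (\<lambda>x. weak_deriv (cube R) \<beta> u x - weak_deriv (cube R) \<beta> u' x)" if "morder \<beta> \<le> s" for \<beta>
    by (intro has_weak_deriv_diff Sobolev_weak_deriv[OF R _ that] u Sobolev_L2[OF u(1)] Sobolev_L2[OF u(2)])
  show "(\<lambda>x. u x - u' x) \<in> Sobolev s (cube R)"
    unfolding Sobolev_def
  proof (intro CollectI conjI allI impI)
    show "(\<lambda>x. u x - u' x) \<in> L2 (cube R)" by (rule L2_diff[OF Sobolev_L2[OF u(1)] Sobolev_L2[OF u(2)]])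
    fix \<beta> :: "nat^3" assume b: "morder \<beta> \<le> s"
    show "\<exists>v\<in>L2 (cube R). has_weak_deriv (cube R) \<beta> (\<lambda>x. u x - u' x) v"
      by (rule bexI[where x = "\<lambda>x. weak_deriv (cube R) \<beta> u x - weak_deriv (cube R) \<beta> u' x"], rule h[OF b])
        (rule L2_diff[OF Sobolev_weak_deriv(1)[OF R u(1) b] Sobolev_weak_deriv(1)[OF R u(2) b]])
  qed
  show "morder \<beta> \<le> s \<Longrightarrow> AE x in lebesgue_on (cube R).
       weak_deriv (cube R) \<beta> (\<lambda>x. u x - u' x) x = weak_deriv (cube R) \<beta> u x - weak_deriv (cube R) \<beta> u' x"
    by (rule weak_deriv_AE[OF R h])
qed

section \<open>Smooth approximation up to the boundary\<close>

definition mbump :: "real \<Rightarrow> nat \<Rightarrow> real \<Rightarrow> real" where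
  "mbump R = bump 1 (- (R / 2)) (R / 2)"

definition mker :: "real \<Rightarrow> nat^3 \<Rightarrow> real^3 \<Rightarrow> real" where
  "mker R = prodjet (\<lambda>_. mbump R)"

definition mmass :: "real \<Rightarrow> real" where
  "mmass R = (LINT x|lborel. mker R 0 x)"

lemma smooth1_mbump: "smooth1 (mbump R)"
  unfolding mbump_def by (rule smooth1_bump)

lemma mbump_support: "x \<notin> {- (R / 2)..R / 2} \<Longrightarrow> mbump R n x = 0"
  unfolding mbump_def by (rule bump_support) auto

lemma mbump_bounded: "\<exists>C. \<forall>x. \<bar>mbump R n x\<bar> \<le> C"
proof -
  obtain C where "\<And>x. \<bar>mbump R n x\<bar> \<le> C"
    by (rule smooth1_bounded[of "mbump R" "- (R / 2)" "R / 2" n, OF smooth1_mbump]) (auto intro: mbump_support)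
  then show ?thesis by blast
qed

definition mbound :: "real \<Rightarrow> nat \<Rightarrow> real" where
  "mbound R n = (SOME C. \<forall>x. \<bar>mbump R n x\<bar> \<le> C)"

lemma mbump_le_mbound: "\<bar>mbump R n x\<bar> \<le> mbound R n"
  using someI_ex[OF mbump_bounded] unfolding mbound_def by blast

lemma mbound_nonneg: "mbound R n \<ge> 0"
  using mbump_le_mbound[of R n 0] by linarith

lemma mker_Cinf: "Cinf (mker R \<beta>)"
  unfolding mker_def by (intro prodjet_Cinf smooth1_mbump)

lemma mker_continuous: "continuous_on S (mker R \<beta>)"
  by (rule Cinf_continuous[OF mker_Cinf])

lemma mker_borel [measurable]: "mker R \<beta> \<in> borel_measurable borel"
  by (intro borel_measurable_continuous_onI mker_continuous)

lemma mker_nonneg: "mker R 0 x \<ge> 0"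
  unfolding mker_def prodjet_def mbump_def by (auto simp: bump_0 intro!: mult_nonneg_nonneg hfun_0)

lemma mker_support: "x \<notin> ccube (R / 2) \<Longrightarrow> mker R \<beta> x = 0"
  unfolding mker_def by (rule prodjet_support[of "\<chi> i. - (R / 2)" "\<chi> i. R / 2"]) (auto intro: mbump_support)

lemma mker_integrable: "integrable lborel (mker R \<beta>)"
proof -
  have "integrable lborel (\<lambda>x. indicator (ccube (R / 2)) x *\<^sub>R mker R \<beta> x)"
    by (intro borel_integrable_compact compact_cbox mker_continuous)
  moreover have "(\<lambda>x. indicator (ccube (R / 2)) x *\<^sub>R mker R \<beta> x) = mker R \<beta>"
  proof
    fix x show "indicator (ccube (R / 2)) x *\<^sub>R mker R \<beta> x = mker R \<beta> x"
      by (cases "x \<in> ccube (R / 2)") (simp_all add: mker_support)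
  qed
  ultimately show ?thesis by simp
qed

lemma mmass_pos: assumes "R > 0" shows "mmass R > 0"
proof (rule ccontr)
  assume "\<not> mmass R > 0"
  moreover have "mmass R \<ge> 0" unfolding mmass_def by (intro Bochner_Integration.integral_nonneg mker_nonneg)
  ultimately have "(LINT x|lborel. mker R 0 x) = 0" by (simp add: mmass_def)
  then have "AE x in lborel. mker R 0 x = 0"
    using integral_nonneg_eq_0_iff_AE[OF mker_integrable, of R 0] mker_nonneg by simp
  then have ae: "AE x in lebesgue. x \<in> {x. mker R 0 x = 0}" using AE_completion by simp
  have "closed {x. mker R 0 x = 0}" by (intro closed_Collect_eq mker_continuous continuous_on_const)
  from mem_closed_if_AE_lebesgue[OF this ae] have "mker R 0 0 = 0" by blast
  moreover have "mker R 0 0 > 0"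
    unfolding mker_def prodjet_def mbump_def using assms
    by (auto simp: bump_0 intro!: mult_pos_pos hfun_0)
  ultimately show False by simp
qed

lemma nn_integral_affine3:
  fixes g :: "real^3 \<Rightarrow> ennreal"
  assumes [measurable]: "g \<in> borel_measurable borel" and c: "c \<noteq> 0"
  shows "(\<integral>\<^sup>+x. g x \<partial>lborel) = ennreal (\<bar>c\<bar> ^ 3) * (\<integral>\<^sup>+x. g (d + c *\<^sub>R x) \<partial>lborel)"
proof -
  have "(\<integral>\<^sup>+x. g x \<partial>lborel)
      = (\<integral>\<^sup>+x. g x \<partial>density (distr lborel borel (\<lambda>x. d + c *\<^sub>R x)) (\<lambda>_. ennreal (\<bar>c\<bar> ^ 3)))"
    using lborel_affine[OF c, of d] by (simp add: ennreal_power)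
  also have "\<dots> = (\<integral>\<^sup>+x. ennreal (\<bar>c\<bar> ^ 3) * g (d + c *\<^sub>R x) \<partial>lborel)"
    by (simp add: nn_integral_density nn_integral_distr)
  also have "\<dots> = ennreal (\<bar>c\<bar> ^ 3) * (\<integral>\<^sup>+x. g (d + c *\<^sub>R x) \<partial>lborel)"
    by (rule nn_integral_cmult) measurable
  finally show ?thesis .
qed

lemma mker_nn_integral: "(\<integral>\<^sup>+x. ennreal (mker R 0 x) \<partial>lborel) = ennreal (mmass R)"
  unfolding mmass_def by (intro nn_integral_eq_integral mker_integrable) (simp add: mker_nonneg)

lemma mker_nn_integral_affine:
  assumes "c \<noteq> 0"
  shows "(\<integral>\<^sup>+x. ennreal (mker R 0 (d + c *\<^sub>R x)) \<partial>lborel) = ennreal (mmass R / \<bar>c\<bar> ^ 3)"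
proof -
  have c: "\<bar>c\<bar> ^ 3 > 0" using assms by simp
  let ?I = "\<integral>\<^sup>+x. ennreal (mker R 0 (d + c *\<^sub>R x)) \<partial>lborel"
  have e: "ennreal (mmass R) = ennreal (\<bar>c\<bar> ^ 3) * ?I"
    using nn_integral_affine3[of "\<lambda>x. ennreal (mker R 0 x)" c d] assms mker_nn_integral by simp
  have "?I = (ennreal (1 / \<bar>c\<bar> ^ 3) * ennreal (\<bar>c\<bar> ^ 3)) * ?I"
    using c assms by (simp add: ennreal_mult[symmetric])
  also have "\<dots> = ennreal (1 / \<bar>c\<bar> ^ 3) * ennreal (mmass R)"
    unfolding e by (simp add: mult.assoc)
  also have "\<dots> = ennreal (mmass R / \<bar>c\<bar> ^ 3)"
    using c by (subst ennreal_mult'[symmetric]) auto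
  finally show ?thesis .
qed

text \<open>The averaging kernel with scale \<open>s\<close>.  As a function of \<open>t\<close> it is concentrated near
  \<open>(1 - s) x\<close>, so that for \<open>x\<close> in the closed cube its support stays inside the open cube: no
  margin is lost at the boundary, and the kernel is an admissible test function even for boundary
  points \<open>x\<close>.\<close>

definition mk :: "real \<Rightarrow> real \<Rightarrow> real^3 \<Rightarrow> real^3 \<Rightarrow> real" where
  "mk R s x t = mker R 0 ((1 / s) *\<^sub>R (t - (1 - s) *\<^sub>R x)) / (mmass R * s ^ 3)"

definition mfam_t :: "real \<Rightarrow> real \<Rightarrow> real^3 \<Rightarrow> 3 \<Rightarrow> nat \<Rightarrow> real \<Rightarrow> real" where
  "mfam_t R s x i n \<tau> = (1 / s) ^ n * mbump R n ((1 / s) * \<tau> + - ((1 - s) * x $ i / s))"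

definition mfam_x :: "real \<Rightarrow> real \<Rightarrow> real^3 \<Rightarrow> 3 \<Rightarrow> nat \<Rightarrow> real \<Rightarrow> real" where
  "mfam_x R s t i n \<xi> = (- (1 - s) / s) ^ n * mbump R n ((- (1 - s) / s) * \<xi> + t $ i / s)"

lemma smooth1_mfam: "smooth1 (mfam_t R s x i)" "smooth1 (mfam_x R s t i)"
  unfolding mfam_t_def[abs_def] mfam_x_def[abs_def] by (intro smooth1_affine smooth1_mbump)+

lemma power_morder: "c ^ (\<beta> $ 1) * c ^ (\<beta> $ 2) * c ^ (\<beta> $ 3) = (c::real) ^ morder \<beta>"
  by (simp add: morder_def sum_3 power_add)

text \<open>As functions of \<open>t\<close> or of \<open>x\<close> the kernels are products of functions of one variable.  Differentiating
  in \<open>x\<close> differs from differentiating in \<open>t\<close> only by the factor \<open>- (1 - s)\<close> for each derivative.\<close>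

lemma mfam_t_mker:
  "prodjet (mfam_t R s x) \<beta> t = (1 / s) ^ morder \<beta> * mker R \<beta> ((1 / s) *\<^sub>R (t - (1 - s) *\<^sub>R x))"
  unfolding power_morder[symmetric] prodjet_def mfam_t_def mker_def
  by (simp add: algebra_simps diff_divide_distrib)

lemma mfam_x_mker:
  "prodjet (mfam_x R s t) \<beta> x = (- (1 - s) / s) ^ morder \<beta> * mker R \<beta> ((1 / s) *\<^sub>R (t - (1 - s) *\<^sub>R x))"
proof -
  have "(- (1 - s) / s) * x $ i + t $ i / s = ((1 / s) *\<^sub>R (t - (1 - s) *\<^sub>R x)) $ i" for i
    by (simp add: algebra_simps diff_divide_distrib add_divide_distrib)
  then show ?thesis
    unfolding power_morder[symmetric] prodjet_def mfam_x_def mker_def by (simp only: mult_ac)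
qed

lemma mk_eq: "mk R s x t = prodjet (mfam_t R s x) 0 t / (mmass R * s ^ 3)"
  by (simp add: mk_def mfam_t_mker)

lemma mfam_x_bounded: "\<exists>M. \<forall>t x. \<bar>prodjet (mfam_x R s t) \<beta> x\<bar> \<le> M"
proof -
  have "\<bar>mfam_x R s t i n \<xi>\<bar> \<le> \<bar>- (1 - s) / s\<bar> ^ n * mbound R n" for t i n \<xi>
    unfolding mfam_x_def abs_mult power_abs by (intro mult_left_mono mbump_le_mbound) simp
  then have "\<bar>prodjet (mfam_x R s t) \<beta> x\<bar> \<le> (\<bar>- (1 - s) / s\<bar> ^ (\<beta> $ 1) * mbound R (\<beta> $ 1)) *
     (\<bar>- (1 - s) / s\<bar> ^ (\<beta> $ 2) * mbound R (\<beta> $ 2)) * (\<bar>- (1 - s) / s\<bar> ^ (\<beta> $ 3) * mbound R (\<beta> $ 3))" for t x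
    unfolding prodjet_def abs_mult by (intro mult_mono mult_nonneg_nonneg mbound_nonneg) auto
  then show ?thesis by blast
qed

text \<open>Uniform bounds on the second derivatives turn differentiability into a quadratic error bound, which
  can be integrated over a parameter.\<close>

lemma jet_Taylor_bound:
  fixes J :: "nat^3 \<Rightarrow> real^3 \<Rightarrow> real"
  assumes J: "\<And>\<beta> x. (J \<beta> has_derivative (\<lambda>h. \<Sum>i\<in>UNIV. h $ i *\<^sub>R J (\<beta> + axis i 1) x)) (at x)"
    and M: "\<And>i j x. \<bar>J (\<beta> + axis i 1 + axis j 1) x\<bar> \<le> M"
  shows "\<bar>J \<beta> y - J \<beta> x - (\<Sum>i\<in>UNIV. (y - x) $ i *\<^sub>R J (\<beta> + axis i 1) x)\<bar> \<le> 9 * M * (norm (y - x))\<^sup>2"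
proof -
  have M0: "M \<ge> 0" using M[of 1 1 0] by linarith
  have s3: "\<bar>\<Sum>i\<in>UNIV. h $ i *\<^sub>R g i\<bar> \<le> 3 * K * norm h" if "\<And>i. \<bar>g i\<bar> \<le> K" for h :: "real^3" and g :: "3 \<Rightarrow> real" and K
  proof -
    have "\<bar>\<Sum>i\<in>UNIV. h $ i *\<^sub>R g i\<bar> \<le> (\<Sum>i\<in>(UNIV::3 set). norm h * K)"
    proof (rule order_trans[OF sum_abs sum_mono])
      fix i show "\<bar>h $ i *\<^sub>R g i\<bar> \<le> norm h * K"
        using that[of i] component_le_norm_cart[of h i] by (simp add: abs_mult mult_mono)
    qed
    then show ?thesis by (simp add: mult_ac)
  qed
  have L: "\<bar>J (\<beta> + axis i 1) z - J (\<beta> + axis i 1) x\<bar> \<le> 3 * M * norm (z - x)" for i z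
  proof -
    have "norm (J (\<beta> + axis i 1) z - J (\<beta> + axis i 1) x) \<le> 3 * M * norm (z - x)"
    proof (rule differentiable_bound[of UNIV])
      show "onorm (\<lambda>h. \<Sum>j\<in>UNIV. h $ j *\<^sub>R J (\<beta> + axis i 1 + axis j 1) y) \<le> 3 * M" for y
        by (rule onorm_bound) (use M0 s3[OF M] in auto)
    qed (use J in auto)
    then show ?thesis by simp
  qed
  define B where "B = 9 * M * norm (y - x)"
  have "norm (J \<beta> y - J \<beta> x - (\<lambda>h. \<Sum>i\<in>UNIV. h $ i *\<^sub>R J (\<beta> + axis i 1) x) (y - x)) \<le> norm (y - x) * B"
  proof (rule differentiable_bound_linearization[where S = "cball x (norm (y - x))" and
      f' = "\<lambda>z h. \<Sum>i\<in>UNIV. h $ i *\<^sub>R J (\<beta> + axis i 1) z"])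
    show "x + t *\<^sub>R (y - x) \<in> cball x (norm (y - x))" if "t \<in> {0..1}" for t
      using that mult_right_mono[of t 1 "norm (y - x)"] by (simp add: dist_norm)
    show "(J \<beta> has_derivative (\<lambda>h. \<Sum>i\<in>UNIV. h $ i *\<^sub>R J (\<beta> + axis i 1) z)) (at z within cball x (norm (y - x)))" for z
      using J has_derivative_at_withinI by blast
    show "x \<in> cball x (norm (y - x))" by simp
    fix z assume z: "z \<in> cball x (norm (y - x))"
    then have zx: "norm (z - x) \<le> norm (y - x)" by (simp add: dist_norm norm_minus_commute)
    have eqf: "(\<lambda>h. \<Sum>i\<in>UNIV. h $ i *\<^sub>R J (\<beta> + axis i 1) z) - (\<lambda>h. \<Sum>i\<in>UNIV. h $ i *\<^sub>R J (\<beta> + axis i 1) x)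
        = (\<lambda>h. \<Sum>i\<in>UNIV. h $ i *\<^sub>R (J (\<beta> + axis i 1) z - J (\<beta> + axis i 1) x))"
      by (rule ext) (simp add: sum_subtractf[symmetric] right_diff_distrib)
    have on: "onorm (\<lambda>h. \<Sum>i\<in>UNIV. h $ i *\<^sub>R (J (\<beta> + axis i 1) z - J (\<beta> + axis i 1) x)) \<le> B"
    proof (rule onorm_bound)
      fix h :: "real^3"
      have "\<bar>J (\<beta> + axis i 1) z - J (\<beta> + axis i 1) x\<bar> \<le> 3 * M * norm (y - x)" for i
        using L[of i z] mult_left_mono[OF zx, of "3 * M"] M0 by linarith
      then have "\<bar>\<Sum>i\<in>UNIV. h $ i *\<^sub>R (J (\<beta> + axis i 1) z - J (\<beta> + axis i 1) x)\<bar> \<le> 3 * (3 * M * norm (y - x)) * norm h"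
        by (rule s3)
      then show "norm (\<Sum>i\<in>UNIV. h $ i *\<^sub>R (J (\<beta> + axis i 1) z - J (\<beta> + axis i 1) x)) \<le> B * norm h"
        by (simp add: B_def mult_ac)
    qed (simp add: B_def M0)
    show "onorm ((\<lambda>h. \<Sum>i\<in>UNIV. h $ i *\<^sub>R J (\<beta> + axis i 1) z) - (\<lambda>h. \<Sum>i\<in>UNIV. h $ i *\<^sub>R J (\<beta> + axis i 1) x)) \<le> B"
      unfolding eqf by (rule on)
  qed
  then show ?thesis by (simp add: B_def power2_eq_square mult_ac)
qed

lemma has_derivative_quadratic_bound:
  fixes f :: "real^3 \<Rightarrow> 'b::real_normed_vector"
  assumes "bounded_linear D" "\<And>y. norm (f y - f x - D (y - x)) \<le> C * (norm (y - x))\<^sup>2"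
  shows "(f has_derivative D) (at x)"
proof (rule has_derivativeI_sandwich[where e = 1 and H = "\<lambda>y. C * norm (y - x)"])
  show "norm (f y - f x - D (y - x)) / norm (y - x) \<le> C * norm (y - x)" if "y \<noteq> x" for y
    using assms(2)[of y] that by (simp add: divide_le_eq power2_eq_square mult.assoc)
  have "((\<lambda>y. C * norm (y - x)) \<longlongrightarrow> C * norm (x - x)) (at x)" by (intro tendsto_intros)
  then show "((\<lambda>y. C * norm (y - x)) \<longlongrightarrow> 0) (at x)" by simp
qed (use assms in auto)

text \<open>\<open>mjet R s u \<beta>\<close> is the \<open>\<beta>\<close>-th derivative of \<open>mollify R s u\<close>, with all derivatives on the kernel,
  so that it exists for every square integrable \<open>u\<close>.\<close>

definition mjet :: "real \<Rightarrow> real \<Rightarrow> (real^3 \<Rightarrow> complex) \<Rightarrow> nat^3 \<Rightarrow> real^3 \<Rightarrow> complex" where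
  "mjet R s u \<beta> x = (LINT t|lebesgue_on (cube R). (prodjet (mfam_x R s t) \<beta> x / (mmass R * s ^ 3)) *\<^sub>R u t)"

definition mollify :: "real \<Rightarrow> real \<Rightarrow> (real^3 \<Rightarrow> complex) \<Rightarrow> real^3 \<Rightarrow> complex" where
  "mollify R s v x = (LINT t|lebesgue_on (cube R). mk R s x t *\<^sub>R v t)"

lemma L2_integrable_scaleR:
  fixes \<phi> :: "real^3 \<Rightarrow> real"
  assumes "u \<in> L2 (cube R)" "continuous_on UNIV \<phi>"
  shows "integrable (lebesgue_on (cube R)) (\<lambda>x. \<phi> x *\<^sub>R u x)"
  using L2_cube_integrable_mult[OF assms] by (simp add: scaleR_conv_of_real mult.commute)

lemma mfam_x_continuous: "continuous_on UNIV (\<lambda>t. prodjet (mfam_x R s t) \<beta> x / c)"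
proof -
  have "continuous_on UNIV (\<lambda>t. ((- (1 - s) / s) ^ morder \<beta> * mker R \<beta> ((1 / s) *\<^sub>R (t - (1 - s) *\<^sub>R x))) * inverse c)"
    by (intro continuous_on_mult continuous_on_const continuous_on_compose2[OF mker_continuous[of UNIV]] continuous_on_scaleR
        continuous_on_diff continuous_on_id) auto
  then show ?thesis unfolding mfam_x_mker divide_inverse .
qed

lemma mjet_has_derivative:
  assumes u: "u \<in> L2 (cube R)"
  shows "(mjet R s u \<beta> has_derivative (\<lambda>h. \<Sum>i\<in>UNIV. h $ i *\<^sub>R mjet R s u (\<beta> + axis i 1) x)) (at x)"
proof -
  define c where "c = mmass R * s ^ 3"
  define E where "E = (\<lambda>t \<beta> x. prodjet (mfam_x R s t) \<beta> x)"
  have m: "mjet R s u \<beta> x = (LINT t|lebesgue_on (cube R). (E t \<beta> x / c) *\<^sub>R u t)" for \<beta> x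
    by (simp add: mjet_def c_def E_def)
  have int: "integrable (lebesgue_on (cube R)) (\<lambda>t. (E t \<beta> x / c) *\<^sub>R u t)" for \<beta> x
    unfolding E_def by (intro L2_integrable_scaleR u mfam_x_continuous)
  obtain M where M: "\<And>i j t x. \<bar>E t (\<beta> + axis i 1 + axis j 1) x\<bar> \<le> M"
  proof -
    define F where "F = (\<lambda>p. SOME M. \<forall>t x. \<bar>E t (\<beta> + axis (fst p) 1 + axis (snd p) 1) x\<bar> \<le> M)"
    have F: "\<bar>E t (\<beta> + axis i 1 + axis j 1) x\<bar> \<le> F (i, j)" for i j t x
      using someI_ex[OF mfam_x_bounded[of R s "\<beta> + axis i 1 + axis j 1"]] by (simp add: F_def E_def)
    have "F (i, j) \<le> Max (range F)" for i j by (rule Max_ge) auto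
    then show ?thesis using that order_trans[OF F] by blast
  qed
  show ?thesis
  proof (rule has_derivative_quadratic_bound)
    show "bounded_linear (\<lambda>h. \<Sum>i\<in>UNIV. h $ i *\<^sub>R mjet R s u (\<beta> + axis i 1) x)"
      by (intro bounded_linear_sum bounded_linear_scaleR_const bounded_linear_vec_nth)
    fix y
    define r where "r = (\<lambda>t. E t \<beta> y - E t \<beta> x - (\<Sum>i\<in>UNIV. (y - x) $ i *\<^sub>R E t (\<beta> + axis i 1) x))"
    have rb: "\<bar>r t\<bar> \<le> 9 * M * (norm (y - x))\<^sup>2" for t
      unfolding r_def
      by (rule jet_Taylor_bound) (use M prodjet_has_derivative[OF smooth1_mfam(2)] in \<open>auto simp: E_def\<close>)
    have i3: "integrable (lebesgue_on (cube R)) (\<lambda>t. \<Sum>i\<in>UNIV. (y - x) $ i *\<^sub>R ((E t (\<beta> + axis i 1) x / c) *\<^sub>R u t))"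
        by (intro Bochner_Integration.integrable_sum integrable_scaleR_right int)
    have "mjet R s u \<beta> y - mjet R s u \<beta> x - (\<Sum>i\<in>UNIV. (y - x) $ i *\<^sub>R mjet R s u (\<beta> + axis i 1) x)
       = (LINT t|lebesgue_on (cube R). (E t \<beta> y / c) *\<^sub>R u t - (E t \<beta> x / c) *\<^sub>R u t
            - (\<Sum>i\<in>UNIV. (y - x) $ i *\<^sub>R ((E t (\<beta> + axis i 1) x / c) *\<^sub>R u t)))"
    proof -
      have "(LINT t|lebesgue_on (cube R). (\<Sum>i\<in>UNIV. (y - x) $ i *\<^sub>R ((E t (\<beta> + axis i 1) x / c) *\<^sub>R u t)))
          = (\<Sum>i\<in>UNIV. LINT t|lebesgue_on (cube R). (y - x) $ i *\<^sub>R ((E t (\<beta> + axis i 1) x / c) *\<^sub>R u t))"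
        by (intro Bochner_Integration.integral_sum integrable_scaleR_right int)
      also have "\<dots> = (\<Sum>i\<in>UNIV. (y - x) $ i *\<^sub>R mjet R s u (\<beta> + axis i 1) x)"
        unfolding m by (simp only: integral_scaleR_right)
      finally have e3: "(LINT t|lebesgue_on (cube R). (\<Sum>i\<in>UNIV. (y - x) $ i *\<^sub>R ((E t (\<beta> + axis i 1) x / c) *\<^sub>R u t)))
          = (\<Sum>i\<in>UNIV. (y - x) $ i *\<^sub>R mjet R s u (\<beta> + axis i 1) x)" .
      show ?thesis
        by (subst Bochner_Integration.integral_diff[OF Bochner_Integration.integrable_diff[OF int int] i3],
            subst Bochner_Integration.integral_diff[OF int int]) (simp only: e3 m[of \<beta>])
    qed
    also have "\<dots> = (LINT t|lebesgue_on (cube R). (r t / c) *\<^sub>R u t)"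
      by (intro Bochner_Integration.integral_cong refl)
        (simp add: r_def diff_divide_distrib scaleR_diff_left sum_divide_distrib scaleR_sum_left)
    also have "norm \<dots> \<le> (LINT t|lebesgue_on (cube R). (9 * M * (norm (y - x))\<^sup>2 / \<bar>c\<bar>) * norm (u t))"
    proof (rule order_trans[OF integral_norm_bound integral_mono])
      show "integrable (lebesgue_on (cube R)) (\<lambda>t. (9 * M * (norm (y - x))\<^sup>2 / \<bar>c\<bar>) * norm (u t))"
        using L2_cube_integrable[OF u] by simp
      have "integrable (lebesgue_on (cube R)) (\<lambda>t. (E t \<beta> y / c) *\<^sub>R u t - (E t \<beta> x / c) *\<^sub>R u t
            - (\<Sum>i\<in>UNIV. (y - x) $ i *\<^sub>R ((E t (\<beta> + axis i 1) x / c) *\<^sub>R u t)))"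
        by (rule Bochner_Integration.integrable_diff[OF Bochner_Integration.integrable_diff[OF int int] i3])
      then have "integrable (lebesgue_on (cube R)) (\<lambda>t. (r t / c) *\<^sub>R u t)"
        by (simp add: r_def diff_divide_distrib scaleR_diff_left sum_divide_distrib scaleR_sum_left)
      then show "integrable (lebesgue_on (cube R)) (\<lambda>t. norm ((r t / c) *\<^sub>R u t))"
        by (rule integrable_norm)
      show "norm ((r t / c) *\<^sub>R u t) \<le> (9 * M * (norm (y - x))\<^sup>2 / \<bar>c\<bar>) * norm (u t)" for t
        unfolding norm_scaleR using rb[of t] by (intro mult_right_mono) (auto simp: abs_divide divide_right_mono)
    qed
    also have "\<dots> = (9 * M / \<bar>c\<bar> * (LINT t|lebesgue_on (cube R). norm (u t))) * (norm (y - x))\<^sup>2"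
      by simp
    finally show "norm (mjet R s u \<beta> y - mjet R s u \<beta> x - (\<Sum>i\<in>UNIV. (y - x) $ i *\<^sub>R mjet R s u (\<beta> + axis i 1) x))
        \<le> (9 * M / \<bar>c\<bar> * (LINT t|lebesgue_on (cube R). norm (u t))) * (norm (y - x))\<^sup>2" .
  qed
qed

lemma mk_zero:
  assumes "R > 0" "0 < s" "s \<le> 1" "x \<in> ccube R" and t: "mk R s x t \<noteq> 0"
  shows "\<bar>t $ i - (1 - s) * x $ i\<bar> \<le> s * (R / 2)"
proof -
  have "(1 / s) *\<^sub>R (t - (1 - s) *\<^sub>R x) \<in> ccube (R / 2)"
    using t mker_support by (auto simp: mk_def)
  then have "\<bar>(1 / s) * (t $ i - (1 - s) * x $ i)\<bar> \<le> R / 2" by (simp add: mem_ccube)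
  then show ?thesis using assms by (simp add: abs_mult field_simps)
qed

lemma mfam_t_test_function:
  assumes R: "R > 0" and s: "0 < s" "s \<le> 1" and x: "x \<in> ccube R"
  shows "test_function (cube R) (prodjet (mfam_t R s x) 0)"
proof (rule prodjet_test_function[OF smooth1_mfam(1)])
  define p where "p = (\<chi> i. (1 - s) * x $ i - s * (R / 2) :: real^3)"
  define q where "q = (\<chi> i. (1 - s) * x $ i + s * (R / 2) :: real^3)"
  show "mfam_t R s x i n \<tau> = 0" if "\<tau> \<notin> {p $ i..q $ i}" for i n \<tau>
  proof -
    have "(1 / s) * \<tau> + - ((1 - s) * x $ i / s) \<notin> {- (R / 2)..R / 2}"
      using that s by (auto simp: p_def q_def field_simps)
    then show ?thesis by (simp add: mfam_t_def mbump_support)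
  qed
  show "cbox p q \<subseteq> cube R"
  proof
    fix t assume t: "t \<in> cbox p q"
    have "\<bar>t $ i\<bar> < R" for i
    proof -
      have "\<bar>t $ i - (1 - s) * x $ i\<bar> \<le> s * (R / 2)"
      proof -
        have "p $ i \<le> t $ i" "t $ i \<le> q $ i" using t by (auto simp: mem_box_cart)
        then show ?thesis unfolding p_def q_def abs_le_iff by auto
      qed
      moreover have "\<bar>(1 - s) * x $ i\<bar> \<le> (1 - s) * R"
        using x s by (auto simp: abs_mult mem_ccube intro!: mult_left_mono)
      ultimately have "\<bar>t $ i\<bar> \<le> (1 - s) * R + s * (R / 2)" by linarith
      also have "\<dots> < R" using R s by (simp add: algebra_simps)
      finally show ?thesis .
    qed
    then show "t \<in> cube R" by (simp add: mem_cube)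
  qed
qed

text \<open>Derivatives in \<open>x\<close> of the kernel are turned into derivatives in \<open>t\<close>, and these are moved to \<open>u\<close>
  because the kernel is a test function.  So differentiating the average of \<open>u\<close> amounts to averaging
  the weak derivative of \<open>u\<close>, up to the factor from the contraction by \<open>1 - s\<close>.\<close>

lemma mjet_eq_mollify:
  assumes R: "R > 0" and s: "0 < s" "s \<le> 1" and x: "x \<in> ccube R" and w: "has_weak_deriv (cube R) \<beta> u v"
  shows "mjet R s u \<beta> x = (1 - s) ^ morder \<beta> *\<^sub>R mollify R s v x"
proof -
  let ?L = "lebesgue_on (cube R)"
  define c where "c = mmass R * s ^ 3"
  define C where "C = complex_of_real ((- (1 - s)) ^ morder \<beta> / c)"
  define \<phi> where "\<phi> = prodjet (mfam_t R s x) 0"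
  have mp: "mpartial \<beta> \<phi> = prodjet (mfam_t R s x) \<beta>"
    unfolding \<phi>_def by (rule prodjet_mpartial[OF smooth1_mfam(1)])
  have e: "(prodjet (mfam_x R s t) \<beta> x / c) *\<^sub>R u t = C * (u t * of_real (mpartial \<beta> \<phi> t))" for t
    unfolding mp mfam_x_mker mfam_t_mker C_def
    by (simp add: scaleR_conv_of_real power_divide power_minus mult_ac)
  have "mjet R s u \<beta> x = (LINT t|?L. C * (u t * of_real (mpartial \<beta> \<phi> t)))"
    unfolding mjet_def c_def[symmetric] e ..
  also have "\<dots> = C * (LINT t|?L. u t * of_real (mpartial \<beta> \<phi> t))"
    by (rule integral_mult_right_zero)
  also have "(LINT t|?L. u t * of_real (mpartial \<beta> \<phi> t)) = (-1) ^ morder \<beta> * (LINT t|?L. v t * of_real (\<phi> t))"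
    using w mfam_t_test_function[OF R s x] by (simp add: has_weak_deriv_def \<phi>_def)
  also have "C * ((-1) ^ morder \<beta> * (LINT t|?L. v t * of_real (\<phi> t)))
      = of_real ((1 - s) ^ morder \<beta>) * (of_real (1 / c) * (LINT t|?L. v t * of_real (\<phi> t)))"
  proof -
    have "(- (1 - s)) ^ morder \<beta> * (-1) ^ morder \<beta> = (1 - s) ^ morder \<beta>"
      unfolding power_mult_distrib[symmetric] by simp
    then have "complex_of_real ((- (1 - s)) ^ morder \<beta>) * (-1) ^ morder \<beta> = of_real ((1 - s) ^ morder \<beta>)"
      by (metis of_real_1 of_real_minus of_real_mult of_real_power)
    then have "C * (-1) ^ morder \<beta> = of_real ((1 - s) ^ morder \<beta>) * of_real (1 / c)"
      unfolding C_def of_real_divide by (simp add: field_simps)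
    then show ?thesis by (simp only: mult.assoc[symmetric])
  qed
  also have "of_real (1 / c) * (LINT t|?L. v t * of_real (\<phi> t)) = (LINT t|?L. of_real (1 / c) * (v t * of_real (\<phi> t)))"
    by (rule integral_mult_right_zero[symmetric])
  also have "\<dots> = mollify R s v x"
    unfolding mollify_def mk_eq \<phi>_def c_def
    by (intro Bochner_Integration.integral_cong refl) (simp add: scaleR_conv_of_real mult_ac)
  finally show ?thesis by (simp add: scaleR_conv_of_real)
qed

lemma mk_nonneg: "R > 0 \<Longrightarrow> 0 < s \<Longrightarrow> mk R s x t \<ge> 0"
  unfolding mk_def using mmass_pos[of R] by (intro divide_nonneg_nonneg mker_nonneg) auto

lemma mk_continuous: "continuous_on UNIV (mk R s x)"
proof -
  have "continuous_on UNIV (\<lambda>t. mker R 0 ((1 / s) *\<^sub>R (t - (1 - s) *\<^sub>R x)) * inverse (mmass R * s ^ 3))"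
    by (intro continuous_on_mult continuous_on_const continuous_on_compose2[OF mker_continuous[of UNIV]] continuous_on_scaleR
        continuous_on_diff continuous_on_id) auto
  then show ?thesis unfolding mk_def[abs_def] divide_inverse .
qed

lemma mk_support:
  assumes "R > 0" "0 < s" "s \<le> 1" "x \<in> ccube R" "mk R s x t \<noteq> 0" shows "t \<in> cube R"
proof -
  have "\<bar>t $ i\<bar> < R" for i
  proof -
    have "\<bar>t $ i - (1 - s) * x $ i\<bar> \<le> s * (R / 2)" by (rule mk_zero[OF assms])
    moreover have "\<bar>(1 - s) * x $ i\<bar> \<le> (1 - s) * R"
      using assms by (auto simp: abs_mult mem_ccube intro!: mult_left_mono)
    ultimately have "\<bar>t $ i\<bar> \<le> (1 - s) * R + s * (R / 2)" by linarith
    also have "\<dots> < R" using assms by (simp add: algebra_simps)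
    finally show ?thesis .
  qed
  then show ?thesis by (simp add: mem_cube)
qed

lemma mk_nn_integral_t:
  assumes "R > 0" "0 < s"
  shows "(\<integral>\<^sup>+t. ennreal (mk R s x t) \<partial>lborel) = 1"
proof -
  have pos: "mmass R * s ^ 3 > 0" using mmass_pos assms by simp
  have e: "ennreal (mk R s x t) = ennreal (1 / (mmass R * s ^ 3)) * ennreal (mker R 0 (- ((1 - s) / s) *\<^sub>R x + (1 / s) *\<^sub>R t))" for t
  proof -
    have "(1 / s) *\<^sub>R (t - (1 - s) *\<^sub>R x) = - ((1 - s) / s) *\<^sub>R x + (1 / s) *\<^sub>R t"
      by (simp add: scaleR_diff_right)
    then show ?thesis using pos mker_nonneg unfolding mk_def by (subst ennreal_mult[symmetric]) auto
  qed
  have "(\<integral>\<^sup>+t. ennreal (mk R s x t) \<partial>lborel)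
     = ennreal (1 / (mmass R * s ^ 3)) * (\<integral>\<^sup>+t. ennreal (mker R 0 (- ((1 - s) / s) *\<^sub>R x + (1 / s) *\<^sub>R t)) \<partial>lborel)"
    unfolding e by (rule nn_integral_cmult) measurable
  also have "\<dots> = ennreal (1 / (mmass R * s ^ 3)) * ennreal (mmass R / \<bar>1 / s\<bar> ^ 3)"
    using assms by (subst mker_nn_integral_affine) auto
  also have "\<dots> = ennreal (1 / (mmass R * s ^ 3) * (mmass R / \<bar>1 / s\<bar> ^ 3))"
    using pos mmass_pos[OF assms(1)] by (intro ennreal_mult[symmetric]) auto
  also have "1 / (mmass R * s ^ 3) * (mmass R / \<bar>1 / s\<bar> ^ 3) = 1"
    using mmass_pos[OF assms(1)] assms by (simp add: power_divide)
  finally show ?thesis by simp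
qed

text \<open>The change of variables in \<open>x\<close> costs the factor \<open>(1 - s)\<^sup>-\<^sup>3\<close>, which is \<open>8\<close> for \<open>s = 1 / 2\<close>.\<close>

lemma mk_nn_integral_x:
  assumes "R > 0" "0 < s" "s \<le> 1 / 2"
  shows "(\<integral>\<^sup>+x. ennreal (mk R s x t) \<partial>lborel) \<le> 8"
proof -
  have pos: "mmass R * s ^ 3 > 0" using mmass_pos assms by simp
  have e: "ennreal (mk R s x t) = ennreal (1 / (mmass R * s ^ 3)) * ennreal (mker R 0 ((1 / s) *\<^sub>R t + (- ((1 - s) / s)) *\<^sub>R x))" for x
  proof -
    have "(1 / s) *\<^sub>R (t - (1 - s) *\<^sub>R x) = (1 / s) *\<^sub>R t + (- ((1 - s) / s)) *\<^sub>R x"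
      by (simp add: scaleR_diff_right)
    then show ?thesis using pos mker_nonneg unfolding mk_def by (subst ennreal_mult[symmetric]) auto
  qed
  have "(\<integral>\<^sup>+x. ennreal (mk R s x t) \<partial>lborel)
     = ennreal (1 / (mmass R * s ^ 3)) * (\<integral>\<^sup>+x. ennreal (mker R 0 ((1 / s) *\<^sub>R t + (- ((1 - s) / s)) *\<^sub>R x)) \<partial>lborel)"
    unfolding e by (rule nn_integral_cmult) measurable
  also have "\<dots> = ennreal (1 / (mmass R * s ^ 3)) * ennreal (mmass R / \<bar>- ((1 - s) / s)\<bar> ^ 3)"
    using assms by (subst mker_nn_integral_affine) auto
  also have "\<dots> = ennreal (1 / (mmass R * s ^ 3) * (mmass R / \<bar>- ((1 - s) / s)\<bar> ^ 3))"
    using pos mmass_pos[OF assms(1)] by (intro ennreal_mult[symmetric]) auto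
  also have "1 / (mmass R * s ^ 3) * (mmass R / \<bar>- ((1 - s) / s)\<bar> ^ 3) = (1 / (1 - s)) ^ 3"
    using pos mmass_pos[OF assms(1)] assms by (simp add: power_divide)
  also have "(1 / (1 - s)) ^ 3 \<le> 2 ^ 3" using assms by (intro power_mono) (auto simp: field_simps)
  finally show ?thesis by (simp add: ennreal_leI)
qed

lemma mk_mass:
  assumes "R > 0" "0 < s" "s \<le> 1" "x \<in> ccube R"
  shows "integrable (lebesgue_on (cube R)) (mk R s x)" "(LINT t|lebesgue_on (cube R). mk R s x t) = 1"
proof -
  show "integrable (lebesgue_on (cube R)) (mk R s x)"
    using mk_continuous continuous_on_subset by (intro continuous_integrable_cube) blast
  have m [measurable]: "mk R s x \<in> borel_measurable borel"
    by (rule borel_measurable_continuous_onI[OF mk_continuous])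
  have "(\<lambda>t. indicator (cube R) t *\<^sub>R mk R s x t) = mk R s x"
  proof
    fix t show "indicator (cube R) t *\<^sub>R mk R s x t = mk R s x t"
      using mk_support[OF assms, of t] by (auto simp: indicator_def)
  qed
  then have "(LINT t|lebesgue_on (cube R). mk R s x t) = (LINT t|lebesgue. mk R s x t)"
    by (simp add: integral_restrict_space)
  also have "\<dots> = (LINT t|lborel. mk R s x t)" by (intro integral_completion) simp
  also have "\<dots> = 1"
    using mk_nn_integral_t[OF assms(1,2)] assms by (subst integral_eq_nn_integral) (auto simp: mk_nonneg)
  finally show "(LINT t|lebesgue_on (cube R). mk R s x t) = 1" .
qed

text \<open>Jensen's inequality, from the nonnegativity of the variance.\<close>

lemma mollify_pointwise_bound:
  assumes R: "R > 0" and s: "0 < s" "s \<le> 1" and x: "x \<in> ccube R" and v: "v \<in> L2 (cube R)"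
  shows "integrable (lebesgue_on (cube R)) (\<lambda>t. mk R s x t * (cmod (v t))\<^sup>2)"
    "(cmod (mollify R s v x))\<^sup>2 \<le> (LINT t|lebesgue_on (cube R). mk R s x t * (cmod (v t))\<^sup>2)"
proof -
  let ?L = "lebesgue_on (cube R)"
  define m where "m = mollify R s v x"
  have i1: "integrable ?L (\<lambda>t. mk R s x t *\<^sub>R v t)" by (rule L2_integrable_scaleR[OF v mk_continuous])
  have c: "continuous_on (ccube R) (mk R s x)" using mk_continuous continuous_on_subset by blast
  obtain B where B: "\<And>t. t \<in> ccube R \<Longrightarrow> norm (mk R s x t) \<le> B"
    using continuous_bounded_on_ccube[OF c] by blast
  have i2: "integrable ?L (\<lambda>t. (mk R s x t *\<^sub>R v t) \<bullet> v t)"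
    by (rule L2_inner_integrable[OF L2_mult_bounded[OF v measurable_cube_continuous[OF c], of B] v])
      (use B cube_subset_ccube[of R] in auto)
  then show i3: "integrable ?L (\<lambda>t. mk R s x t * (cmod (v t))\<^sup>2)"
    by (simp add: power2_norm_eq_inner)
  have "mk R s x t * (cmod (v t - m))\<^sup>2
       = mk R s x t * (cmod (v t))\<^sup>2 - 2 * ((mk R s x t *\<^sub>R v t) \<bullet> m) + mk R s x t * (cmod m)\<^sup>2" for t
  proof -
    have e: "(cmod (v t - m))\<^sup>2 = (cmod (v t))\<^sup>2 - 2 * (v t \<bullet> m) + (cmod m)\<^sup>2"
      using norm_add_scaleR_sq[of "v t" "-1" m] by simp
    show ?thesis unfolding e inner_scaleR_left by (simp add: algebra_simps)
  qed
  then have "(LINT t|?L. mk R s x t * (cmod (v t - m))\<^sup>2)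
     = (LINT t|?L. mk R s x t * (cmod (v t))\<^sup>2 - 2 * ((mk R s x t *\<^sub>R v t) \<bullet> m) + mk R s x t * (cmod m)\<^sup>2)"
    by simp
  also have "\<dots> = (LINT t|?L. mk R s x t * (cmod (v t))\<^sup>2) - 2 * (LINT t|?L. (mk R s x t *\<^sub>R v t) \<bullet> m)
       + (LINT t|?L. mk R s x t * (cmod m)\<^sup>2)"
    using i3 integrable_inner_left[OF i1, of m] mk_mass(1)[OF R s x] by simp
  also have "(LINT t|?L. (mk R s x t *\<^sub>R v t) \<bullet> m) = m \<bullet> m"
    using i1 by (subst integral_inner_left) (auto simp: m_def mollify_def)
  also have "(LINT t|?L. mk R s x t * (cmod m)\<^sup>2) = (cmod m)\<^sup>2"
    using mk_mass(2)[OF R s x] by simp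
  finally have "(LINT t|?L. mk R s x t * (cmod (v t - m))\<^sup>2) = (LINT t|?L. mk R s x t * (cmod (v t))\<^sup>2) - (cmod m)\<^sup>2"
    by (simp add: power2_norm_eq_inner)
  moreover have "(LINT t|?L. mk R s x t * (cmod (v t - m))\<^sup>2) \<ge> 0"
    using mk_nonneg[OF R s(1)] by (intro Bochner_Integration.integral_nonneg) auto
  ultimately show "(cmod (mollify R s v x))\<^sup>2 \<le> (LINT t|?L. mk R s x t * (cmod (v t))\<^sup>2)"
    by (simp add: m_def)
qed

lemma nn_integral_lebesgue_on:
  fixes f :: "real^3 \<Rightarrow> ennreal"
  assumes "S \<in> sets lebesgue"
  shows "(\<integral>\<^sup>+x. f x \<partial>lebesgue_on S) = (\<integral>\<^sup>+x. f x * indicator S x \<partial>lebesgue)"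
  using assms by (simp add: nn_integral_restrict_space)

text \<open>Averaging is bounded in mean square uniformly in the scale: integrate the pointwise bound over \<open>x\<close>
  and exchange the integrals.  The constant is rounded up from \<open>\<surd>8\<close>.\<close>

lemma mollify_L2_bound:
  assumes R: "R > 0" and s: "0 < s" "s \<le> 1 / 2" and v: "v \<in> L2 (cube R)"
    and m: "mollify R s v \<in> L2 (cube R)"
  shows "L2_norm (cube R) (mollify R s v) \<le> 3 * L2_norm (cube R) v"
proof -
  let ?L = "lebesgue_on (cube R)"
  define q where "q = (\<lambda>t. indicator (cube R) t * (cmod (v t))\<^sup>2)"
  have qi: "integrable lebesgue q"
    using L2_integrable[OF v] by (simp add: q_def integrable_restrict_space)
  obtain q' where q' [measurable]: "q' \<in> borel_measurable lborel" and ae: "AE t in lborel. q t = q' t"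
    using completion_ex_borel_measurable_real[OF borel_measurable_integrable[OF qi]] by blast
  have ae': "AE t in lebesgue. q t = q' t" by (rule AE_completion[OF ae])
  have nnc: "(\<integral>\<^sup>+t. f t \<partial>lebesgue) = (\<integral>\<^sup>+t. f t \<partial>lborel)" if "f \<in> borel_measurable borel" for f :: "real^3 \<Rightarrow> ennreal"
    using that by (intro nn_integral_completion)
  have kc: "continuous_on UNIV (\<lambda>p. mk R s (snd p) (fst p))"
  proof -
    have "continuous_on UNIV (\<lambda>p. mker R 0 ((1 / s) *\<^sub>R (fst p - (1 - s) *\<^sub>R snd p)) * inverse (mmass R * s ^ 3))"
      by (intro continuous_on_mult continuous_on_const continuous_on_compose2[OF mker_continuous[of UNIV]] continuous_on_scaleR
          continuous_on_diff continuous_on_fst continuous_on_snd continuous_on_id) auto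
    then show ?thesis unfolding mk_def divide_inverse .
  qed
  then have km: "(\<lambda>p. mk R s (snd p) (fst p)) \<in> borel_measurable (borel \<Otimes>\<^sub>M borel)"
    unfolding borel_prod by (rule borel_measurable_continuous_onI)
  have m1 [measurable]: "mk R s x \<in> borel_measurable borel" for x
    by (rule borel_measurable_continuous_onI[OF mk_continuous])
  have m2 [measurable]: "(\<lambda>x. mk R s x t) \<in> borel_measurable borel" for t
  proof (rule borel_measurable_continuous_onI)
    have "continuous_on UNIV (\<lambda>x. mk R s (snd (t, x)) (fst (t, x)))"
      by (rule continuous_on_compose2[OF kc]) (auto intro!: continuous_on_Pair continuous_on_const continuous_on_id)
    then show "continuous_on UNIV (\<lambda>x. mk R s x t)" by simp
  qed
  have q'b [measurable]: "q' \<in> borel_measurable borel" using q' by simp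
  define F where "F = (\<lambda>t x. ennreal (mk R s x t) * ennreal (q' t))"
  have pw: "ennreal ((cmod (mollify R s v x))\<^sup>2) \<le> (\<integral>\<^sup>+t. F t x \<partial>lborel)" if x: "x \<in> cube R" for x
  proof -
    have x': "x \<in> ccube R" using x cube_subset_ccube by blast
    have s1: "s \<le> 1" using s by simp
    note b = mollify_pointwise_bound[OF R s(1) s1 x' v]
    have "ennreal ((cmod (mollify R s v x))\<^sup>2) \<le> ennreal (LINT t|?L. mk R s x t * (cmod (v t))\<^sup>2)"
      using b(2) by (rule ennreal_leI)
    also have "\<dots> = (\<integral>\<^sup>+t. ennreal (mk R s x t * (cmod (v t))\<^sup>2) \<partial>?L)"
      using mk_nonneg[OF R s(1)] by (intro nn_integral_eq_integral[symmetric] b(1)) auto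
    also have "\<dots> = (\<integral>\<^sup>+t. ennreal (mk R s x t * (cmod (v t))\<^sup>2) * indicator (cube R) t \<partial>lebesgue)"
      by (rule nn_integral_lebesgue_on) simp
    also have "\<dots> = (\<integral>\<^sup>+t. F t x \<partial>lebesgue)"
    proof (rule nn_integral_cong_AE)
      show "AE t in lebesgue. ennreal (mk R s x t * (cmod (v t))\<^sup>2) * indicator (cube R) t = F t x"
        using ae'
      proof eventually_elim
        fix t assume "q t = q' t"
        then show "ennreal (mk R s x t * (cmod (v t))\<^sup>2) * indicator (cube R) t = F t x"
          using mk_nonneg[OF R s(1), of x t] zero_le_power2[of "cmod (v t)"]
          by (cases "t \<in> cube R") (auto simp: F_def q_def ennreal_mult simp del: zero_le_power2)
      qed
    qed
    also have "\<dots> = (\<integral>\<^sup>+t. F t x \<partial>lborel)"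
      unfolding F_def by (rule nnc) measurable
    finally show ?thesis .
  qed
  have mF: "(\<lambda>x. \<integral>\<^sup>+t. F t x \<partial>lborel) \<in> borel_measurable borel"
  proof -
    have "case_prod (\<lambda>x t. F t x) \<in> borel_measurable (borel \<Otimes>\<^sub>M lborel)"
    proof -
      have "continuous_on UNIV (\<lambda>p. mk R s (snd (snd p, fst p)) (fst (snd p, fst p)))"
        by (rule continuous_on_compose2[OF kc]) (auto intro!: continuous_on_Pair continuous_on_fst continuous_on_snd continuous_on_id)
      then have "(\<lambda>p. mk R s (fst p) (snd p)) \<in> borel_measurable (borel \<Otimes>\<^sub>M borel)"
        unfolding borel_prod by (intro borel_measurable_continuous_onI) simp
      then show ?thesis unfolding F_def split_def by simp
    qed
    then show ?thesis by (rule lborel.borel_measurable_nn_integral)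
  qed
  have Fp: "case_prod F \<in> borel_measurable (lborel \<Otimes>\<^sub>M lborel)"
    unfolding F_def split_def using km by simp
  have "ennreal ((L2_norm (cube R) (mollify R s v))\<^sup>2) = (\<integral>\<^sup>+x. ennreal ((cmod (mollify R s v x))\<^sup>2) \<partial>?L)"
    unfolding L2_norm_sq by (rule nn_integral_eq_integral[symmetric, OF L2_integrable[OF m]]) simp
  also have "\<dots> \<le> (\<integral>\<^sup>+x. (\<integral>\<^sup>+t. F t x \<partial>lborel) \<partial>?L)"
    by (rule nn_integral_mono) (simp add: pw space_restrict_space)
  also have "\<dots> = (\<integral>\<^sup>+x. (\<integral>\<^sup>+t. F t x \<partial>lborel) * indicator (cube R) x \<partial>lebesgue)"
    by (rule nn_integral_lebesgue_on) simp
  also have "\<dots> \<le> (\<integral>\<^sup>+x. (\<integral>\<^sup>+t. F t x \<partial>lborel) \<partial>lebesgue)"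
    by (rule nn_integral_mono) (auto simp: indicator_def)
  also have "\<dots> = (\<integral>\<^sup>+x. (\<integral>\<^sup>+t. F t x \<partial>lborel) \<partial>lborel)"
    by (rule nnc[OF mF])
  also have "\<dots> = (\<integral>\<^sup>+t. (\<integral>\<^sup>+x. F t x \<partial>lborel) \<partial>lborel)"
    by (rule lborel_pair.Fubini'[OF Fp])
  also have "\<dots> = (\<integral>\<^sup>+t. (\<integral>\<^sup>+x. ennreal (mk R s x t) \<partial>lborel) * ennreal (q' t) \<partial>lborel)"
    unfolding F_def by (intro nn_integral_cong nn_integral_multc) measurable
  also have "\<dots> \<le> (\<integral>\<^sup>+t. 8 * ennreal (q' t) \<partial>lborel)"
    by (intro nn_integral_mono mult_right_mono mk_nn_integral_x R s) simp
  also have "\<dots> = 8 * (\<integral>\<^sup>+t. ennreal (q' t) \<partial>lborel)"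
    by (rule nn_integral_cmult) measurable
  also have "(\<integral>\<^sup>+t. ennreal (q' t) \<partial>lborel) = (\<integral>\<^sup>+t. ennreal (q t) \<partial>lebesgue)"
  proof -
    have "(\<integral>\<^sup>+t. ennreal (q' t) \<partial>lborel) = (\<integral>\<^sup>+t. ennreal (q' t) \<partial>lebesgue)"
      by (rule nnc[symmetric]) measurable
    also have "\<dots> = (\<integral>\<^sup>+t. ennreal (q t) \<partial>lebesgue)"
      by (rule nn_integral_cong_AE) (use ae' in \<open>eventually_elim, simp\<close>)
    finally show ?thesis .
  qed
  also have "(\<integral>\<^sup>+t. ennreal (q t) \<partial>lebesgue) = ennreal (LINT t|lebesgue. q t)"
    by (rule nn_integral_eq_integral[OF qi]) (simp add: q_def)
  also have "(LINT t|lebesgue. q t) = (L2_norm (cube R) v)\<^sup>2"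
    unfolding L2_norm_sq q_def by (simp add: integral_restrict_space)
  also have "8 * ennreal ((L2_norm (cube R) v)\<^sup>2) = ennreal (8 * (L2_norm (cube R) v)\<^sup>2)"
    by (simp add: ennreal_mult)
  finally have "(L2_norm (cube R) (mollify R s v))\<^sup>2 \<le> 8 * (L2_norm (cube R) v)\<^sup>2"
    by (subst (asm) ennreal_le_iff) simp_all
  also have "\<dots> \<le> (3 * L2_norm (cube R) v)\<^sup>2" by (simp add: power_mult_distrib)
  finally show ?thesis by (rule power2_le_imp_le) (simp add: L2_norm_nonneg)
qed

lemma L2_cong: "(\<And>x. x \<in> \<Omega> \<Longrightarrow> u x = v x) \<Longrightarrow> u \<in> L2 \<Omega> \<longleftrightarrow> v \<in> L2 \<Omega>"
  unfolding L2_def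
  using measurable_cong[of "lebesgue_on \<Omega>" u v borel]
    Bochner_Integration.integrable_cong[of "lebesgue_on \<Omega>" "lebesgue_on \<Omega>" "\<lambda>x. (cmod (u x))\<^sup>2" "\<lambda>x. (cmod (v x))\<^sup>2"]
  by (simp add: space_restrict_space)

lemma L2_norm_cong: "(\<And>x. x \<in> \<Omega> \<Longrightarrow> u x = v x) \<Longrightarrow> L2_norm \<Omega> u = L2_norm \<Omega> v"
  unfolding L2_norm_def
  by (intro arg_cong[where f = sqrt] Bochner_Integration.integral_cong) (simp_all add: space_restrict_space)

lemma L2_norm_dominated:
  assumes m: "\<And>n. f n \<in> borel_measurable (lebesgue_on \<Omega>)" and w: "integrable (lebesgue_on \<Omega>) w"
    and b: "\<And>n. AE x in lebesgue_on \<Omega>. (cmod (f n x))\<^sup>2 \<le> w x"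
    and lim: "AE x in lebesgue_on \<Omega>. (\<lambda>n. f n x) \<longlonglongrightarrow> 0"
  shows "(\<lambda>n. L2_norm \<Omega> (f n)) \<longlonglongrightarrow> 0"
proof -
  have "(\<lambda>n. LINT x|lebesgue_on \<Omega>. (cmod (f n x))\<^sup>2) \<longlonglongrightarrow> (LINT x|lebesgue_on \<Omega>. 0)"
  proof (rule integral_dominated_convergence[where w = w])
    show "AE x in lebesgue_on \<Omega>. (\<lambda>n. (cmod (f n x))\<^sup>2) \<longlonglongrightarrow> 0"
      using lim
    proof eventually_elim
      fix x assume "(\<lambda>n. f n x) \<longlonglongrightarrow> 0"
      then have "(\<lambda>n. (cmod (f n x))\<^sup>2) \<longlonglongrightarrow> (cmod 0)\<^sup>2" by (rule tendsto_power[OF tendsto_norm])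
      then show "(\<lambda>n. (cmod (f n x))\<^sup>2) \<longlonglongrightarrow> 0" by simp
    qed
    show "AE x in lebesgue_on \<Omega>. norm ((cmod (f n x))\<^sup>2) \<le> w x" for n using b[of n] by simp
  qed (use m w in auto)
  from tendsto_real_sqrt[OF this] show ?thesis by (simp add: L2_norm_def)
qed

text \<open>Truncation makes dominated convergence applicable to the almost everywhere convergent continuous
  approximations of a measurable function.\<close>

definition clip :: "real \<Rightarrow> complex \<Rightarrow> complex" where
  "clip K z = (1 / max 1 (cmod z / K)) *\<^sub>R z"

lemma clip_continuous: "continuous_on UNIV (clip K)"
proof -
  have "max 1 (cmod z / K) \<noteq> 0" for z by simp
  then show ?thesis unfolding clip_def[abs_def] divide_inverse
    by (intro continuous_on_scaleR continuous_on_mult continuous_on_inverse continuous_on_max continuous_on_const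
        continuous_on_norm continuous_on_id) auto
qed

lemma clip_bound: "K > 0 \<Longrightarrow> cmod (clip K z) \<le> K"
  by (auto simp: clip_def max_def field_simps)

lemma clip_le: "cmod (clip K z) \<le> cmod z"
proof -
  have "cmod (clip K z) = (1 / max 1 (cmod z / K)) * cmod z" by (simp add: clip_def)
  also have "\<dots> \<le> 1 * cmod z" by (intro mult_right_mono) (auto simp: divide_le_eq)
  finally show ?thesis by simp
qed

lemma clip_id: "K > 0 \<Longrightarrow> cmod z \<le> K \<Longrightarrow> clip K z = z"
  by (auto simp: clip_def max_def field_simps)

lemma clip_measurable: "v \<in> borel_measurable M \<Longrightarrow> (\<lambda>x. clip K (v x)) \<in> borel_measurable M"
  by (rule measurable_compose[OF _ borel_measurable_continuous_onI[OF clip_continuous]])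

lemma L2_dense_continuous:
  assumes v: "v \<in> L2 (cube R)" and e: "e > 0"
  obtains g where "continuous_on UNIV g" "L2_norm (cube R) (\<lambda>x. v x - g x) < e"
proof -
  let ?L = "lebesgue_on (cube R)"
  note vm = L2_measurable[OF v]
  have "(\<lambda>n. L2_norm (cube R) (\<lambda>x. v x - clip (real (Suc n)) (v x))) \<longlonglongrightarrow> 0"
  proof (rule L2_norm_dominated[where w = "\<lambda>x. 4 * (cmod (v x))\<^sup>2"])
    show "(\<lambda>x. v x - clip (real (Suc n)) (v x)) \<in> borel_measurable ?L" for n
      by (intro borel_measurable_diff vm clip_measurable)
    show "integrable ?L (\<lambda>x. 4 * (cmod (v x))\<^sup>2)" using L2_integrable[OF v] by simp
    have "(cmod (v x - clip (real (Suc n)) (v x)))\<^sup>2 \<le> 4 * (cmod (v x))\<^sup>2" for n x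
    proof -
      have "cmod (v x - clip (real (Suc n)) (v x)) \<le> 2 * cmod (v x)"
        using norm_triangle_ineq4[of "v x" "clip (real (Suc n)) (v x)"] clip_le[of "real (Suc n)" "v x"] by linarith
      then have "(cmod (v x - clip (real (Suc n)) (v x)))\<^sup>2 \<le> (2 * cmod (v x))\<^sup>2" by (intro power_mono) auto
      then show ?thesis by (simp add: power_mult_distrib)
    qed
    then show "AE x in ?L. (cmod (v x - clip (real (Suc n)) (v x)))\<^sup>2 \<le> 4 * (cmod (v x))\<^sup>2" for n by simp
    have "(\<lambda>n. v x - clip (real (Suc n)) (v x)) \<longlonglongrightarrow> 0" for x
    proof (rule tendsto_eventually)
      obtain n0 where n0: "cmod (v x) \<le> real n0" using real_arch_simple by blast
      have "v x - clip (real (Suc n)) (v x) = 0" if "n \<ge> n0" for n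
        using clip_id[of "real (Suc n)" "v x"] n0 that by simp
      then show "eventually (\<lambda>n. v x - clip (real (Suc n)) (v x) = 0) sequentially"
        unfolding eventually_sequentially by blast
    qed
    then show "AE x in ?L. (\<lambda>n. v x - clip (real (Suc n)) (v x)) \<longlonglongrightarrow> 0" by simp
  qed
  then have "eventually (\<lambda>n. L2_norm (cube R) (\<lambda>x. v x - clip (real (Suc n)) (v x)) < e / 2) sequentially"
    using e by (intro order_tendstoD(2)) auto
  then obtain n where n: "L2_norm (cube R) (\<lambda>x. v x - clip (real (Suc n)) (v x)) < e / 2"
    unfolding eventually_sequentially by blast
  define K where "K = real (Suc n)"
  have K: "K > 0" by (simp add: K_def)
  have "v measurable_on cube R" using vm by (subst measurable_on_iff_borel_measurable) auto
  then obtain N g where N: "negligible N" and gc: "\<And>n. continuous_on UNIV (g n)"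
    and g: "\<And>x. x \<notin> N \<Longrightarrow> (\<lambda>n. g n x) \<longlonglongrightarrow> (if x \<in> cube R then v x else 0)"
    unfolding measurable_on_def by blast
  have cg: "continuous_on UNIV (\<lambda>x. clip K (g n x))" for n
    by (rule continuous_on_compose2[OF clip_continuous gc]) simp
  have cgL: "(\<lambda>x. clip K (g n x)) \<in> L2 (cube R)" for n
    using cg continuous_on_subset by (intro continuous_L2_cube) blast
  have "(\<lambda>n. L2_norm (cube R) (\<lambda>x. clip K (v x) - clip K (g n x))) \<longlonglongrightarrow> 0"
  proof (rule L2_norm_dominated[where w = "\<lambda>x. 4 * K\<^sup>2"])
    show "(\<lambda>x. clip K (v x) - clip K (g n x)) \<in> borel_measurable ?L" for n
      by (intro borel_measurable_diff clip_measurable vm L2_measurable[OF cgL])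
    show "integrable ?L (\<lambda>x. 4 * K\<^sup>2)" by (rule continuous_integrable_cube) simp
    have "(cmod (clip K (v x) - clip K (g n x)))\<^sup>2 \<le> 4 * K\<^sup>2" for n x
    proof -
      have "cmod (clip K (v x) - clip K (g n x)) \<le> 2 * K"
        using norm_triangle_ineq4[of "clip K (v x)" "clip K (g n x)"] clip_bound[OF K, of "v x"] clip_bound[OF K, of "g n x"]
        by linarith
      then have "(cmod (clip K (v x) - clip K (g n x)))\<^sup>2 \<le> (2 * K)\<^sup>2" by (intro power_mono) auto
      then show ?thesis by (simp add: power_mult_distrib)
    qed
    then show "AE x in ?L. (cmod (clip K (v x) - clip K (g n x)))\<^sup>2 \<le> 4 * K\<^sup>2" for n by simp
    have "AE x in lebesgue. x \<notin> N"
      using N by (intro AE_not_in) (simp add: negligible_iff_null_sets)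
    then have "AE x in lebesgue. x \<in> cube R \<longrightarrow> (\<lambda>n. clip K (v x) - clip K (g n x)) \<longlonglongrightarrow> 0"
    proof eventually_elim
      fix x assume x: "x \<notin> N"
      show "x \<in> cube R \<longrightarrow> (\<lambda>n. clip K (v x) - clip K (g n x)) \<longlonglongrightarrow> 0"
      proof
        assume "x \<in> cube R"
        then have "(\<lambda>n. g n x) \<longlonglongrightarrow> v x" using g[OF x] by simp
        then have "(\<lambda>n. clip K (g n x)) \<longlonglongrightarrow> clip K (v x)"
          using clip_continuous[of K] by (intro isCont_tendsto_compose[of _ "clip K"]) (simp add: continuous_on_eq_continuous_at)
        then have "(\<lambda>n. clip K (v x) - clip K (g n x)) \<longlonglongrightarrow> clip K (v x) - clip K (v x)"
          by (rule tendsto_diff[OF tendsto_const])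
        then show "(\<lambda>n. clip K (v x) - clip K (g n x)) \<longlonglongrightarrow> 0" by simp
      qed
    qed
    then show "AE x in ?L. (\<lambda>n. clip K (v x) - clip K (g n x)) \<longlonglongrightarrow> 0"
      by (simp add: AE_restrict_space_iff)
  qed
  then have "eventually (\<lambda>n. L2_norm (cube R) (\<lambda>x. clip K (v x) - clip K (g n x)) < e / 2) sequentially"
    using e by (intro order_tendstoD(2)) auto
  then obtain m where m: "L2_norm (cube R) (\<lambda>x. clip K (v x) - clip K (g m x)) < e / 2"
    unfolding eventually_sequentially by blast
  have cv: "(\<lambda>x. clip K (v x)) \<in> L2 (cube R)"
    unfolding L2_def
  proof (intro CollectI conjI clip_measurable vm)
    show "integrable ?L (\<lambda>x. (cmod (clip K (v x)))\<^sup>2)"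
    proof (rule Bochner_Integration.integrable_bound[OF L2_integrable[OF v]])
      show "(\<lambda>x. (cmod (clip K (v x)))\<^sup>2) \<in> borel_measurable ?L"
        using clip_measurable[OF vm] by measurable
      show "AE x in ?L. norm ((cmod (clip K (v x)))\<^sup>2) \<le> norm ((cmod (v x))\<^sup>2)"
        by (intro AE_I2) (simp add: power_mono clip_le)
    qed
  qed
  have "L2_norm (cube R) (\<lambda>x. v x - clip K (g m x)) < e"
    using L2_norm_triangle[OF L2_diff[OF v cv] L2_diff[OF cv cgL[of m]]] m n by (simp add: K_def)
  with cg[of m] that show ?thesis by blast
qed

lemma norm_le_3: "(\<And>i. \<bar>x $ i\<bar> \<le> b) \<Longrightarrow> norm (x :: real^3) \<le> 3 * b"
  using norm_le_l1_cart[of x] sum_mono[of UNIV "\<lambda>i. \<bar>x $ i\<bar>" "\<lambda>i. b"] by simp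

text \<open>The kernel at \<open>x\<close> is supported within a distance of order \<open>s R\<close> from \<open>x\<close>, inside the cube, so
  uniform continuity on the closed cube suffices, also at its boundary.\<close>

lemma mollify_uniform:
  assumes R: "R > 0" and v: "v \<in> L2 (cube R)" and U: "continuous_on (ccube R) U"
    and ae: "AE x in lebesgue_on (cube R). U x = v x" and e: "e > 0"
  obtains s0 where "s0 > 0"
    "\<And>s x. 0 < s \<Longrightarrow> s \<le> s0 \<Longrightarrow> s \<le> 1 \<Longrightarrow> x \<in> ccube R \<Longrightarrow> cmod (mollify R s v x - U x) \<le> e"
proof -
  let ?L = "lebesgue_on (cube R)"
  have "uniformly_continuous_on (ccube R) U" by (rule compact_uniformly_continuous[OF U compact_cbox])
  then obtain \<delta> where \<delta>: "\<delta> > 0" "\<And>x y. x \<in> ccube R \<Longrightarrow> y \<in> ccube R \<Longrightarrow> dist x y < \<delta> \<Longrightarrow> dist (U x) (U y) < e"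
    unfolding uniformly_continuous_on_def using e by metis
  have "cmod (mollify R s v x - U x) \<le> e" if s: "0 < s" "s \<le> \<delta> / (7 * R)" "s \<le> 1" and x: "x \<in> ccube R" for s x
  proof -
    have UL: "U \<in> L2 (cube R)" by (rule continuous_L2_cube[OF U])
    note kc = mk_continuous[of R s x] and km = mk_mass[OF R s(1,3) x]
    have i: "integrable ?L (\<lambda>t. mk R s x t *\<^sub>R U t)" by (rule L2_integrable_scaleR[OF UL kc])
    have i': "integrable ?L (\<lambda>t. mk R s x t *\<^sub>R U x)" using km(1) by simp
    have "mollify R s v x = (LINT t|?L. mk R s x t *\<^sub>R U t)"
      unfolding mollify_def
    proof (rule integral_cong_AE)
      show "(\<lambda>t. mk R s x t *\<^sub>R v t) \<in> borel_measurable ?L"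
        using L2_integrable_scaleR[OF v kc] by (rule borel_measurable_integrable)
      show "(\<lambda>t. mk R s x t *\<^sub>R U t) \<in> borel_measurable ?L"
        using i by (rule borel_measurable_integrable)
      show "AE t in ?L. mk R s x t *\<^sub>R v t = mk R s x t *\<^sub>R U t" using ae by eventually_elim simp
    qed
    then have "mollify R s v x - U x = (LINT t|?L. mk R s x t *\<^sub>R U t) - (LINT t|?L. mk R s x t *\<^sub>R U x)"
      using km by simp
    also have "\<dots> = (LINT t|?L. mk R s x t *\<^sub>R U t - mk R s x t *\<^sub>R U x)"
      by (rule Bochner_Integration.integral_diff[symmetric, OF i i'])
    also have "cmod \<dots> \<le> (LINT t|?L. mk R s x t * e)"
    proof (rule order_trans[OF integral_norm_bound integral_mono])
      show "integrable ?L (\<lambda>t. cmod (mk R s x t *\<^sub>R U t - mk R s x t *\<^sub>R U x))"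
        by (rule integrable_norm[OF Bochner_Integration.integrable_diff[OF i i']])
      show "integrable ?L (\<lambda>t. mk R s x t * e)" using km(1) by simp
      fix t assume "t \<in> space ?L"
      then have t: "t \<in> ccube R" using cube_subset_ccube by (auto simp: space_restrict_space)
      show "cmod (mk R s x t *\<^sub>R U t - mk R s x t *\<^sub>R U x) \<le> mk R s x t * e"
      proof (cases "mk R s x t = 0")
        case False
        have "\<bar>(t - x) $ i\<bar> \<le> s * (2 * R)" for i
        proof -
          have "\<bar>t $ i - (1 - s) * x $ i\<bar> \<le> s * (R / 2)" by (rule mk_zero[OF R s(1,3) x False])
          moreover have "\<bar>s * x $ i\<bar> \<le> s * R" using x s by (auto simp: abs_mult mem_ccube)
          moreover have "\<bar>(t - x) $ i\<bar> \<le> \<bar>t $ i - (1 - s) * x $ i\<bar> + \<bar>s * x $ i\<bar>"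
          proof -
            have "(t - x) $ i = (t $ i - (1 - s) * x $ i) - s * x $ i" by (simp add: algebra_simps)
            then show ?thesis using abs_triangle_ineq4 by metis
          qed
          moreover have "s * (R / 2) \<le> s * R" using s R by simp
          moreover have "s * (2 * R) = s * R + s * R" by simp
          ultimately show ?thesis by linarith
        qed
        then have "norm (t - x) \<le> 3 * (s * (2 * R))" by (rule norm_le_3)
        also have "\<dots> < \<delta>"
        proof -
          have "s * (7 * R) \<le> \<delta>" using s R by (simp add: pos_le_divide_eq)
          moreover have "s * R > 0" using s R by simp
          ultimately show ?thesis by simp
        qed
        finally have "dist (U t) (U x) < e" by (intro \<delta>(2) t x) (simp add: dist_norm)
        then have "cmod (U t - U x) \<le> e" by (simp add: dist_norm)
        then have "mk R s x t * cmod (U t - U x) \<le> mk R s x t * e"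
          using mk_nonneg[OF R s(1)] by (intro mult_left_mono)
        moreover have "cmod (mk R s x t *\<^sub>R U t - mk R s x t *\<^sub>R U x) = mk R s x t * cmod (U t - U x)"
          using mk_nonneg[OF R s(1), of x t] by (simp add: scaleR_diff_right[symmetric])
        ultimately show ?thesis by simp
      qed simp
    qed
    also have "(LINT t|?L. mk R s x t * e) = e" using km by simp
    finally show ?thesis .
  qed
  then show ?thesis using that[of "\<delta> / (7 * R)"] \<delta>(1) R by simp
qed

lemma mollify_eq_mjet:
  assumes "R > 0" "0 < s" "s \<le> 1" "v \<in> L2 (cube R)" "x \<in> ccube R"
  shows "mollify R s v x = mjet R s v 0 x"
proof -
  have "has_weak_deriv (cube R) 0 v v"
    using assms by (simp add: has_weak_deriv_def L2_locally_integrable)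
  from mjet_eq_mollify[OF assms(1-3,5) this] show ?thesis by simp
qed

lemma mjet_Cinf: "u \<in> L2 (cube R) \<Longrightarrow> Cinf (mjet R s u \<beta>)"
  and mjet_dir: "u \<in> L2 (cube R) \<Longrightarrow> dir i (mjet R s u \<beta>) = mjet R s u (\<beta> + axis i 1)"
  by (rule Cinf_jet[of "mjet R s u"], rule mjet_has_derivative, assumption)+

lemma mollify_L2:
  assumes "R > 0" "0 < s" "s \<le> 1" "v \<in> L2 (cube R)"
  shows "mollify R s v \<in> L2 (cube R)"
  using Cinf_L2[OF mjet_Cinf[OF assms(4), of s 0]] mollify_eq_mjet[OF assms] cube_subset_ccube
  by (subst L2_cong[where v = "mjet R s v 0"]) auto

lemma mollify_diff:
  assumes "v \<in> L2 (cube R)" "w \<in> L2 (cube R)"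
  shows "mollify R s (\<lambda>x. v x - w x) x = mollify R s v x - mollify R s w x"
  unfolding mollify_def scaleR_diff_right
  by (intro Bochner_Integration.integral_diff L2_integrable_scaleR assms mk_continuous)

definition mscale :: "nat \<Rightarrow> real" where "mscale n = 1 / (real n + 2)"

lemma mscale: "0 < mscale n" "mscale n \<le> 1 / 2" "mscale n \<le> 1" "mscale \<longlonglongrightarrow> 0"
proof -
  show "0 < mscale n" "mscale n \<le> 1 / 2" "mscale n \<le> 1" by (auto simp: mscale_def field_simps)
  have "(\<lambda>n. inverse (real (Suc (Suc n)))) \<longlonglongrightarrow> 0" by (rule LIMSEQ_Suc[OF LIMSEQ_inverse_real_of_nat])
  moreover have "mscale = (\<lambda>n. inverse (real (Suc (Suc n))))" by (auto simp: mscale_def field_simps)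
  ultimately show "mscale \<longlonglongrightarrow> 0" by simp
qed

lemma mollify_uniform_limit:
  assumes R: "R > 0" and v: "v \<in> L2 (cube R)" and U: "continuous_on (ccube R) U"
    and ae: "AE x in lebesgue_on (cube R). U x = v x"
  shows "uniform_limit (ccube R) (\<lambda>n. mollify R (mscale n) v) U sequentially"
proof (rule uniform_limitI)
  fix e :: real assume e: "e > 0"
  then have e2: "e / 2 > 0" by simp
  obtain s0 where s0: "s0 > 0"
    "\<And>s x. 0 < s \<Longrightarrow> s \<le> s0 \<Longrightarrow> s \<le> 1 \<Longrightarrow> x \<in> ccube R \<Longrightarrow> cmod (mollify R s v x - U x) \<le> e / 2"
    using mollify_uniform[OF R v U ae e2] by blast
  have "eventually (\<lambda>n. mscale n < s0) sequentially" by (rule order_tendstoD(2)[OF mscale(4) s0(1)])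
  then show "\<forall>\<^sub>F n in sequentially. \<forall>x\<in>ccube R. dist (mollify R (mscale n) v x) (U x) < e"
  proof eventually_elim
    fix n assume n: "mscale n < s0"
    show "\<forall>x\<in>ccube R. dist (mollify R (mscale n) v x) (U x) < e"
    proof
      fix x assume x: "x \<in> ccube R"
      have "cmod (mollify R (mscale n) v x - U x) \<le> e / 2"
        by (rule s0(2)[OF mscale(1) _ mscale(3) x]) (use n in simp)
      then show "dist (mollify R (mscale n) v x) (U x) < e" using e by (simp add: dist_norm)
    qed
  qed
qed

lemma L2_norm_cube_le:
  assumes f: "f \<in> L2 (cube R)" and b: "\<And>x. x \<in> cube R \<Longrightarrow> cmod (f x) \<le> b"
  shows "L2_norm (cube R) f \<le> b * L2_norm (cube R) (\<lambda>x. 1)"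
proof -
  have o: "(\<lambda>x. 1) \<in> L2 (cube R)" by (rule continuous_L2_cube) simp
  have b0: "cube R = {} \<or> b \<ge> 0"
  proof (cases "cube R = {}")
    case False
    then obtain x where "x \<in> cube R" by blast
    from b[OF this] show ?thesis using norm_ge_zero[of "f x"] by linarith
  qed simp
  show ?thesis
  proof (cases "cube R = {}")
    case True
    then have "L2_norm (cube R) g = 0" for g
      by (simp add: L2_norm_def integral_restrict_space)
    then show ?thesis by simp
  next
    case False
    then have "b \<ge> 0" using b0 by simp
    have "L2_norm (cube R) f \<le> L2_norm (cube R) (\<lambda>x. b *\<^sub>R 1)"
    proof (rule L2_norm_mono_AE[OF L2_measurable[OF f] L2_scaleR[OF o]])
      show "AE x in lebesgue_on (cube R). cmod (f x) \<le> cmod (b *\<^sub>R 1)"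
      proof (rule AE_I2)
        fix x assume "x \<in> space (lebesgue_on (cube R))"
        then have "x \<in> cube R" by (simp add: space_restrict_space)
        from b[OF this] show "cmod (f x) \<le> cmod (b *\<^sub>R 1)" by simp
      qed
    qed
    also have "\<dots> = b * L2_norm (cube R) (\<lambda>x. 1)" using \<open>b \<ge> 0\<close> by (simp only: L2_norm_scaleR abs_of_nonneg)
    finally show ?thesis .
  qed
qed

text \<open>By density of the continuous functions, for which the convergence is uniform.\<close>

lemma mollify_L2_tendsto:
  assumes R: "R > 0" and v: "v \<in> L2 (cube R)"
  shows "L2_tendsto (cube R) (\<lambda>n. mollify R (mscale n) v) v"
  unfolding L2_tendsto_def
proof (intro conjI allI v mollify_L2[OF R mscale(1) mscale(3) v])
  show "(\<lambda>n. L2_norm (cube R) (\<lambda>x. mollify R (mscale n) v x - v x)) \<longlonglongrightarrow> 0"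
  proof (rule LIMSEQ_I)
    fix e :: real assume e: "e > 0"
    define c where "c = L2_norm (cube R) (\<lambda>x. 1)"
    have c: "c \<ge> 0" by (simp add: c_def L2_norm_nonneg)
    obtain g where g: "continuous_on UNIV g" "L2_norm (cube R) (\<lambda>x. v x - g x) < e / 8"
      using L2_dense_continuous[OF v, of "e / 8"] e by auto
    have gc: "continuous_on (ccube R) g" using g(1) continuous_on_subset by blast
    have gL: "g \<in> L2 (cube R)" by (rule continuous_L2_cube[OF gc])
    have "uniform_limit (ccube R) (\<lambda>n. mollify R (mscale n) g) g sequentially"
      by (rule mollify_uniform_limit[OF R gL gc]) simp
    then have "\<forall>\<^sub>F n in sequentially. \<forall>x\<in>ccube R. dist (mollify R (mscale n) g x) (g x) < e / (4 * (c + 1))"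
      using e c by (intro uniform_limitD) auto
    then obtain n0 where n0: "\<And>n x. n \<ge> n0 \<Longrightarrow> x \<in> ccube R \<Longrightarrow> dist (mollify R (mscale n) g x) (g x) < e / (4 * (c + 1))"
      unfolding eventually_sequentially by blast
    have "norm (L2_norm (cube R) (\<lambda>x. mollify R (mscale n) v x - v x) - 0) < e" if n: "n \<ge> n0" for n
    proof -
      let ?M = "mollify R (mscale n)"
      have vg: "(\<lambda>x. v x - g x) \<in> L2 (cube R)" by (rule L2_diff[OF v gL])
      note mo = mollify_L2[OF R mscale(1)[of n] mscale(3)[of n]]
      have "L2_norm (cube R) (\<lambda>x. ?M v x - v x)
          = L2_norm (cube R) (\<lambda>x. ?M (\<lambda>x. v x - g x) x + ((?M g x - g x) + (g x - v x)))"
        by (rule L2_norm_cong) (simp add: mollify_diff[OF v gL])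
      also have "\<dots> \<le> L2_norm (cube R) (?M (\<lambda>x. v x - g x)) + L2_norm (cube R) (\<lambda>x. (?M g x - g x) + (g x - v x))"
        by (intro L2_norm_triangle L2_add L2_diff mo v gL)
      also have "L2_norm (cube R) (\<lambda>x. (?M g x - g x) + (g x - v x))
          \<le> L2_norm (cube R) (\<lambda>x. ?M g x - g x) + L2_norm (cube R) (\<lambda>x. g x - v x)"
        by (intro L2_norm_triangle L2_diff mo v gL)
      also have "L2_norm (cube R) (\<lambda>x. g x - v x) = L2_norm (cube R) (\<lambda>x. v x - g x)"
        by (rule L2_norm_minus_commute)
      also have "L2_norm (cube R) (?M (\<lambda>x. v x - g x)) \<le> 3 * L2_norm (cube R) (\<lambda>x. v x - g x)"
        by (rule mollify_L2_bound[OF R mscale(1,2) vg mo[OF vg]])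
      also have "L2_norm (cube R) (\<lambda>x. ?M g x - g x) \<le> e / (4 * (c + 1)) * c"
        unfolding c_def
      proof (rule L2_norm_cube_le)
        show "(\<lambda>x. ?M g x - g x) \<in> L2 (cube R)" by (intro L2_diff mo gL)
        show "cmod (?M g x - g x) \<le> e / (4 * (L2_norm (cube R) (\<lambda>x. 1) + 1))" if "x \<in> cube R" for x
          using n0[OF n, of x] that cube_subset_ccube[of R] by (auto simp: dist_norm c_def)
      qed
      also have "e / (4 * (c + 1)) * c \<le> e / 4"
      proof -
        have "e / (4 * (c + 1)) * c = e / 4 * (c / (c + 1))" by simp
        also have "\<dots> \<le> e / 4 * 1" using e c by (intro mult_left_mono) auto
        finally show ?thesis by simp
      qed
      finally show ?thesis using g(2) L2_norm_nonneg[of "cube R" "\<lambda>x. ?M v x - v x"] by simp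
    qed
    then show "\<exists>no. \<forall>n\<ge>no. norm (L2_norm (cube R) (\<lambda>x. mollify R (mscale n) v x - v x) - 0) < e" by blast
  qed
qed

text \<open>The averages of \<open>u\<close> with scales tending to \<open>0\<close>: their derivatives are averages of the weak
  derivatives, up to factors that tend to \<open>1\<close>.  The uniform convergence to a continuous
  representative makes its boundary values visible in the approximations.\<close>

theorem Sobolev_approximation:
  assumes R: "R > 0" and u: "u \<in> Sobolev s (cube R)"
  obtains g :: "nat \<Rightarrow> nat^3 \<Rightarrow> real^3 \<Rightarrow> complex" where
    "\<And>n \<beta>. Cinf (g n \<beta>)" "\<And>n \<beta> i. dir i (g n \<beta>) = g n (\<beta> + axis i 1)"
    "\<And>\<beta>. morder \<beta> \<le> s \<Longrightarrow> L2_tendsto (cube R) (\<lambda>n. g n \<beta>) (weak_deriv (cube R) \<beta> u)"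
    "\<And>\<beta> U. morder \<beta> \<le> s \<Longrightarrow> continuous_on (ccube R) U \<Longrightarrow>
       AE x in lebesgue_on (cube R). U x = weak_deriv (cube R) \<beta> u x \<Longrightarrow>
       uniform_limit (ccube R) (\<lambda>n. g n \<beta>) U sequentially"
proof -
  let ?g = "\<lambda>n. mjet R (mscale n) u"
  note uL = Sobolev_L2[OF u]
  have 1: "Cinf (?g n \<beta>)" for n \<beta> by (rule mjet_Cinf[OF uL])
  have 2: "dir i (?g n \<beta>) = ?g n (\<beta> + axis i 1)" for n \<beta> i by (rule mjet_dir[OF uL])
  have 3: "L2_tendsto (cube R) (\<lambda>n. ?g n \<beta>) (weak_deriv (cube R) \<beta> u)"
    and 4: "\<And>U. continuous_on (ccube R) U \<Longrightarrow>
       AE x in lebesgue_on (cube R). U x = weak_deriv (cube R) \<beta> u x \<Longrightarrow>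
       uniform_limit (ccube R) (\<lambda>n. ?g n \<beta>) U sequentially" if \<beta>: "morder \<beta> \<le> s" for \<beta>
  proof -
  define v where "v = weak_deriv (cube R) \<beta> u"
  have vL: "v \<in> L2 (cube R)" and vw: "has_weak_deriv (cube R) \<beta> u v"
    unfolding v_def by (rule Sobolev_weak_deriv[OF R u \<beta>])+
  define c where "c = (\<lambda>n. (1 - mscale n) ^ morder \<beta>)"
  have ge: "?g n \<beta> x = c n *\<^sub>R mollify R (mscale n) v x" if "x \<in> ccube R" for n x
    unfolding c_def by (rule mjet_eq_mollify[OF R mscale(1) mscale(3) that vw])
  have "c \<longlonglongrightarrow> (1 - 0) ^ morder \<beta>" unfolding c_def by (intro tendsto_intros mscale(4))
  then have c1: "c \<longlonglongrightarrow> 1" by simp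
  show "L2_tendsto (cube R) (\<lambda>n. ?g n \<beta>) (weak_deriv (cube R) \<beta> u)"
    unfolding L2_tendsto_def v_def[symmetric]
  proof (intro conjI allI)
    show "v \<in> L2 (cube R)" by (rule vL)
    show "?g n \<beta> \<in> L2 (cube R)" for n by (rule Cinf_L2[OF 1])
    have mo: "mollify R (mscale n) v \<in> L2 (cube R)" for n by (rule mollify_L2[OF R mscale(1) mscale(3) vL])
    have "\<bar>L2_norm (cube R) (\<lambda>x. ?g n \<beta> x - v x)\<bar>
        \<le> \<bar>c n\<bar> * L2_norm (cube R) (\<lambda>x. mollify R (mscale n) v x - v x) + \<bar>c n - 1\<bar> * L2_norm (cube R) v" for n
    proof -
      have "L2_norm (cube R) (\<lambda>x. ?g n \<beta> x - v x)
          = L2_norm (cube R) (\<lambda>x. c n *\<^sub>R (mollify R (mscale n) v x - v x) + (c n - 1) *\<^sub>R v x)"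
        by (rule L2_norm_cong) (use ge cube_subset_ccube[of R] in \<open>auto simp: algebra_simps\<close>)
      also have "\<dots> \<le> L2_norm (cube R) (\<lambda>x. c n *\<^sub>R (mollify R (mscale n) v x - v x)) + L2_norm (cube R) (\<lambda>x. (c n - 1) *\<^sub>R v x)"
        by (intro L2_norm_triangle L2_scaleR L2_diff mo vL)
      finally show ?thesis by (simp only: L2_norm_scaleR abs_of_nonneg[OF L2_norm_nonneg])
    qed
    moreover have "(\<lambda>n. \<bar>c n\<bar> * L2_norm (cube R) (\<lambda>x. mollify R (mscale n) v x - v x) + \<bar>c n - 1\<bar> * L2_norm (cube R) v)
        \<longlonglongrightarrow> 0"
    proof -
      have l: "(\<lambda>n. L2_norm (cube R) (\<lambda>x. mollify R (mscale n) v x - v x)) \<longlonglongrightarrow> 0"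
        using mollify_L2_tendsto[OF R vL] by (simp add: L2_tendsto_def)
      have "(\<lambda>n. \<bar>c n\<bar> * L2_norm (cube R) (\<lambda>x. mollify R (mscale n) v x - v x) + \<bar>c n - 1\<bar> * L2_norm (cube R) v)
        \<longlonglongrightarrow> \<bar>1\<bar> * 0 + \<bar>1 - 1\<bar> * L2_norm (cube R) v"
        by (rule tendsto_add[OF tendsto_mult[OF tendsto_rabs[OF c1] l]
          tendsto_mult[OF tendsto_rabs[OF tendsto_diff[OF c1 tendsto_const]] tendsto_const]])
      then show ?thesis by simp
    qed
    ultimately show "(\<lambda>n. L2_norm (cube R) (\<lambda>x. ?g n \<beta> x - v x)) \<longlonglongrightarrow> 0"
      by (rule real_tendsto_0_bound)
  qed
  fix U assume U: "continuous_on (ccube R) U" "AE x in lebesgue_on (cube R). U x = weak_deriv (cube R) \<beta> u x"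
  have "uniform_limit (ccube R) (\<lambda>n. mollify R (mscale n) v) U sequentially"
    by (rule mollify_uniform_limit[OF R vL U(1)]) (use U(2) in \<open>simp add: v_def\<close>)
  moreover have "bounded (U ` ccube R)" by (intro compact_imp_bounded compact_continuous_image U compact_cbox)
  moreover have "bounded ((\<lambda>x. 1 :: real) ` ccube R)" by (auto simp: bounded_iff)
  moreover have "uniform_limit (ccube R) (\<lambda>n x. c n) (\<lambda>x. 1) sequentially"
    using c1 by (auto simp: uniform_limit_iff tendsto_iff elim!: eventually_mono)
  ultimately have "uniform_limit (ccube R) (\<lambda>n x. c n *\<^sub>R mollify R (mscale n) v x) (\<lambda>x. 1 *\<^sub>R U x) sequentially"
    by (intro bounded_bilinear.bounded_uniform_limit[OF bounded_bilinear_scaleR]) auto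
  then show "uniform_limit (ccube R) (\<lambda>n. ?g n \<beta>) U sequentially"
    by (subst uniform_limit_cong'[where g = "\<lambda>n x. c n *\<^sub>R mollify R (mscale n) v x" and i = "\<lambda>x. 1 *\<^sub>R U x"])
      (auto simp: ge)
  qed
  show thesis
  proof (rule that[of ?g])
    show "Cinf (?g n \<beta>)" for n \<beta> by (rule 1)
    show "dir i (?g n \<beta>) = ?g n (\<beta> + axis i 1)" for n \<beta> i by (rule 2)
    show "L2_tendsto (cube R) (\<lambda>n. ?g n \<beta>) (weak_deriv (cube R) \<beta> u)" if "morder \<beta> \<le> s" for \<beta>
      using that by (rule 3)
    show "uniform_limit (ccube R) (\<lambda>n. ?g n \<beta>) U sequentially"
      if "morder \<beta> \<le> s" "continuous_on (ccube R) U" "AE x in lebesgue_on (cube R). U x = weak_deriv (cube R) \<beta> u x" for \<beta> U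
      using that by (rule 4)
  qed
qed

section \<open>Vanishing boundary values and integration by parts\<close>

text \<open>Symmetry of second derivatives: the integral of \<open>\<partial>\<^sub>i \<partial>\<^sub>j f\<close> along a segment in direction \<open>j\<close> is computed
  by differentiating under the integral sign, and the result is differentiated in the length of the
  segment.\<close>

lemma dir_commute:
  fixes f :: "real^3 \<Rightarrow> 'b::euclidean_space"
  assumes f: "Cinf f"
  shows "dir i (dir j f) = dir j (dir i f)"
proof
  fix x
  define u where "u = (axis i 1 :: real^3)"
  define v where "v = (axis j 1 :: real^3)"
  have D: "Cinf g \<Longrightarrow> ((\<lambda>t. g (y + t *\<^sub>R axis k 1)) has_vector_derivative dir k g (y + t *\<^sub>R axis k 1)) (at t within S)"
    for g :: "real^3 \<Rightarrow> 'b" and y k t S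
    by (rule has_vector_derivative_at_within[OF dir_has_vector_derivative[OF Cinf_differentiable]])
  have C: "Cinf g \<Longrightarrow> continuous_on S (\<lambda>t. g (y + t *\<^sub>R v))" for g :: "real^3 \<Rightarrow> 'b" and y S
    by (rule continuous_on_compose2[OF Cinf_continuous[of g UNIV]])
      (auto intro!: continuous_on_add continuous_on_scaleR continuous_on_const continuous_on_id)
  have main: "integral {0..t} (\<lambda>\<tau>. dir i (dir j f) (x + \<tau> *\<^sub>R v)) = dir i f (x + t *\<^sub>R v) - dir i f x"
    if t: "t \<in> {0..1}" for t
  proof -
    have F: "integral {0..t} (\<lambda>\<tau>. dir j f (x + s *\<^sub>R u + \<tau> *\<^sub>R v)) = f (x + s *\<^sub>R u + t *\<^sub>R v) - f (x + s *\<^sub>R u)" for s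
    proof -
      have "((\<lambda>\<tau>. dir j f (x + s *\<^sub>R u + \<tau> *\<^sub>R v)) has_integral
          f (x + s *\<^sub>R u + t *\<^sub>R v) - f (x + s *\<^sub>R u + 0 *\<^sub>R v)) {0..t}"
        using t unfolding v_def by (intro fundamental_theorem_of_calculus D f) auto
      then show ?thesis by (simp add: integral_unique)
    qed
    have "((\<lambda>s. integral (cbox 0 t) (\<lambda>\<tau>. dir j f (x + s *\<^sub>R u + \<tau> *\<^sub>R v))) has_vector_derivative
        integral (cbox 0 t) (\<lambda>\<tau>. dir i (dir j f) (x + 0 *\<^sub>R u + \<tau> *\<^sub>R v))) (at 0 within UNIV)"
    proof (rule leibniz_rule_vector_derivative)
      show "((\<lambda>s. dir j f (x + s *\<^sub>R u + \<tau> *\<^sub>R v)) has_vector_derivative dir i (dir j f) (x + s *\<^sub>R u + \<tau> *\<^sub>R v)) (at s within UNIV)" for s \<tau>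
        using D[OF Cinf_dir[OF f], of j "x + \<tau> *\<^sub>R v" i s UNIV] by (simp add: u_def add_ac)
      show "(\<lambda>\<tau>. dir j f (x + s *\<^sub>R u + \<tau> *\<^sub>R v)) integrable_on cbox 0 t" for s
        by (intro integrable_continuous C Cinf_dir f)
      show "continuous_on (UNIV \<times> cbox 0 t) (\<lambda>(s, \<tau>). dir i (dir j f) (x + s *\<^sub>R u + \<tau> *\<^sub>R v))"
        unfolding split_def
        by (rule continuous_on_compose2[OF Cinf_continuous[OF Cinf_dir[OF Cinf_dir[OF f]], of UNIV]])
          (auto intro!: continuous_intros)
    qed auto
    then have 1: "((\<lambda>s. f (x + s *\<^sub>R u + t *\<^sub>R v) - f (x + s *\<^sub>R u)) has_vector_derivative
        integral {0..t} (\<lambda>\<tau>. dir i (dir j f) (x + \<tau> *\<^sub>R v))) (at 0)"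
      by (simp add: F)
    have 2: "((\<lambda>s. f (x + s *\<^sub>R u + t *\<^sub>R v) - f (x + s *\<^sub>R u)) has_vector_derivative
        dir i f (x + t *\<^sub>R v) - dir i f x) (at 0)"
      using has_vector_derivative_diff[OF D[OF f, of "x + t *\<^sub>R v" i 0 UNIV] D[OF f, of x i 0 UNIV]]
      by (simp add: u_def add_ac)
    show ?thesis by (rule vector_derivative_unique_at[OF 1 2])
  qed
  have "((\<lambda>t. integral {0..t} (\<lambda>\<tau>. dir i (dir j f) (x + \<tau> *\<^sub>R v))) has_vector_derivative
      dir i (dir j f) (x + 0 *\<^sub>R v)) (at 0 within {0..1})"
    by (rule integral_has_vector_derivative) (auto intro: C Cinf_dir f)
  then have 1: "((\<lambda>t. dir i f (x + t *\<^sub>R v) - dir i f x) has_vector_derivative dir i (dir j f) x) (at 0 within {0..1})"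
    by (intro has_vector_derivative_transform[of 0 "{0..1}" "\<lambda>t. dir i f (x + t *\<^sub>R v) - dir i f x"]) (auto simp: main)
  have 2: "((\<lambda>t. dir i f (x + t *\<^sub>R v) - dir i f x) has_vector_derivative dir j (dir i f) x) (at 0 within {0..1})"
    using has_vector_derivative_diff[OF D[OF Cinf_dir[OF f], of i x j 0 "{0..1}"] has_vector_derivative_const]
    by (simp add: v_def)
  show "dir i (dir j f) x = dir j (dir i f) x"
    by (rule vector_derivative_unique_within[OF _ 1 2]) (simp add: trivial_limit_within)
qed

abbreviation cint :: "real \<Rightarrow> (real^3 \<Rightarrow> real) \<Rightarrow> real" where
  "cint R f \<equiv> integral\<^sup>L (lebesgue_on (cube R)) f"

lemma dir_inner:
  fixes f g :: "real^3 \<Rightarrow> complex"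
  assumes "Cinf f" "Cinf g"
  shows "dir i (\<lambda>x. f x \<bullet> g x) x = f x \<bullet> dir i g x + dir i f x \<bullet> g x"
  by (rule dir_bilinear[OF bounded_bilinear_inner Cinf_differentiable[OF assms(1)] Cinf_differentiable[OF assms(2)]])

lemma dir_scaleR:
  fixes f :: "real^3 \<Rightarrow> real" and g :: "real^3 \<Rightarrow> complex"
  assumes "Cinf f" "Cinf g"
  shows "dir i (\<lambda>x. f x *\<^sub>R g x) x = f x *\<^sub>R dir i g x + dir i f x *\<^sub>R g x"
  by (rule dir_bilinear[OF bounded_bilinear_scaleR Cinf_differentiable[OF assms(1)] Cinf_differentiable[OF assms(2)]])

lemma integral_dir_abs_le:
  fixes F :: "real^3 \<Rightarrow> real"
  assumes R: "R > 0" and F: "Cinf F" and face: "\<And>x. x \<in> ccube R \<Longrightarrow> \<bar>x $ i\<bar> = R \<Longrightarrow> \<bar>F x\<bar> \<le> e"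
  shows "\<bar>cint R (dir i F)\<bar> \<le> 8 * R\<^sup>2 * e"
proof -
  have b: "cint R (dir i G) \<ge> - (8 * R\<^sup>2 * e)"
    if G: "Cinf G" and Ge: "\<And>x. \<bar>G x\<bar> = \<bar>F x\<bar>" for G :: "real^3 \<Rightarrow> real"
  proof (rule integral_dir_ge[OF R Cinf_differentiable[OF G] Cinf_continuous[OF Cinf_dir[OF G]]])
    show "- e \<le> G x" if "x \<in> ccube R" "x $ i = R" for x using face[of x] Ge[of x] that R by simp
    show "G x \<le> e" if "x \<in> ccube R" "x $ i = - R" for x using face[of x] Ge[of x] that R by simp
  qed
  have d: "dir i (\<lambda>x. - F x) = (\<lambda>x. - dir i F x)"
  proof
    fix x
    have "dir i (\<lambda>x. (- 1) * F x) x = (- 1) * dir i F x + dir i (\<lambda>x. - 1) x * F x"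
      by (rule dir_bilinear[OF bounded_bilinear_mult]) (auto intro: Cinf_differentiable F)
    then show "dir i (\<lambda>x. - F x) x = - dir i F x" by (simp add: dir_const)
  qed
  show ?thesis using b[OF F] b[OF Cinf_uminus[OF F]] by (simp add: d abs_le_iff)
qed

lemma L2_tendsto_Cinf_mult:
  fixes \<eta> :: "real^3 \<Rightarrow> real"
  assumes "Cinf \<eta>" "L2_tendsto (cube R) u v"
  shows "L2_tendsto (cube R) (\<lambda>n x. \<eta> x *\<^sub>R u n x) (\<lambda>x. \<eta> x *\<^sub>R v x)"
proof -
  obtain B where "\<And>x. x \<in> cube R \<Longrightarrow> \<bar>\<eta> x\<bar> \<le> B" using Cinf_bounded_cube[OF assms(1)] by blast
  from L2_tendsto_mult_bounded[OF assms(2) Cinf_measurable_cube[OF assms(1)] this] show ?thesis .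
qed

lemma L2_Cinf_mult:
  fixes \<eta> :: "real^3 \<Rightarrow> real"
  assumes "Cinf \<eta>" "u \<in> L2 (cube R)" shows "(\<lambda>x. \<eta> x *\<^sub>R u x) \<in> L2 (cube R)"
  using L2_tendsto_L2(2)[OF L2_tendsto_Cinf_mult[OF assms(1) L2_tendsto_const[OF assms(2)]]] .

text \<open>\<open>trace0 R i u u\<^sub>i\<close> says, without speaking of traces, that \<open>u\<close> with weak derivative \<open>u\<^sub>i\<close> has
  vanishing boundary values on the two faces orthogonal to direction \<open>i\<close>: integration by parts in
  direction \<open>i\<close> against functions smooth up to the boundary leaves no boundary term.\<close>

definition trace0 :: "real \<Rightarrow> 3 \<Rightarrow> (real^3 \<Rightarrow> complex) \<Rightarrow> (real^3 \<Rightarrow> complex) \<Rightarrow> bool" where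
  "trace0 R i u u' \<longleftrightarrow> u \<in> L2 (cube R) \<and> u' \<in> L2 (cube R) \<and>
     (\<forall>b. Cinf b \<longrightarrow> cint R (\<lambda>x. u' x \<bullet> b x) + cint R (\<lambda>x. u x \<bullet> dir i b x) = 0)"

lemma trace0_integration_by_parts:
  fixes \<eta> :: "real^3 \<Rightarrow> real"
  assumes T: "trace0 R i u u'" and b: "\<And>n. Cinf (b n)"
    and l: "L2_tendsto (cube R) b v" "L2_tendsto (cube R) (\<lambda>n. dir i (b n)) v'" and \<eta>: "Cinf \<eta>"
  shows "cint R (\<lambda>x. \<eta> x * (u' x \<bullet> v x)) = - cint R (\<lambda>x. \<eta> x * (u x \<bullet> v' x)) - cint R (\<lambda>x. dir i \<eta> x * (u x \<bullet> v x))"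
proof -
  have uL: "u \<in> L2 (cube R)" "u' \<in> L2 (cube R)" using T by (auto simp: trace0_def)
  define c where "c = (\<lambda>n x. \<eta> x *\<^sub>R b n x)"
  have cc: "Cinf (c n)" for n unfolding c_def by (intro Cinf_scaleR \<eta> b)
  have dc: "dir i (c n) = (\<lambda>x. \<eta> x *\<^sub>R dir i (b n) x + dir i \<eta> x *\<^sub>R b n x)" for n
    unfolding c_def by (intro ext dir_scaleR \<eta> b)
  have l1: "L2_tendsto (cube R) c (\<lambda>x. \<eta> x *\<^sub>R v x)"
    unfolding c_def by (rule L2_tendsto_Cinf_mult[OF \<eta> l(1)])
  have l2: "L2_tendsto (cube R) (\<lambda>n. dir i (c n)) (\<lambda>x. \<eta> x *\<^sub>R v' x + dir i \<eta> x *\<^sub>R v x)"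
    unfolding dc by (rule L2_tendsto_add[OF L2_tendsto_Cinf_mult[OF \<eta> l(2)] L2_tendsto_Cinf_mult[OF Cinf_dir[OF \<eta>] l(1)]])
  have "(\<lambda>n. cint R (\<lambda>x. u' x \<bullet> c n x) + cint R (\<lambda>x. u x \<bullet> dir i (c n) x)) \<longlonglongrightarrow>
      cint R (\<lambda>x. u' x \<bullet> (\<eta> x *\<^sub>R v x)) + cint R (\<lambda>x. u x \<bullet> (\<eta> x *\<^sub>R v' x + dir i \<eta> x *\<^sub>R v x))"
    by (rule tendsto_add[OF L2_tendsto_inner[OF L2_tendsto_const[OF uL(2)] l1] L2_tendsto_inner[OF L2_tendsto_const[OF uL(1)] l2]])
  moreover have "cint R (\<lambda>x. u' x \<bullet> c n x) + cint R (\<lambda>x. u x \<bullet> dir i (c n) x) = 0" for n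
    using T cc by (simp add: trace0_def)
  ultimately have "cint R (\<lambda>x. u' x \<bullet> (\<eta> x *\<^sub>R v x)) + cint R (\<lambda>x. u x \<bullet> (\<eta> x *\<^sub>R v' x + dir i \<eta> x *\<^sub>R v x)) = 0"
    by (simp add: LIMSEQ_const_iff)
  moreover have "cint R (\<lambda>x. u x \<bullet> (\<eta> x *\<^sub>R v' x + dir i \<eta> x *\<^sub>R v x))
      = cint R (\<lambda>x. u x \<bullet> (\<eta> x *\<^sub>R v' x)) + cint R (\<lambda>x. u x \<bullet> (dir i \<eta> x *\<^sub>R v x))"
    unfolding inner_add_right
    by (intro Bochner_Integration.integral_add L2_inner_integrable uL L2_Cinf_mult[OF \<eta>] L2_Cinf_mult[OF Cinf_dir[OF \<eta>]]
        L2_tendsto_L2(2)[OF l(1)] L2_tendsto_L2(2)[OF l(2)])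
  ultimately show ?thesis by simp
qed

lemma morder_axis [simp]: "morder (\<beta> + axis i 1) = Suc (morder \<beta>)"
  unfolding morder_def by (simp add: sum.distrib axis_def)

lemma morder_axis_Suc [simp]: "morder (\<beta> + axis i (Suc 0)) = Suc (morder \<beta>)"
  using morder_axis[of \<beta> i] by simp

text \<open>\<open>W \<beta>\<close> are the weak derivatives up to order three of a function on the cube, and \<open>G n\<close> are the jets
  of smooth functions that converge to it in mean square together with these derivatives.\<close>

locale H3_jet =
  fixes R :: real and W :: "nat^3 \<Rightarrow> real^3 \<Rightarrow> complex" and G :: "nat \<Rightarrow> nat^3 \<Rightarrow> real^3 \<Rightarrow> complex"
  assumes R: "R > 0" and G: "\<And>n \<beta>. Cinf (G n \<beta>)" and G_dir: "\<And>n \<beta> i. dir i (G n \<beta>) = G n (\<beta> + axis i 1)"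
    and G_lim: "\<And>\<beta>. morder \<beta> \<le> 3 \<Longrightarrow> L2_tendsto (cube R) (\<lambda>n. G n \<beta>) (W \<beta>)"
begin

lemma W_L2: "morder \<beta> \<le> 3 \<Longrightarrow> W \<beta> \<in> L2 (cube R)"
  by (rule L2_tendsto_L2(2)[OF G_lim])

lemma W_integrable: "morder \<beta> \<le> 3 \<Longrightarrow> morder \<gamma> \<le> 3 \<Longrightarrow> Cinf \<eta> \<Longrightarrow>
  integrable (lebesgue_on (cube R)) (\<lambda>x. \<eta> x * (W \<beta> x \<bullet> W \<gamma> x))"
  using L2_inner_integrable[OF L2_Cinf_mult[OF _ W_L2] W_L2, of \<eta> \<beta> \<gamma>] by simp

lemma by_parts:
  assumes "trace0 R i (W \<beta>) (W (\<beta> + axis i 1))" "morder \<gamma> \<le> 2" "Cinf \<eta>"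
  shows "cint R (\<lambda>x. \<eta> x * (W (\<beta> + axis i 1) x \<bullet> W \<gamma> x))
    = - cint R (\<lambda>x. \<eta> x * (W \<beta> x \<bullet> W (\<gamma> + axis i 1) x)) - cint R (\<lambda>x. dir i \<eta> x * (W \<beta> x \<bullet> W \<gamma> x))"
proof (rule trace0_integration_by_parts[OF assms(1) G[of _ \<gamma>] G_lim _ assms(3)])
  show "morder \<gamma> \<le> 3" using assms(2) by simp
  show "L2_tendsto (cube R) (\<lambda>n. dir i (G n \<gamma>)) (W (\<gamma> + axis i 1))"
    unfolding G_dir by (rule G_lim) (use assms(2) in simp)
qed

text \<open>The boundary term of the smooth approximations has a limit, given by the weak derivatives.\<close>

lemma pairing_limit:
  assumes "morder \<gamma> \<le> 2" "Cinf b"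
  shows "(\<lambda>n. cint R (dir i (\<lambda>x. G n \<gamma> x \<bullet> b x)))
    \<longlonglongrightarrow> cint R (\<lambda>x. W (\<gamma> + axis i 1) x \<bullet> b x) + cint R (\<lambda>x. W \<gamma> x \<bullet> dir i b x)"
proof -
  have L: "L2_tendsto (cube R) (\<lambda>n. b) b" "L2_tendsto (cube R) (\<lambda>n. dir i b) (dir i b)"
    by (intro L2_tendsto_const Cinf_L2 Cinf_dir assms)+
  have g: "L2_tendsto (cube R) (\<lambda>n. G n \<gamma>) (W \<gamma>)" "L2_tendsto (cube R) (\<lambda>n. G n (\<gamma> + axis i 1)) (W (\<gamma> + axis i 1))"
    by (rule G_lim, use assms in simp)+
  have "cint R (dir i (\<lambda>x. G n \<gamma> x \<bullet> b x)) = cint R (\<lambda>x. G n (\<gamma> + axis i 1) x \<bullet> b x) + cint R (\<lambda>x. G n \<gamma> x \<bullet> dir i b x)" for n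
  proof -
    have "dir i (\<lambda>x. G n \<gamma> x \<bullet> b x) = (\<lambda>x. G n (\<gamma> + axis i 1) x \<bullet> b x + G n \<gamma> x \<bullet> dir i b x)"
      using dir_inner[OF G assms(2)] by (auto simp: G_dir add.commute)
    then show ?thesis
      by (simp add: L2_inner_integrable Cinf_L2 G assms(2) Cinf_dir)
  qed
  then show ?thesis
    using tendsto_add[OF L2_tendsto_inner[OF g(2) L(1)] L2_tendsto_inner[OF g(1) L(2)]] by simp
qed

text \<open>The approximations are uniformly small on the two faces, and so is the boundary term.\<close>

lemma trace0_if_zero_on_faces:
  assumes \<beta>: "morder \<beta> \<le> 2" and lim: "uniform_limit (ccube R) (\<lambda>n. G n \<beta>) U sequentially"
    and U: "\<And>x. x \<in> ccube R \<Longrightarrow> \<bar>x $ i\<bar> = R \<Longrightarrow> U x = 0"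
  shows "trace0 R i (W \<beta>) (W (\<beta> + axis i 1))"
  unfolding trace0_def
proof (intro conjI allI impI)
  show "W \<beta> \<in> L2 (cube R)" "W (\<beta> + axis i 1) \<in> L2 (cube R)" using \<beta> by (auto intro: W_L2)
  fix b :: "real^3 \<Rightarrow> complex" assume b: "Cinf b"
  obtain B where B: "\<And>x. x \<in> ccube R \<Longrightarrow> norm (b x) \<le> B"
    using continuous_bounded_on_ccube[OF Cinf_continuous[OF b, of "ccube R"]] by blast
  have "0 \<in> ccube R" using R by (simp add: mem_ccube)
  from B[OF this] have B0: "B \<ge> 0" using norm_ge_zero[of "b 0"] by linarith
  have "(\<lambda>n. cint R (dir i (\<lambda>x. G n \<beta> x \<bullet> b x))) \<longlonglongrightarrow> 0"
  proof (rule LIMSEQ_I)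
    fix e :: real assume e: "e > 0"
    define d where "d = e / (2 * (8 * R\<^sup>2 * (B + 1)))"
    have d: "d > 0" using e R B0 by (simp add: d_def)
    from uniform_limitD[OF lim d] obtain n0 where n0: "\<And>n x. n \<ge> n0 \<Longrightarrow> x \<in> ccube R \<Longrightarrow> dist (G n \<beta> x) (U x) < d"
      unfolding eventually_sequentially by blast
    have "norm (cint R (dir i (\<lambda>x. G n \<beta> x \<bullet> b x)) - 0) < e" if n: "n \<ge> n0" for n
    proof -
      let ?F = "\<lambda>x. G n \<beta> x \<bullet> b x"
      have F: "Cinf ?F" by (intro Cinf_inner G b)
      have Fb: "\<bar>?F x\<bar> \<le> d * (B + 1)" if x: "x \<in> ccube R" "\<bar>x $ i\<bar> = R" for x
      proof -
        have "norm (G n \<beta> x) \<le> d" using n0[OF n x(1)] U[OF x] by (simp add: dist_norm)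
        then have "norm (G n \<beta> x) * norm (b x) \<le> d * (B + 1)"
          using B[OF x(1)] d by (intro mult_mono) auto
        then show ?thesis using Cauchy_Schwarz_ineq2[of "G n \<beta> x" "b x"] by linarith
      qed
      have 1: "\<bar>cint R (dir i ?F)\<bar> \<le> 8 * R\<^sup>2 * (d * (B + 1))"
        by (rule integral_dir_abs_le[OF R F Fb])
      have "8 * R\<^sup>2 * (d * (B + 1)) = e / 2" using R B0 by (simp add: d_def)
      with 1 e show ?thesis by simp
    qed
    then show "\<exists>no. \<forall>n\<ge>no. norm (cint R (dir i (\<lambda>x. G n \<beta> x \<bullet> b x)) - 0) < e" by blast
  qed
  with pairing_limit[OF \<beta> b, of i]
  show "cint R (\<lambda>x. W (\<beta> + axis i 1) x \<bullet> b x) + cint R (\<lambda>x. W \<beta> x \<bullet> dir i b x) = 0"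
    by (rule LIMSEQ_unique)
qed

lemma by_parts_test_zero_on_faces:
  assumes \<gamma>: "morder \<gamma> \<le> 2" and b: "Cinf b" and z: "\<And>x. \<bar>x $ j\<bar> = R \<Longrightarrow> b x = 0"
  shows "cint R (\<lambda>x. W (\<gamma> + axis j 1) x \<bullet> b x) + cint R (\<lambda>x. W \<gamma> x \<bullet> dir j b x) = 0"
proof -
  have "cint R (dir j (\<lambda>x. G n \<gamma> x \<bullet> b x)) = 0" for n
  proof -
    let ?F = "\<lambda>x. G n \<gamma> x \<bullet> b x"
    have F: "Cinf ?F" by (intro Cinf_inner G b)
    have zF: "?F x = 0" if "\<bar>x $ j\<bar> = R" for x using z[OF that] by simp
    have "\<bar>cint R (dir j ?F)\<bar> \<le> 8 * R\<^sup>2 * 0"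
      by (rule integral_dir_abs_le[OF R F]) (simp add: zF)
    then show ?thesis by simp
  qed
  with pairing_limit[OF \<gamma> b, of j] show ?thesis by (simp add: LIMSEQ_const_iff)
qed

text \<open>Tangential derivatives inherit vanishing boundary values.  The cutoffs \<open>1 - (x\<^sub>j / R)\<^sup>2\<^sup>n\<^sup>+\<^sup>2\<close>
  remove the faces orthogonal to direction \<open>j\<close>, so that \<open>\<partial>\<^sub>j\<close> can be moved to the test function and
  back.  As they do not depend on \<open>x\<^sub>i\<close>, only their values are left afterwards, and these tend to \<open>1\<close>
  boundedly.\<close>

lemma trace0_tangential:
  assumes T: "trace0 R i (W \<beta>) (W (\<beta> + axis i 1))" and ij: "i \<noteq> j" and \<beta>: "morder \<beta> \<le> 1"
  shows "trace0 R i (W (\<beta> + axis j 1)) (W (\<beta> + axis j 1 + axis i 1))"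
  unfolding trace0_def
proof (intro conjI allI impI)
  show "W (\<beta> + axis j 1) \<in> L2 (cube R)" "W (\<beta> + axis j 1 + axis i 1) \<in> L2 (cube R)"
    using \<beta> by (auto intro: W_L2)
  fix b :: "real^3 \<Rightarrow> complex" assume b: "Cinf b"
  define ch where "ch = (\<lambda>n (x::real^3). 1 - (x $ j * (1 / R)) ^ (2 * Suc n))"
  have ch: "Cinf (ch n)" for n
    unfolding ch_def by (intro Cinf_diff Cinf_const Cinf_power Cinf_mult Cinf_coord)
  have dch: "dir i (ch n) = (\<lambda>x. 0)" for n
  proof
    fix x
    have "((\<lambda>t. ch n (x + t *\<^sub>R axis i 1)) has_vector_derivative dir i (ch n) (x + 0 *\<^sub>R axis i 1)) (at 0)"
      by (rule dir_has_vector_derivative[OF Cinf_differentiable[OF ch]])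
    moreover have "(\<lambda>t. ch n (x + t *\<^sub>R axis i 1)) = (\<lambda>t. ch n x)"
      using ij by (auto simp: ch_def axis_def)
    ultimately have "((\<lambda>t. ch n x) has_vector_derivative dir i (ch n) x) (at (0::real))" by simp
    from vector_derivative_unique_at[OF this has_vector_derivative_const] show "dir i (ch n) x = 0" .
  qed
  have chz: "ch n x = 0" if "\<bar>x $ j\<bar> = R" for n x
  proof -
    have "\<bar>x $ j * (1 / R)\<bar> = 1" using that R by (simp add: abs_mult)
    moreover have "(x $ j * (1 / R)) ^ (2 * Suc n) = \<bar>x $ j * (1 / R)\<bar> ^ (2 * Suc n)"
      by (rule power_even_abs[symmetric]) simp
    ultimately have "(x $ j * (1 / R)) ^ (2 * Suc n) = 1" by (simp only: power_one)
    then show ?thesis by (simp only: ch_def)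
  qed
  define c where "c = (\<lambda>n x. ch n x *\<^sub>R b x)"
  have cC: "Cinf (c n)" for n unfolding c_def by (intro Cinf_scaleR ch b)
  have dc: "dir i (c n) = (\<lambda>x. ch n x *\<^sub>R dir i b x)" for n
    using dir_scaleR[OF ch b] by (auto simp: c_def dch)
  have 1: "cint R (\<lambda>x. W (\<beta> + axis i 1 + axis j 1) x \<bullet> c n x) + cint R (\<lambda>x. W (\<beta> + axis i 1) x \<bullet> dir j (c n) x) = 0" for n
    by (rule by_parts_test_zero_on_faces) (use \<beta> cC chz in \<open>auto simp: c_def\<close>)
  have 2: "cint R (\<lambda>x. W (\<beta> + axis j 1) x \<bullet> dir i (c n) x) + cint R (\<lambda>x. W \<beta> x \<bullet> dir j (dir i (c n)) x) = 0" for n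
  proof (rule by_parts_test_zero_on_faces[OF _ Cinf_dir[OF cC]])
    show "morder \<beta> \<le> 2" using \<beta> by simp
    show "dir i (c n) x = 0" if "\<bar>x $ j\<bar> = R" for x using chz[OF that] by (simp add: dc)
  qed
  have 3: "cint R (\<lambda>x. W (\<beta> + axis i 1) x \<bullet> dir j (c n) x) + cint R (\<lambda>x. W \<beta> x \<bullet> dir i (dir j (c n)) x) = 0" for n
    using T Cinf_dir[OF cC] by (simp add: trace0_def)
  have z: "cint R (\<lambda>x. W (\<beta> + axis j 1 + axis i 1) x \<bullet> c n x) + cint R (\<lambda>x. W (\<beta> + axis j 1) x \<bullet> dir i (c n) x) = 0" for n
    using 1[of n] 2[of n] 3[of n] dir_commute[OF cC, of i j n] by (simp add: add_ac)
  have chb: "\<bar>ch n x\<bar> \<le> 1" "(\<lambda>n. ch n x) \<longlonglongrightarrow> 1" if x: "x \<in> cube R" for n x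
  proof -
    define q where "q = (x $ j * (1 / R))\<^sup>2"
    have "\<bar>x $ j * (1 / R)\<bar> < 1" using x R by (simp add: mem_cube abs_mult)
    then have q: "0 \<le> q" "q < 1" unfolding q_def by (auto simp: abs_square_less_1)
    have e: "ch n x = 1 - q ^ Suc n" for n unfolding ch_def q_def by (simp only: power_mult)
    have "0 \<le> q ^ Suc n" "q ^ Suc n \<le> 1" using q by (auto intro: power_le_one simp del: power_Suc)
    then show "\<bar>ch n x\<bar> \<le> 1" unfolding e by linarith
    have "(\<lambda>n. 1 - q ^ Suc n) \<longlonglongrightarrow> 1 - 0"
      using q by (intro tendsto_diff tendsto_const LIMSEQ_Suc[OF LIMSEQ_power_zero]) auto
    then show "(\<lambda>n. ch n x) \<longlonglongrightarrow> 1" unfolding e by simp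
  qed
  have l1: "L2_tendsto (cube R) c b"
    unfolding c_def by (rule L2_tendsto_factor[OF Cinf_L2[OF b] Cinf_measurable_cube[OF ch]]) (use chb in auto)
  have l2: "L2_tendsto (cube R) (\<lambda>n. dir i (c n)) (dir i b)"
    unfolding dc by (rule L2_tendsto_factor[OF Cinf_L2[OF Cinf_dir[OF b]] Cinf_measurable_cube[OF ch]]) (use chb in auto)
  have "(\<lambda>n. cint R (\<lambda>x. W (\<beta> + axis j 1 + axis i 1) x \<bullet> c n x) + cint R (\<lambda>x. W (\<beta> + axis j 1) x \<bullet> dir i (c n) x))
      \<longlonglongrightarrow> cint R (\<lambda>x. W (\<beta> + axis j 1 + axis i 1) x \<bullet> b x) + cint R (\<lambda>x. W (\<beta> + axis j 1) x \<bullet> dir i b x)"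
    using \<beta> by (intro tendsto_add L2_tendsto_inner l1 l2 L2_tendsto_const W_L2) auto
  then show "cint R (\<lambda>x. W (\<beta> + axis j 1 + axis i 1) x \<bullet> b x) + cint R (\<lambda>x. W (\<beta> + axis j 1) x \<bullet> dir i b x) = 0"
    unfolding z by (simp only: LIMSEQ_const_iff)
qed

end

section \<open>The Carleman estimate\<close>

lemma nonneg_if_ge_all_negative:
  fixes x :: real
  assumes "\<And>e. e > 0 \<Longrightarrow> - e \<le> x" shows "0 \<le> x"
proof (rule ccontr)
  assume n: "\<not> 0 \<le> x"
  then have "- (- x / 2) \<le> x" by (intro assms) simp
  with n show False by simp
qed

lemma dir_fun_coord3:
  fixes \<phi> :: "real \<Rightarrow> real"
  assumes "(\<phi> has_real_derivative d) (at (x $ 3))"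
  shows "dir i (\<lambda>x::real^3. \<phi> (x $ 3)) x = (if i = 3 then d else 0)"
proof -
  have "(\<phi> has_derivative (\<lambda>t. d * t)) (at (x $ 3))" using assms by (simp add: has_field_derivative_def)
  from has_derivative_compose[OF bounded_linear_imp_has_derivative[OF bounded_linear_vec_nth] this]
  have "((\<lambda>x::real^3. \<phi> (x $ 3)) has_derivative (\<lambda>h. d * h $ 3)) (at x)" .
  from dir_eqI[OF this, of i] show ?thesis by (auto simp: axis_def)
qed

text \<open>The weight \<open>exp (l (z - 2 R)\<^sup>2)\<close> is largest at the face \<open>z = - R\<close>, where both Cauchy data are
  given, and the square makes its exponent strictly convex in \<open>z\<close>; \<open>p z = 2 R - z\<close> is half the
  negative derivative of \<open>(z - 2 R)\<^sup>2\<close> and is at least \<open>R\<close> on the cube.\<close>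

definition wt :: "real \<Rightarrow> real \<Rightarrow> real \<Rightarrow> real" where
  "wt R l z = exp (l * (z - 2 * R)\<^sup>2)"

abbreviation ex :: "nat^3" where "ex \<equiv> axis 1 1"
abbreviation ey :: "nat^3" where "ey \<equiv> axis 2 1"
abbreviation ez :: "nat^3" where "ez \<equiv> axis 3 1"

definition pz :: "real \<Rightarrow> real \<Rightarrow> real" where "pz R z = 2 * R - z"

lemma wt_deriv: "(wt R l has_real_derivative - 2 * l * pz R z * wt R l z) (at z)"
  unfolding wt_def[abs_def] pz_def by (auto intro!: derivative_eq_intros simp: algebra_simps)

lemma pz_deriv: "(pz R has_real_derivative - 1) (at z)"
  unfolding pz_def[abs_def] by (auto intro!: derivative_eq_intros)

lemma wt_pz_deriv:
  "((\<lambda>z. wt R l z * pz R z) has_real_derivative wt R l z * (- 2 * l * (pz R z)\<^sup>2 - 1)) (at z)"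
  by (rule DERIV_cong[OF DERIV_mult[OF wt_deriv pz_deriv]]) (simp add: algebra_simps power2_eq_square)

lemma wt_pz3_deriv:
  "((\<lambda>z. wt R l z * pz R z ^ 3) has_real_derivative wt R l z * (- 2 * l * (pz R z) ^ 4 - 3 * (pz R z)\<^sup>2)) (at z)"
  by (rule DERIV_cong[OF DERIV_mult[OF wt_deriv DERIV_power[OF pz_deriv]]])
    (simp add: algebra_simps power2_eq_square power3_eq_cube power4_eq_xxxx)

lemma wt_pz2_deriv:
  "((\<lambda>z. wt R l z * (pz R z)\<^sup>2) has_real_derivative wt R l z * (- 2 * l * (pz R z) ^ 3 - 2 * pz R z)) (at z)"
  by (rule DERIV_cong[OF DERIV_mult[OF wt_deriv DERIV_power[OF pz_deriv]]])
    (simp add: algebra_simps power2_eq_square power3_eq_cube)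

lemma Cinf_wt: "Cinf (\<lambda>x. wt R l (x $ 3))"
  unfolding wt_def by (intro Cinf_exp Cinf_mult Cinf_power Cinf_diff Cinf_const Cinf_coord)

lemma Cinf_pz: "Cinf (\<lambda>x. pz R (x $ 3))"
  unfolding pz_def by (intro Cinf_diff Cinf_const Cinf_coord)

lemma Cinf_wt_pz: "Cinf (\<lambda>x. wt R l (x $ 3) * pz R (x $ 3) ^ n)"
  by (intro Cinf_mult Cinf_power Cinf_wt Cinf_pz)

lemma wt_mult_integrable:
  "u \<in> L2 (cube R) \<Longrightarrow> v \<in> L2 (cube R) \<Longrightarrow> integrable (lebesgue_on (cube R)) (\<lambda>x. wt R l (x $ 3) * (u x \<bullet> v x))"
  using L2_inner_integrable[OF L2_Cinf_mult[OF Cinf_wt]] by simp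

lemma wt_sq_integrable:
  "u \<in> L2 (cube R) \<Longrightarrow> integrable (lebesgue_on (cube R)) (\<lambda>x. wt R l (x $ 3) * (cmod (u x))\<^sup>2)"
  using wt_mult_integrable[of u R u l] by (simp add: power2_norm_eq_inner)

lemma wt_pos: "wt R l z > 0" by (simp add: wt_def)

text \<open>Where the Carleman inequality comes from: with \<open>p = pz\<close>, \<open>v = \<partial>\<^sub>z u\<close> and both sides multiplied by
  \<open>wt\<close>, the left-hand side is the integrand left after all integrations by parts, and the right-hand
  side consists of squares up to the derivative in \<open>z\<close> of a multiple of the square of \<open>u\<close>.\<close>

lemma Carleman_pointwise:
  fixes u v :: complex and p l :: real
  shows "(4 * l * p\<^sup>2 + 2) * (cmod v)\<^sup>2 - (4 * l ^ 3 * p ^ 4 + 12 * l\<^sup>2 * p\<^sup>2 + 3 * l) * (cmod u)\<^sup>2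
     = l * (cmod ((2 * p) *\<^sub>R v - (2 * l * p\<^sup>2 + 1) *\<^sub>R u))\<^sup>2 + 2 * (cmod (v - (l * p) *\<^sub>R u))\<^sup>2
       + 2 * l\<^sup>2 * p\<^sup>2 * (cmod u)\<^sup>2
       + ((8 * l\<^sup>2 * p ^ 3 + 8 * l * p) * (v \<bullet> u)
          - (8 * l ^ 3 * p ^ 4 + 20 * l\<^sup>2 * p\<^sup>2 + 4 * l) * (cmod u)\<^sup>2)"
proof -
  have 1: "(cmod ((2 * p) *\<^sub>R v - (2 * l * p\<^sup>2 + 1) *\<^sub>R u))\<^sup>2
     = 4 * p\<^sup>2 * (cmod v)\<^sup>2 - 4 * p * (2 * l * p\<^sup>2 + 1) * (v \<bullet> u) + (2 * l * p\<^sup>2 + 1)\<^sup>2 * (cmod u)\<^sup>2"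
  proof -
    have n: "(2 * p) *\<^sub>R v - (2 * l * p\<^sup>2 + 1) *\<^sub>R u = (2 * p) *\<^sub>R v + (- (2 * l * p\<^sup>2 + 1)) *\<^sub>R u"
      by (simp only: scaleR_minus_left diff_conv_add_uminus)
    show ?thesis
      unfolding n norm_add_scaleR_sq inner_scaleR_left norm_scaleR power_mult_distrib power2_abs power2_minus
      by (simp add: algebra_simps)
  qed
  have 2: "(cmod (v - (l * p) *\<^sub>R u))\<^sup>2 = (cmod v)\<^sup>2 - 2 * l * p * (v \<bullet> u) + l\<^sup>2 * p\<^sup>2 * (cmod u)\<^sup>2"
    using norm_add_scaleR_sq[of v "- (l * p)" u] by (simp add: power_mult_distrib)
  have 3: "(2 * l * p\<^sup>2 + 1)\<^sup>2 = 4 * l\<^sup>2 * p ^ 4 + 4 * l * p\<^sup>2 + 1"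
    by (simp add: algebra_simps power2_eq_square power4_eq_xxxx)
  show ?thesis unfolding 1 2 3
    by (simp add: algebra_simps power2_eq_square[of l] power2_eq_square[of p] power3_eq_cube power4_eq_xxxx)
qed

lemma morder_axis_nat [simp]: "morder (axis i c) = c"
  by (simp add: morder_def axis_def)

context H3_jet
begin

lemma W_sq_integrable:
  assumes "morder \<beta> \<le> 3" "Cinf \<eta>" shows "integrable (lebesgue_on (cube R)) (\<lambda>x. \<eta> x * (cmod (W \<beta> x))\<^sup>2)"
  using W_integrable[OF assms(1,1,2)] by (simp add: power2_norm_eq_inner)

end

locale Cauchy_zero = H3_jet +
  fixes U0 U3 :: "real^3 \<Rightarrow> complex"
  assumes U0: "uniform_limit (ccube R) (\<lambda>n. G n 0) U0 sequentially"
    and U0_zero: "\<And>x i. x \<in> ccube R \<Longrightarrow> \<bar>x $ i\<bar> = R \<Longrightarrow> U0 x = 0"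
    and U3: "uniform_limit (ccube R) (\<lambda>n. G n ez) U3 sequentially"
    and U3_zero: "\<And>x. x \<in> ccube R \<Longrightarrow> x $ 3 = - R \<Longrightarrow> U3 x = 0"
begin

lemma tr0: "trace0 R i (W 0) (W (axis i 1))"
  using trace0_if_zero_on_faces[of 0 U0 i] U0 U0_zero by simp

lemma tr1: "i \<noteq> j \<Longrightarrow> trace0 R i (W (axis j 1)) (W (axis j 1 + axis i 1))"
  using trace0_tangential[of i 0 j] tr0[of i] by simp

lemma tr2: "i \<noteq> j \<Longrightarrow> trace0 R i (W (axis j 1 + axis j 1)) (W (axis j 1 + axis j 1 + axis i 1))"
  using trace0_tangential[of i "axis j 1" j] tr1[of i j] by simp

lemma first_with_zeroth:
  assumes "Cinf \<eta>"
  shows "cint R (\<lambda>x. \<eta> x * (W (axis i 1) x \<bullet> W 0 x)) = - (1 / 2) * cint R (\<lambda>x. dir i \<eta> x * (cmod (W 0 x))\<^sup>2)"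
  using by_parts[OF _ _ assms, of i 0 0] tr0[of i] by (simp add: inner_commute power2_norm_eq_inner)

lemma second_with_zeroth:
  assumes "Cinf \<eta>"
  shows "cint R (\<lambda>x. \<eta> x * (W (axis i 1 + axis i 1) x \<bullet> W 0 x))
    = - cint R (\<lambda>x. \<eta> x * (cmod (W (axis i 1) x))\<^sup>2) + (1 / 2) * cint R (\<lambda>x. dir i (dir i \<eta>) x * (cmod (W 0 x))\<^sup>2)"
proof -
  have "cint R (\<lambda>x. \<eta> x * (W (axis i 1) x \<bullet> W (axis i 1) x))
    = - cint R (\<lambda>x. \<eta> x * (W 0 x \<bullet> W (axis i 1 + axis i 1) x)) - cint R (\<lambda>x. dir i \<eta> x * (W 0 x \<bullet> W (axis i 1) x))"
    using by_parts[OF _ _ assms, of i 0 "axis i 1"] tr0[of i] by simp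
  then show ?thesis
    using first_with_zeroth[OF Cinf_dir[OF assms], of i i] by (simp add: inner_commute power2_norm_eq_inner)
qed

lemma tangential_with_normal:
  assumes \<eta>: "Cinf \<eta>" and i: "i \<noteq> 3" and z: "\<And>x. dir i \<eta> x = 0"
  shows "cint R (\<lambda>x. \<eta> x * (W (axis i 1 + axis i 1) x \<bullet> W ez x)) = (1 / 2) * cint R (\<lambda>x. dir 3 \<eta> x * (cmod (W (axis i 1) x))\<^sup>2)"
proof -
  have "cint R (\<lambda>x. \<eta> x * (W (ez + axis i 1) x \<bullet> W (axis i 1) x))
     = - cint R (\<lambda>x. \<eta> x * (W ez x \<bullet> W (axis i 1 + axis i 1) x))"
    using by_parts[OF tr1[OF i] _ \<eta>, of "axis i 1"] z by simp
  moreover have "cint R (\<lambda>x. \<eta> x * (W (axis i 1 + ez) x \<bullet> W (axis i 1) x))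
     = - cint R (\<lambda>x. \<eta> x * (W (axis i 1) x \<bullet> W (axis i 1 + ez) x)) - cint R (\<lambda>x. dir 3 \<eta> x * (W (axis i 1) x \<bullet> W (axis i 1) x))"
    using by_parts[OF tr1[OF i[symmetric]] _ \<eta>, of "axis i 1"] by simp
  ultimately show ?thesis by (simp add: inner_commute power2_norm_eq_inner add.commute)
qed

text \<open>The only integration by parts with a boundary term: the one at the top face has the right sign,
  and the one at the bottom face vanishes because the normal derivative does.\<close>

lemma normal_with_normal:
  assumes h: "Cinf h" and h0: "\<And>x. x \<in> ccube R \<Longrightarrow> h x \<ge> 0"
  shows "cint R (\<lambda>x. h x * (W (ez + ez) x \<bullet> W ez x)) \<ge> - (1 / 2) * cint R (\<lambda>x. dir 3 h x * (cmod (W ez x))\<^sup>2)"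
proof -
  obtain B where B: "\<And>x. x \<in> ccube R \<Longrightarrow> norm (h x) \<le> B"
    using continuous_bounded_on_ccube[OF Cinf_continuous[OF h, of "ccube R"]] by blast
  have "0 \<in> ccube R" using R by (simp add: mem_ccube)
  from B[OF this] have B0: "B \<ge> 0" using norm_ge_zero[of "h 0"] by linarith
  let ?F = "\<lambda>n x. h x * (G n ez x \<bullet> G n ez x)"
  have F: "Cinf (?F n)" for n by (intro Cinf_mult Cinf_inner G h)
  have dF: "dir 3 (?F n) = (\<lambda>x. 2 * ((h x *\<^sub>R G n (ez + ez) x) \<bullet> G n ez x) + (dir 3 h x *\<^sub>R G n ez x) \<bullet> G n ez x)" for n
  proof
    fix x
    have "dir 3 (?F n) x = h x * dir 3 (\<lambda>x. G n ez x \<bullet> G n ez x) x + dir 3 h x * (G n ez x \<bullet> G n ez x)"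
      by (rule dir_bilinear[OF bounded_bilinear_mult]) (intro Cinf_differentiable Cinf_inner G h)+
    then show "dir 3 (?F n) x = 2 * ((h x *\<^sub>R G n (ez + ez) x) \<bullet> G n ez x) + (dir 3 h x *\<^sub>R G n ez x) \<bullet> G n ez x"
      unfolding dir_inner[OF G G] G_dir by (simp add: inner_commute algebra_simps)
  qed
  have l1: "L2_tendsto (cube R) (\<lambda>n. G n ez) (W ez)" by (rule G_lim) simp
  have l2: "L2_tendsto (cube R) (\<lambda>n. G n (ez + ez)) (W (ez + ez))" by (rule G_lim) simp
  have "(\<lambda>n. 2 * cint R (\<lambda>x. (h x *\<^sub>R G n (ez + ez) x) \<bullet> G n ez x) + cint R (\<lambda>x. (dir 3 h x *\<^sub>R G n ez x) \<bullet> G n ez x))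
    \<longlonglongrightarrow> 2 * cint R (\<lambda>x. (h x *\<^sub>R W (ez + ez) x) \<bullet> W ez x) + cint R (\<lambda>x. (dir 3 h x *\<^sub>R W ez x) \<bullet> W ez x)"
    by (rule tendsto_add[OF tendsto_mult[OF tendsto_const L2_tendsto_inner[OF L2_tendsto_Cinf_mult[OF h l2] l1]]
          L2_tendsto_inner[OF L2_tendsto_Cinf_mult[OF Cinf_dir[OF h] l1] l1]])
  moreover have "cint R (dir 3 (?F n)) = 2 * cint R (\<lambda>x. (h x *\<^sub>R G n (ez + ez) x) \<bullet> G n ez x) + cint R (\<lambda>x. (dir 3 h x *\<^sub>R G n ez x) \<bullet> G n ez x)" for n
  proof -
    have "integrable (lebesgue_on (cube R)) (\<lambda>x. (h x *\<^sub>R G n (ez + ez) x) \<bullet> G n ez x)"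
      "integrable (lebesgue_on (cube R)) (\<lambda>x. (dir 3 h x *\<^sub>R G n ez x) \<bullet> G n ez x)"
      by (intro L2_inner_integrable Cinf_L2 Cinf_scaleR Cinf_dir G h)+
    then show ?thesis unfolding dF by simp
  qed
  ultimately have lim: "(\<lambda>n. cint R (dir 3 (?F n))) \<longlonglongrightarrow>
      2 * cint R (\<lambda>x. h x * (W (ez + ez) x \<bullet> W ez x)) + cint R (\<lambda>x. dir 3 h x * (W ez x \<bullet> W ez x))" (is "_ \<longlonglongrightarrow> ?L")
    by simp
  have "- e \<le> ?L" if e: "e > 0" for e
  proof -
    define d where "d = min 1 (e / (8 * R\<^sup>2 * (B + 1)))"
    have d: "d > 0" "d \<le> 1" "d \<le> e / (8 * R\<^sup>2 * (B + 1))" using e R B0 by (auto simp: d_def)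
    have "eventually (\<lambda>n. \<forall>x\<in>ccube R. dist (G n ez x) (U3 x) < d) sequentially" by (rule uniform_limitD[OF U3 d(1)])
    then have "eventually (\<lambda>n. - e \<le> cint R (dir 3 (?F n))) sequentially"
    proof eventually_elim
      fix n assume n: "\<forall>x\<in>ccube R. dist (G n ez x) (U3 x) < d"
      have "- (8 * R\<^sup>2 * (B * d)) \<le> cint R (dir 3 (?F n))"
      proof (rule integral_dir_ge[OF R Cinf_differentiable[OF F] Cinf_continuous[OF Cinf_dir[OF F]]])
        show "- (B * d) \<le> ?F n x" if "x \<in> ccube R" "x $ 3 = R" for x
        proof -
          have "0 \<le> ?F n x" by (intro mult_nonneg_nonneg h0 that inner_ge_zero)
          moreover have "0 \<le> B * d" using B0 d by simp
          ultimately show ?thesis by linarith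
        qed
        show "?F n x \<le> B * d" if x: "x \<in> ccube R" "x $ 3 = - R" for x
        proof -
          have "norm (G n ez x) < d" using n x U3_zero[OF x] by (auto simp: dist_norm)
          then have "(norm (G n ez x))\<^sup>2 \<le> d * 1" unfolding power2_eq_square using d by (intro mult_mono) auto
          then have "G n ez x \<bullet> G n ez x \<le> d" by (simp add: power2_norm_eq_inner)
          moreover have "h x \<le> B" using B[OF x(1)] by simp
          ultimately show ?thesis using B0 by (intro mult_mono) auto
        qed
      qed
      moreover have "8 * R\<^sup>2 * (B * d) \<le> e"
      proof -
        have "8 * R\<^sup>2 * (B * d) \<le> 8 * R\<^sup>2 * ((B + 1) * (e / (8 * R\<^sup>2 * (B + 1))))"
          using d B0 by (intro mult_left_mono mult_mono) auto
        also have "\<dots> = e" using R B0 by simp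
        finally show ?thesis .
      qed
      ultimately show "- e \<le> cint R (dir 3 (?F n))" by linarith
    qed
    then show ?thesis by (intro tendsto_lowerbound[OF lim]) auto
  qed
  then have "0 \<le> ?L" by (rule nonneg_if_ge_all_negative)
  then show ?thesis by (simp add: power2_norm_eq_inner)
qed

text \<open>One derivative in direction \<open>i\<close> and one in direction \<open>j\<close> change places.  No boundary terms arise,
  because \<open>\<partial>\<^sub>i w\<close> vanishes on the faces orthogonal to direction \<open>j\<close> and \<open>\<partial>\<^sub>j \<partial>\<^sub>j w\<close> on those orthogonal to
  direction \<open>i\<close>.\<close>

lemma mixed_second:
  assumes ij: "i \<noteq> j"
  shows "cint R (\<lambda>x. (cmod (W (axis i 1 + axis j 1) x))\<^sup>2) = cint R (\<lambda>x. W (axis i 1 + axis i 1) x \<bullet> W (axis j 1 + axis j 1) x)"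
proof -
  have o: "Cinf (\<lambda>x::real^3. 1 :: real)" by (rule Cinf_const)
  have "cint R (\<lambda>x. 1 * (W (axis j 1 + axis j 1 + axis i 1) x \<bullet> W (axis i 1) x))
     = - cint R (\<lambda>x. 1 * (W (axis j 1 + axis j 1) x \<bullet> W (axis i 1 + axis i 1) x)) - cint R (\<lambda>x. dir i (\<lambda>x. 1) x * (W (axis j 1 + axis j 1) x \<bullet> W (axis i 1) x))"
    by (rule by_parts[OF tr2[OF ij] _ o]) simp
  moreover have "cint R (\<lambda>x. 1 * (W (axis i 1 + axis j 1) x \<bullet> W (axis i 1 + axis j 1) x))
     = - cint R (\<lambda>x. 1 * (W (axis i 1) x \<bullet> W (axis i 1 + axis j 1 + axis j 1) x)) - cint R (\<lambda>x. dir j (\<lambda>x. 1) x * (W (axis i 1) x \<bullet> W (axis i 1 + axis j 1) x))"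
    by (rule by_parts[OF tr1[OF ij[symmetric]] _ o]) simp
  moreover have "axis j 1 + axis j 1 + axis i 1 = axis i 1 + axis j 1 + (axis j 1 :: nat^3)" by (simp add: add_ac)
  ultimately show ?thesis by (simp add: dir_const power2_norm_eq_inner inner_commute)
qed

definition lap :: "real^3 \<Rightarrow> complex" where
  "lap x = W (ex + ex) x + W (ey + ey) x + W (ez + ez) x"

lemma lap_L2: "lap \<in> L2 (cube R)"
  unfolding lap_def[abs_def] by (intro L2_add W_L2) auto

text \<open>In the square of the Laplacian the mixed products integrate to squares of mixed derivatives, and
  so do not lower the sum of the squares of the pure second derivatives.\<close>

lemma second_derivatives_le_lap:
  "cint R (\<lambda>x. (cmod (W (axis i 1 + axis j 1) x))\<^sup>2) \<le> cint R (\<lambda>x. (cmod (lap x))\<^sup>2)"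
proof -
  let ?D = "\<lambda>i. W (axis i 1 + axis i 1)"
  have L: "?D i \<in> L2 (cube R)" for i by (rule W_L2) simp
  have nn: "cint R (\<lambda>x. ?D i x \<bullet> ?D j x) \<ge> 0" if "i \<noteq> j" for i j
    unfolding mixed_second[OF that, symmetric] by (rule Bochner_Integration.integral_nonneg) simp
  have sq: "cint R (\<lambda>x. (cmod (?D i x))\<^sup>2) \<ge> 0" for i by (rule Bochner_Integration.integral_nonneg) simp
  have "(\<lambda>x. (cmod (lap x))\<^sup>2) = (\<lambda>x. ((cmod (?D 1 x))\<^sup>2 + (cmod (?D 2 x))\<^sup>2 + (cmod (?D 3 x))\<^sup>2)
      + 2 * (?D 1 x \<bullet> ?D 2 x) + 2 * (?D 1 x \<bullet> ?D 3 x) + 2 * (?D 2 x \<bullet> ?D 3 x))"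
    by (rule ext) (simp add: lap_def power2_norm_eq_inner inner_add_left inner_add_right inner_commute)
  then have e: "cint R (\<lambda>x. (cmod (lap x))\<^sup>2) = cint R (\<lambda>x. (cmod (?D 1 x))\<^sup>2) + cint R (\<lambda>x. (cmod (?D 2 x))\<^sup>2) + cint R (\<lambda>x. (cmod (?D 3 x))\<^sup>2)
      + 2 * cint R (\<lambda>x. ?D 1 x \<bullet> ?D 2 x) + 2 * cint R (\<lambda>x. ?D 1 x \<bullet> ?D 3 x) + 2 * cint R (\<lambda>x. ?D 2 x \<bullet> ?D 3 x)"
    using L2_integrable[OF L] L2_inner_integrable[OF L L] by simp
  have n: "cint R (\<lambda>x. ?D 1 x \<bullet> ?D 2 x) \<ge> 0" "cint R (\<lambda>x. ?D 1 x \<bullet> ?D 3 x) \<ge> 0" "cint R (\<lambda>x. ?D 2 x \<bullet> ?D 3 x) \<ge> 0"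
    by (rule nn; simp)+
  show ?thesis
  proof (cases "i = j")
    case True
    then show ?thesis using e n sq[of 1] sq[of 2] sq[of 3] exhaust_3[of j] by auto
  next
    case False
    have c: "cint R (\<lambda>x. ?D i x \<bullet> ?D j x) = cint R (\<lambda>x. ?D j x \<bullet> ?D i x)" by (simp add: inner_commute)
    from False have "cint R (\<lambda>x. ?D i x \<bullet> ?D j x) \<in>
        {cint R (\<lambda>x. ?D 1 x \<bullet> ?D 2 x), cint R (\<lambda>x. ?D 1 x \<bullet> ?D 3 x), cint R (\<lambda>x. ?D 2 x \<bullet> ?D 3 x)}"
      using exhaust_3[of i] exhaust_3[of j] c by auto
    then show ?thesis unfolding mixed_second[OF False] using e n sq[of 1] sq[of 2] sq[of 3] by auto
  qed
qed

text \<open>The vector field \<open>2 p \<partial>\<^sub>z\<close> points towards the top face, where the boundary term has the right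
  sign.  The coefficient of \<open>W 0\<close> is the one for which the terms with tangential derivatives cancel:
  times \<open>wt\<close> it is the \<open>z\<close>-derivative of \<open>p wt\<close>.\<close>

definition multiplier :: "real \<Rightarrow> real^3 \<Rightarrow> complex" where
  "multiplier l x = (2 * pz R (x $ 3)) *\<^sub>R W ez x - (2 * l * (pz R (x $ 3))\<^sup>2 + 1) *\<^sub>R W 0 x"

lemma multiplier_L2: "multiplier l \<in> L2 (cube R)"
  unfolding multiplier_def[abs_def]
  by (intro L2_diff L2_Cinf_mult W_L2 Cinf_mult Cinf_add Cinf_power Cinf_const Cinf_pz) auto

lemma pz_bounds: "x \<in> ccube R \<Longrightarrow> R \<le> pz R (x $ 3)"
  unfolding mem_ccube pz_def by (drule spec[of _ 3]) linarith

text \<open>With \<open>h = p wt\<close> the pairing consists of \<open>2 h \<partial>\<^sub>i\<partial>\<^sub>i w \<partial>\<^sub>z w\<close> and \<open>h' \<partial>\<^sub>i\<partial>\<^sub>i w w\<close>.  For a tangential direction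
  \<open>i\<close> the first gives \<open>h' (\<partial>\<^sub>i w)\<^sup>2\<close>, the second \<open>- h' (\<partial>\<^sub>i w)\<^sup>2\<close>; what remains are the terms with \<open>\<partial>\<^sub>z w\<close>
  and \<open>w\<close>.\<close>

lemma multiplier_lower_bound:
  "cint R (\<lambda>x. wt R l (x $ 3) * (lap x \<bullet> multiplier l x))
    \<ge> cint R (\<lambda>x. wt R l (x $ 3) * ((4 * l * (pz R (x $ 3))\<^sup>2 + 2) * (cmod (W ez x))\<^sup>2
        - (4 * l ^ 3 * (pz R (x $ 3)) ^ 4 + 12 * l\<^sup>2 * (pz R (x $ 3))\<^sup>2 + 3 * l) * (cmod (W 0 x))\<^sup>2))"
proof -
  let ?w = "\<lambda>x::real^3. wt R l (x $ 3)" and ?p = "\<lambda>x::real^3. pz R (x $ 3)"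
  define h where "h = (\<lambda>x::real^3. wt R l (x $ 3) * pz R (x $ 3))"
  define h1 where "h1 = (\<lambda>x::real^3. wt R l (x $ 3) * (- 2 * l * (pz R (x $ 3))\<^sup>2 - 1))"
  define h2 where "h2 = (\<lambda>x::real^3. wt R l (x $ 3) * (4 * l\<^sup>2 * (pz R (x $ 3)) ^ 3 + 6 * l * pz R (x $ 3)))"
  define h3 where "h3 = (\<lambda>x::real^3. - (wt R l (x $ 3) * (8 * l ^ 3 * (pz R (x $ 3)) ^ 4 + 24 * l\<^sup>2 * (pz R (x $ 3))\<^sup>2 + 6 * l)))"
  have d0: "dir i h x = (if i = 3 then h1 x else 0)" for i x
    unfolding h_def h1_def by (rule dir_fun_coord3[OF wt_pz_deriv])
  have d1: "dir i h1 x = (if i = 3 then h2 x else 0)" for i x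
  proof -
    have "((\<lambda>z. - 2 * l * (wt R l z * (pz R z)\<^sup>2) - wt R l z) has_real_derivative
       - 2 * l * (wt R l (x $ 3) * (- 2 * l * (pz R (x $ 3)) ^ 3 - 2 * pz R (x $ 3))) - - 2 * l * pz R (x $ 3) * wt R l (x $ 3)) (at (x $ 3))"
      by (intro DERIV_diff DERIV_cmult wt_pz2_deriv wt_deriv)
    from dir_fun_coord3[OF this, of i] show ?thesis
      by (simp add: h1_def h2_def algebra_simps power2_eq_square power3_eq_cube)
  qed
  have d2: "dir i h2 x = (if i = 3 then h3 x else 0)" for i x
  proof -
    have "((\<lambda>z. 4 * l\<^sup>2 * (wt R l z * (pz R z) ^ 3) + 6 * l * (wt R l z * pz R z)) has_real_derivative
       4 * l\<^sup>2 * (wt R l (x $ 3) * (- 2 * l * (pz R (x $ 3)) ^ 4 - 3 * (pz R (x $ 3))\<^sup>2)) + 6 * l * (wt R l (x $ 3) * (- 2 * l * (pz R (x $ 3))\<^sup>2 - 1))) (at (x $ 3))"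
      by (intro DERIV_add DERIV_cmult wt_pz3_deriv wt_pz_deriv)
    from dir_fun_coord3[OF this, of i] show ?thesis
      by (simp add: h2_def h3_def algebra_simps power2_eq_square power3_eq_cube power4_eq_xxxx)
  qed
  have Ch: "Cinf h" "Cinf h1" unfolding h_def h1_def
    by (intro Cinf_mult Cinf_wt Cinf_pz Cinf_diff Cinf_const Cinf_power)+
  have dd: "dir i (dir i h1) x = (if i = 3 then h3 x else 0)" for i x
  proof (cases "i = 3")
    case True
    have "dir 3 h1 = h2" by (rule ext) (simp add: d1)
    then show ?thesis using d2[of 3 x] True by simp
  next
    case False
    have "dir i h1 = (\<lambda>x. 0)" by (rule ext) (simp add: d1 False)
    then show ?thesis using False by (simp add: dir_const)
  qed
  have Ch3: "Cinf h3" unfolding h3_def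
    by (intro Cinf_uminus Cinf_mult Cinf_wt Cinf_pz Cinf_add Cinf_const Cinf_power)
  have h0: "h x \<ge> 0" if "x \<in> ccube R" for x
    unfolding h_def using pz_bounds[OF that] R wt_pos[of R l "x $ 3"] by simp
  have t: "cint R (\<lambda>x. h x * (W (axis i 1 + axis i 1) x \<bullet> W ez x)) = (1 / 2) * cint R (\<lambda>x. h1 x * (cmod (W (axis i 1) x))\<^sup>2)"
    if "i \<noteq> 3" for i
    using tangential_with_normal[OF Ch(1) that] that by (simp add: d0)
  have n: "cint R (\<lambda>x. h x * (W (ez + ez) x \<bullet> W ez x)) \<ge> - (1 / 2) * cint R (\<lambda>x. h1 x * (cmod (W ez x))\<^sup>2)"
    using normal_with_normal[OF Ch(1) h0] by (simp add: d0)
  have z: "cint R (\<lambda>x. h1 x * (W (axis i 1 + axis i 1) x \<bullet> W 0 x))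
      = - cint R (\<lambda>x. h1 x * (cmod (W (axis i 1) x))\<^sup>2)
        + (1 / 2) * cint R (\<lambda>x. (if i = 3 then h3 x else 0) * (cmod (W 0 x))\<^sup>2)" for i
    using second_with_zeroth[OF Ch(2), of i] by (simp only: dd)
  have e: "wt R l (x $ 3) * (lap x \<bullet> multiplier l x)
     = 2 * (h x * (W (ex + ex) x \<bullet> W ez x)) + 2 * (h x * (W (ey + ey) x \<bullet> W ez x)) + 2 * (h x * (W (ez + ez) x \<bullet> W ez x))
       + h1 x * (W (ex + ex) x \<bullet> W 0 x) + h1 x * (W (ey + ey) x \<bullet> W 0 x) + h1 x * (W (ez + ez) x \<bullet> W 0 x)" for x
    unfolding lap_def multiplier_def h_def h1_def
    by (simp add: inner_add_left inner_diff_right algebra_simps)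
  have i: "integrable (lebesgue_on (cube R)) (\<lambda>x. h x * (W (axis i 1 + axis i 1) x \<bullet> W ez x))"
    "integrable (lebesgue_on (cube R)) (\<lambda>x. h1 x * (W (axis i 1 + axis i 1) x \<bullet> W 0 x))" for i
    by (intro W_integrable Ch; simp)+
  have "cint R (\<lambda>x. wt R l (x $ 3) * (lap x \<bullet> multiplier l x))
     = 2 * cint R (\<lambda>x. h x * (W (ex + ex) x \<bullet> W ez x)) + 2 * cint R (\<lambda>x. h x * (W (ey + ey) x \<bullet> W ez x)) + 2 * cint R (\<lambda>x. h x * (W (ez + ez) x \<bullet> W ez x))
       + cint R (\<lambda>x. h1 x * (W (ex + ex) x \<bullet> W 0 x)) + cint R (\<lambda>x. h1 x * (W (ey + ey) x \<bullet> W 0 x)) + cint R (\<lambda>x. h1 x * (W (ez + ez) x \<bullet> W 0 x))"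
    unfolding e using i by simp
  also have "\<dots> \<ge> - 2 * cint R (\<lambda>x. h1 x * (cmod (W ez x))\<^sup>2) + (1 / 2) * cint R (\<lambda>x. h3 x * (cmod (W 0 x))\<^sup>2)"
    using t[of 1] t[of 2] n z[of 1] z[of 2] z[of 3] by simp
  finally have "cint R (\<lambda>x. wt R l (x $ 3) * (lap x \<bullet> multiplier l x))
     \<ge> - 2 * cint R (\<lambda>x. h1 x * (cmod (W ez x))\<^sup>2) + (1 / 2) * cint R (\<lambda>x. h3 x * (cmod (W 0 x))\<^sup>2)" .
  moreover have "cint R (\<lambda>x. wt R l (x $ 3) * ((4 * l * (pz R (x $ 3))\<^sup>2 + 2) * (cmod (W ez x))\<^sup>2
        - (4 * l ^ 3 * (pz R (x $ 3)) ^ 4 + 12 * l\<^sup>2 * (pz R (x $ 3))\<^sup>2 + 3 * l) * (cmod (W 0 x))\<^sup>2))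
      = cint R (\<lambda>x. - 2 * (h1 x * (cmod (W ez x))\<^sup>2) + (1 / 2) * (h3 x * (cmod (W 0 x))\<^sup>2))"
    by (intro Bochner_Integration.integral_cong refl) (simp add: h1_def h3_def algebra_simps)
  moreover have "\<dots> = - 2 * cint R (\<lambda>x. h1 x * (cmod (W ez x))\<^sup>2) + (1 / 2) * cint R (\<lambda>x. h3 x * (cmod (W 0 x))\<^sup>2)"
    using W_sq_integrable[OF _ Ch(2), of ez] W_sq_integrable[OF _ Ch3, of 0] by simp
  ultimately show ?thesis by linarith
qed

text \<open>The exact derivative in \<open>Carleman_pointwise\<close> integrates to zero because \<open>w\<close> vanishes on the top and
  bottom faces.\<close>

lemma multiplier_squares:
  "cint R (\<lambda>x. wt R l (x $ 3) * (lap x \<bullet> multiplier l x))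
    \<ge> l * cint R (\<lambda>x. wt R l (x $ 3) * (cmod (multiplier l x))\<^sup>2)
      + 2 * cint R (\<lambda>x. wt R l (x $ 3) * (cmod (W ez x - (l * pz R (x $ 3)) *\<^sub>R W 0 x))\<^sup>2)
      + 2 * l\<^sup>2 * cint R (\<lambda>x. wt R l (x $ 3) * ((pz R (x $ 3))\<^sup>2 * (cmod (W 0 x))\<^sup>2))"
proof -
  define q where "q = (\<lambda>x::real^3. wt R l (x $ 3) * (8 * l\<^sup>2 * (pz R (x $ 3)) ^ 3 + 8 * l * pz R (x $ 3)))"
  define q1 where "q1 = (\<lambda>x::real^3. - (wt R l (x $ 3) * (16 * l ^ 3 * (pz R (x $ 3)) ^ 4 + 40 * l\<^sup>2 * (pz R (x $ 3))\<^sup>2 + 8 * l)))"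
  have Cq: "Cinf q" "Cinf q1" unfolding q_def q1_def
    by (intro Cinf_uminus Cinf_mult Cinf_wt Cinf_pz Cinf_add Cinf_const Cinf_power)+
  have dq: "dir 3 q x = q1 x" for x
  proof -
    have "((\<lambda>z. 8 * l\<^sup>2 * (wt R l z * (pz R z) ^ 3) + 8 * l * (wt R l z * pz R z)) has_real_derivative
       8 * l\<^sup>2 * (wt R l (x $ 3) * (- 2 * l * (pz R (x $ 3)) ^ 4 - 3 * (pz R (x $ 3))\<^sup>2)) + 8 * l * (wt R l (x $ 3) * (- 2 * l * (pz R (x $ 3))\<^sup>2 - 1))) (at (x $ 3))"
      by (intro DERIV_add DERIV_cmult wt_pz3_deriv wt_pz_deriv)
    from dir_fun_coord3[OF this, of 3] show ?thesis
      by (simp add: q_def q1_def algebra_simps power2_eq_square power3_eq_cube power4_eq_xxxx)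
  qed
  have zero: "cint R (\<lambda>x. q x * (W ez x \<bullet> W 0 x)) + (1 / 2) * cint R (\<lambda>x. q1 x * (cmod (W 0 x))\<^sup>2) = 0"
    using first_with_zeroth[OF Cq(1), of 3] by (simp add: dq)
  have v: "(\<lambda>x. W ez x - (l * pz R (x $ 3)) *\<^sub>R W 0 x) \<in> L2 (cube R)"
    by (intro L2_diff L2_Cinf_mult W_L2 Cinf_mult Cinf_const Cinf_pz) auto
  have i1: "integrable (lebesgue_on (cube R)) (\<lambda>x. wt R l (x $ 3) * (cmod (multiplier l x))\<^sup>2)"
    by (rule wt_sq_integrable[OF multiplier_L2])
  have i2: "integrable (lebesgue_on (cube R)) (\<lambda>x. wt R l (x $ 3) * (cmod (W ez x - (l * pz R (x $ 3)) *\<^sub>R W 0 x))\<^sup>2)"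
    by (rule wt_sq_integrable[OF v])
  have i3: "integrable (lebesgue_on (cube R)) (\<lambda>x. wt R l (x $ 3) * ((pz R (x $ 3))\<^sup>2 * (cmod (W 0 x))\<^sup>2))"
    using W_sq_integrable[OF _ Cinf_wt_pz[of R l 2], of 0] by (simp add: mult.assoc)
  have i4: "integrable (lebesgue_on (cube R)) (\<lambda>x. q x * (W ez x \<bullet> W 0 x))" by (intro W_integrable Cq) simp_all
  have i5: "integrable (lebesgue_on (cube R)) (\<lambda>x. q1 x * (cmod (W 0 x))\<^sup>2)" by (intro W_sq_integrable Cq) simp
  have e: "wt R l (x $ 3) * ((4 * l * (pz R (x $ 3))\<^sup>2 + 2) * (cmod (W ez x))\<^sup>2
        - (4 * l ^ 3 * (pz R (x $ 3)) ^ 4 + 12 * l\<^sup>2 * (pz R (x $ 3))\<^sup>2 + 3 * l) * (cmod (W 0 x))\<^sup>2)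
     = l * (wt R l (x $ 3) * (cmod (multiplier l x))\<^sup>2)
       + 2 * (wt R l (x $ 3) * (cmod (W ez x - (l * pz R (x $ 3)) *\<^sub>R W 0 x))\<^sup>2)
       + 2 * l\<^sup>2 * (wt R l (x $ 3) * ((pz R (x $ 3))\<^sup>2 * (cmod (W 0 x))\<^sup>2))
       + (q x * (W ez x \<bullet> W 0 x) + (1 / 2) * (q1 x * (cmod (W 0 x))\<^sup>2))" for x
    unfolding Carleman_pointwise multiplier_def q_def q1_def by (simp add: algebra_simps)
  have "cint R (\<lambda>x. wt R l (x $ 3) * ((4 * l * (pz R (x $ 3))\<^sup>2 + 2) * (cmod (W ez x))\<^sup>2
        - (4 * l ^ 3 * (pz R (x $ 3)) ^ 4 + 12 * l\<^sup>2 * (pz R (x $ 3))\<^sup>2 + 3 * l) * (cmod (W 0 x))\<^sup>2))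
     = l * cint R (\<lambda>x. wt R l (x $ 3) * (cmod (multiplier l x))\<^sup>2)
      + 2 * cint R (\<lambda>x. wt R l (x $ 3) * (cmod (W ez x - (l * pz R (x $ 3)) *\<^sub>R W 0 x))\<^sup>2)
      + 2 * l\<^sup>2 * cint R (\<lambda>x. wt R l (x $ 3) * ((pz R (x $ 3))\<^sup>2 * (cmod (W 0 x))\<^sup>2))
      + (cint R (\<lambda>x. q x * (W ez x \<bullet> W 0 x)) + (1 / 2) * cint R (\<lambda>x. q1 x * (cmod (W 0 x))\<^sup>2))"
    unfolding e using i1 i2 i3 i4 i5
    by (simp only: Bochner_Integration.integral_add Bochner_Integration.integrable_add integral_mult_right_zero integrable_mult_right)
  with multiplier_lower_bound[of l] zero show ?thesis by linarith
qed

text \<open>The square of the multiplier on the left absorbs the multiplier from the inequality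
  \<open>\<Delta>w q \<le> l q\<^sup>2 + (\<Delta>w)\<^sup>2 / (4 l)\<close>, and the square of \<open>p w\<close> remains, which is the first claim since \<open>p \<ge> R\<close>.
  For the second claim \<open>\<Delta>w\<close> is paired with \<open>w\<close>; differentiating the weight twice produces \<open>l\<^sup>2 p\<^sup>2 w\<^sup>2\<close>,
  which has just been bounded.\<close>

theorem Carleman_estimate:
  assumes l: "l \<ge> 1"
  shows "8 * l ^ 3 * R\<^sup>2 * cint R (\<lambda>x. wt R l (x $ 3) * (cmod (W 0 x))\<^sup>2) \<le> cint R (\<lambda>x. wt R l (x $ 3) * (cmod (lap x))\<^sup>2)"
    "l * cint R (\<lambda>x. wt R l (x $ 3) * (\<Sum>i\<in>UNIV. (cmod (W (axis i 1) x))\<^sup>2))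
      \<le> (1 + 1 / R\<^sup>2) * cint R (\<lambda>x. wt R l (x $ 3) * (cmod (lap x))\<^sup>2)"
proof -
  let ?I = "\<lambda>f. cint R (\<lambda>x. wt R l (x $ 3) * f x)"
  define F where "F = ?I (\<lambda>x. (cmod (lap x))\<^sup>2)"
  define B where "B = ?I (\<lambda>x. (cmod (multiplier l x))\<^sup>2)"
  define P where "P = ?I (\<lambda>x. (pz R (x $ 3))\<^sup>2 * (cmod (W 0 x))\<^sup>2)"
  define V where "V = ?I (\<lambda>x. (cmod (W ez x - (l * pz R (x $ 3)) *\<^sub>R W 0 x))\<^sup>2)"
  define E where "E = ?I (\<lambda>x. (cmod (W 0 x))\<^sup>2)"
  have w0: "wt R l z \<ge> 0" for z using wt_pos[of R l z] by simp
  have iF: "integrable (lebesgue_on (cube R)) (\<lambda>x. wt R l (x $ 3) * (cmod (lap x))\<^sup>2)"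
    by (rule wt_sq_integrable[OF lap_L2])
  have iB: "integrable (lebesgue_on (cube R)) (\<lambda>x. wt R l (x $ 3) * (cmod (multiplier l x))\<^sup>2)"
    by (rule wt_sq_integrable[OF multiplier_L2])
  have iE: "integrable (lebesgue_on (cube R)) (\<lambda>x. wt R l (x $ 3) * (cmod (W 0 x))\<^sup>2)"
    by (rule wt_sq_integrable[OF W_L2]) simp
  have iP: "integrable (lebesgue_on (cube R)) (\<lambda>x. wt R l (x $ 3) * ((pz R (x $ 3))\<^sup>2 * (cmod (W 0 x))\<^sup>2))"
    using W_sq_integrable[OF _ Cinf_wt_pz[of R l 2], of 0] by (simp add: mult.assoc)
  have V0: "V \<ge> 0" unfolding V_def by (intro Bochner_Integration.integral_nonneg mult_nonneg_nonneg w0) simp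
  have up: "?I (\<lambda>x. lap x \<bullet> multiplier l x) \<le> l * B + (1 / (4 * l)) * F"
  proof -
    have "?I (\<lambda>x. lap x \<bullet> multiplier l x)
        \<le> cint R (\<lambda>x. l * (wt R l (x $ 3) * (cmod (multiplier l x))\<^sup>2) + (1 / (4 * l)) * (wt R l (x $ 3) * (cmod (lap x))\<^sup>2))"
    proof (rule integral_mono[OF wt_mult_integrable[OF lap_L2 multiplier_L2]])
      show "integrable (lebesgue_on (cube R)) (\<lambda>x. l * (wt R l (x $ 3) * (cmod (multiplier l x))\<^sup>2) + (1 / (4 * l)) * (wt R l (x $ 3) * (cmod (lap x))\<^sup>2))"
        using iF iB by (intro Bochner_Integration.integrable_add integrable_mult_right)
      fix x :: "real^3"
      have "0 \<le> (cmod (lap x + (- 2 * l) *\<^sub>R multiplier l x))\<^sup>2" by simp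
      also have "\<dots> = (cmod (lap x))\<^sup>2 - 4 * l * (lap x \<bullet> multiplier l x) + 4 * l\<^sup>2 * (cmod (multiplier l x))\<^sup>2"
        unfolding norm_add_scaleR_sq by (simp add: power_mult_distrib)
      finally have "lap x \<bullet> multiplier l x \<le> l * (cmod (multiplier l x))\<^sup>2 + (1 / (4 * l)) * (cmod (lap x))\<^sup>2"
        using l by (simp add: field_simps power2_eq_square)
      from mult_left_mono[OF this w0[of "x $ 3"]]
      show "wt R l (x $ 3) * (lap x \<bullet> multiplier l x) \<le> l * (wt R l (x $ 3) * (cmod (multiplier l x))\<^sup>2) + (1 / (4 * l)) * (wt R l (x $ 3) * (cmod (lap x))\<^sup>2)"
        by (simp add: algebra_simps)
    qed
    also have "\<dots> = l * B + (1 / (4 * l)) * F"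
      unfolding B_def F_def using iF iB
      by (simp only: Bochner_Integration.integral_add integral_mult_right_zero integrable_mult_right)
    finally show ?thesis .
  qed
  have "l * B + 2 * V + 2 * l\<^sup>2 * P \<le> ?I (\<lambda>x. lap x \<bullet> multiplier l x)"
    using multiplier_squares[of l] by (simp add: B_def V_def P_def)
  with up V0 have lP: "2 * l\<^sup>2 * P \<le> (1 / (4 * l)) * F" by linarith
  have PE: "R\<^sup>2 * E \<le> P"
  proof -
    have "R\<^sup>2 * E = cint R (\<lambda>x. R\<^sup>2 * (wt R l (x $ 3) * (cmod (W 0 x))\<^sup>2))"
      unfolding E_def by (rule integral_mult_right_zero[symmetric])
    also have "\<dots> \<le> P"
      unfolding P_def
    proof (rule integral_mono[OF integrable_mult_right[OF iE] iP])
      fix x assume "x \<in> space (lebesgue_on (cube R))"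
      then have "x \<in> ccube R" using cube_subset_ccube[of R] by (auto simp: space_restrict_space)
      then have "R\<^sup>2 \<le> (pz R (x $ 3))\<^sup>2" using pz_bounds R by (intro power_mono) auto
      then have "R\<^sup>2 * (wt R l (x $ 3) * (cmod (W 0 x))\<^sup>2) \<le> (pz R (x $ 3))\<^sup>2 * (wt R l (x $ 3) * (cmod (W 0 x))\<^sup>2)"
        by (intro mult_right_mono mult_nonneg_nonneg w0) auto
      then show "R\<^sup>2 * (wt R l (x $ 3) * (cmod (W 0 x))\<^sup>2) \<le> wt R l (x $ 3) * ((pz R (x $ 3))\<^sup>2 * (cmod (W 0 x))\<^sup>2)"
        by (simp add: mult_ac)
    qed
    finally show ?thesis .
  qed
  have "2 * l\<^sup>2 * (R\<^sup>2 * E) \<le> (1 / (4 * l)) * F"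
    using lP mult_left_mono[OF PE, of "2 * l\<^sup>2"] by simp
  from mult_left_mono[OF this, of "4 * l"] l have EF: "8 * l ^ 3 * R\<^sup>2 * E \<le> F"
    by (simp add: power2_eq_square power3_eq_cube mult_ac)
  then show "8 * l ^ 3 * R\<^sup>2 * cint R (\<lambda>x. wt R l (x $ 3) * (cmod (W 0 x))\<^sup>2) \<le> cint R (\<lambda>x. wt R l (x $ 3) * (cmod (lap x))\<^sup>2)"
    by (simp add: E_def F_def)
  have F0: "F \<ge> 0" unfolding F_def by (intro Bochner_Integration.integral_nonneg mult_nonneg_nonneg w0) simp
  have E0: "E \<ge> 0" unfolding E_def by (intro Bochner_Integration.integral_nonneg mult_nonneg_nonneg w0) simp
  define D where "D = (\<lambda>i. ?I (\<lambda>x. (cmod (W (axis i 1) x))\<^sup>2))"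
  have iD: "integrable (lebesgue_on (cube R)) (\<lambda>x. wt R l (x $ 3) * (cmod (W (axis i 1) x))\<^sup>2)" for i
    by (rule wt_sq_integrable[OF W_L2]) simp
  have sD: "?I (\<lambda>x. \<Sum>i\<in>UNIV. (cmod (W (axis i 1) x))\<^sup>2) = D 1 + D 2 + D 3"
    unfolding D_def sum_3 distrib_left using iD by simp
  define g2 where "g2 = (\<lambda>x::real^3. wt R l (x $ 3) * (4 * l\<^sup>2 * (pz R (x $ 3))\<^sup>2 + 2 * l))"
  have dd: "dir i (dir i (\<lambda>x. wt R l (x $ 3))) x = (if i = 3 then g2 x else 0)" for i x
  proof -
    have d: "dir i (\<lambda>x. wt R l (x $ 3)) = (\<lambda>x. if i = 3 then - 2 * l * (wt R l (x $ 3) * pz R (x $ 3)) else 0)" for i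
      by (rule ext, subst dir_fun_coord3[OF wt_deriv]) simp
    have "((\<lambda>z. - 2 * l * (wt R l z * pz R z)) has_real_derivative - 2 * l * (wt R l (x $ 3) * (- 2 * l * (pz R (x $ 3))\<^sup>2 - 1))) (at (x $ 3))"
      by (intro DERIV_cmult wt_pz_deriv)
    from dir_fun_coord3[OF this, of 3] have "dir 3 (\<lambda>x. - 2 * l * (wt R l (x $ 3) * pz R (x $ 3))) x = g2 x"
      by (simp add: g2_def algebra_simps power2_eq_square)
    then show ?thesis unfolding d by (simp add: dir_const)
  qed
  have s: "?I (\<lambda>x. W (axis i 1 + axis i 1) x \<bullet> W 0 x) = - D i + (1 / 2) * cint R (\<lambda>x. (if i = 3 then g2 x else 0) * (cmod (W 0 x))\<^sup>2)" for i
    using second_with_zeroth[OF Cinf_wt, of R l i] unfolding dd D_def .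
  have g2P: "cint R (\<lambda>x. g2 x * (cmod (W 0 x))\<^sup>2) = 4 * l\<^sup>2 * P + 2 * l * E"
  proof -
    have "cint R (\<lambda>x. g2 x * (cmod (W 0 x))\<^sup>2) = cint R (\<lambda>x. 4 * l\<^sup>2 * (wt R l (x $ 3) * ((pz R (x $ 3))\<^sup>2 * (cmod (W 0 x))\<^sup>2)) + 2 * l * (wt R l (x $ 3) * (cmod (W 0 x))\<^sup>2))"
      by (intro Bochner_Integration.integral_cong refl) (simp add: g2_def algebra_simps)
    also have "\<dots> = 4 * l\<^sup>2 * P + 2 * l * E"
      unfolding P_def E_def using iP iE
      by (simp only: Bochner_Integration.integral_add integral_mult_right_zero integrable_mult_right)
    finally show ?thesis .
  qed
  have lapW: "?I (\<lambda>x. lap x \<bullet> W 0 x) = - (D 1 + D 2 + D 3) + 2 * l\<^sup>2 * P + l * E"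
  proof -
    have "?I (\<lambda>x. lap x \<bullet> W 0 x) = ?I (\<lambda>x. W (ex + ex) x \<bullet> W 0 x) + ?I (\<lambda>x. W (ey + ey) x \<bullet> W 0 x) + ?I (\<lambda>x. W (ez + ez) x \<bullet> W 0 x)"
      unfolding lap_def inner_add_left distrib_left
      using wt_mult_integrable[OF W_L2 W_L2, of _ 0 l] by simp
    then show ?thesis using s[of 1] s[of 2] s[of 3] g2P by simp
  qed
  have low: "- ?I (\<lambda>x. lap x \<bullet> W 0 x) \<le> (1 / (4 * l)) * F + l * E"
  proof -
    have "- ?I (\<lambda>x. lap x \<bullet> W 0 x) = cint R (\<lambda>x. - (wt R l (x $ 3) * (lap x \<bullet> W 0 x)))" by simp
    also have "\<dots> \<le> cint R (\<lambda>x. (1 / (4 * l)) * (wt R l (x $ 3) * (cmod (lap x))\<^sup>2) + l * (wt R l (x $ 3) * (cmod (W 0 x))\<^sup>2))"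
    proof (rule integral_mono)
      show "integrable (lebesgue_on (cube R)) (\<lambda>x. - (wt R l (x $ 3) * (lap x \<bullet> W 0 x)))"
        using wt_mult_integrable[OF lap_L2 W_L2, of 0 l] by simp
      show "integrable (lebesgue_on (cube R)) (\<lambda>x. (1 / (4 * l)) * (wt R l (x $ 3) * (cmod (lap x))\<^sup>2) + l * (wt R l (x $ 3) * (cmod (W 0 x))\<^sup>2))"
        using iF iE by (intro Bochner_Integration.integrable_add integrable_mult_right)
      fix x :: "real^3"
      have "0 \<le> (cmod (lap x + (2 * l) *\<^sub>R W 0 x))\<^sup>2" by simp
      also have "\<dots> = (cmod (lap x))\<^sup>2 + 4 * l * (lap x \<bullet> W 0 x) + 4 * l\<^sup>2 * (cmod (W 0 x))\<^sup>2"
        unfolding norm_add_scaleR_sq by (simp add: power_mult_distrib)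
      finally have "- (lap x \<bullet> W 0 x) \<le> (1 / (4 * l)) * (cmod (lap x))\<^sup>2 + l * (cmod (W 0 x))\<^sup>2"
        using l by (simp add: field_simps power2_eq_square)
      from mult_left_mono[OF this w0[of "x $ 3"]]
      show "- (wt R l (x $ 3) * (lap x \<bullet> W 0 x)) \<le> (1 / (4 * l)) * (wt R l (x $ 3) * (cmod (lap x))\<^sup>2) + l * (wt R l (x $ 3) * (cmod (W 0 x))\<^sup>2)"
        by (simp add: algebra_simps)
    qed
    also have "\<dots> = (1 / (4 * l)) * F + l * E"
      unfolding E_def F_def using iF iE
      by (simp only: Bochner_Integration.integral_add integral_mult_right_zero integrable_mult_right)
    finally show ?thesis .
  qed
  have "D 1 + D 2 + D 3 \<le> (1 / (4 * l)) * F + (1 / (4 * l)) * F + 2 * l * E"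
    using lapW low lP by linarith
  from mult_left_mono[OF this, of l] have "l * (D 1 + D 2 + D 3) \<le> l * ((1 / (4 * l)) * F + (1 / (4 * l)) * F + 2 * l * E)"
    using l by simp
  also have "\<dots> = l * ((1 / (4 * l)) * F) + l * ((1 / (4 * l)) * F) + 2 * l\<^sup>2 * E"
    by (simp only: distrib_left power2_eq_square mult_ac)
  also have "l * ((1 / (4 * l)) * F) = F / 4" using l by simp
  also have "F / 4 + F / 4 + 2 * l\<^sup>2 * E = F / 2 + 2 * l\<^sup>2 * E" by simp
  also have "2 * l\<^sup>2 * E \<le> F / R\<^sup>2"
  proof -
    have "8 * l\<^sup>2 * 1 * R\<^sup>2 * E \<le> 8 * l\<^sup>2 * l * R\<^sup>2 * E"
      using l E0 by (intro mult_right_mono mult_left_mono) auto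
    also have "\<dots> \<le> F" using EF by (simp add: power2_eq_square power3_eq_cube mult_ac)
    finally have "8 * l\<^sup>2 * R\<^sup>2 * E \<le> F" by simp
    moreover have "0 \<le> l\<^sup>2 * R\<^sup>2 * E" using E0 by simp
    ultimately have "(2 * l\<^sup>2 * E) * R\<^sup>2 \<le> F" by (simp add: mult_ac)
    then show ?thesis using R by (simp add: pos_le_divide_eq)
  qed
  finally have "l * (D 1 + D 2 + D 3) \<le> F / 2 + F / R\<^sup>2" by simp
  then show "l * cint R (\<lambda>x. wt R l (x $ 3) * (\<Sum>i\<in>UNIV. (cmod (W (axis i 1) x))\<^sup>2))
      \<le> (1 + 1 / R\<^sup>2) * cint R (\<lambda>x. wt R l (x $ 3) * (cmod (lap x))\<^sup>2)"
    using F0 unfolding sD F_def[symmetric] by (simp add: algebra_simps)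
qed

end

section \<open>The Sobolev embedding of order two\<close>

lemma L1_le_L2_cube:
  assumes "f \<in> L2 (cube R)"
  shows "(LINT x|lebesgue_on (cube R). cmod (f x)) \<le> L2_norm (cube R) f * L2_norm (cube R) (\<lambda>x. 1)"
proof -
  have o: "(\<lambda>x. 1) \<in> L2 (cube R)" by (rule continuous_L2_cube) simp
  have c: "(\<lambda>x. complex_of_real (cmod (f x))) \<in> L2 (cube R)"
    using assms L2_measurable[OF assms] by (auto simp: L2_def)
  have n: "L2_norm (cube R) (\<lambda>x. complex_of_real (cmod (f x))) = L2_norm (cube R) f" by (simp add: L2_norm_def)
  have "\<bar>LINT x|lebesgue_on (cube R). complex_of_real (cmod (f x)) \<bullet> 1\<bar> \<le> L2_norm (cube R) f * L2_norm (cube R) (\<lambda>x. 1)"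
    using L2_Cauchy_Schwarz[OF c o] unfolding n .
  then show ?thesis by (simp add: inner_complex_def)
qed

lemma nn_integral_cube_continuous:
  fixes f :: "real^3 \<Rightarrow> real"
  assumes f: "continuous_on UNIV f" "\<And>x. f x \<ge> 0"
  shows "ennreal (cint R f) = (\<integral>\<^sup>+x. ennreal (f x) * indicator (cube R) x \<partial>lborel)"
proof -
  have m [measurable]: "f \<in> borel_measurable borel" by (rule borel_measurable_continuous_onI[OF f(1)])
  have "ennreal (cint R f) = (\<integral>\<^sup>+x. ennreal (f x) \<partial>lebesgue_on (cube R))"
    using f continuous_on_subset[OF f(1)] by (intro nn_integral_eq_integral[symmetric] continuous_integrable_cube) auto
  also have "\<dots> = (\<integral>\<^sup>+x. ennreal (f x) * indicator (cube R) x \<partial>lebesgue)"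
    by (rule nn_integral_lebesgue_on) simp
  also have "\<dots> = (\<integral>\<^sup>+x. ennreal (f x) * indicator (cube R) x \<partial>lborel)"
    by (rule nn_integral_completion)
  finally show ?thesis .
qed

lemma cube_segment:
  assumes "x \<in> ccube R" "y \<in> cube R" "0 < t" "t \<le> 1" shows "x + t *\<^sub>R (y - x) \<in> cube R"
  unfolding mem_cube
proof
  fix i
  have 1: "\<bar>x $ i\<bar> \<le> R" "\<bar>y $ i\<bar> < R" using assms by (auto simp: mem_ccube mem_cube)
  have "(x + t *\<^sub>R (y - x)) $ i = (1 - t) * x $ i + t * y $ i" by (simp add: algebra_simps)
  also have "\<bar>\<dots>\<bar> \<le> (1 - t) * \<bar>x $ i\<bar> + t * \<bar>y $ i\<bar>"
    using assms abs_triangle_ineq[of "(1 - t) * x $ i" "t * y $ i"] by (simp add: abs_mult)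
  also have "\<dots> \<le> (1 - t) * R + t * \<bar>y $ i\<bar>" using assms 1 by (intro add_right_mono mult_left_mono) auto
  also have "\<dots> < (1 - t) * R + t * R" using assms 1 by (intro add_strict_left_mono mult_strict_left_mono) auto
  finally show "\<bar>(x + t *\<^sub>R (y - x)) $ i\<bar> < R" by (simp add: algebra_simps)
qed

lemma shrink_continuous: "continuous_on UNIV f \<Longrightarrow> continuous_on S (\<lambda>y. f (x + t *\<^sub>R (y - x)))"
  for f :: "real^3 \<Rightarrow> 'b::topological_space"
  by (rule continuous_on_compose2[of UNIV f])
    (auto intro!: continuous_on_add continuous_on_scaleR continuous_on_diff continuous_on_const continuous_on_id)

text \<open>The substitution maps the cube into itself, with volume scaled by \<open>t\<^sup>3\<close>.\<close>

lemma shrunk_cube_integral_le: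
  fixes f :: "real^3 \<Rightarrow> real"
  assumes f: "continuous_on UNIV f" "\<And>x. f x \<ge> 0" and x: "x \<in> ccube R" and t: "0 < t" "t \<le> 1"
  shows "cint R (\<lambda>y. f (x + t *\<^sub>R (y - x))) \<le> cint R f / t ^ 3"
proof -
  have m [measurable]: "f \<in> borel_measurable borel" by (rule borel_measurable_continuous_onI[OF f(1)])
  have c [measurable]: "cube R \<in> sets borel" by simp
  define F where "F = (\<lambda>y. ennreal (f y) * indicator (cube R) y)"
  have Fm [measurable]: "F \<in> borel_measurable borel" unfolding F_def by measurable
  have i0: "cint R f \<ge> 0" using f by (intro Bochner_Integration.integral_nonneg) auto
  have "ennreal (t ^ 3) * ennreal (cint R (\<lambda>y. f (x + t *\<^sub>R (y - x))))
      = ennreal (t ^ 3) * (\<integral>\<^sup>+y. ennreal (f (x + t *\<^sub>R (y - x))) * indicator (cube R) y \<partial>lborel)"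
    by (subst nn_integral_cube_continuous) (use f shrink_continuous[OF f(1)] in auto)
  also have "\<dots> \<le> ennreal (t ^ 3) * (\<integral>\<^sup>+y. F ((x - t *\<^sub>R x) + t *\<^sub>R y) \<partial>lborel)"
  proof (intro mult_left_mono nn_integral_mono)
    fix y :: "real^3"
    have e: "x + t *\<^sub>R (y - x) = (x - t *\<^sub>R x) + t *\<^sub>R y" by (simp add: algebra_simps)
    show "ennreal (f (x + t *\<^sub>R (y - x))) * indicator (cube R) y \<le> F ((x - t *\<^sub>R x) + t *\<^sub>R y)"
      unfolding F_def e[symmetric] using cube_segment[OF x _ t, of y] by (auto simp: indicator_def)
  qed simp
  also have "\<dots> = (\<integral>\<^sup>+y. F y \<partial>lborel)"
    using nn_integral_affine3[OF Fm, of t "x - t *\<^sub>R x"] t by simp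
  also have "\<dots> = ennreal (cint R f)" unfolding F_def by (rule nn_integral_cube_continuous[symmetric, OF f])
  finally have "ennreal (t ^ 3 * cint R (\<lambda>y. f (x + t *\<^sub>R (y - x)))) \<le> ennreal (cint R f)"
    using t by (subst ennreal_mult') auto
  then have "t ^ 3 * cint R (\<lambda>y. f (x + t *\<^sub>R (y - x))) \<le> cint R f"
    using i0 by (subst (asm) ennreal_le_iff) auto
  then show ?thesis using t by (simp add: pos_le_divide_eq mult.commute)
qed

text \<open>The embedding in three dimensions, by averaging Taylor's formula along the rays from \<open>x\<close> over
  the cube.  Let \<open>m t\<close> be the integral of \<open>g (x + t (y - x))\<close> over \<open>y\<close> in the cube.  The derivative
  of \<open>m - t m'\<close> is \<open>- t m''\<close>; as \<open>m''\<close> is \<open>O(t\<^sup>-\<^sup>3\<^sup>/\<^sup>2)\<close> by the Cauchy-Schwarz inequality and a change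
  of variables, this is integrable at \<open>0\<close>.\<close>

lemma Sobolev_sup_smooth:
  fixes g :: "real^3 \<Rightarrow> complex"
  assumes R: "R > 0" and g: "Cinf g" and x: "x \<in> ccube R"
  defines "\<kappa> \<equiv> L2_norm (cube R) (\<lambda>x. 1)"
  shows "cint R (\<lambda>x. 1) * cmod (g x) \<le> \<kappa> * (L2_norm (cube R) g + 2 * R * (\<Sum>i\<in>UNIV. L2_norm (cube R) (dir i g))
     + 8 * R\<^sup>2 * (\<Sum>i\<in>UNIV. \<Sum>j\<in>UNIV. L2_norm (cube R) (dir j (dir i g))))"
proof -
  let ?C = "ccube R"
  have k0: "\<kappa> \<ge> 0" unfolding \<kappa>_def by (rule L2_norm_nonneg)
  define f where "f = (\<lambda>t y. g (x + t *\<^sub>R (y - x)))"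
  define f1 where "f1 = (\<lambda>t y. \<Sum>i\<in>UNIV. (y - x) $ i *\<^sub>R dir i g (x + t *\<^sub>R (y - x)))"
  define f2 where "f2 = (\<lambda>t y. \<Sum>i\<in>UNIV. (y - x) $ i *\<^sub>R (\<Sum>j\<in>UNIV. (y - x) $ j *\<^sub>R dir j (dir i g) (x + t *\<^sub>R (y - x))))"
  define m where "m = (\<lambda>t. integral ?C (f t))"
  define m1 where "m1 = (\<lambda>t. integral ?C (f1 t))"
  define m2 where "m2 = (\<lambda>t. integral ?C (f2 t))"
  have ray: "((\<lambda>t. b (x + t *\<^sub>R (y - x))) has_vector_derivative (\<Sum>i\<in>UNIV. (y - x) $ i *\<^sub>R dir i b (x + t *\<^sub>R (y - x)))) (at t within S)"
    if b: "Cinf b" for b :: "real^3 \<Rightarrow> complex" and y t S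
  proof -
    have d1: "((\<lambda>t. x + t *\<^sub>R (y - x)) has_derivative (\<lambda>h. h *\<^sub>R (y - x))) (at t within S)"
      by (auto intro!: derivative_eq_intros)
    have d2: "(b has_derivative (\<lambda>h. \<Sum>i\<in>UNIV. h $ i *\<^sub>R dir i b (x + t *\<^sub>R (y - x)))) (at (x + t *\<^sub>R (y - x)))"
      by (rule differentiable_has_derivative_dir[OF Cinf_differentiable[OF b]])
    have "((\<lambda>t. b (x + t *\<^sub>R (y - x))) has_derivative (\<lambda>h. \<Sum>i\<in>UNIV. (h *\<^sub>R (y - x)) $ i *\<^sub>R dir i b (x + t *\<^sub>R (y - x)))) (at t within S)"
      by (rule has_derivative_compose[OF d1 d2])
    then show ?thesis by (simp add: has_vector_derivative_def scaleR_sum_right)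
  qed
  have cg: "continuous_on S (\<lambda>p. b (x + fst p *\<^sub>R (snd p - x)))" if b: "Cinf b" for b :: "real^3 \<Rightarrow> complex" and S
    by (rule continuous_on_compose2[OF Cinf_continuous[OF b, of UNIV]])
      (auto intro!: continuous_on_add continuous_on_scaleR continuous_on_diff continuous_on_const continuous_on_fst continuous_on_snd continuous_on_id)
  have cc: "continuous_on S (\<lambda>p. (snd p - x) $ i)" for S :: "(real \<times> (real^3)) set" and i
    by (intro continuous_on_component continuous_on_diff continuous_on_const continuous_on_snd continuous_on_id)
  have cf: "continuous_on S (\<lambda>p. f (fst p) (snd p))" for S unfolding f_def by (rule cg[OF g])
  have cf1: "continuous_on S (\<lambda>p. f1 (fst p) (snd p))" for S
    unfolding f1_def by (intro continuous_on_sum continuous_on_scaleR cc cg Cinf_dir g)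
  have cf2: "continuous_on S (\<lambda>p. f2 (fst p) (snd p))" for S
    unfolding f2_def by (intro continuous_on_sum continuous_on_scaleR cc cg Cinf_dir g)
  have sec: "continuous_on ?C (\<lambda>y. F t y)" if "\<And>S. continuous_on S (\<lambda>p. F (fst p) (snd p))" for F :: "real \<Rightarrow> real^3 \<Rightarrow> complex" and t
    using continuous_on_compose2[OF that[of UNIV], of ?C "\<lambda>y. (t, y)"] by (simp add: continuous_on_Pair)
  have dm: "(m has_vector_derivative m1 t) (at t)" for t
    unfolding m_def m1_def
  proof (rule leibniz_rule_vector_derivative[where U = UNIV])
    show "((\<lambda>t. f t y) has_vector_derivative f1 t y) (at t within UNIV)" for t y unfolding f_def f1_def by (rule ray[OF g])
    show "f t integrable_on ?C" for t using integrable_continuous[OF sec[OF cf]] .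
    show "continuous_on (UNIV \<times> ?C) (\<lambda>(t, y). f1 t y)" unfolding split_def by (rule cf1)
  qed auto
  have dm1: "(m1 has_vector_derivative m2 t) (at t)" for t
    unfolding m1_def m2_def
  proof (rule leibniz_rule_vector_derivative[where U = UNIV])
    show "((\<lambda>t. f1 t y) has_vector_derivative f2 t y) (at t within UNIV)" for t y
      unfolding f1_def f2_def
      by (intro has_vector_derivative_sum bounded_linear.has_vector_derivative[OF bounded_linear_scaleR_right] ray Cinf_dir g)
    show "f1 t integrable_on ?C" for t using integrable_continuous[OF sec[OF cf1]] .
    show "continuous_on (UNIV \<times> ?C) (\<lambda>(t, y). f2 t y)" unfolding split_def by (rule cf2)
  qed auto
  define N where "N = (\<Sum>i\<in>UNIV. \<Sum>j\<in>UNIV. L2_norm (cube R) (dir j (dir i g)))"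
  have yx: "\<bar>(y - x) $ i\<bar> \<le> 2 * R" if "y \<in> cube R" for y i
  proof -
    have "\<bar>y $ i\<bar> < R" "\<bar>x $ i\<bar> \<le> R" using that x by (auto simp: mem_cube mem_ccube)
    then show ?thesis by simp
  qed
  have L2s: "L2_norm (cube R) (\<lambda>y. b (x + t *\<^sub>R (y - x))) \<le> L2_norm (cube R) b * t powr (- 3 / 2)"
    if b: "Cinf b" and t: "0 < t" "t \<le> 1" for b :: "real^3 \<Rightarrow> complex" and t
  proof -
    have "(L2_norm (cube R) (\<lambda>y. b (x + t *\<^sub>R (y - x))))\<^sup>2 \<le> cint R (\<lambda>y. (cmod (b y))\<^sup>2) / t ^ 3"
      unfolding L2_norm_sq
      by (rule shrunk_cube_integral_le[of "\<lambda>y. (cmod (b y))\<^sup>2", OF _ _ x t])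
        (auto intro!: continuous_on_power continuous_on_norm Cinf_continuous[OF b])
    also have "\<dots> = (L2_norm (cube R) b * t powr (- 3 / 2))\<^sup>2"
    proof -
      have "(t powr (- 3 / 2))\<^sup>2 = t powr (- 3)" unfolding power2_eq_square powr_add[symmetric] by simp
      also have "\<dots> = 1 / t ^ 3" using t by (simp add: powr_minus powr_numeral divide_inverse)
      finally show ?thesis by (simp add: power_mult_distrib L2_norm_sq)
    qed
    finally show ?thesis by (rule power2_le_imp_le) (simp add: L2_norm_nonneg)
  qed
  have shL2: "(\<lambda>y. b (x + t *\<^sub>R (y - x))) \<in> L2 (cube R)" if b: "Cinf b" for b :: "real^3 \<Rightarrow> complex" and t
    by (intro continuous_L2_cube shrink_continuous Cinf_continuous b)
  have b2: "cmod (m2 t) \<le> 4 * R\<^sup>2 * \<kappa> * N * t powr (- 3 / 2)" if t: "0 < t" "t \<le> 1" for t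
  proof -
    have "m2 t = (LINT y|lebesgue_on (cube R). f2 t y)"
      unfolding m2_def by (rule integral_cube_eq_ccube[symmetric, OF sec[OF cf2]])
    also have "cmod \<dots> \<le> (LINT y|lebesgue_on (cube R). (\<Sum>i\<in>UNIV. \<Sum>j\<in>UNIV. 4 * R\<^sup>2 * cmod (dir j (dir i g) (x + t *\<^sub>R (y - x)))))"
    proof (rule order_trans[OF integral_norm_bound integral_mono])
      show "integrable (lebesgue_on (cube R)) (\<lambda>y. cmod (f2 t y))"
        by (intro integrable_norm continuous_integrable_cube sec[OF cf2])
      show "integrable (lebesgue_on (cube R)) (\<lambda>y. \<Sum>i\<in>UNIV. \<Sum>j\<in>UNIV. 4 * R\<^sup>2 * cmod (dir j (dir i g) (x + t *\<^sub>R (y - x))))"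
        by (intro Bochner_Integration.integrable_sum integrable_mult_right integrable_norm L2_cube_integrable shL2 Cinf_dir g)
      fix y assume "y \<in> space (lebesgue_on (cube R))"
      then have y: "y \<in> cube R" by (simp add: space_restrict_space)
      show "cmod (f2 t y) \<le> (\<Sum>i\<in>UNIV. \<Sum>j\<in>UNIV. 4 * R\<^sup>2 * cmod (dir j (dir i g) (x + t *\<^sub>R (y - x))))"
        unfolding f2_def scaleR_sum_right
      proof (intro order_trans[OF norm_sum] sum_mono)
        fix i j
        have "\<bar>(y - x) $ i\<bar> * \<bar>(y - x) $ j\<bar> \<le> (2 * R) * (2 * R)" using yx[OF y] R by (intro mult_mono) auto
        then have "(\<bar>(y - x) $ i\<bar> * \<bar>(y - x) $ j\<bar>) * cmod (dir j (dir i g) (x + t *\<^sub>R (y - x)))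
            \<le> (4 * R\<^sup>2) * cmod (dir j (dir i g) (x + t *\<^sub>R (y - x)))"
          by (intro mult_right_mono) (auto simp: power2_eq_square)
        then show "cmod ((y - x) $ i *\<^sub>R (y - x) $ j *\<^sub>R dir j (dir i g) (x + t *\<^sub>R (y - x)))
            \<le> 4 * R\<^sup>2 * cmod (dir j (dir i g) (x + t *\<^sub>R (y - x)))"
          by (simp only: norm_scaleR mult.assoc)
      qed
    qed
    also have "\<dots> = (\<Sum>i\<in>UNIV. \<Sum>j\<in>UNIV. 4 * R\<^sup>2 * (LINT y|lebesgue_on (cube R). cmod (dir j (dir i g) (x + t *\<^sub>R (y - x)))))"
      using integrable_norm[OF L2_cube_integrable[OF shL2[OF Cinf_dir[OF Cinf_dir[OF g]]]]]
      by (subst Bochner_Integration.integral_sum, (intro Bochner_Integration.integrable_sum integrable_mult_right, simp),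
          subst Bochner_Integration.integral_sum, (intro integrable_mult_right, simp)) simp
    also have "\<dots> \<le> (\<Sum>i\<in>UNIV. \<Sum>j\<in>UNIV. 4 * R\<^sup>2 * (L2_norm (cube R) (dir j (dir i g)) * t powr (- 3 / 2) * \<kappa>))"
    proof (intro sum_mono mult_left_mono)
      fix i j
      have "(LINT y|lebesgue_on (cube R). cmod (dir j (dir i g) (x + t *\<^sub>R (y - x))))
          \<le> L2_norm (cube R) (\<lambda>y. dir j (dir i g) (x + t *\<^sub>R (y - x))) * \<kappa>"
        unfolding \<kappa>_def by (rule L1_le_L2_cube[OF shL2[OF Cinf_dir[OF Cinf_dir[OF g]]]])
      also have "\<dots> \<le> L2_norm (cube R) (dir j (dir i g)) * t powr (- 3 / 2) * \<kappa>"
        by (rule mult_right_mono[OF L2s[OF Cinf_dir[OF Cinf_dir[OF g]] t] k0])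
      finally show "(LINT y|lebesgue_on (cube R). cmod (dir j (dir i g) (x + t *\<^sub>R (y - x))))
          \<le> L2_norm (cube R) (dir j (dir i g)) * t powr (- 3 / 2) * \<kappa>" .
    qed simp
    also have "\<dots> = 4 * R\<^sup>2 * \<kappa> * N * t powr (- 3 / 2)"
      unfolding N_def by (simp add: sum_distrib_left sum_distrib_right mult_ac)
    finally show ?thesis .
  qed
  define Q where "Q = (\<lambda>t. m t - t *\<^sub>R m1 t)"
  have dQ: "(Q has_vector_derivative - (t *\<^sub>R m2 t)) (at t)" for t
  proof -
    have "((\<lambda>t. m t - t *\<^sub>R m1 t) has_vector_derivative m1 t - (t *\<^sub>R m2 t + 1 *\<^sub>R m1 t)) (at t)"
      by (intro has_vector_derivative_diff has_vector_derivative_scaleR dm dm1) (rule DERIV_ident)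
    then show ?thesis by (simp add: Q_def)
  qed
  \<comment> \<open>\<open>K / sqrt t\<close> dominates the derivative of \<open>Q\<close> for \<open>t > 0\<close>; at \<open>t = 0\<close> continuity is enough.\<close>
  define K where "K = 4 * R\<^sup>2 * \<kappa> * N"
  have QQ: "cmod (Q 1 - Q 0) \<le> 2 * K * sqrt 1 - 2 * K * sqrt 0"
  proof (rule differentiable_bound_general[where f' = "\<lambda>t. - (t *\<^sub>R m2 t)" and \<phi>' = "\<lambda>t. K / sqrt t"])
    show "continuous_on {0..1} Q"
      by (intro continuous_at_imp_continuous_on ballI has_vector_derivative_continuous[OF dQ])
    show "continuous_on {0..1} (\<lambda>t. 2 * K * sqrt t)" by (intro continuous_intros)
    show "(Q has_vector_derivative - (t *\<^sub>R m2 t)) (at t)" for t by (rule dQ)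
    show "((\<lambda>t. 2 * K * sqrt t) has_vector_derivative K / sqrt t) (at t)" if "0 < t" for t
      using that unfolding has_real_derivative_iff_has_vector_derivative[symmetric]
      by (auto intro!: derivative_eq_intros simp: field_simps)
    show "norm (- (t *\<^sub>R m2 t)) \<le> K / sqrt t" if t: "0 < t" "t < 1" for t
    proof -
      have "t * cmod (m2 t) \<le> t * (K * t powr (- 3 / 2))"
        using b2[of t] t by (intro mult_left_mono) (auto simp: K_def)
      also have "\<dots> = K * (t powr 1 * t powr (- 3 / 2))" using t by simp
      also have "t powr 1 * t powr (- 3 / 2) = t powr (- (1 / 2))" unfolding powr_add[symmetric] by simp
      also have "K * t powr (- (1 / 2)) = K / sqrt t"
        using t powr_half_sqrt[of t] by (simp only: powr_minus divide_inverse less_imp_le)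
      finally show ?thesis using t by simp
    qed
  qed simp
  have Q0: "Q 0 = cint R (\<lambda>x. 1) *\<^sub>R g x"
  proof -
    have "Q 0 = (LINT y|lebesgue_on (cube R). g x)"
      unfolding Q_def m_def f_def by (subst integral_cube_eq_ccube) simp_all
    also have "\<dots> = (LINT y|lebesgue_on (cube R). 1 *\<^sub>R g x)" by simp
    also have "\<dots> = cint R (\<lambda>x. 1) *\<^sub>R g x"
      by (rule integral_scaleR_left) (rule continuous_integrable_cube, simp)
    finally show ?thesis .
  qed
  have q1: "cmod (m 1) \<le> L2_norm (cube R) g * \<kappa>"
  proof -
    have "m 1 = (LINT y|lebesgue_on (cube R). g y)"
      using integral_cube_eq_ccube[OF Cinf_continuous[OF g], of R] unfolding m_def f_def by simp
    also have "cmod \<dots> \<le> (LINT y|lebesgue_on (cube R). cmod (g y))" by (rule integral_norm_bound)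
    also have "\<dots> \<le> L2_norm (cube R) g * \<kappa>" unfolding \<kappa>_def by (rule L1_le_L2_cube[OF Cinf_L2[OF g]])
    finally show ?thesis .
  qed
  have q2: "cmod (m1 1) \<le> (\<Sum>i\<in>UNIV. 2 * R * (L2_norm (cube R) (dir i g) * \<kappa>))"
  proof -
    have "m1 1 = (LINT y|lebesgue_on (cube R). f1 1 y)"
      unfolding m1_def by (rule integral_cube_eq_ccube[symmetric, OF sec[OF cf1]])
    also have "cmod \<dots> \<le> (LINT y|lebesgue_on (cube R). (\<Sum>i\<in>UNIV. 2 * R * cmod (dir i g y)))"
    proof (rule order_trans[OF integral_norm_bound integral_mono])
      show "integrable (lebesgue_on (cube R)) (\<lambda>y. cmod (f1 1 y))"
        by (intro integrable_norm continuous_integrable_cube sec[OF cf1])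
      show "integrable (lebesgue_on (cube R)) (\<lambda>y. \<Sum>i\<in>UNIV. 2 * R * cmod (dir i g y))"
        by (intro Bochner_Integration.integrable_sum integrable_mult_right integrable_norm L2_cube_integrable Cinf_L2 Cinf_dir g)
      fix y assume "y \<in> space (lebesgue_on (cube R))"
      then have y: "y \<in> cube R" by (simp add: space_restrict_space)
      have "cmod (f1 1 y) = cmod (\<Sum>i\<in>UNIV. (y - x) $ i *\<^sub>R dir i g y)" by (simp add: f1_def)
      also have "\<dots> \<le> (\<Sum>i\<in>UNIV. 2 * R * cmod (dir i g y))"
        using yx[OF y] by (intro order_trans[OF norm_sum] sum_mono) (simp only: norm_scaleR, intro mult_right_mono, auto)
      finally show "cmod (f1 1 y) \<le> (\<Sum>i\<in>UNIV. 2 * R * cmod (dir i g y))" .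
    qed
    also have "\<dots> = (\<Sum>i\<in>UNIV. 2 * R * (LINT y|lebesgue_on (cube R). cmod (dir i g y)))"
      using integrable_norm[OF L2_cube_integrable[OF Cinf_L2[OF Cinf_dir[OF g]]]]
      by (subst Bochner_Integration.integral_sum, (intro integrable_mult_right, simp)) simp
    also have "\<dots> \<le> (\<Sum>i\<in>UNIV. 2 * R * (L2_norm (cube R) (dir i g) * \<kappa>))"
      unfolding \<kappa>_def using R by (intro sum_mono mult_left_mono L1_le_L2_cube Cinf_L2 Cinf_dir g) simp
    finally show ?thesis .
  qed
  have i1: "cint R (\<lambda>x. 1) \<ge> 0" by (rule Bochner_Integration.integral_nonneg) simp
  have "cint R (\<lambda>x. 1) * cmod (g x) = cmod (Q 0)" using i1 by (simp add: Q0)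
  also have "\<dots> \<le> cmod (Q 1) + cmod (Q 1 - Q 0)" using norm_triangle_sub[of "Q 0" "Q 1"] by (simp add: norm_minus_commute)
  also have "\<dots> \<le> (cmod (m 1) + cmod (m1 1)) + 2 * K"
    using QQ norm_triangle_ineq4[of "m 1" "m1 1"] by (simp add: Q_def)
  also have "\<dots> \<le> (L2_norm (cube R) g * \<kappa> + (\<Sum>i\<in>UNIV. 2 * R * (L2_norm (cube R) (dir i g) * \<kappa>))) + 2 * K"
    using q1 q2 by simp
  also have "\<dots> = \<kappa> * (L2_norm (cube R) g + 2 * R * (\<Sum>i\<in>UNIV. L2_norm (cube R) (dir i g)) + 8 * R\<^sup>2 * N)"
    by (simp add: K_def sum_distrib_left sum_distrib_right algebra_simps)
  finally show ?thesis unfolding N_def .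
qed

lemma L2_tendsto_AE_bound:
  assumes l: "L2_tendsto (cube R) u v" and b: "\<And>n x. x \<in> cube R \<Longrightarrow> cmod (u n x) \<le> c n" and c: "c \<longlonglongrightarrow> c0"
  shows "AE x in lebesgue_on (cube R). cmod (v x) \<le> c0"
proof -
  note L = L2_tendsto_L2[OF l]
  have "(\<lambda>n. (L2_norm (cube R) (\<lambda>x. u n x - v x))\<^sup>2) \<longlonglongrightarrow> 0\<^sup>2"
    using l by (intro tendsto_power) (auto simp: L2_tendsto_def)
  then have "(\<lambda>n. LINT x|lebesgue_on (cube R). norm ((cmod (u n x - v x))\<^sup>2)) \<longlonglongrightarrow> 0"
    by (simp add: L2_norm_sq)
  from tendsto_L1_AE_subseq[OF L2_integrable[OF L2_diff[OF L]] this]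
  obtain r where r: "strict_mono r" and ae: "AE x in lebesgue_on (cube R). (\<lambda>n. (cmod (u (r n) x - v x))\<^sup>2) \<longlonglongrightarrow> 0"
    by blast
  have cr: "(\<lambda>n. c (r n)) \<longlonglongrightarrow> c0" using LIMSEQ_subseq_LIMSEQ[OF c r] by (simp add: o_def)
  show ?thesis
  proof (rule lebesgue_on_mono[OF ae])
    fix x assume a: "(\<lambda>n. (cmod (u (r n) x - v x))\<^sup>2) \<longlonglongrightarrow> 0" and x: "x \<in> cube R"
    have "(\<lambda>n. sqrt ((cmod (u (r n) x - v x))\<^sup>2)) \<longlonglongrightarrow> sqrt 0" by (rule tendsto_real_sqrt[OF a])
    then have "(\<lambda>n. cmod (u (r n) x - v x)) \<longlonglongrightarrow> 0" by simp
    then have "(\<lambda>n. c (r n) + cmod (u (r n) x - v x)) \<longlonglongrightarrow> c0 + 0" by (intro tendsto_add cr)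
    moreover have "cmod (v x) \<le> c (r n) + cmod (u (r n) x - v x)" for n
      using b[OF x, of "r n"] norm_triangle_sub[of "v x" "u (r n) x"] by (simp add: norm_minus_commute)
    ultimately show "cmod (v x) \<le> c0" by (intro LIMSEQ_le_const[of _ c0]) auto
  qed
qed

lemma finite_morder: "finite {\<beta> :: nat^3. morder \<beta> \<le> s}"
proof (rule finite_subset)
  show "{\<beta> :: nat^3. morder \<beta> \<le> s} \<subseteq> (\<lambda>(a, b, c). axis 1 a + axis 2 b + axis 3 c) ` ({..s} \<times> {..s} \<times> {..s})"
  proof
    fix \<beta> :: "nat^3" assume "\<beta> \<in> {\<beta>. morder \<beta> \<le> s}"
    then have "\<beta> $ 1 \<le> s" "\<beta> $ 2 \<le> s" "\<beta> $ 3 \<le> s" by (auto simp: morder_def sum_3)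
    then show "\<beta> \<in> (\<lambda>(a, b, c). axis 1 a + axis 2 b + axis 3 c) ` ({..s} \<times> {..s} \<times> {..s})"
      by (intro image_eqI[of _ _ "(\<beta> $ 1, \<beta> $ 2, \<beta> $ 3)"]) (auto simp: nat3_expansion)
  qed
qed simp

lemma L2_norm_weak_deriv_le:
  assumes "morder \<beta> \<le> s" shows "L2_norm \<Omega> (weak_deriv \<Omega> \<beta> u) \<le> Sobolev_norm s \<Omega> u"
  unfolding Sobolev_norm_def
  by (rule real_le_rsqrt, rule member_le_sum) (use assms finite_morder in auto)

lemma Sobolev_norm_le_vec:
  assumes "m < N" shows "Sobolev_norm s \<Omega> (V m) \<le> Sobolev_vec_norm N s \<Omega> V"
  unfolding Sobolev_vec_norm_def
  by (rule real_le_rsqrt, rule member_le_sum[of m "{..<N}" "\<lambda>m. (Sobolev_norm s \<Omega> (V m))\<^sup>2"]) (use assms in auto)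

lemma cube_volume_pos: assumes R: "R > 0" shows "cint R (\<lambda>x. 1) > 0"
proof -
  have "cint R (\<lambda>x. 1) = integral (ccube R) (\<lambda>x. 1::real)" by (rule integral_cube_eq_ccube) simp
  also have "\<dots> = measure lborel (ccube R)" by simp
  also have "\<dots> > 0" using R by (subst content_cbox_cart) (auto simp: interval_eq_empty_cart not_less)
  finally show ?thesis .
qed

text \<open>The embedding for smooth functions, applied to the first derivatives of the approximations, passes
  to the limit almost everywhere.\<close>

theorem first_derivatives_bounded:
  assumes R: "R > 0"
  obtains C where "C \<ge> 0" "\<And>u i. u \<in> Sobolev 3 (cube R) \<Longrightarrow>
    AE x in lebesgue_on (cube R). cmod (weak_deriv (cube R) (axis i 1) u x) \<le> C * Sobolev_norm 3 (cube R) u"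
proof -
  define \<kappa> where "\<kappa> = L2_norm (cube R) (\<lambda>x. 1)"
  define v where "v = cint R (\<lambda>x. 1)"
  have k0: "\<kappa> \<ge> 0" unfolding \<kappa>_def by (rule L2_norm_nonneg)
  have v0: "v > 0" unfolding v_def by (rule cube_volume_pos[OF R])
  define C where "C = (\<kappa> / v) * (1 + 2 * R * 3 + 8 * R\<^sup>2 * 9)"
  have C0: "C \<ge> 0" using k0 v0 R by (simp add: C_def)
  show thesis
  proof (rule that[OF C0])
    fix u i assume u: "u \<in> Sobolev 3 (cube R)"
    define W where "W = (\<lambda>\<beta>. weak_deriv (cube R) \<beta> u)"
    obtain g where g: "\<And>n \<beta>. Cinf (g n \<beta>)" "\<And>n \<beta> i. dir i (g n \<beta>) = g n (\<beta> + axis i 1)"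
      "\<And>\<beta>. morder \<beta> \<le> 3 \<Longrightarrow> L2_tendsto (cube R) (\<lambda>n. g n \<beta>) (W \<beta>)"
      unfolding W_def by (rule Sobolev_approximation[OF R u]) blast
    let ?\<beta> = "axis i 1 :: nat^3"
    define S where "S = (\<lambda>F :: nat^3 \<Rightarrow> real^3 \<Rightarrow> complex. (\<kappa> / v) * (L2_norm (cube R) (F ?\<beta>) + 2 * R * (\<Sum>i\<in>UNIV. L2_norm (cube R) (F (?\<beta> + axis i 1)))
      + 8 * R\<^sup>2 * (\<Sum>i\<in>UNIV. \<Sum>j\<in>UNIV. L2_norm (cube R) (F (?\<beta> + axis i 1 + axis j 1)))))"
    have nl: "(\<lambda>n. L2_norm (cube R) (g n \<beta>)) \<longlonglongrightarrow> L2_norm (cube R) (W \<beta>)" if "morder \<beta> \<le> 3" for \<beta>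
      by (rule L2_tendsto_norm[OF g(3)[OF that]])
    have "(\<lambda>n. S (g n)) \<longlonglongrightarrow> S W"
      unfolding S_def by (intro tendsto_mult tendsto_add tendsto_const tendsto_sum nl) simp_all
    moreover have "cmod (g n ?\<beta> x) \<le> S (g n)" if "x \<in> cube R" for n x
    proof -
      have "v * cmod (g n ?\<beta> x) \<le> \<kappa> * (L2_norm (cube R) (g n ?\<beta>) + 2 * R * (\<Sum>i\<in>UNIV. L2_norm (cube R) (g n (?\<beta> + axis i 1)))
        + 8 * R\<^sup>2 * (\<Sum>i\<in>UNIV. \<Sum>j\<in>UNIV. L2_norm (cube R) (g n (?\<beta> + axis i 1 + axis j 1))))"
        using Sobolev_sup_smooth[OF R g(1), of x n ?\<beta>] that cube_subset_ccube[of R] unfolding g(2) v_def \<kappa>_def by blast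
      then show ?thesis using v0 by (simp add: S_def field_simps)
    qed
    ultimately have "AE x in lebesgue_on (cube R). cmod (W ?\<beta> x) \<le> S W"
      by (intro L2_tendsto_AE_bound[OF g(3)]) simp_all
    moreover have "S W \<le> C * Sobolev_norm 3 (cube R) u"
    proof -
      define n where "n = Sobolev_norm 3 (cube R) u"
      have w: "L2_norm (cube R) (W \<beta>) \<le> n" if "morder \<beta> \<le> 3" for \<beta>
        unfolding W_def n_def by (rule L2_norm_weak_deriv_le[OF that])
      have s1: "(\<Sum>i\<in>UNIV. L2_norm (cube R) (W (?\<beta> + axis i 1))) \<le> 3 * n"
        using sum_mono[of UNIV "\<lambda>i. L2_norm (cube R) (W (?\<beta> + axis i 1))" "\<lambda>i::3. n"] w by simp
      have s2: "(\<Sum>i\<in>UNIV. \<Sum>j\<in>UNIV. L2_norm (cube R) (W (?\<beta> + axis i 1 + axis j 1))) \<le> 9 * n"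
      proof -
        have "(\<Sum>i\<in>UNIV. \<Sum>j\<in>UNIV. L2_norm (cube R) (W (?\<beta> + axis i 1 + axis j 1))) \<le> (\<Sum>i\<in>(UNIV::3 set). \<Sum>j\<in>(UNIV::3 set). n)"
          by (intro sum_mono w) simp
        then show ?thesis by simp
      qed
      have "S W \<le> (\<kappa> / v) * (n + 2 * R * (3 * n) + 8 * R\<^sup>2 * (9 * n))"
        unfolding S_def using k0 v0 R w[of ?\<beta>] s1 s2 by (intro mult_left_mono add_mono) auto
      also have "\<dots> = C * n" by (simp add: C_def algebra_simps)
      finally show ?thesis by (simp add: n_def)
    qed
    ultimately show "AE x in lebesgue_on (cube R). cmod (weak_deriv (cube R) ?\<beta> u x) \<le> C * Sobolev_norm 3 (cube R) u"
      unfolding W_def by (auto elim!: eventually_mono)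
  qed
qed

section \<open>Lipschitz continuity of the nonlinearity\<close>

lemma Psi_poly_exp: "\<exists>p. Psi a n = (\<lambda>t. poly p t * exp t)"
proof (induction n rule: less_induct)
  case (less n)
  then have "\<forall>m. \<exists>p. m < n \<longrightarrow> Psi a m = (\<lambda>t. poly p t * exp t)" by blast
  then obtain p where p: "\<And>m. m < n \<Longrightarrow> Psi a m = (\<lambda>t. poly (p m) t * exp t)" by metis
  define g where "g = (\<lambda>t::real. t ^ n * exp t)"
  define w where "w = (\<lambda>t. g t - (\<Sum>m<n. ip a g (Psi a m) * Psi a m t))"
  define q where "q = monom 1 n - (\<Sum>m<n. Polynomial.smult (ip a g (Psi a m)) (p m))"
  have "w t = poly q t * exp t" for t
    unfolding w_def g_def q_def using p
    by (simp add: poly_monom poly_sum left_diff_distrib sum_distrib_right mult.assoc)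
  moreover have "Psi a n = (\<lambda>t. w t / sqrt (ip a w w))"
    by (subst Psi.simps) (simp add: Let_def g_def w_def)
  ultimately have "Psi a n = (\<lambda>t. poly (Polynomial.smult (1 / sqrt (ip a w w)) q) t * exp t)"
    by simp
  then show ?case by blast
qed

lemma Psi_continuous: "continuous_on S (Psi a n)"
  and Psi_deriv_continuous: "continuous_on S (deriv (Psi a n))"
proof -
  obtain p where p: "Psi a n = (\<lambda>t. poly p t * exp t)" using Psi_poly_exp by blast
  show "continuous_on S (Psi a n)" unfolding p by (intro continuous_intros)
  have "deriv (\<lambda>t. poly p t * exp t) t = (poly (pderiv p) t + poly p t) * exp t" for t
    by (rule DERIV_imp_deriv) (auto intro!: derivative_eq_intros simp: algebra_simps)
  then have "deriv (Psi a n) = (\<lambda>t. (poly (pderiv p) t + poly p t) * exp t)" unfolding p by blast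
  then show "continuous_on S (deriv (Psi a n))" by (simp add: continuous_intros)
qed

lemma interval_integral_bound:
  fixes f :: "real \<Rightarrow> complex"
  assumes a: "a > 0" and f: "continuous_on {-a..a} f" and B: "\<And>t. t \<in> {-a..a} \<Longrightarrow> cmod (f t) \<le> B"
  shows "set_integrable lborel {-a<..<a} f" "cmod (LINT t:{-a<..<a}|lborel. f t) \<le> 2 * a * B"
proof -
  have "set_integrable lborel {-a..a} f"
    unfolding set_integrable_def by (rule borel_integrable_compact[OF compact_Icc f])
  then show i: "set_integrable lborel {-a<..<a} f" by (rule set_integrable_subset) auto
  have iB: "integrable lborel (\<lambda>t. indicator {-a<..<a} t *\<^sub>R B)" using a by simp
  have "cmod (LINT t:{-a<..<a}|lborel. f t) \<le> (LINT t|lborel. indicator {-a<..<a} t *\<^sub>R B)"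
    unfolding set_lebesgue_integral_def
  proof (rule order_trans[OF integral_norm_bound integral_mono])
    show "integrable lborel (\<lambda>t. cmod (indicator {-a<..<a} t *\<^sub>R f t))"
      using i unfolding set_integrable_def by (rule integrable_norm)
    show "cmod (indicator {-a<..<a} t *\<^sub>R f t) \<le> indicator {-a<..<a} t *\<^sub>R B" for t
      using B[of t] by (auto simp: indicator_def)
  qed (rule iB)
  also have "\<dots> = 2 * a * B" using a by simp
  finally show "cmod (LINT t:{-a<..<a}|lborel. f t) \<le> 2 * a * B" .
qed

text \<open>The sources lie at distance at least \<open>d - R\<close> below the cube, so the coefficients of the
  linear part of the nonlinearity are bounded on the cube.\<close>

lemma source_distance:
  assumes x: "x \<in> cube R" and d: "d > R"
  defines "r \<equiv> (\<lambda>t. norm (x - source d t))"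
  shows "r t = sqrt ((x$1 - t)\<^sup>2 + (x$2)\<^sup>2 + (x$3 + d)\<^sup>2)" "r t \<ge> d - R" "r t > 0" "continuous_on S r"
    "\<bar>(x - source d t) $ j\<bar> \<le> r t" "continuous_on S (\<lambda>t. (x - source d t) $ j)"
proof -
  show e: "r t = sqrt ((x$1 - t)\<^sup>2 + (x$2)\<^sup>2 + (x$3 + d)\<^sup>2)" for t
    by (simp add: r_def norm_vec_def L2_set_def sum_3 source_def add.assoc)
  show n: "\<bar>(x - source d t) $ j\<bar> \<le> r t" for t j unfolding r_def by (rule component_le_norm_cart)
  have "x $ 3 > - R" using x unfolding mem_cube by (drule_tac spec[of _ 3]) linarith
  then show g: "r t \<ge> d - R" for t using n[of t 3] d by (simp add: source_def)
  show "r t > 0" using g[of t] d by simp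
  have "r = (\<lambda>t. sqrt ((x$1 - t)\<^sup>2 + (x$2)\<^sup>2 + (x$3 + d)\<^sup>2))" using e by blast
  then show "continuous_on S r" by (simp add: continuous_intros)
  have "j = 1 \<or> j = 2 \<or> j = 3" by (rule exhaust_3)
  then show "continuous_on S (\<lambda>t. (x - source d t) $ j)"
    by (elim disjE) (simp_all add: source_def vector_3 continuous_intros)
qed

lemma x_tilde_bound:
  assumes x: "x \<in> cube R" and d: "d > R" and k: "k > 0"
  shows "continuous_on S (\<lambda>t. x_tilde k d x t $ j)" "cmod (x_tilde k d x t $ j) \<le> k + 1 / (d - R)"
proof -
  note s = source_distance[OF x d]
  have nz: "norm (x - source d t) \<noteq> 0" for t using s(3)[of t] by simp
  have e: "x_tilde k d x t $ j = \<i> * of_real k * of_real ((x - source d t) $ j) / of_real (norm (x - source d t))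
      - of_real ((x - source d t) $ j) / of_real ((norm (x - source d t))\<^sup>2)" for t
    unfolding x_tilde_def Let_def by simp
  have c1: "continuous_on S (\<lambda>t. complex_of_real ((x - source d t) $ j))"
    by (intro continuous_on_of_real s(6))
  have c2: "continuous_on S (\<lambda>t. complex_of_real (norm (x - source d t)))"
    by (intro continuous_on_of_real s(4))
  have c3: "continuous_on S (\<lambda>t. complex_of_real ((norm (x - source d t))\<^sup>2))"
    by (intro continuous_on_of_real continuous_on_power s(4))
  show "continuous_on S (\<lambda>t. x_tilde k d x t $ j)"
    unfolding e using nz
    by (intro continuous_on_diff continuous_on_divide continuous_on_mult continuous_on_const c1 c2 c3) auto
  define r where "r = norm (x - source d t)"
  define w where "w = (x - source d t) $ j"
  have r: "r > 0" "r \<ge> d - R" "\<bar>w\<bar> \<le> r" using s(3)[of t] s(2)[of t] s(5)[of t j] by (auto simp: r_def w_def)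
  have "cmod (x_tilde k d x t $ j) \<le> cmod (\<i> * of_real k * of_real w / of_real r) + cmod (complex_of_real w / of_real (r\<^sup>2))"
    unfolding e r_def[symmetric] w_def[symmetric] by (rule norm_triangle_ineq4)
  also have "\<dots> = k * (\<bar>w\<bar> / r) + (\<bar>w\<bar> / r) / r"
    using r k by (simp add: norm_mult norm_divide norm_power power2_eq_square)
  also have "\<dots> \<le> k * 1 + 1 / (d - R)"
    using r k d by (intro add_mono mult_left_mono frac_le) (auto simp: divide_le_eq)
  finally show "cmod (x_tilde k d x t $ j) \<le> k + 1 / (d - R)" by simp
qed

lemma x_hat_bound:
  assumes x: "x \<in> cube R" and d: "d > R" and k: "k > 0"
  shows "continuous_on S (\<lambda>t. x_hat k d x t $ j)" "cmod (x_hat k d x t $ j) \<le> k / (d - R) + 1 / (d - R)\<^sup>2"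
proof -
  note s = source_distance[OF x d]
  define p where "p = (\<lambda>t. (vector [- (x$2)\<^sup>2 - (x$3 + d)\<^sup>2, (x$1 - t) * x$2, (x$1 - t) * (x$3 + d)] :: real^3) $ j)"
  define q where "q = (\<lambda>t. (vector [(x$1 - t)\<^sup>2 - (x$2)\<^sup>2 - (x$3 + d)\<^sup>2,
                       2 * (x$1 - t) * x$2, 2 * (x$1 - t) * (x$3 + d)] :: real^3) $ j)"
  have nz: "norm (x - source d t) \<noteq> 0" for t using s(3)[of t] by simp
  have j: "j = 1 \<or> j = 2 \<or> j = 3" by (rule exhaust_3)
  have e: "x_hat k d x t $ j = \<i> * of_real k / of_real (norm (x - source d t) ^ 3) * of_real (p t)
      - of_real (q t) / of_real (norm (x - source d t) ^ 4)" for t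
    unfolding x_hat_def Let_def p_def q_def by simp
  have cp: "continuous_on S p" "continuous_on S q"
    using j unfolding p_def q_def by (elim disjE; simp add: vector_3 continuous_intros)+
  have c1: "continuous_on S (\<lambda>t. complex_of_real (p t))" "continuous_on S (\<lambda>t. complex_of_real (q t))"
    by (intro continuous_on_of_real cp)+
  have c2: "continuous_on S (\<lambda>t. complex_of_real (norm (x - source d t) ^ n))" for n
    by (intro continuous_on_of_real continuous_on_power s(4))
  show "continuous_on S (\<lambda>t. x_hat k d x t $ j)"
    unfolding e using nz
    by (intro continuous_on_diff continuous_on_divide continuous_on_mult continuous_on_const c1 c2) auto
  define r where "r = norm (x - source d t)"
  define X where "X = x$1 - t"
  define Y where "Y = x$2"
  define Z where "Z = x$3 + d"
  have r: "r > 0" "r \<ge> d - R" using s(3)[of t] s(2)[of t] by (auto simp: r_def)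
  have r2: "r\<^sup>2 = X\<^sup>2 + Y\<^sup>2 + Z\<^sup>2" using s(1)[of t] by (simp add: r_def X_def Y_def Z_def)
  have am: "2 * \<bar>X\<bar> * \<bar>Y\<bar> \<le> r\<^sup>2" "2 * \<bar>X\<bar> * \<bar>Z\<bar> \<le> r\<^sup>2"
    using sum_squares_bound[of "\<bar>X\<bar>" "\<bar>Y\<bar>"] sum_squares_bound[of "\<bar>X\<bar>" "\<bar>Z\<bar>"] zero_le_power2[of Y] zero_le_power2[of Z]
    unfolding r2 power2_abs by linarith+
  have nn: "0 \<le> \<bar>X\<bar> * \<bar>Y\<bar>" "0 \<le> \<bar>X\<bar> * \<bar>Z\<bar>" by auto
  have sq: "0 \<le> X\<^sup>2" "0 \<le> Y\<^sup>2" "0 \<le> Z\<^sup>2" by auto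
  have xy: "\<bar>X * Y\<bar> \<le> r\<^sup>2" "\<bar>X * Z\<bar> \<le> r\<^sup>2" "\<bar>2 * X * Y\<bar> \<le> r\<^sup>2" "\<bar>2 * X * Z\<bar> \<le> r\<^sup>2"
    using am nn unfolding abs_mult abs_numeral by linarith+
  have x1: "\<bar>- Y\<^sup>2 - Z\<^sup>2\<bar> \<le> r\<^sup>2" "\<bar>X\<^sup>2 - Y\<^sup>2 - Z\<^sup>2\<bar> \<le> r\<^sup>2"
    using sq unfolding r2 by linarith+
  have pq: "\<bar>p t\<bar> \<le> r\<^sup>2" "\<bar>q t\<bar> \<le> r\<^sup>2"
    using j unfolding p_def q_def X_def[symmetric] Y_def[symmetric] Z_def[symmetric]
    by (elim disjE; simp only: vector_3 xy x1)+
  have "cmod (x_hat k d x t $ j) \<le> cmod (\<i> * of_real k / of_real (r ^ 3) * of_real (p t)) + cmod (complex_of_real (q t) / of_real (r ^ 4))"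
    unfolding e r_def[symmetric] by (rule norm_triangle_ineq4)
  also have "\<dots> = k * (\<bar>p t\<bar> / r\<^sup>2) / r + (\<bar>q t\<bar> / r\<^sup>2) / r\<^sup>2"
    using r k by (simp add: norm_mult norm_divide norm_power power2_eq_square power3_eq_cube power4_eq_xxxx)
  also have "\<dots> \<le> k * 1 / (d - R) + 1 / (d - R)\<^sup>2"
    using r k d pq by (intro add_mono frac_le mult_left_mono power_mono) (auto simp: divide_le_eq)
  finally show "cmod (x_hat k d x t $ j) \<le> k / (d - R) + 1 / (d - R)\<^sup>2" by simp
qed

definition grad_dist :: "nat \<Rightarrow> (nat \<Rightarrow> complex^3) \<Rightarrow> (nat \<Rightarrow> complex^3) \<Rightarrow> real" where
  "grad_dist N P Q = (\<Sum>n<N. \<Sum>i\<in>UNIV. cmod (P n $ i - Q n $ i))"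

lemma grad_dist_nonneg: "grad_dist N P Q \<ge> 0"
  unfolding grad_dist_def by (intro sum_nonneg) simp

lemma grad_dist_ge: "n < N \<Longrightarrow> (\<Sum>i\<in>UNIV. cmod (P n $ i - Q n $ i)) \<le> grad_dist N P Q"
  unfolding grad_dist_def
  by (rule member_le_sum[of n "{..<N}" "\<lambda>n. \<Sum>i\<in>UNIV. cmod (P n $ i - Q n $ i)"]) (auto intro: sum_nonneg)

text \<open>A product of differences is avoided by changing one factor at a time.\<close>

lemma cdot_quadratic:
  assumes B: "\<And>n i. n < N \<Longrightarrow> cmod (P n $ i) \<le> B" "\<And>n i. n < N \<Longrightarrow> cmod (Q n $ i) \<le> B" and nl: "n < N" "l < N"
  shows "cmod (cdot (P n) (P l) - cdot (Q n) (Q l)) \<le> 2 * B * grad_dist N P Q"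
proof -
  have B0: "B \<ge> 0" using B(1)[OF nl(1), of 1] norm_ge_zero[of "P n $ 1"] by linarith
  have "cdot (P n) (P l) - cdot (Q n) (Q l) = (\<Sum>j\<in>UNIV. (P n $ j - Q n $ j) * P l $ j + Q n $ j * (P l $ j - Q l $ j))"
    unfolding cdot_def sum_subtractf[symmetric] by (intro sum.cong refl) (simp add: algebra_simps)
  also have "cmod \<dots> \<le> (\<Sum>j\<in>UNIV. cmod (P n $ j - Q n $ j) * B + B * cmod (P l $ j - Q l $ j))"
  proof (intro order_trans[OF norm_sum] sum_mono)
    fix j
    have "cmod ((P n $ j - Q n $ j) * P l $ j) \<le> cmod (P n $ j - Q n $ j) * B"
      unfolding norm_mult using B(1)[OF nl(2)] by (intro mult_left_mono) auto
    moreover have "cmod (Q n $ j * (P l $ j - Q l $ j)) \<le> B * cmod (P l $ j - Q l $ j)"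
      unfolding norm_mult using B(2)[OF nl(1)] by (intro mult_right_mono) auto
    ultimately show "cmod ((P n $ j - Q n $ j) * P l $ j + Q n $ j * (P l $ j - Q l $ j))
        \<le> cmod (P n $ j - Q n $ j) * B + B * cmod (P l $ j - Q l $ j)"
      using norm_triangle_ineq[of "(P n $ j - Q n $ j) * P l $ j" "Q n $ j * (P l $ j - Q l $ j)"] by linarith
  qed
  also have "\<dots> = B * (\<Sum>j\<in>UNIV. cmod (P n $ j - Q n $ j)) + B * (\<Sum>j\<in>UNIV. cmod (P l $ j - Q l $ j))"
    by (simp add: sum.distrib sum_distrib_left mult.commute)
  also have "\<dots> \<le> B * grad_dist N P Q + B * grad_dist N P Q"
    using B0 nl by (intro add_mono mult_left_mono grad_dist_ge) auto
  finally show ?thesis by simp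
qed

lemma linear_term_Lipschitz:
  fixes A :: "real \<Rightarrow> complex^3" and \<psi> :: "real \<Rightarrow> real"
  assumes a: "a > 0" and \<psi>: "continuous_on {-a..a} \<psi>" "\<And>t. t \<in> {-a..a} \<Longrightarrow> \<bar>\<psi> t\<bar> \<le> b"
    and A: "\<And>j. continuous_on {-a..a} (\<lambda>t. A t $ j)" "\<And>t j. t \<in> {-a..a} \<Longrightarrow> cmod (A t $ j) \<le> M"
  shows "cmod ((LINT t:{-a<..<a}|lborel. of_real (\<psi> t) * cdot p (A t)) - (LINT t:{-a<..<a}|lborel. of_real (\<psi> t) * cdot q (A t)))
    \<le> 2 * a * (b * M) * (\<Sum>i\<in>UNIV. cmod (p $ i - q $ i))"
proof -
  have c: "continuous_on {-a..a} (\<lambda>t. complex_of_real (\<psi> t) * A t $ j)" for j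
    by (intro continuous_on_mult continuous_on_of_real \<psi> A)
  have bd: "cmod (complex_of_real (\<psi> t) * A t $ j) \<le> b * M" if "t \<in> {-a..a}" for t j
    unfolding norm_mult using \<psi>(2)[OF that] A(2)[OF that, of j] by (intro mult_mono) auto
  note I = interval_integral_bound[OF a c bd]
  have e: "(LINT t:{-a<..<a}|lborel. of_real (\<psi> t) * cdot r (A t)) = (\<Sum>j\<in>UNIV. r $ j * (LINT t:{-a<..<a}|lborel. of_real (\<psi> t) * A t $ j))" for r
  proof -
    have "(LINT t:{-a<..<a}|lborel. of_real (\<psi> t) * cdot r (A t))
        = (LINT t|lborel. (\<Sum>j\<in>UNIV. r $ j * (indicator {-a<..<a} t *\<^sub>R (of_real (\<psi> t) * A t $ j))))"
      unfolding set_lebesgue_integral_def cdot_def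
      by (intro Bochner_Integration.integral_cong refl) (simp add: sum_distrib_left scaleR_sum_right mult_ac)
    also have "\<dots> = (\<Sum>j\<in>UNIV. (LINT t|lborel. r $ j * (indicator {-a<..<a} t *\<^sub>R (of_real (\<psi> t) * A t $ j))))"
      using I(1) unfolding set_integrable_def by (intro Bochner_Integration.integral_sum integrable_mult_right)
    also have "\<dots> = (\<Sum>j\<in>UNIV. r $ j * (LINT t:{-a<..<a}|lborel. of_real (\<psi> t) * A t $ j))"
      unfolding set_lebesgue_integral_def by (simp only: integral_mult_right_zero)
    finally show ?thesis .
  qed
  have "(LINT t:{-a<..<a}|lborel. of_real (\<psi> t) * cdot p (A t)) - (LINT t:{-a<..<a}|lborel. of_real (\<psi> t) * cdot q (A t))
     = (\<Sum>j\<in>UNIV. (p $ j - q $ j) * (LINT t:{-a<..<a}|lborel. of_real (\<psi> t) * A t $ j))"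
    unfolding e sum_subtractf[symmetric] by (simp only: left_diff_distrib)
  also have "cmod \<dots> \<le> (\<Sum>j\<in>UNIV. cmod (p $ j - q $ j) * (2 * a * (b * M)))"
    by (intro order_trans[OF norm_sum] sum_mono) (simp only: norm_mult, intro mult_left_mono I(2) norm_ge_zero)
  finally show ?thesis by (simp add: sum_distrib_left mult.commute)
qed

lemma continuous_Icc_bounded:
  fixes f :: "real \<Rightarrow> real"
  assumes "continuous_on {-a..a} f" shows "\<exists>b. \<forall>t\<in>{-a..a}. \<bar>f t\<bar> \<le> b"
proof -
  have "bounded (f ` {-a..a})" by (intro compact_imp_bounded compact_continuous_image assms compact_Icc)
  then show ?thesis unfolding bounded_iff by auto
qed

lemma Psi_products_bounded:
  fixes a :: real and N :: nat
  obtains b where "b \<ge> 0"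
    "\<And>m n t. m < N \<Longrightarrow> n < N \<Longrightarrow> t \<in> {-a..a} \<Longrightarrow> \<bar>Psi a m t * deriv (Psi a n) t\<bar> \<le> b"
    "\<And>m n t. m < N \<Longrightarrow> n < N \<Longrightarrow> t \<in> {-a..a} \<Longrightarrow> \<bar>Psi a m t * Psi a n t\<bar> \<le> b"
    "\<And>m n l. m < N \<Longrightarrow> n < N \<Longrightarrow> l < N \<Longrightarrow> \<bar>LINT t:{-a<..<a}|lborel. Psi a m t * Psi a n t * deriv (Psi a l) t\<bar> \<le> b"
proof -
  have "\<forall>m n. \<exists>b. \<forall>t\<in>{-a..a}. \<bar>Psi a m t * deriv (Psi a n) t\<bar> \<le> b"
    by (intro allI continuous_Icc_bounded continuous_on_mult Psi_continuous Psi_deriv_continuous)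
  then obtain b1 where b1: "\<And>m n t. t \<in> {-a..a} \<Longrightarrow> \<bar>Psi a m t * deriv (Psi a n) t\<bar> \<le> b1 m n" by metis
  have "\<forall>m n. \<exists>b. \<forall>t\<in>{-a..a}. \<bar>Psi a m t * Psi a n t\<bar> \<le> b"
    by (intro allI continuous_Icc_bounded continuous_on_mult Psi_continuous)
  then obtain b2 where b2: "\<And>m n t. t \<in> {-a..a} \<Longrightarrow> \<bar>Psi a m t * Psi a n t\<bar> \<le> b2 m n" by metis
  define b3 where "b3 = (\<lambda>m n l. \<bar>LINT t:{-a<..<a}|lborel. Psi a m t * Psi a n t * deriv (Psi a l) t\<bar>)"
  define b where "b = (\<Sum>m<N. \<Sum>n<N. \<bar>b1 m n\<bar>) + (\<Sum>m<N. \<Sum>n<N. \<bar>b2 m n\<bar>) + (\<Sum>m<N. \<Sum>n<N. \<Sum>l<N. b3 m n l)"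
  have mem2: "h m n \<le> (\<Sum>m<N. \<Sum>n<N. h m n)" if "m < N" "n < N" "\<And>m n. h m n \<ge> 0" for h :: "nat \<Rightarrow> nat \<Rightarrow> real" and m n
  proof -
    have "h m n \<le> (\<Sum>n<N. h m n)" using that by (intro member_le_sum) auto
    also have "\<dots> \<le> (\<Sum>m<N. \<Sum>n<N. h m n)"
      using that by (intro member_le_sum[of m "{..<N}" "\<lambda>m. \<Sum>n<N. h m n"]) (auto intro: sum_nonneg)
    finally show ?thesis .
  qed
  have p: "(\<Sum>m<N. \<Sum>n<N. \<bar>b1 m n\<bar>) \<ge> 0" "(\<Sum>m<N. \<Sum>n<N. \<bar>b2 m n\<bar>) \<ge> 0" "(\<Sum>m<N. \<Sum>n<N. \<Sum>l<N. b3 m n l) \<ge> 0"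
    by (intro sum_nonneg, simp add: b3_def)+
  show thesis
  proof (rule that[of b])
    show "b \<ge> 0" using p by (simp add: b_def)
    show "\<bar>Psi a m t * deriv (Psi a n) t\<bar> \<le> b" if "m < N" "n < N" "t \<in> {-a..a}" for m n t
      using b1[OF that(3), of m n] mem2[of m n "\<lambda>m n. \<bar>b1 m n\<bar>"] that p unfolding b_def by linarith
    show "\<bar>Psi a m t * Psi a n t\<bar> \<le> b" if "m < N" "n < N" "t \<in> {-a..a}" for m n t
      using b2[OF that(3), of m n] mem2[of m n "\<lambda>m n. \<bar>b2 m n\<bar>"] that p unfolding b_def by linarith
    show "\<bar>LINT t:{-a<..<a}|lborel. Psi a m t * Psi a n t * deriv (Psi a l) t\<bar> \<le> b" if "m < N" "n < N" "l < N" for m n l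
    proof -
      have "b3 m n l \<le> (\<Sum>l<N. b3 m n l)" using that by (intro member_le_sum) (auto simp: b3_def)
      also have "\<dots> \<le> (\<Sum>m<N. \<Sum>n<N. \<Sum>l<N. b3 m n l)"
        using that by (intro mem2[of m n "\<lambda>m n. \<Sum>l<N. b3 m n l"]) (auto simp: b3_def intro: sum_nonneg)
      finally show ?thesis using p unfolding b_def b3_def by linarith
    qed
  qed
qed

lemma f_fun_Lipschitz:
  assumes d: "d > R" and a: "a > 0" and k: "k > 0" and B: "B \<ge> 0"
  obtains L where "L \<ge> 0" "\<And>x P Q m. x \<in> cube R \<Longrightarrow> (\<And>n i. n < N \<Longrightarrow> cmod (P n $ i) \<le> B) \<Longrightarrow>
     (\<And>n i. n < N \<Longrightarrow> cmod (Q n $ i) \<le> B) \<Longrightarrow> m < N \<Longrightarrow>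
     cmod (f_fun k a d N x P m - f_fun k a d N x Q m) \<le> L * grad_dist N P Q"
proof -
  obtain b where b: "b \<ge> 0"
    "\<And>m n t. m < N \<Longrightarrow> n < N \<Longrightarrow> t \<in> {-a..a} \<Longrightarrow> \<bar>Psi a m t * deriv (Psi a n) t\<bar> \<le> b"
    "\<And>m n t. m < N \<Longrightarrow> n < N \<Longrightarrow> t \<in> {-a..a} \<Longrightarrow> \<bar>Psi a m t * Psi a n t\<bar> \<le> b"
    "\<And>m n l. m < N \<Longrightarrow> n < N \<Longrightarrow> l < N \<Longrightarrow> \<bar>LINT t:{-a<..<a}|lborel. Psi a m t * Psi a n t * deriv (Psi a l) t\<bar> \<le> b"
    by (rule Psi_products_bounded[of N a]) blast
  define M1 where "M1 = k + 1 / (d - R)"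
  define M2 where "M2 = k / (d - R) + 1 / (d - R)\<^sup>2"
  have M0: "M1 \<ge> 0" "M2 \<ge> 0" using k d by (auto simp: M1_def M2_def)
  define L where "L = 2 * (real N * (real N * (2 * B * b))) + 2 * (real N * (2 * a * (b * M1))) + 2 * (real N * (2 * a * (b * M2)))"
  show thesis
  proof (rule that[of L])
    show "L \<ge> 0" using B b M0 a by (auto simp: L_def intro!: add_nonneg_nonneg mult_nonneg_nonneg)
    fix x m and P Q :: "nat \<Rightarrow> complex^3"
    assume x: "x \<in> cube R" and P: "\<And>n i. n < N \<Longrightarrow> cmod (P n $ i) \<le> B" and Q: "\<And>n i. n < N \<Longrightarrow> cmod (Q n $ i) \<le> B" and m: "m < N"
    let ?G = "grad_dist N P Q"
    have G0: "?G \<ge> 0" by (rule grad_dist_nonneg)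
    define c where "c = (\<lambda>n l. complex_of_real (LINT t:{-a<..<a}|lborel. Psi a m t * Psi a n t * deriv (Psi a l) t))"
    define T1 where "T1 = (\<lambda>P. \<Sum>n<N. \<Sum>l<N. cdot (P n) (P l) * c n l)"
    define T2 where "T2 = (\<lambda>P :: nat \<Rightarrow> complex^3. \<Sum>n<N. LINT t:{-a<..<a}|lborel. of_real (Psi a m t * deriv (Psi a n) t) * cdot (P n) (x_tilde k d x t))"
    define T3 where "T3 = (\<lambda>P :: nat \<Rightarrow> complex^3. \<Sum>n<N. LINT t:{-a<..<a}|lborel. of_real (Psi a m t * Psi a n t) * cdot (P n) (x_hat k d x t))"
    have cc: "cdot u v = cdot v u" for u v by (simp add: cdot_def mult.commute)
    have f: "f_fun k a d N x P m = 2 * T1 P + 2 * T2 P + 2 * T3 P" for P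
      unfolding f_fun_def T1_def T2_def T3_def c_def by (simp only: cc[of "x_hat k d x _"])
    have 1: "cmod (T1 P - T1 Q) \<le> real N * (real N * (2 * B * b)) * ?G"
    proof -
      have "T1 P - T1 Q = (\<Sum>n<N. \<Sum>l<N. (cdot (P n) (P l) - cdot (Q n) (Q l)) * c n l)"
        unfolding T1_def sum_subtractf[symmetric] by (simp only: left_diff_distrib)
      also have "cmod \<dots> \<le> (\<Sum>n<N. \<Sum>l<N. (2 * B * ?G) * b)"
      proof (intro order_trans[OF norm_sum] sum_mono)
        fix n l assume "n \<in> {..<N}" "l \<in> {..<N}"
        then have nl: "n < N" "l < N" by auto
        show "cmod ((cdot (P n) (P l) - cdot (Q n) (Q l)) * c n l) \<le> (2 * B * ?G) * b"
          unfolding norm_mult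
          using cdot_quadratic[OF P Q nl] b(4)[OF m nl] B G0 by (intro mult_mono) (auto simp: c_def)
      qed
      also have "\<dots> = real N * (real N * (2 * B * b)) * ?G" by simp
      finally show ?thesis .
    qed
    have 2: "cmod (T2 P - T2 Q) \<le> real N * (2 * a * (b * M1)) * ?G"
    proof -
      have "cmod (T2 P - T2 Q) \<le> (\<Sum>n<N. 2 * a * (b * M1) * ?G)"
        unfolding T2_def sum_subtractf[symmetric]
      proof (intro order_trans[OF norm_sum] sum_mono)
        fix n assume "n \<in> {..<N}"
        then have n: "n < N" by simp
        have "cmod ((LINT t:{-a<..<a}|lborel. of_real (Psi a m t * deriv (Psi a n) t) * cdot (P n) (x_tilde k d x t))
            - (LINT t:{-a<..<a}|lborel. of_real (Psi a m t * deriv (Psi a n) t) * cdot (Q n) (x_tilde k d x t)))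
            \<le> 2 * a * (b * M1) * (\<Sum>i\<in>UNIV. cmod (P n $ i - Q n $ i))"
          unfolding M1_def
          by (rule linear_term_Lipschitz[OF a _ b(2)[OF m n] x_tilde_bound[OF x d k]])
            (intro continuous_on_mult Psi_continuous Psi_deriv_continuous)
        also have "\<dots> \<le> 2 * a * (b * M1) * ?G"
          using a b(1) M0 by (intro mult_left_mono grad_dist_ge n) auto
        finally show "cmod ((LINT t:{-a<..<a}|lborel. of_real (Psi a m t * deriv (Psi a n) t) * cdot (P n) (x_tilde k d x t))
            - (LINT t:{-a<..<a}|lborel. of_real (Psi a m t * deriv (Psi a n) t) * cdot (Q n) (x_tilde k d x t)))
            \<le> 2 * a * (b * M1) * ?G" .
      qed
      then show ?thesis by simp
    qed
    have 3: "cmod (T3 P - T3 Q) \<le> real N * (2 * a * (b * M2)) * ?G"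
    proof -
      have "cmod (T3 P - T3 Q) \<le> (\<Sum>n<N. 2 * a * (b * M2) * ?G)"
        unfolding T3_def sum_subtractf[symmetric]
      proof (intro order_trans[OF norm_sum] sum_mono)
        fix n assume "n \<in> {..<N}"
        then have n: "n < N" by simp
        have "cmod ((LINT t:{-a<..<a}|lborel. of_real (Psi a m t * Psi a n t) * cdot (P n) (x_hat k d x t))
            - (LINT t:{-a<..<a}|lborel. of_real (Psi a m t * Psi a n t) * cdot (Q n) (x_hat k d x t)))
            \<le> 2 * a * (b * M2) * (\<Sum>i\<in>UNIV. cmod (P n $ i - Q n $ i))"
          unfolding M2_def
          by (rule linear_term_Lipschitz[OF a _ b(3)[OF m n] x_hat_bound[OF x d k]])
            (intro continuous_on_mult Psi_continuous)
        also have "\<dots> \<le> 2 * a * (b * M2) * ?G"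
          using a b(1) M0 by (intro mult_left_mono grad_dist_ge n) auto
        finally show "cmod ((LINT t:{-a<..<a}|lborel. of_real (Psi a m t * Psi a n t) * cdot (P n) (x_hat k d x t))
            - (LINT t:{-a<..<a}|lborel. of_real (Psi a m t * Psi a n t) * cdot (Q n) (x_hat k d x t)))
            \<le> 2 * a * (b * M2) * ?G" .
      qed
      then show ?thesis by simp
    qed
    have "f_fun k a d N x P m - f_fun k a d N x Q m = 2 * (T1 P - T1 Q) + 2 * (T2 P - T2 Q) + 2 * (T3 P - T3 Q)"
      unfolding f by (simp add: algebra_simps)
    also have "cmod \<dots> \<le> 2 * cmod (T1 P - T1 Q) + 2 * cmod (T2 P - T2 Q) + 2 * cmod (T3 P - T3 Q)"
    proof -
      have t2: "cmod (2 * z) = 2 * cmod z" for z :: complex by (simp add: norm_mult)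
      show ?thesis unfolding t2[symmetric] by (intro order_trans[OF norm_triangle_ineq] add_mono norm_triangle_ineq order_refl)
    qed
    also have "\<dots> \<le> L * ?G" using 1 2 3 unfolding L_def by (simp add: algebra_simps)
    finally show "cmod (f_fun k a d N x P m - f_fun k a d N x Q m) \<le> L * ?G" .
  qed
qed

lemma vec_index_out_of_range: "\<not> i < n \<Longrightarrow> Matrix.vec_index (Matrix.vec n f) i = undef_vec (i - n)"
  by transfer (simp add: mk_vec_def)

text \<open>Row \<open>m\<close> of a matrix-vector product is a fixed linear combination of the entries of the vector,
  also for an index \<open>m\<close> beyond the number of rows, where it is a constant.\<close>

lemma mult_mat_vec_diff_le:
  fixes A :: "complex mat"
  obtains c where "c \<ge> 0" "\<And>f g e m. m < N \<Longrightarrow> (\<And>j. j < N \<Longrightarrow> cmod (f j - g j) \<le> e) \<Longrightarrow> e \<ge> 0 \<Longrightarrow>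
    cmod (Matrix.vec_index (A *\<^sub>v Matrix.vec N f) m - Matrix.vec_index (A *\<^sub>v Matrix.vec N g) m) \<le> c * e"
proof -
  define r where "r = (\<lambda>m j. Matrix.vec_index (Matrix.row A m) j)"
  define c where "c = (\<Sum>m<N. \<Sum>j<N. cmod (r m j))"
  show thesis
  proof (rule that[of c])
    show "c \<ge> 0" unfolding c_def by (intro sum_nonneg) simp
    fix f g :: "nat \<Rightarrow> complex" and e m
    assume m: "m < N" and fg: "\<And>j. j < N \<Longrightarrow> cmod (f j - g j) \<le> e" and e: "e \<ge> 0"
    show "cmod (Matrix.vec_index (A *\<^sub>v Matrix.vec N f) m - Matrix.vec_index (A *\<^sub>v Matrix.vec N g) m) \<le> c * e"
    proof (cases "m < dim_row A")
      case True
      have i: "Matrix.vec_index (A *\<^sub>v Matrix.vec N h) m = (\<Sum>j<N. r m j * h j)" for h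
        using True by (simp add: scalar_prod_def r_def lessThan_atLeast0)
      have "Matrix.vec_index (A *\<^sub>v Matrix.vec N f) m - Matrix.vec_index (A *\<^sub>v Matrix.vec N g) m = (\<Sum>j<N. r m j * (f j - g j))"
        unfolding i sum_subtractf[symmetric] by (simp only: right_diff_distrib)
      also have "cmod \<dots> \<le> (\<Sum>j<N. cmod (r m j) * e)"
        by (intro order_trans[OF norm_sum] sum_mono) (simp only: norm_mult, intro mult_left_mono fg, auto)
      also have "\<dots> = (\<Sum>j<N. cmod (r m j)) * e" by (simp add: sum_distrib_right)
      also have "\<dots> \<le> c * e"
        unfolding c_def using m e
        by (intro mult_right_mono member_le_sum[of m "{..<N}" "\<lambda>m. \<Sum>j<N. cmod (r m j)"]) (auto intro: sum_nonneg)
      finally show ?thesis .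
    next
      case False
      then have "Matrix.vec_index (A *\<^sub>v Matrix.vec N f) m = Matrix.vec_index (A *\<^sub>v Matrix.vec N g) m"
        by (simp add: mult_mat_vec_def vec_index_out_of_range)
      moreover have "c \<ge> 0" unfolding c_def by (intro sum_nonneg) simp
      ultimately show ?thesis using e by simp
    qed
  qed
qed

text \<open>The bound \<open>B\<close> on the gradients is what makes the quadratic part Lipschitz continuous; the constant
  is uniform in the point \<open>x\<close> of the cube.\<close>

theorem K_fun_Lipschitz:
  assumes d: "d > R" and a: "a > 0" and k: "k > 0" and B: "B \<ge> 0"
  obtains L where "L \<ge> 0" "\<And>x P Q m. x \<in> cube R \<Longrightarrow> (\<And>n i. n < N \<Longrightarrow> cmod (P n $ i) \<le> B) \<Longrightarrow>
     (\<And>n i. n < N \<Longrightarrow> cmod (Q n $ i) \<le> B) \<Longrightarrow> m < N \<Longrightarrow>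
     cmod (Matrix.vec_index (K_fun k a d N x P) m - Matrix.vec_index (K_fun k a d N x Q) m) \<le> L * grad_dist N P Q"
proof -
  obtain L where L: "L \<ge> 0" "\<And>x P Q m. x \<in> cube R \<Longrightarrow> (\<And>n i. n < N \<Longrightarrow> cmod (P n $ i) \<le> B) \<Longrightarrow>
     (\<And>n i. n < N \<Longrightarrow> cmod (Q n $ i) \<le> B) \<Longrightarrow> m < N \<Longrightarrow>
     cmod (f_fun k a d N x P m - f_fun k a d N x Q m) \<le> L * grad_dist N P Q"
    by (rule f_fun_Lipschitz[OF d a k B, of N]) blast
  obtain c where c: "c \<ge> 0" "\<And>f g e m. m < N \<Longrightarrow> (\<And>j. j < N \<Longrightarrow> cmod (f j - g j) \<le> e) \<Longrightarrow> e \<ge> 0 \<Longrightarrow>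
    cmod (Matrix.vec_index (the (mat_inverse (S_mat a N)) *\<^sub>v Matrix.vec N f) m
      - Matrix.vec_index (the (mat_inverse (S_mat a N)) *\<^sub>v Matrix.vec N g) m) \<le> c * e"
    by (rule mult_mat_vec_diff_le[of N "the (mat_inverse (S_mat a N))"]) blast
  show thesis
  proof (rule that[of "c * L"])
    show "c * L \<ge> 0" using L(1) c(1) by simp
    fix x m and P Q :: "nat \<Rightarrow> complex^3"
    assume x: "x \<in> cube R" and P: "\<And>n i. n < N \<Longrightarrow> cmod (P n $ i) \<le> B" and Q: "\<And>n i. n < N \<Longrightarrow> cmod (Q n $ i) \<le> B" and m: "m < N"
    have "cmod (Matrix.vec_index (K_fun k a d N x P) m - Matrix.vec_index (K_fun k a d N x Q) m) \<le> c * (L * grad_dist N P Q)"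
      unfolding K_fun_def
      by (rule c(2)[OF m L(2)[OF x P Q]]) (auto intro: mult_nonneg_nonneg L(1) grad_dist_nonneg)
    then show "cmod (Matrix.vec_index (K_fun k a d N x P) m - Matrix.vec_index (K_fun k a d N x Q) m) \<le> c * L * grad_dist N P Q"
      by (simp only: mult.assoc)
  qed
qed

section \<open>Vanishing Cauchy data\<close>

lemma has_boundary_values_diff:
  assumes "has_boundary_values \<Omega> u S g" "has_boundary_values \<Omega> v S h"
  shows "has_boundary_values \<Omega> (\<lambda>x. u x - v x) S (\<lambda>x. g x - h x)"
proof -
  obtain U V where U: "continuous_on (closure \<Omega>) U" "AE x in lebesgue_on \<Omega>. U x = u x" "\<forall>x\<in>S. U x = g x"
    and V: "continuous_on (closure \<Omega>) V" "AE x in lebesgue_on \<Omega>. V x = v x" "\<forall>x\<in>S. V x = h x"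
    using assms unfolding has_boundary_values_def by blast
  have "AE x in lebesgue_on \<Omega>. U x - V x = u x - v x" using U(2) V(2) by eventually_elim simp
  then show ?thesis
    unfolding has_boundary_values_def
    using continuous_on_diff[OF U(1) V(1)] U(3) V(3) by (intro exI[of _ "\<lambda>x. U x - V x"]) auto
qed

lemma has_boundary_values_cong_AE:
  assumes "has_boundary_values \<Omega> u S g" "AE x in lebesgue_on \<Omega>. v x = u x"
  shows "has_boundary_values \<Omega> v S g"
proof -
  obtain U where U: "continuous_on (closure \<Omega>) U" "AE x in lebesgue_on \<Omega>. U x = u x" "\<forall>x\<in>S. U x = g x"
    using assms(1) unfolding has_boundary_values_def by blast
  have "AE x in lebesgue_on \<Omega>. U x = v x" using U(2) assms(2) by eventually_elim simp
  then show ?thesis unfolding has_boundary_values_def using U by blast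
qed

definition zero_Cauchy_data :: "real \<Rightarrow> (real^3 \<Rightarrow> complex) \<Rightarrow> bool" where
  "zero_Cauchy_data R w \<longleftrightarrow> w \<in> Sobolev 3 (cube R) \<and>
     has_boundary_values (cube R) w (frontier (cube R)) (\<lambda>_. 0) \<and>
     has_boundary_values (cube R) (weak_deriv (cube R) (axis 3 1) w) (Gam R) (\<lambda>_. 0)"

lemma zero_Cauchy_data_difference:
  assumes R: "R > 0" and S: "v \<in> Sobolev 3 (cube R)" "f \<in> Sobolev 3 (cube R)" "v' \<in> Sobolev 3 (cube R)" "f' \<in> Sobolev 3 (cube R)"
    and b: "has_boundary_values (cube R) v (frontier (cube R)) g" "has_boundary_values (cube R) f (frontier (cube R)) g"
      "has_boundary_values (cube R) v' (frontier (cube R)) g'" "has_boundary_values (cube R) f' (frontier (cube R)) g'"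
    and c: "has_boundary_values (cube R) (weak_deriv (cube R) (axis 3 1) v) (Gam R) h"
      "has_boundary_values (cube R) (weak_deriv (cube R) (axis 3 1) f) (Gam R) h"
      "has_boundary_values (cube R) (weak_deriv (cube R) (axis 3 1) v') (Gam R) h'"
      "has_boundary_values (cube R) (weak_deriv (cube R) (axis 3 1) f') (Gam R) h'"
  shows "zero_Cauchy_data R (\<lambda>x. (v x - v' x) - (f x - f' x))"
proof -
  let ?v = "\<lambda>x. v x - v' x" and ?f = "\<lambda>x. f x - f' x"
  have Sv: "?v \<in> Sobolev 3 (cube R)" and Sf: "?f \<in> Sobolev 3 (cube R)"
    using Sobolev_diff(1)[OF R] S by auto
  have e: "(\<lambda>x. (g x - g' x) - (g x - g' x)) = (\<lambda>_. 0)" "(\<lambda>x. (h x - h' x) - (h x - h' x)) = (\<lambda>_. 0)"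
    by auto
  have 1: "has_boundary_values (cube R) (\<lambda>x. ?v x - ?f x) (frontier (cube R)) (\<lambda>_. 0)"
    using has_boundary_values_diff[OF has_boundary_values_diff[OF b(1,3)] has_boundary_values_diff[OF b(2,4)]]
    unfolding e .
  have ax: "morder (axis 3 1) \<le> 3" by simp
  have "AE x in lebesgue_on (cube R). weak_deriv (cube R) (axis 3 1) (\<lambda>x. ?v x - ?f x) x
      = (weak_deriv (cube R) (axis 3 1) v x - weak_deriv (cube R) (axis 3 1) v' x)
        - (weak_deriv (cube R) (axis 3 1) f x - weak_deriv (cube R) (axis 3 1) f' x)"
    using Sobolev_diff(2)[OF R Sv Sf ax] Sobolev_diff(2)[OF R S(1,3) ax] Sobolev_diff(2)[OF R S(2,4) ax]
    by eventually_elim simp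
  moreover have "has_boundary_values (cube R) (\<lambda>x. (weak_deriv (cube R) (axis 3 1) v x - weak_deriv (cube R) (axis 3 1) v' x)
        - (weak_deriv (cube R) (axis 3 1) f x - weak_deriv (cube R) (axis 3 1) f' x)) (Gam R) (\<lambda>_. 0)"
    using has_boundary_values_diff[OF has_boundary_values_diff[OF c(1,3)] has_boundary_values_diff[OF c(2,4)]]
    unfolding e .
  ultimately have 2: "has_boundary_values (cube R) (weak_deriv (cube R) (axis 3 1) (\<lambda>x. ?v x - ?f x)) (Gam R) (\<lambda>_. 0)"
    using has_boundary_values_cong_AE by blast
  show ?thesis
    unfolding zero_Cauchy_data_def using 1 2 Sobolev_diff(1)[OF R Sv Sf] by blast
qed

lemma face_in_frontier:
  assumes "R > 0" "x \<in> ccube R" "\<bar>x $ i\<bar> = R" shows "x \<in> frontier (cube R)"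
proof -
  have "open (cube R)" unfolding cube_eq_box by (rule open_box)
  then have "frontier (cube R) = ccube R - cube R"
    by (simp add: frontier_def closure_cube[OF assms(1)] interior_open)
  moreover have "x \<notin> cube R" using assms(3) by (force simp: mem_cube)
  ultimately show ?thesis using assms(2) by blast
qed

text \<open>\<open>\<Gamma>\<close> excludes the edges of the bottom face, on which the boundary values are recovered by continuity.\<close>

lemma closed_bottom_face_closure_Gam:
  assumes R: "R > 0" and x: "x \<in> ccube R" "x $ 3 = - R" shows "x \<in> closure (Gam R)"
proof -
  define y where "y = (\<lambda>n::nat. (\<chi> i. if i = 3 then - R else (1 - 1 / (real n + 2)) * x $ i) :: real^3)"
  have "y n \<in> Gam R" for n
  proof -
    have "\<bar>(1 - 1 / (real n + 2)) * x $ i\<bar> < R" for i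
    proof -
      have q: "0 \<le> 1 - 1 / (real n + 2)" "1 - 1 / (real n + 2) < 1" by (auto simp: field_simps)
      have "\<bar>(1 - 1 / (real n + 2)) * x $ i\<bar> = (1 - 1 / (real n + 2)) * \<bar>x $ i\<bar>" using q by (simp add: abs_mult)
      also have "\<dots> \<le> (1 - 1 / (real n + 2)) * R" using q x(1) by (intro mult_left_mono) (auto simp: mem_ccube)
      also have "\<dots> < 1 * R" using q R by (intro mult_strict_right_mono) auto
      finally show ?thesis by simp
    qed
    then show ?thesis by (simp add: Gam_def y_def)
  qed
  moreover have "y \<longlonglongrightarrow> x"
  proof (rule vec_tendstoI)
    fix i
    have "(\<lambda>n. 1 / (real n + 2)) \<longlonglongrightarrow> 0" by real_asymp
    then have "(\<lambda>n. (1 - 1 / (real n + 2)) * x $ i) \<longlonglongrightarrow> (1 - 0) * x $ i"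
      by (intro tendsto_mult tendsto_diff tendsto_const)
    then show "(\<lambda>n. y n $ i) \<longlonglongrightarrow> x $ i" using x(2) by (cases "i = 3") (auto simp: y_def)
  qed
  ultimately show ?thesis unfolding closure_sequential by blast
qed

lemma zero_Cauchy_data_jet:
  assumes R: "R > 0" and w: "zero_Cauchy_data R w"
  obtains G U0 U3 where "Cauchy_zero R (\<lambda>\<beta>. weak_deriv (cube R) \<beta> w) G U0 U3"
proof -
  have wS: "w \<in> Sobolev 3 (cube R)" using w by (simp add: zero_Cauchy_data_def)
  obtain U0 where U0: "continuous_on (ccube R) U0" "AE x in lebesgue_on (cube R). U0 x = w x" "\<forall>x\<in>frontier (cube R). U0 x = 0"
    using w unfolding zero_Cauchy_data_def has_boundary_values_def closure_cube[OF R] by blast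
  obtain U3 where U3: "continuous_on (ccube R) U3"
    "AE x in lebesgue_on (cube R). U3 x = weak_deriv (cube R) (axis 3 1) w x" "\<forall>x\<in>Gam R. U3 x = 0"
    using w unfolding zero_Cauchy_data_def has_boundary_values_def closure_cube[OF R] by blast
  obtain G :: "nat \<Rightarrow> nat^3 \<Rightarrow> real^3 \<Rightarrow> complex" where G:
    "\<And>n \<beta>. Cinf (G n \<beta>)" "\<And>n \<beta> i. dir i (G n \<beta>) = G n (\<beta> + axis i 1)"
    "\<And>\<beta>. morder \<beta> \<le> 3 \<Longrightarrow> L2_tendsto (cube R) (\<lambda>n. G n \<beta>) (weak_deriv (cube R) \<beta> w)"
    "\<And>\<beta> U. morder \<beta> \<le> 3 \<Longrightarrow> continuous_on (ccube R) U \<Longrightarrow>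
       AE x in lebesgue_on (cube R). U x = weak_deriv (cube R) \<beta> w x \<Longrightarrow>
       uniform_limit (ccube R) (\<lambda>n. G n \<beta>) U sequentially"
    by (rule Sobolev_approximation[OF R wS]) blast
  have m0: "morder (0 :: nat^3) \<le> 3" by (simp add: morder_def)
  have ae0: "AE x in lebesgue_on (cube R). U0 x = weak_deriv (cube R) 0 w x"
    using U0(2) weak_deriv_0_AE[OF R Sobolev_L2[OF wS]] by eventually_elim simp
  have "Gam R \<subseteq> ccube R" using R by (auto simp: Gam_def mem_ccube forall_3)
  then have cl: "closure (Gam R) \<subseteq> ccube R" by (rule closure_minimal) (rule closed_cbox)
  show thesis
  proof (rule that[of G U0 U3], unfold_locales)
    show "R > 0" by (rule R)
    show "Cinf (G n \<beta>)" for n \<beta> by (rule G(1))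
    show "dir i (G n \<beta>) = G n (\<beta> + axis i 1)" for n \<beta> i by (rule G(2))
    show "L2_tendsto (cube R) (\<lambda>n. G n \<beta>) (weak_deriv (cube R) \<beta> w)" if "morder \<beta> \<le> 3" for \<beta>
      by (rule G(3)[OF that])
    show "uniform_limit (ccube R) (\<lambda>n. G n 0) U0 sequentially" by (rule G(4)[OF m0 U0(1) ae0])
    show "U0 x = 0" if "x \<in> ccube R" "\<bar>x $ i\<bar> = R" for x i
      using U0(3) face_in_frontier[OF R that] by blast
    show "uniform_limit (ccube R) (\<lambda>n. G n (axis 3 1)) U3 sequentially"
      by (rule G(4)[OF _ U3(1) U3(2)]) simp
    show "U3 x = 0" if "x \<in> ccube R" "x $ 3 = - R" for x
      by (rule continuous_constant_on_closure[OF continuous_on_subset[OF U3(1) cl] _ closed_bottom_face_closure_Gam[OF R that]])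
        (use U3(3) in blast)
  qed
qed

lemma zero_Cauchy_data_estimates:
  assumes R: "R > 0" and w: "zero_Cauchy_data R w"
  defines "F \<equiv> \<lambda>l. cint R (\<lambda>x. wt R l (x $ 3) * (cmod (weak_laplacian (cube R) w x))\<^sup>2)"
  shows "l \<ge> 1 \<Longrightarrow> 8 * l ^ 3 * R\<^sup>2 * cint R (\<lambda>x. wt R l (x $ 3) * (cmod (weak_deriv (cube R) 0 w x))\<^sup>2) \<le> F l"
    and "l \<ge> 1 \<Longrightarrow> l * cint R (\<lambda>x. wt R l (x $ 3) * (\<Sum>i\<in>UNIV. (cmod (weak_deriv (cube R) (axis i 1) w x))\<^sup>2)) \<le> (1 + 1 / R\<^sup>2) * F l"
    and "cint R (\<lambda>x. (cmod (weak_deriv (cube R) (axis i 1 + axis j 1) w x))\<^sup>2) \<le> cint R (\<lambda>x. (cmod (weak_laplacian (cube R) w x))\<^sup>2)"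
    and "weak_laplacian (cube R) w \<in> L2 (cube R)"
proof -
  obtain G U0 U3 where C: "Cauchy_zero R (\<lambda>\<beta>. weak_deriv (cube R) \<beta> w) G U0 U3"
    by (rule zero_Cauchy_data_jet[OF R w])
  have e: "Cauchy_zero.lap (\<lambda>\<beta>. weak_deriv (cube R) \<beta> w) = weak_laplacian (cube R) w"
    by (rule ext) (simp only: Cauchy_zero.lap_def[OF C] weak_laplacian_def sum_3 one_add_one[symmetric] axis_add_nat)
  show "l \<ge> 1 \<Longrightarrow> 8 * l ^ 3 * R\<^sup>2 * cint R (\<lambda>x. wt R l (x $ 3) * (cmod (weak_deriv (cube R) 0 w x))\<^sup>2) \<le> F l"
    unfolding F_def by (rule Cauchy_zero.Carleman_estimate(1)[OF C, unfolded e])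
  show "l \<ge> 1 \<Longrightarrow> l * cint R (\<lambda>x. wt R l (x $ 3) * (\<Sum>i\<in>UNIV. (cmod (weak_deriv (cube R) (axis i 1) w x))\<^sup>2)) \<le> (1 + 1 / R\<^sup>2) * F l"
    unfolding F_def by (rule Cauchy_zero.Carleman_estimate(2)[OF C, unfolded e])
  show "cint R (\<lambda>x. (cmod (weak_deriv (cube R) (axis i 1 + axis j 1) w x))\<^sup>2) \<le> cint R (\<lambda>x. (cmod (weak_laplacian (cube R) w x))\<^sup>2)"
    by (rule Cauchy_zero.second_derivatives_le_lap[OF C, unfolded e])
  show "weak_laplacian (cube R) w \<in> L2 (cube R)" by (rule Cauchy_zero.lap_L2[OF C, unfolded e])
qed

section \<open>Stability for a differential inequality\<close>

text \<open>The derivatives counted by the norm of \<open>H\<^sup>2\<close>, each of which is bounded in its own way.\<close>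

lemma morder_le_2_cases:
  assumes "morder \<beta> \<le> 2"
  obtains "\<beta> = 0" | i where "\<beta> = axis i 1" | i j where "\<beta> = axis i 1 + axis j 1"
proof -
  have z: "\<beta> = 0" if "morder \<beta> = 0" for \<beta>
    using that by (simp add: morder_def Finite_Cartesian_Product.vec_eq_iff)
  have s: "\<exists>i \<gamma>. \<beta> = \<gamma> + axis i 1 \<and> morder \<beta> = Suc (morder \<gamma>)" if b: "\<beta> \<noteq> 0" for \<beta>
  proof -
    obtain i where i: "\<beta> $ i \<noteq> 0" using b by (auto simp: Finite_Cartesian_Product.vec_eq_iff)
    define \<gamma> where "\<gamma> = (\<chi> j. if j = i then \<beta> $ i - 1 else \<beta> $ j)"
    have "\<beta> = \<gamma> + axis i 1" using i by (auto simp: Finite_Cartesian_Product.vec_eq_iff \<gamma>_def axis_def)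
    then show ?thesis using morder_axis by metis
  qed
  show thesis
  proof (cases "\<beta> = 0")
    case False
    then obtain i \<gamma> where 1: "\<beta> = \<gamma> + axis i 1" "morder \<beta> = Suc (morder \<gamma>)" using s by blast
    show thesis
    proof (cases "\<gamma> = 0")
      case True then show thesis using that(2)[of i] 1 by simp
    next
      case False
      then obtain j \<delta> where 2: "\<gamma> = \<delta> + axis j 1" "morder \<gamma> = Suc (morder \<delta>)" using s by blast
      then have "\<delta> = 0" using 1 assms z by simp
      then show thesis using that(3)[of j i] 1 2 by simp
    qed
  qed (rule that(1))
qed

lemma wt_bounds:
  assumes "x \<in> cube R" "R > 0" "l \<ge> 0" shows "1 \<le> wt R l (x $ 3)" "wt R l (x $ 3) \<le> exp (9 * l * R\<^sup>2)"
proof -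
  have a: "\<bar>x $ 3\<bar> < R" using assms(1) by (simp add: mem_cube)
  show "1 \<le> wt R l (x $ 3)" using assms(3) by (simp add: wt_def)
  have "\<bar>x $ 3 - 2 * R\<bar> \<le> 3 * R" using a assms(2) by linarith
  then have "(x $ 3 - 2 * R)\<^sup>2 \<le> (3 * R)\<^sup>2" using assms(2) by (simp only: abs_le_square_iff[symmetric])
  then have "l * (x $ 3 - 2 * R)\<^sup>2 \<le> l * (3 * R)\<^sup>2" using assms(3) by (intro mult_left_mono)
  then show "wt R l (x $ 3) \<le> exp (9 * l * R\<^sup>2)" by (simp add: wt_def power_mult_distrib mult_ac)
qed

lemma le_weighted:
  assumes R: "R > 0" and l: "l \<ge> 0" and u: "u \<in> L2 (cube R)"
  shows "cint R (\<lambda>x. (cmod (u x))\<^sup>2) \<le> cint R (\<lambda>x. wt R l (x $ 3) * (cmod (u x))\<^sup>2)"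
    "cint R (\<lambda>x. wt R l (x $ 3) * (cmod (u x))\<^sup>2) \<le> exp (9 * l * R\<^sup>2) * (L2_norm (cube R) u)\<^sup>2"
proof -
  note w = wt_bounds[OF _ R l]
  show "cint R (\<lambda>x. (cmod (u x))\<^sup>2) \<le> cint R (\<lambda>x. wt R l (x $ 3) * (cmod (u x))\<^sup>2)"
  proof (rule integral_mono[OF L2_integrable[OF u] wt_sq_integrable[OF u]])
    fix x assume "x \<in> space (lebesgue_on (cube R))"
    then have "x \<in> cube R" by simp
    from mult_right_mono[OF w(1)[OF this] zero_le_power2[of "cmod (u x)"]]
    show "(cmod (u x))\<^sup>2 \<le> wt R l (x $ 3) * (cmod (u x))\<^sup>2" by simp
  qed
  have "cint R (\<lambda>x. wt R l (x $ 3) * (cmod (u x))\<^sup>2) \<le> cint R (\<lambda>x. exp (9 * l * R\<^sup>2) * (cmod (u x))\<^sup>2)"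
  proof (rule integral_mono[OF wt_sq_integrable[OF u] integrable_mult_right[OF L2_integrable[OF u]]])
    fix x assume "x \<in> space (lebesgue_on (cube R))"
    then have "x \<in> cube R" by simp
    from mult_right_mono[OF w(2)[OF this] zero_le_power2[of "cmod (u x)"]]
    show "wt R l (x $ 3) * (cmod (u x))\<^sup>2 \<le> exp (9 * l * R\<^sup>2) * (cmod (u x))\<^sup>2" by simp
  qed
  then show "cint R (\<lambda>x. wt R l (x $ 3) * (cmod (u x))\<^sup>2) \<le> exp (9 * l * R\<^sup>2) * (L2_norm (cube R) u)\<^sup>2"
    by (simp add: L2_norm_sq)
qed

definition grad_sq :: "real \<Rightarrow> nat \<Rightarrow> vfun \<Rightarrow> real^3 \<Rightarrow> real" where
  "grad_sq R N w x = (\<Sum>n<N. \<Sum>i\<in>UNIV. (cmod (weak_deriv (cube R) (axis i 1) (w n) x))\<^sup>2)"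

definition jet_sq :: "real \<Rightarrow> nat \<Rightarrow> vfun \<Rightarrow> real^3 \<Rightarrow> real" where
  "jet_sq R N \<phi> x = (\<Sum>n<N. \<Sum>\<beta> | morder \<beta> \<le> 2. (cmod (weak_deriv (cube R) \<beta> (\<phi> n) x))\<^sup>2)"

text \<open>Summed over the components, the Carleman estimate and the differential inequality give
  \<open>l X \<le> A N K (X + Y)\<close> for the weighted square integrals \<open>X\<close> of the gradients of \<open>w\<close> and \<open>Y\<close> of the
  derivatives of \<open>\<phi>\<close>, with \<open>A\<close>, \<open>N\<close>, \<open>K\<close> independent of \<open>l\<close>.  For large \<open>l\<close> this is \<open>X \<le> Y\<close>.  As \<open>l\<close> is then
  fixed, the weight can be removed: it lies between \<open>1\<close> and \<open>exp (9 l R\<^sup>2)\<close> on the cube.\<close>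

theorem differential_inequality_stability:
  assumes R: "R > 0" and K: "K \<ge> 0"
  obtains C where "C \<ge> 0" "\<And>w \<phi> m \<beta>. (\<And>n. n < N \<Longrightarrow> zero_Cauchy_data R (w n)) \<Longrightarrow>
     (\<And>n. n < N \<Longrightarrow> \<phi> n \<in> Sobolev 3 (cube R)) \<Longrightarrow>
     (\<And>n. n < N \<Longrightarrow> AE x in lebesgue_on (cube R).
        (cmod (weak_laplacian (cube R) (w n) x))\<^sup>2 \<le> K * (grad_sq R N w x + jet_sq R N \<phi> x)) \<Longrightarrow>
     m < N \<Longrightarrow> morder \<beta> \<le> 2 \<Longrightarrow>
     (L2_norm (cube R) (weak_deriv (cube R) \<beta> (w m)))\<^sup>2 \<le> C * (Sobolev_vec_norm N 2 (cube R) \<phi>)\<^sup>2"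
proof -
  define A where "A = 1 + 1 / R\<^sup>2"
  \<comment> \<open>More than twice the constant in front of \<open>X + Y\<close>; the summand 1 also ensures \<open>l \<ge> 1\<close>.\<close>
  define l where "l = 2 * (A * real N * K) + 1"
  define E where "E = exp (9 * l * R\<^sup>2)"
  have A: "A \<ge> 0" by (simp add: A_def)
  have l: "l \<ge> 1" using A K by (simp add: l_def)
  have E: "E > 0" by (simp add: E_def)
  \<comment> \<open>The three summands serve the derivatives of order one, two and zero.\<close>
  define C where "C = (1 + 2 * K + 2 * K / (8 * l ^ 3 * R\<^sup>2)) * E"
  have q0: "2 * K / (8 * l ^ 3 * R\<^sup>2) \<ge> 0" using K l by (intro divide_nonneg_nonneg mult_nonneg_nonneg) auto
  show thesis
  proof (rule that[of C])
    show "C \<ge> 0" unfolding C_def using q0 K E by (intro mult_nonneg_nonneg add_nonneg_nonneg) auto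
    fix w \<phi> :: vfun and m \<beta>
    assume w: "\<And>n. n < N \<Longrightarrow> zero_Cauchy_data R (w n)" and \<phi>: "\<And>n. n < N \<Longrightarrow> \<phi> n \<in> Sobolev 3 (cube R)"
      and ineq: "\<And>n. n < N \<Longrightarrow> AE x in lebesgue_on (cube R).
        (cmod (weak_laplacian (cube R) (w n) x))\<^sup>2 \<le> K * (grad_sq R N w x + jet_sq R N \<phi> x)"
      and m: "m < N" and \<beta>: "morder \<beta> \<le> 2"
    have wS: "w n \<in> Sobolev 3 (cube R)" if "n < N" for n using w[OF that] by (simp add: zero_Cauchy_data_def)
    define P where "P = (Sobolev_vec_norm N 2 (cube R) \<phi>)\<^sup>2"
    define X where "X = (\<lambda>n. cint R (\<lambda>x. wt R l (x $ 3) * (\<Sum>i\<in>UNIV. (cmod (weak_deriv (cube R) (axis i 1) (w n) x))\<^sup>2)))"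
    define F where "F = (\<lambda>n. cint R (\<lambda>x. wt R l (x $ 3) * (cmod (weak_laplacian (cube R) (w n) x))\<^sup>2))"
    define Y where "Y = cint R (\<lambda>x. wt R l (x $ 3) * jet_sq R N \<phi> x)"
    have dL: "weak_deriv (cube R) (axis i 1) (w n) \<in> L2 (cube R)" if "n < N" for n i
      by (rule Sobolev_weak_deriv(1)[OF R wS[OF that]]) simp
    have pL: "weak_deriv (cube R) \<gamma> (\<phi> n) \<in> L2 (cube R)" if "n < N" "morder \<gamma> \<le> 2" for n \<gamma>
      by (rule Sobolev_weak_deriv(1)[OF R \<phi>[OF that(1)]]) (use that(2) in simp)
    have iX: "integrable (lebesgue_on (cube R)) (\<lambda>x. wt R l (x $ 3) * (\<Sum>i\<in>UNIV. (cmod (weak_deriv (cube R) (axis i 1) (w n) x))\<^sup>2))" if "n < N" for n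
      unfolding sum_distrib_left by (intro Bochner_Integration.integrable_sum wt_sq_integrable dL that)
    have gX: "(\<lambda>x. wt R l (x $ 3) * grad_sq R N w x) = (\<lambda>x. \<Sum>n<N. wt R l (x $ 3) * (\<Sum>i\<in>UNIV. (cmod (weak_deriv (cube R) (axis i 1) (w n) x))\<^sup>2))"
      unfolding grad_sq_def by (rule ext) (rule sum_distrib_left)
    have ig: "integrable (lebesgue_on (cube R)) (\<lambda>x. wt R l (x $ 3) * grad_sq R N w x)"
      unfolding gX by (intro Bochner_Integration.integrable_sum iX) simp
    have Ig: "cint R (\<lambda>x. wt R l (x $ 3) * grad_sq R N w x) = (\<Sum>n<N. X n)"
      unfolding gX X_def by (intro Bochner_Integration.integral_sum iX) simp
    have gY: "(\<lambda>x. wt R l (x $ 3) * jet_sq R N \<phi> x) = (\<lambda>x. \<Sum>n<N. \<Sum>\<beta> | morder \<beta> \<le> 2. wt R l (x $ 3) * (cmod (weak_deriv (cube R) \<beta> (\<phi> n) x))\<^sup>2)"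
      unfolding jet_sq_def by (rule ext) (simp only: sum_distrib_left)
    have iY: "integrable (lebesgue_on (cube R)) (\<lambda>x. wt R l (x $ 3) * jet_sq R N \<phi> x)"
      unfolding gY by (intro Bochner_Integration.integrable_sum wt_sq_integrable pL) auto
    have "Y = (\<Sum>n<N. \<Sum>\<beta> | morder \<beta> \<le> 2. cint R (\<lambda>x. wt R l (x $ 3) * (cmod (weak_deriv (cube R) \<beta> (\<phi> n) x))\<^sup>2))"
    proof -
      have "Y = (\<Sum>n<N. cint R (\<lambda>x. \<Sum>\<beta> | morder \<beta> \<le> 2. wt R l (x $ 3) * (cmod (weak_deriv (cube R) \<beta> (\<phi> n) x))\<^sup>2))"
        unfolding Y_def gY by (intro Bochner_Integration.integral_sum Bochner_Integration.integrable_sum wt_sq_integrable pL) auto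
      also have "\<dots> = (\<Sum>n<N. \<Sum>\<beta> | morder \<beta> \<le> 2. cint R (\<lambda>x. wt R l (x $ 3) * (cmod (weak_deriv (cube R) \<beta> (\<phi> n) x))\<^sup>2))"
        by (intro sum.cong refl Bochner_Integration.integral_sum wt_sq_integrable pL) auto
      finally show ?thesis .
    qed
    also have "\<dots> \<le> (\<Sum>n<N. \<Sum>\<beta> | morder \<beta> \<le> 2. E * (L2_norm (cube R) (weak_deriv (cube R) \<beta> (\<phi> n)))\<^sup>2)"
      unfolding E_def using l by (intro sum_mono le_weighted(2) R pL) auto
    also have "\<dots> = E * P"
      unfolding P_def Sobolev_vec_norm_def Sobolev_norm_def
      by (simp add: sum_nonneg sum_distrib_left)
    finally have YP: "Y \<le> E * P" .
    have X0: "X n \<ge> 0" for n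
      unfolding X_def
      by (intro Bochner_Integration.integral_nonneg mult_nonneg_nonneg sum_nonneg less_imp_le[OF wt_pos]) simp
    have FX: "F n \<le> K * ((\<Sum>n<N. X n) + Y)" if n: "n < N" for n
    proof -
      have "F n \<le> cint R (\<lambda>x. K * (wt R l (x $ 3) * grad_sq R N w x + wt R l (x $ 3) * jet_sq R N \<phi> x))"
        unfolding F_def
      proof (rule integral_mono_AE)
        show "integrable (lebesgue_on (cube R)) (\<lambda>x. wt R l (x $ 3) * (cmod (weak_laplacian (cube R) (w n) x))\<^sup>2)"
          by (rule wt_sq_integrable[OF zero_Cauchy_data_estimates(4)[OF R w[OF n]]])
        show "integrable (lebesgue_on (cube R)) (\<lambda>x. K * (wt R l (x $ 3) * grad_sq R N w x + wt R l (x $ 3) * jet_sq R N \<phi> x))"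
          by (intro integrable_mult_right Bochner_Integration.integrable_add ig iY)
        show "AE x in lebesgue_on (cube R). wt R l (x $ 3) * (cmod (weak_laplacian (cube R) (w n) x))\<^sup>2
            \<le> K * (wt R l (x $ 3) * grad_sq R N w x + wt R l (x $ 3) * jet_sq R N \<phi> x)"
          using ineq[OF n]
        proof eventually_elim
          case (elim x)
          from mult_left_mono[OF elim less_imp_le[OF wt_pos[of R l "x $ 3"]]]
          show ?case by (simp add: algebra_simps)
        qed
      qed
      also have "\<dots> = K * ((\<Sum>n<N. X n) + Y)"
        unfolding Y_def Ig[symmetric] using Bochner_Integration.integral_add[OF ig iY] by simp
      finally show ?thesis .
    qed
    have XY: "(\<Sum>n<N. X n) \<le> Y"
    proof -
      have "l * (\<Sum>n<N. X n) = (\<Sum>n<N. l * X n)" by (rule sum_distrib_left)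
      also have "\<dots> \<le> (\<Sum>n<N. A * (K * ((\<Sum>n<N. X n) + Y)))"
      proof (rule sum_mono)
        fix n assume "n \<in> {..<N}"
        then have n: "n < N" by simp
        have "l * X n \<le> A * F n"
          unfolding X_def F_def A_def by (rule zero_Cauchy_data_estimates(2)[OF R w[OF n] l])
        also have "\<dots> \<le> A * (K * ((\<Sum>n<N. X n) + Y))" by (rule mult_left_mono[OF FX[OF n] A])
        finally show "l * X n \<le> A * (K * ((\<Sum>n<N. X n) + Y))" .
      qed
      also have "\<dots> = A * real N * K * ((\<Sum>n<N. X n) + Y)" by simp
      finally have 1: "l * (\<Sum>n<N. X n) \<le> A * real N * K * ((\<Sum>n<N. X n) + Y)" .
      define b where "b = A * real N * K"
      have b: "b \<ge> 0" using A K by (simp add: b_def)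
      have "(b + 1) * (\<Sum>n<N. X n) \<le> b * Y" using 1 unfolding l_def b_def[symmetric] by (simp add: algebra_simps)
      show ?thesis
      proof (rule ccontr)
        assume "\<not> (\<Sum>n<N. X n) \<le> Y"
        then have g: "Y < (\<Sum>n<N. X n)" by simp
        have "b * Y \<le> b * (\<Sum>n<N. X n)" using g b by (intro mult_left_mono) auto
        then have "(\<Sum>n<N. X n) \<le> 0" using \<open>(b + 1) * (\<Sum>n<N. X n) \<le> b * Y\<close> by (simp add: algebra_simps)
        moreover have "Y \<ge> 0"
          unfolding Y_def jet_sq_def
          by (intro Bochner_Integration.integral_nonneg mult_nonneg_nonneg sum_nonneg less_imp_le[OF wt_pos]) simp
        ultimately show False using g by simp
      qed
    qed
    have FP: "F m \<le> 2 * K * (E * P)"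
    proof -
      have "F m \<le> K * ((\<Sum>n<N. X n) + Y)" by (rule FX[OF m])
      also have "\<dots> \<le> K * (2 * (E * P))" using XY YP K by (intro mult_left_mono) auto
      finally show ?thesis by simp
    qed
    have EP: "E * P \<ge> 0" using E by (simp add: P_def)
    have c: "E * P \<le> C * P" "2 * K * (E * P) \<le> C * P" "2 * K / (8 * l ^ 3 * R\<^sup>2) * (E * P) \<le> C * P"
    proof -
      have e: "C * P = E * P + 2 * K * (E * P) + 2 * K / (8 * l ^ 3 * R\<^sup>2) * (E * P)"
        unfolding C_def by (simp only: distrib_right mult_1_left mult.assoc)
      have n: "2 * K * (E * P) \<ge> 0" "2 * K / (8 * l ^ 3 * R\<^sup>2) * (E * P) \<ge> 0"
        by (rule mult_nonneg_nonneg[OF _ EP], use K in simp, rule mult_nonneg_nonneg[OF q0 EP])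
      show "E * P \<le> C * P" "2 * K * (E * P) \<le> C * P" "2 * K / (8 * l ^ 3 * R\<^sup>2) * (E * P) \<le> C * P"
        unfolding e using n EP by linarith+
    qed
    have l0: "l \<ge> 0" using l by simp
    have "cint R (\<lambda>x. (cmod (weak_deriv (cube R) \<beta> (w m) x))\<^sup>2) \<le> C * P"
      using \<beta>
    proof (cases rule: morder_le_2_cases)
      case 1
      have D: "weak_deriv (cube R) 0 (w m) \<in> L2 (cube R)" by (rule Sobolev_weak_deriv(1)[OF R wS[OF m]]) simp
      have p: "8 * l ^ 3 * R\<^sup>2 > 0" using l R by simp
      have "8 * l ^ 3 * R\<^sup>2 * cint R (\<lambda>x. (cmod (weak_deriv (cube R) 0 (w m) x))\<^sup>2)
          \<le> 8 * l ^ 3 * R\<^sup>2 * cint R (\<lambda>x. wt R l (x $ 3) * (cmod (weak_deriv (cube R) 0 (w m) x))\<^sup>2)"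
        using p by (intro mult_left_mono le_weighted(1) R l0 D) simp
      also have "\<dots> \<le> F m" unfolding F_def by (rule zero_Cauchy_data_estimates(1)[OF R w[OF m] l])
      also note FP
      finally have "cint R (\<lambda>x. (cmod (weak_deriv (cube R) 0 (w m) x))\<^sup>2) \<le> 2 * K * (E * P) / (8 * l ^ 3 * R\<^sup>2)"
        using p by (simp add: pos_le_divide_eq mult.commute)
      also have "\<dots> = 2 * K / (8 * l ^ 3 * R\<^sup>2) * (E * P)" by simp
      also note c(3)
      finally show ?thesis unfolding 1 .
    next
      case (2 i)
      have "cint R (\<lambda>x. (cmod (weak_deriv (cube R) (axis i 1) (w m) x))\<^sup>2)
          \<le> cint R (\<lambda>x. wt R l (x $ 3) * (cmod (weak_deriv (cube R) (axis i 1) (w m) x))\<^sup>2)"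
        by (rule le_weighted(1)[OF R l0 dL[OF m]])
      also have "\<dots> \<le> X m"
        unfolding X_def
      proof (rule integral_mono[OF wt_sq_integrable[OF dL[OF m]] iX[OF m]])
        fix x
        show "wt R l (x $ 3) * (cmod (weak_deriv (cube R) (axis i 1) (w m) x))\<^sup>2
          \<le> wt R l (x $ 3) * (\<Sum>i\<in>UNIV. (cmod (weak_deriv (cube R) (axis i 1) (w m) x))\<^sup>2)"
          by (intro mult_left_mono less_imp_le[OF wt_pos]
              member_le_sum[of i UNIV "\<lambda>i. (cmod (weak_deriv (cube R) (axis i 1) (w m) x))\<^sup>2"]) auto
      qed
      also have "\<dots> \<le> (\<Sum>n<N. X n)" using m by (intro member_le_sum X0) auto
      also have "\<dots> \<le> C * P" using XY YP c(1) by linarith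
      finally show ?thesis unfolding 2 .
    next
      case (3 i j)
      have "cint R (\<lambda>x. (cmod (weak_deriv (cube R) (axis i 1 + axis j 1) (w m) x))\<^sup>2)
          \<le> cint R (\<lambda>x. (cmod (weak_laplacian (cube R) (w m) x))\<^sup>2)"
        by (rule zero_Cauchy_data_estimates(3)[OF R w[OF m]])
      also have "\<dots> \<le> F m"
        unfolding F_def by (rule le_weighted(1)[OF R l0 zero_Cauchy_data_estimates(4)[OF R w[OF m]]])
      also note FP
      also note c(2)
      finally show ?thesis unfolding 3 .
    qed
    then show "(L2_norm (cube R) (weak_deriv (cube R) \<beta> (w m)))\<^sup>2 \<le> C * (Sobolev_vec_norm N 2 (cube R) \<phi>)\<^sup>2"
      unfolding L2_norm_sq P_def .
  qed
qed

section \<open>The difference of two solutions\<close>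

lemma square_of_double_sum_le:
  fixes p :: "nat \<Rightarrow> 3 \<Rightarrow> real"
  shows "(\<Sum>n<N. \<Sum>i\<in>UNIV. p n i)\<^sup>2 \<le> 3 * real N * (\<Sum>n<N. \<Sum>i\<in>UNIV. (p n i)\<^sup>2)"
proof -
  have "(\<Sum>n<N. \<Sum>i\<in>UNIV. p n i)\<^sup>2 \<le> (\<Sum>n<N. (\<Sum>i\<in>UNIV. p n i)\<^sup>2) * real N"
    using sum_squared_le_sum_of_squares[of "\<lambda>n. \<Sum>i\<in>UNIV. p n i" "{..<N}"] by simp
  also have "\<dots> \<le> (\<Sum>n<N. (\<Sum>i\<in>UNIV. (p n i)\<^sup>2) * 3) * real N"
    by (intro mult_right_mono sum_mono order_trans[OF sum_squared_le_sum_of_squares]) auto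
  finally show ?thesis by (simp add: sum_distrib_right[symmetric] sum_distrib_left[symmetric] mult_ac)
qed

lemma sum_three_squares:
  fixes x y z :: real shows "(x + y + z)\<^sup>2 \<le> 3 * x\<^sup>2 + 3 * y\<^sup>2 + 3 * z\<^sup>2"
  using sum_squares_bound[of x y] sum_squares_bound[of x z] sum_squares_bound[of y z]
  by (simp add: power2_eq_square algebra_simps)

lemma jet_sq_ge:
  fixes \<phi> :: vfun
  shows "(\<Sum>n<N. \<Sum>i\<in>UNIV. (cmod (weak_deriv (cube R) (axis i 1) (\<phi> n) x))\<^sup>2) \<le> jet_sq R N \<phi> x"
    and "m < N \<Longrightarrow> (\<Sum>i\<in>UNIV. (cmod (weak_deriv (cube R) (axis i 2) (\<phi> m) x))\<^sup>2) \<le> jet_sq R N \<phi> x"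
proof -
  let ?q = "\<lambda>n \<beta>. (cmod (weak_deriv (cube R) \<beta> (\<phi> n) x))\<^sup>2"
  have s: "(\<Sum>i\<in>UNIV. ?q n (axis i c)) \<le> (\<Sum>\<beta> | morder \<beta> \<le> 2. ?q n \<beta>)" if c: "c = 1 \<or> c = 2" for n c
  proof -
    have inj: "inj (\<lambda>i::3. axis i c)" using c by (auto simp: inj_on_def axis_eq_axis)
    have sub: "range (\<lambda>i::3. axis i c) \<subseteq> {\<beta>. morder \<beta> \<le> 2}" using c by auto
    have "(\<Sum>i\<in>UNIV. ?q n (axis i c)) = (\<Sum>\<beta>\<in>range (\<lambda>i::3. axis i c). ?q n \<beta>)"
      by (simp add: sum.reindex[OF inj] o_def)
    also have "\<dots> \<le> (\<Sum>\<beta> | morder \<beta> \<le> 2. ?q n \<beta>)" by (rule sum_mono2[OF finite_morder sub]) simp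
    finally show ?thesis .
  qed
  show "(\<Sum>n<N. \<Sum>i\<in>UNIV. ?q n (axis i 1)) \<le> jet_sq R N \<phi> x"
    unfolding jet_sq_def by (intro sum_mono s) simp
  assume m: "m < N"
  have "(\<Sum>i\<in>UNIV. ?q m (axis i 2)) \<le> (\<Sum>\<beta> | morder \<beta> \<le> 2. ?q m \<beta>)" by (rule s) simp
  also have "\<dots> \<le> jet_sq R N \<phi> x"
    unfolding jet_sq_def using m
    by (intro member_le_sum[of m "{..<N}" "\<lambda>n. \<Sum>\<beta> | morder \<beta> \<le> 2. ?q n \<beta>"]) (auto intro: sum_nonneg)
  finally show "(\<Sum>i\<in>UNIV. ?q m (axis i 2)) \<le> jet_sq R N \<phi> x" .
qed

lemma weak_laplacian_diff:
  assumes R: "R > 0" and u: "u \<in> Sobolev 3 (cube R)" "u' \<in> Sobolev 3 (cube R)"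
  shows "AE x in lebesgue_on (cube R). weak_laplacian (cube R) (\<lambda>x. u x - u' x) x
    = weak_laplacian (cube R) u x - weak_laplacian (cube R) u' x"
proof -
  have "AE x in lebesgue_on (cube R). \<forall>i. weak_deriv (cube R) (axis i 2) (\<lambda>x. u x - u' x) x
      = weak_deriv (cube R) (axis i 2) u x - weak_deriv (cube R) (axis i 2) u' x"
    by (intro eventually_all_finite Sobolev_diff(2)[OF R u]) simp
  then show ?thesis
    by eventually_elim (simp only: weak_laplacian_def sum_subtractf)
qed

lemma G_set_bounds:
  assumes "W \<in> G_set R N M" "n < N"
  shows "W n \<in> Sobolev 3 (cube R)" "Sobolev_norm 3 (cube R) (W n) \<le> M"
  using assms Sobolev_norm_le_vec[OF assms(2), of 3 "cube R" W]
  by (auto simp: G_set_def Sobolev_vec_def)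

text \<open>Both solutions have gradients in the range where \<open>K\<close> is Lipschitz continuous, and the difference of
  their gradients is \<open>\<nabla>w + \<nabla>\<phi>\<close>.\<close>

lemma solution_difference_inequality:
  assumes R: "R > 0" and d: "d > R" and a: "a > 0" and k: "k > 0" and M: "M > 0"
  obtains K where "K \<ge> 0" "\<And>V1 V2 \<phi> n. V1 \<in> G_set R N M \<Longrightarrow> V2 \<in> G_set R N M \<Longrightarrow>
     solves_system R k a d N V1 \<Longrightarrow> solves_system R k a d N V2 \<Longrightarrow>
     (\<And>n. n < N \<Longrightarrow> \<phi> n \<in> Sobolev 3 (cube R)) \<Longrightarrow> n < N \<Longrightarrow>
     AE x in lebesgue_on (cube R). (cmod (weak_laplacian (cube R) (\<lambda>x. (V1 n x - V2 n x) - \<phi> n x) x))\<^sup>2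
       \<le> K * (grad_sq R N (\<lambda>n x. (V1 n x - V2 n x) - \<phi> n x) x + jet_sq R N \<phi> x)"
proof -
  obtain C where C: "C \<ge> 0" "\<And>u i. u \<in> Sobolev 3 (cube R) \<Longrightarrow>
    AE x in lebesgue_on (cube R). cmod (weak_deriv (cube R) (axis i 1) u x) \<le> C * Sobolev_norm 3 (cube R) u"
    by (rule first_derivatives_bounded[OF R]) blast
  define B where "B = C * M"
  have B: "B \<ge> 0" using C(1) M by (simp add: B_def)
  obtain L where L: "L \<ge> 0" "\<And>x P Q m. x \<in> cube R \<Longrightarrow> (\<And>n i. n < N \<Longrightarrow> cmod (P n $ i) \<le> B) \<Longrightarrow>
     (\<And>n i. n < N \<Longrightarrow> cmod (Q n $ i) \<le> B) \<Longrightarrow> m < N \<Longrightarrow>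
     cmod (Matrix.vec_index (K_fun k a d N x P) m - Matrix.vec_index (K_fun k a d N x Q) m) \<le> L * grad_dist N P Q"
    by (rule K_fun_Lipschitz[OF d a k B, of N]) blast
  define K where "K = 9 * real N * L\<^sup>2 + 9"
  show thesis
  proof (rule that[of K])
    show "K \<ge> 0" by (simp add: K_def)
    fix V1 V2 \<phi> :: vfun and m
    assume V: "V1 \<in> G_set R N M" "V2 \<in> G_set R N M" and sol: "solves_system R k a d N V1" "solves_system R k a d N V2"
      and \<phi>: "\<And>n. n < N \<Longrightarrow> \<phi> n \<in> Sobolev 3 (cube R)" and m: "m < N"
    define v where "v = (\<lambda>n x. V1 n x - V2 n x)"
    define w where "w = (\<lambda>n x. v n x - \<phi> n x)"
    have vS: "v n \<in> Sobolev 3 (cube R)" if "n < N" for n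
      unfolding v_def by (rule Sobolev_diff(1)[OF R G_set_bounds(1)[OF V(1) that] G_set_bounds(1)[OF V(2) that]])
    have b: "AE x in lebesgue_on (cube R). \<forall>n\<in>{..<N}. \<forall>i. cmod (weak_deriv (cube R) (axis i 1) (V n) x) \<le> B"
      if V: "V \<in> G_set R N M" for V
    proof (intro eventually_ball_finite ballI eventually_all_finite finite_lessThan)
      fix n and i :: 3 assume "n \<in> {..<N}"
      then have n: "n < N" by simp
      have le: "C * Sobolev_norm 3 (cube R) (V n) \<le> B"
        unfolding B_def by (rule mult_left_mono[OF G_set_bounds(2)[OF V n] C(1)])
      from C(2)[OF G_set_bounds(1)[OF V n], of i]
      show "AE x in lebesgue_on (cube R). cmod (weak_deriv (cube R) (axis i 1) (V n) x) \<le> B"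
        by eventually_elim (use le in linarith)
    qed
    have D: "AE x in lebesgue_on (cube R). \<forall>n\<in>{..<N}. \<forall>i.
        weak_deriv (cube R) (axis i 1) (V1 n) x - weak_deriv (cube R) (axis i 1) (V2 n) x
        = weak_deriv (cube R) (axis i 1) (w n) x + weak_deriv (cube R) (axis i 1) (\<phi> n) x"
    proof (intro eventually_ball_finite ballI eventually_all_finite finite_lessThan)
      fix n and i :: 3 assume "n \<in> {..<N}"
      then have n: "n < N" by simp
      have o: "morder (axis i 1) \<le> 3" by simp
      have "AE x in lebesgue_on (cube R). weak_deriv (cube R) (axis i 1) (v n) x
         = weak_deriv (cube R) (axis i 1) (V1 n) x - weak_deriv (cube R) (axis i 1) (V2 n) x"
        unfolding v_def by (rule Sobolev_diff(2)[OF R G_set_bounds(1)[OF V(1) n] G_set_bounds(1)[OF V(2) n] o])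
      moreover have "AE x in lebesgue_on (cube R). weak_deriv (cube R) (axis i 1) (w n) x
         = weak_deriv (cube R) (axis i 1) (v n) x - weak_deriv (cube R) (axis i 1) (\<phi> n) x"
        unfolding w_def by (rule Sobolev_diff(2)[OF R vS[OF n] \<phi>[OF n] o])
      ultimately show "AE x in lebesgue_on (cube R).
        weak_deriv (cube R) (axis i 1) (V1 n) x - weak_deriv (cube R) (axis i 1) (V2 n) x
        = weak_deriv (cube R) (axis i 1) (w n) x + weak_deriv (cube R) (axis i 1) (\<phi> n) x"
        by eventually_elim simp
    qed
    have l1: "AE x in lebesgue_on (cube R). weak_laplacian (cube R) (v m) x
        = weak_laplacian (cube R) (V1 m) x - weak_laplacian (cube R) (V2 m) x"
      unfolding v_def by (rule weak_laplacian_diff[OF R G_set_bounds(1)[OF V(1) m] G_set_bounds(1)[OF V(2) m]])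
    have l2: "AE x in lebesgue_on (cube R). weak_laplacian (cube R) (w m) x
        = weak_laplacian (cube R) (v m) x - weak_laplacian (cube R) (\<phi> m) x"
      unfolding w_def by (rule weak_laplacian_diff[OF R vS[OF m] \<phi>[OF m]])
    have dom: "AE x in lebesgue_on (cube R). x \<in> cube R" by (rule AE_I2) simp
    show "AE x in lebesgue_on (cube R). (cmod (weak_laplacian (cube R) (\<lambda>x. (V1 m x - V2 m x) - \<phi> m x) x))\<^sup>2
       \<le> K * (grad_sq R N (\<lambda>n x. (V1 n x - V2 n x) - \<phi> n x) x + jet_sq R N \<phi> x)"
      using b[OF V(1)] b[OF V(2)] D l1 l2 dom sol[unfolded solves_system_def]
    proof eventually_elim
      case (elim x)
      define P where "P = (\<lambda>(V :: vfun) n. weak_grad (cube R) (V n) x)"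
      have Pn: "P V n $ i = weak_deriv (cube R) (axis i 1) (V n) x" for V :: vfun and n i
        by (simp add: P_def weak_grad_def)
      define s where "s = (\<Sum>n<N. \<Sum>i\<in>UNIV. cmod (weak_deriv (cube R) (axis i 1) (w n) x))"
      define t where "t = (\<Sum>n<N. \<Sum>i\<in>UNIV. cmod (weak_deriv (cube R) (axis i 1) (\<phi> n) x))"
      define c where "c = (\<Sum>i\<in>UNIV. cmod (weak_deriv (cube R) (axis i 2) (\<phi> m) x))"
      have pos: "s \<ge> 0" "t \<ge> 0" "c \<ge> 0" by (auto simp: s_def t_def c_def intro!: sum_nonneg)
      have "grad_dist N (P V1) (P V2) \<le> (\<Sum>n<N. \<Sum>i\<in>UNIV. cmod (weak_deriv (cube R) (axis i 1) (w n) x) + cmod (weak_deriv (cube R) (axis i 1) (\<phi> n) x))"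
        unfolding grad_dist_def Pn
        by (intro sum_mono) (use elim(3) in \<open>simp add: norm_triangle_ineq\<close>)
      then have gd: "grad_dist N (P V1) (P V2) \<le> s + t" by (simp add: s_def t_def sum.distrib)
      have Kd: "cmod (Matrix.vec_index (K_fun k a d N x (P V1)) m - Matrix.vec_index (K_fun k a d N x (P V2)) m) \<le> L * (s + t)"
        using elim(1,2)
        by (intro order_trans[OF L(2)[OF elim(6) _ _ m] mult_left_mono[OF gd L(1)]]) (auto simp: Pn)
      have lc: "cmod (weak_laplacian (cube R) (\<phi> m) x) \<le> c"
        unfolding weak_laplacian_def c_def by (rule norm_sum)
      have e: "weak_laplacian (cube R) (V1 m) x = - Matrix.vec_index (K_fun k a d N x (P V1)) m"
        "weak_laplacian (cube R) (V2 m) x = - Matrix.vec_index (K_fun k a d N x (P V2)) m"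
        using elim(7,8) m unfolding P_def by (auto simp: eq_neg_iff_add_eq_0)
      have "weak_laplacian (cube R) (w m) x
          = - (Matrix.vec_index (K_fun k a d N x (P V1)) m - Matrix.vec_index (K_fun k a d N x (P V2)) m) - weak_laplacian (cube R) (\<phi> m) x"
        using elim(4,5) e by simp
      also have "cmod \<dots> \<le> L * (s + t) + c"
        by (rule order_trans[OF norm_triangle_ineq4]) (unfold norm_minus_cancel, rule add_mono[OF Kd lc])
      finally have "(cmod (weak_laplacian (cube R) (w m) x))\<^sup>2 \<le> (L * s + L * t + c)\<^sup>2"
        by (intro power_mono) (simp_all add: distrib_left)
      also have "\<dots> \<le> 3 * (L * s)\<^sup>2 + 3 * (L * t)\<^sup>2 + 3 * c\<^sup>2" by (rule sum_three_squares)
      also have "\<dots> = 3 * L\<^sup>2 * s\<^sup>2 + 3 * L\<^sup>2 * t\<^sup>2 + 3 * c\<^sup>2" by (simp add: power_mult_distrib)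
      also have "\<dots> \<le> 3 * L\<^sup>2 * (3 * real N * grad_sq R N w x) + 3 * L\<^sup>2 * (3 * real N * jet_sq R N \<phi> x) + 3 * (3 * jet_sq R N \<phi> x)"
      proof (intro add_mono mult_left_mono)
        show "s\<^sup>2 \<le> 3 * real N * grad_sq R N w x" unfolding s_def grad_sq_def by (rule square_of_double_sum_le)
        show "t\<^sup>2 \<le> 3 * real N * jet_sq R N \<phi> x"
          unfolding t_def by (rule order_trans[OF square_of_double_sum_le mult_left_mono[OF jet_sq_ge(1)]]) simp
        have "c\<^sup>2 \<le> (\<Sum>i\<in>UNIV. (cmod (weak_deriv (cube R) (axis i 2) (\<phi> m) x))\<^sup>2) * 3"
          using sum_squared_le_sum_of_squares[of "\<lambda>i. cmod (weak_deriv (cube R) (axis i 2) (\<phi> m) x)" UNIV] by (simp add: c_def)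
        then show "c\<^sup>2 \<le> 3 * jet_sq R N \<phi> x" using jet_sq_ge(2)[OF m, of R \<phi> x] by linarith
      qed auto
      also have "\<dots> \<le> K * (grad_sq R N w x + jet_sq R N \<phi> x)"
      proof -
        have "grad_sq R N w x \<ge> 0" unfolding grad_sq_def by (intro sum_nonneg) simp
        then show ?thesis unfolding K_def by (simp add: algebra_simps)
      qed
      finally show ?case unfolding w_def v_def .
    qed
  qed
qed

theorem theorem3p2:
  fixes R d a k M :: real and N :: nat
  assumes "R > 0" and "d > R" and "a > 0" and "k > 0" and "N \<ge> 1" and "M > 0"
  shows "\<exists>C1 > 0. \<forall>V1 V2 F1 F2 \<psi>01 \<psi>02 \<psi>11 \<psi>12.
           V1 \<in> G_set R N M \<and> V2 \<in> G_set R N M \<and> F1 \<in> G_set R N M \<and> F2 \<in> G_set R N M \<and>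
           solves_system R k a d N V1 \<and> solves_system R k a d N V2 \<and>
           boundary_conditions R N V1 \<psi>01 \<psi>11 \<and> boundary_conditions R N V2 \<psi>02 \<psi>12 \<and>
           boundary_conditions R N F1 \<psi>01 \<psi>11 \<and> boundary_conditions R N F2 \<psi>02 \<psi>12
           \<longrightarrow> Sobolev_vec_norm N 2 (cube R) (\<lambda>m x. V1 m x - V2 m x)
                 \<le> C1 * Sobolev_vec_norm N 2 (cube R) (\<lambda>m x. F1 m x - F2 m x)"
proof -
  note R = assms(1)
  obtain K where K: "K \<ge> 0" "\<And>V1 V2 \<phi> n. V1 \<in> G_set R N M \<Longrightarrow> V2 \<in> G_set R N M \<Longrightarrow>
     solves_system R k a d N V1 \<Longrightarrow> solves_system R k a d N V2 \<Longrightarrow>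
     (\<And>n. n < N \<Longrightarrow> \<phi> n \<in> Sobolev 3 (cube R)) \<Longrightarrow> n < N \<Longrightarrow>
     AE x in lebesgue_on (cube R). (cmod (weak_laplacian (cube R) (\<lambda>x. (V1 n x - V2 n x) - \<phi> n x) x))\<^sup>2
       \<le> K * (grad_sq R N (\<lambda>n x. (V1 n x - V2 n x) - \<phi> n x) x + jet_sq R N \<phi> x)"
    by (rule solution_difference_inequality[OF R assms(2,3,4,6), of N]) blast
  obtain C where C: "C \<ge> 0" "\<And>w \<phi> m \<beta>. (\<And>n. n < N \<Longrightarrow> zero_Cauchy_data R (w n)) \<Longrightarrow>
     (\<And>n. n < N \<Longrightarrow> \<phi> n \<in> Sobolev 3 (cube R)) \<Longrightarrow>
     (\<And>n. n < N \<Longrightarrow> AE x in lebesgue_on (cube R).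
        (cmod (weak_laplacian (cube R) (w n) x))\<^sup>2 \<le> K * (grad_sq R N w x + jet_sq R N \<phi> x)) \<Longrightarrow>
     m < N \<Longrightarrow> morder \<beta> \<le> 2 \<Longrightarrow>
     (L2_norm (cube R) (weak_deriv (cube R) \<beta> (w m)))\<^sup>2 \<le> C * (Sobolev_vec_norm N 2 (cube R) \<phi>)\<^sup>2"
    by (rule differential_inequality_stability[OF R K(1), of N]) blast
  define T where "T = real N * (real (card {\<beta> :: nat^3. morder \<beta> \<le> 2}) * (2 * C + 2))"
  have T: "T \<ge> 0" using C(1) by (simp add: T_def)
  show ?thesis
  proof (intro exI[of _ "sqrt T + 1"] conjI allI impI)
    show "sqrt T + 1 > 0" using T by (simp add: add_nonneg_pos)
    fix V1 V2 F1 F2 \<psi>01 \<psi>02 \<psi>11 \<psi>12 :: vfun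
    assume h: "V1 \<in> G_set R N M \<and> V2 \<in> G_set R N M \<and> F1 \<in> G_set R N M \<and> F2 \<in> G_set R N M \<and>
           solves_system R k a d N V1 \<and> solves_system R k a d N V2 \<and>
           boundary_conditions R N V1 \<psi>01 \<psi>11 \<and> boundary_conditions R N V2 \<psi>02 \<psi>12 \<and>
           boundary_conditions R N F1 \<psi>01 \<psi>11 \<and> boundary_conditions R N F2 \<psi>02 \<psi>12"
    have G: "V1 \<in> G_set R N M" "V2 \<in> G_set R N M" "F1 \<in> G_set R N M" "F2 \<in> G_set R N M"
      and sol: "solves_system R k a d N V1" "solves_system R k a d N V2" using h by auto
    have bc: "boundary_conditions R N V1 \<psi>01 \<psi>11" "boundary_conditions R N V2 \<psi>02 \<psi>12"
      "boundary_conditions R N F1 \<psi>01 \<psi>11" "boundary_conditions R N F2 \<psi>02 \<psi>12" using h by auto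
    define v where "v = (\<lambda>n x. V1 n x - V2 n x)"
    define \<phi> where "\<phi> = (\<lambda>n x. F1 n x - F2 n x)"
    define w where "w = (\<lambda>n x. v n x - \<phi> n x)"
    have vS: "v n \<in> Sobolev 3 (cube R)" and \<phi>S: "\<phi> n \<in> Sobolev 3 (cube R)" if n: "n < N" for n
      unfolding v_def \<phi>_def
      by (rule Sobolev_diff(1)[OF R G_set_bounds(1)[OF G(1) n] G_set_bounds(1)[OF G(2) n]],
        rule Sobolev_diff(1)[OF R G_set_bounds(1)[OF G(3) n] G_set_bounds(1)[OF G(4) n]])
    have wz: "zero_Cauchy_data R (w n)" if n: "n < N" for n
      unfolding w_def v_def \<phi>_def
      by (rule zero_Cauchy_data_difference[OF R G_set_bounds(1)[OF G(1) n] G_set_bounds(1)[OF G(3) n]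
            G_set_bounds(1)[OF G(2) n] G_set_bounds(1)[OF G(4) n], where g = "\<psi>01 n" and h = "\<psi>11 n" and g' = "\<psi>02 n" and h' = "\<psi>12 n"])
        (use bc n in \<open>auto simp: boundary_conditions_def\<close>)
    define p where "p = Sobolev_vec_norm N 2 (cube R) \<phi>"
    have w: "(L2_norm (cube R) (weak_deriv (cube R) \<beta> (w m)))\<^sup>2 \<le> C * p\<^sup>2" if "m < N" "morder \<beta> \<le> 2" for m \<beta>
      unfolding p_def
    proof (rule C(2)[OF wz \<phi>S _ that])
      show "AE x in lebesgue_on (cube R). (cmod (weak_laplacian (cube R) (w n) x))\<^sup>2 \<le> K * (grad_sq R N w x + jet_sq R N \<phi> x)"
        if "n < N" for n
        using K(2)[OF G(1,2) sol \<phi>S that] unfolding w_def v_def .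
    qed
    have vb: "(L2_norm (cube R) (weak_deriv (cube R) \<beta> (v m)))\<^sup>2 \<le> (2 * C + 2) * p\<^sup>2" if m: "m < N" and \<beta>: "morder \<beta> \<le> 2" for m \<beta>
    proof -
      have b3: "morder \<beta> \<le> 3" using \<beta> by simp
      have wS: "w m \<in> Sobolev 3 (cube R)" using wz[OF m] by (simp add: zero_Cauchy_data_def)
      note L = Sobolev_weak_deriv(1)[OF R _ b3]
      have "AE x in lebesgue_on (cube R). weak_deriv (cube R) \<beta> (w m) x
          = weak_deriv (cube R) \<beta> (v m) x - weak_deriv (cube R) \<beta> (\<phi> m) x"
        unfolding w_def by (rule Sobolev_diff(2)[OF R vS[OF m] \<phi>S[OF m] b3])
      then have ae: "AE x in lebesgue_on (cube R). weak_deriv (cube R) \<beta> (v m) x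
          = weak_deriv (cube R) \<beta> (w m) x + weak_deriv (cube R) \<beta> (\<phi> m) x"
        by eventually_elim simp
      have "L2_norm (cube R) (weak_deriv (cube R) \<beta> (v m))
          = L2_norm (cube R) (\<lambda>x. weak_deriv (cube R) \<beta> (w m) x + weak_deriv (cube R) \<beta> (\<phi> m) x)"
        by (intro L2_norm_cong_AE[OF ae] L2_measurable L2_add L vS \<phi>S wS m)
      also have "\<dots> \<le> L2_norm (cube R) (weak_deriv (cube R) \<beta> (w m)) + L2_norm (cube R) (weak_deriv (cube R) \<beta> (\<phi> m))"
        by (intro L2_norm_triangle L wS \<phi>S m)
      finally have t: "L2_norm (cube R) (weak_deriv (cube R) \<beta> (v m))
          \<le> L2_norm (cube R) (weak_deriv (cube R) \<beta> (w m)) + L2_norm (cube R) (weak_deriv (cube R) \<beta> (\<phi> m))" .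
      have "L2_norm (cube R) (weak_deriv (cube R) \<beta> (\<phi> m)) \<le> p"
        unfolding p_def by (rule order_trans[OF L2_norm_weak_deriv_le[OF \<beta>] Sobolev_norm_le_vec[OF m]])
      then have f: "(L2_norm (cube R) (weak_deriv (cube R) \<beta> (\<phi> m)))\<^sup>2 \<le> p\<^sup>2"
        by (intro power_mono L2_norm_nonneg)
      have "(L2_norm (cube R) (weak_deriv (cube R) \<beta> (v m)))\<^sup>2
          \<le> (L2_norm (cube R) (weak_deriv (cube R) \<beta> (w m)) + L2_norm (cube R) (weak_deriv (cube R) \<beta> (\<phi> m)))\<^sup>2"
        by (intro power_mono t L2_norm_nonneg)
      also have "\<dots> \<le> 2 * (L2_norm (cube R) (weak_deriv (cube R) \<beta> (w m)))\<^sup>2 + 2 * (L2_norm (cube R) (weak_deriv (cube R) \<beta> (\<phi> m)))\<^sup>2"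
        using sum_squares_bound[of "L2_norm (cube R) (weak_deriv (cube R) \<beta> (w m))" "L2_norm (cube R) (weak_deriv (cube R) \<beta> (\<phi> m))"]
        by (simp add: power2_sum)
      also have "\<dots> \<le> (2 * C + 2) * p\<^sup>2" using w[OF m \<beta>] f by (simp add: algebra_simps)
      finally show ?thesis .
    qed
    have "(Sobolev_vec_norm N 2 (cube R) v)\<^sup>2
        = (\<Sum>m<N. \<Sum>\<beta> | morder \<beta> \<le> 2. (L2_norm (cube R) (weak_deriv (cube R) \<beta> (v m)))\<^sup>2)"
      unfolding Sobolev_vec_norm_def Sobolev_norm_def by (simp add: sum_nonneg)
    also have "\<dots> \<le> (\<Sum>m<N. \<Sum>\<beta> | morder (\<beta> :: nat^3) \<le> 2. (2 * C + 2) * p\<^sup>2)"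
      by (intro sum_mono vb) auto
    also have "\<dots> = T * p\<^sup>2" by (simp add: T_def mult_ac)
    also have "\<dots> = (sqrt T * p)\<^sup>2" using T by (simp add: power_mult_distrib)
    also have "\<dots> \<le> ((sqrt T + 1) * p)\<^sup>2"
    proof (intro power_mono mult_right_mono mult_nonneg_nonneg)
      show "0 \<le> p" unfolding p_def Sobolev_vec_norm_def by (intro real_sqrt_ge_zero sum_nonneg) simp
      then show "0 \<le> p" .
    qed (use T in auto)
    finally have "Sobolev_vec_norm N 2 (cube R) v \<le> (sqrt T + 1) * p"
    proof (rule power2_le_imp_le)
      have "0 \<le> p" unfolding p_def Sobolev_vec_norm_def by (intro real_sqrt_ge_zero sum_nonneg) simp
      then show "0 \<le> (sqrt T + 1) * p" using T by simp
    qed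
    then show "Sobolev_vec_norm N 2 (cube R) (\<lambda>m x. V1 m x - V2 m x)
        \<le> (sqrt T + 1) * Sobolev_vec_norm N 2 (cube R) (\<lambda>m x. F1 m x - F2 m x)"
      unfolding p_def v_def \<phi>_def .
  qed
qed

end
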